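(* Assume that $\mathcal{A}$ is a Grothendieck category and that $\mathfrak{M}=(\mathcal{Q},\mathcal{W},\mathcal{R})$ is a cofibrantly generated hereditary abelian model structure on $\mathcal{A}$. Then any canonical resolution of $A\in\mathcal{A}$ provides a cofibrant replacement of $S^0(A)$ in the model structure $(\mathcal{C},\mathcal{V},dg\widetilde{\mathcal{R}})$ on $\mathrm{Ch}(\mathcal{A})$. Moreover, for all $A,B\in\mathcal{A}$ and $n\in\mathbb{Z}$, $$\mathrm{Ext}^n_{\mathrm{Ho}(\mathfrak{M})}(A,B)\cong H^n[\mathrm{Hom}_{\mathcal{A}}(C,RB)],$$ where $C$ is any cofibrant replacement of $S^0(A)$ in the model structure $(\mathcal{C},\mathcal{V},dg\widetilde{\mathcal{R}})$, and $RB$ is any fibrant replacement of $B$ in $\mathfrak{M}$.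
   Context: A cotorsion pair in an abelian category is a pair of classes $(\mathcal{X},\mathcal{Y})$ with $\mathcal{Y}=\mathcal{X}^\perp:=\{Y:\mathrm{Ext}^1(X,Y)=0\ \forall X\in\mathcal{X}\}$ and $\mathcal{X}={}^\perp\mathcal{Y}$ (defined dually), with Yoneda Ext. It is complete if every object $A$ admits short exact sequences $0\to Y\to X\to A\to0$ and $0\to A\to Y'\to X'\to 0$ with $X,X'\in\mathcal{X}$, $Y,Y'\in\mathcal{Y}$; hereditary if $\mathrm{Ext}^i(X,Y)=0$ for all $X\in\mathcal{X}$, $Y\in\mathcal{Y}$, $i\ge1$. An abelian model structure is a triple $\mathfrak{M}=(\mathcal{Q},\mathcal{W},\mathcal{R})$ of classes of objects such that $\mathcal{W}$ is thick (2 out of 3 property on short exact sequences) and, with $\mathcal{Q}_{\mathcal{W}}=\mathcal{Q}\cap\mathcal{W}$ and $\mathcal{R}_{\mathcal{W}}=\mathcal{W}\cap\mathcal{R}$, both $(\mathcal{Q},\mathcal{R}_{\mathcal{W}})$ and $(\mathcal{Q}_{\mathcal{W}},\mathcal{R})$ are complete cotorsion pairs; it is hereditary if both are hereditary. Objects of $\mathcal{Q},\mathcal{R},\mathcal{Q}_{\mathcal{W}},\mathcal{R}_{\mathcal{W}}$ are cofibrant, fibrant, trivially cofibrant, trivially fibrant. In any abelian model structure $(\mathcal{Q},\mathcal{W},\mathcal{R})$, a cofibrant replacement $QA$ of $A$ is given by a short exact sequence $0\to F\to QA\to A\to0$ with $QA\in\mathcal{Q}$, $F\in\mathcal{R}_{\mathcal{W}}$;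 a fibrant replacement $RA$ by $0\to A\to RA\to C\to0$ with $RA\in\mathcal{R}$, $C\in\mathcal{Q}_{\mathcal{W}}$. An $\mathfrak{M}$-resolution of $A$ is an exact chain complex $W_A\equiv\cdots\to Q_1\xrightarrow{d_1}Q_0\xrightarrow{d_0}R_{-1}\xrightarrow{d_{-1}}R_{-2}\to\cdots$ with $d_0=\eta_A\epsilon_A$, where $\cdots\to Q_1\to Q_0\xrightarrow{\epsilon_A}A\to0$ is exact with each $Q_i\in\mathcal{Q}_{\mathcal{W}}$ and all kernels $\ker\epsilon_A$, $\ker d_i$ ($i\ge1$) in $\mathcal{R}$, and $0\to A\xrightarrow{\eta_A}R_{-1}\to R_{-2}\to\cdots$ is exact with each $R_i\in\mathcal{R}_{\mathcal{W}}$ and all cokernels $\mathrm{cok}\,\eta_A$, $\mathrm{cok}\,d_i$ ($i\le-1$) in $\mathcal{Q}$. A canonical resolution of $A$ is an $\mathfrak{M}$-resolution $W_{QA}$ of any cofibrant replacement $p_A:QA\to A$. $S^0(A)$ is the chain complex with $A$ in degree $0$ and zero elsewhere; $\epsilon_{QA}$ gives a chain map $W_{QA}\to S^0(QA)$, and composing with $S^0(p_A)$ gives the map $W_{QA}\to S^0(A)$ by which $W_{QA}$ is a cofibrant replacement. For $A$ cofibrant and $B$ fibrant, $\mathrm{Ext}^n_{\mathfrak{M}}(A,B)$ denotes $H^n[\mathrm{Hom}_{\mathcal{A}}(W_A,B)]$ (independent of $W_A$ up to canonical isomorphism); for arbitrary $A,B$, $\mathrm{Ext}^n_{\mathrm{Ho}(\mathfrak{M})}(A,B):=\mathrm{Ext}^n_{\mathfrak{M}}(RQA,RQB)$.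 $\mathrm{Ch}(\mathcal{A})$ is the category of chain complexes. $\mathcal{C}$ is the class of exact chain complexes with all cycles in $\mathcal{Q}$ and all components in $\mathcal{Q}_{\mathcal{W}}$. $\widetilde{\mathcal{Q}_{\mathcal{W}}}$ is the class of exact complexes with all cycles in $\mathcal{Q}_{\mathcal{W}}$, and $dg\widetilde{\mathcal{R}}:=(\widetilde{\mathcal{Q}_{\mathcal{W}}})^\perp$ in $\mathrm{Ch}(\mathcal{A})$. By a theorem of Becker, under the stated hypotheses there is a cofibrantly generated abelian model structure $(\mathcal{C},\mathcal{V},dg\widetilde{\mathcal{R}})$ on $\mathrm{Ch}(\mathcal{A})$ with cofibrant objects $\mathcal{C}$, fibrant objects $dg\widetilde{\mathcal{R}}$, and trivially cofibrant objects $\mathcal{C}\cap\mathcal{V}=\widetilde{\mathcal{Q}_{\mathcal{W}}}$ (so its trivially fibrant objects are $\mathcal{V}\cap dg\widetilde{\mathcal{R}}=\mathcal{C}^\perp$); this existence result may be taken as given. *)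

theory Defs
  imports "HOL-Algebra.Coset" "HOL-Library.Equipollence"
begin

section \<open>Abelian categories\<close>

text \<open>A category enriched in abelian groups. Hom-sets of different pairs of objects need not be
  disjoint (chain maps below are plain families of morphisms); composition and addition are
  therefore operations on raw morphisms, and every statement about morphisms carries the objects
  along.\<close>

record ('o, 'm) cat =
  Obj :: "'o set"
  Mor :: "'o \<Rightarrow> 'o \<Rightarrow> 'm set"
  Idt :: "'o \<Rightarrow> 'm"
  Cmp :: "'m \<Rightarrow> 'm \<Rightarrow> 'm"  (infixr "\<cdot>\<index>" 75)
  Pls :: "'m \<Rightarrow> 'm \<Rightarrow> 'm"
  Zer :: "'o \<Rightarrow> 'o \<Rightarrow> 'm"

definition hom_group :: "('o, 'm) cat \<Rightarrow> 'o \<Rightarrow> 'o \<Rightarrow> 'm monoid" where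
  "hom_group K X Y = \<lparr>carrier = Mor K X Y, mult = Pls K, one = Zer K X Y\<rparr>"

locale preadditive_category =
  fixes K :: "('o, 'm) cat" (structure)
  assumes Idt_Mor: "X \<in> Obj K \<Longrightarrow> Idt K X \<in> Mor K X X"
    and Cmp_Mor: "\<lbrakk>X \<in> Obj K; Y \<in> Obj K; Z \<in> Obj K; f \<in> Mor K X Y; g \<in> Mor K Y Z\<rbrakk>
      \<Longrightarrow> g \<cdot> f \<in> Mor K X Z"
    and Cmp_Idt: "\<lbrakk>X \<in> Obj K; Y \<in> Obj K; f \<in> Mor K X Y\<rbrakk> \<Longrightarrow> f \<cdot> Idt K X = f"
    and Idt_Cmp: "\<lbrakk>X \<in> Obj K; Y \<in> Obj K; f \<in> Mor K X Y\<rbrakk> \<Longrightarrow> Idt K Y \<cdot> f = f"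
    and Cmp_assoc: "\<lbrakk>X \<in> Obj K; Y \<in> Obj K; Z \<in> Obj K; T \<in> Obj K;
        f \<in> Mor K X Y; g \<in> Mor K Y Z; h \<in> Mor K Z T\<rbrakk> \<Longrightarrow> (h \<cdot> g) \<cdot> f = h \<cdot> (g \<cdot> f)"
    and Mor_group: "\<lbrakk>X \<in> Obj K; Y \<in> Obj K\<rbrakk> \<Longrightarrow> comm_group (hom_group K X Y)"
    and Cmp_Pls: "\<lbrakk>X \<in> Obj K; Y \<in> Obj K; Z \<in> Obj K;
        f \<in> Mor K X Y; f' \<in> Mor K X Y; g \<in> Mor K Y Z\<rbrakk>
      \<Longrightarrow> g \<cdot> Pls K f f' = Pls K (g \<cdot> f) (g \<cdot> f')"
    and Pls_Cmp: "\<lbrakk>X \<in> Obj K; Y \<in> Obj K; Z \<in> Obj K;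
        f \<in> Mor K X Y; g \<in> Mor K Y Z; g' \<in> Mor K Y Z\<rbrakk>
      \<Longrightarrow> Pls K g g' \<cdot> f = Pls K (g \<cdot> f) (g' \<cdot> f)"

definition zero_object :: "('o, 'm) cat \<Rightarrow> 'o \<Rightarrow> bool" where
  "zero_object K Z \<longleftrightarrow> Z \<in> Obj K \<and>
     (\<forall>X\<in>Obj K. (\<exists>!f. f \<in> Mor K X Z) \<and> (\<exists>!f. f \<in> Mor K Z X))"

definition monic :: "('o, 'm) cat \<Rightarrow> 'o \<Rightarrow> 'o \<Rightarrow> 'm \<Rightarrow> bool" where
  "monic K X Y f \<longleftrightarrow> X \<in> Obj K \<and> Y \<in> Obj K \<and> f \<in> Mor K X Y \<and>
     (\<forall>T\<in>Obj K. \<forall>u\<in>Mor K T X. \<forall>v\<in>Mor K T X. f \<cdot>\<^bsub>K\<^esub> u = f \<cdot>\<^bsub>K\<^esub> v \<longrightarrow> u = v)"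

definition epic :: "('o, 'm) cat \<Rightarrow> 'o \<Rightarrow> 'o \<Rightarrow> 'm \<Rightarrow> bool" where
  "epic K X Y f \<longleftrightarrow> X \<in> Obj K \<and> Y \<in> Obj K \<and> f \<in> Mor K X Y \<and>
     (\<forall>T\<in>Obj K. \<forall>u\<in>Mor K Y T. \<forall>v\<in>Mor K Y T. u \<cdot>\<^bsub>K\<^esub> f = v \<cdot>\<^bsub>K\<^esub> f \<longrightarrow> u = v)"

definition is_kernel :: "('o, 'm) cat \<Rightarrow> 'o \<Rightarrow> 'o \<Rightarrow> 'm \<Rightarrow> 'o \<Rightarrow> 'm \<Rightarrow> bool" where
  "is_kernel K X Y f N k \<longleftrightarrow>
     X \<in> Obj K \<and> Y \<in> Obj K \<and> f \<in> Mor K X Y \<and> N \<in> Obj K \<and> k \<in> Mor K N X \<and>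
     f \<cdot>\<^bsub>K\<^esub> k = Zer K N Y \<and>
     (\<forall>T\<in>Obj K. \<forall>u\<in>Mor K T X. f \<cdot>\<^bsub>K\<^esub> u = Zer K T Y \<longrightarrow>
        (\<exists>!v. v \<in> Mor K T N \<and> k \<cdot>\<^bsub>K\<^esub> v = u))"

definition is_cokernel :: "('o, 'm) cat \<Rightarrow> 'o \<Rightarrow> 'o \<Rightarrow> 'm \<Rightarrow> 'o \<Rightarrow> 'm \<Rightarrow> bool" where
  "is_cokernel K X Y f N c \<longleftrightarrow>
     X \<in> Obj K \<and> Y \<in> Obj K \<and> f \<in> Mor K X Y \<and> N \<in> Obj K \<and> c \<in> Mor K Y N \<and>
     c \<cdot>\<^bsub>K\<^esub> f = Zer K X N \<and>
     (\<forall>T\<in>Obj K. \<forall>u\<in>Mor K Y T. u \<cdot>\<^bsub>K\<^esub> f = Zer K X T \<longrightarrow>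
        (\<exists>!v. v \<in> Mor K N T \<and> v \<cdot>\<^bsub>K\<^esub> c = u))"

definition is_product :: "('o, 'm) cat \<Rightarrow> 'o \<Rightarrow> 'o \<Rightarrow> 'o \<Rightarrow> 'm \<Rightarrow> 'm \<Rightarrow> bool" where
  "is_product K X Y P p q \<longleftrightarrow> P \<in> Obj K \<and> p \<in> Mor K P X \<and> q \<in> Mor K P Y \<and>
     (\<forall>T\<in>Obj K. \<forall>f\<in>Mor K T X. \<forall>g\<in>Mor K T Y.
        (\<exists>!h. h \<in> Mor K T P \<and> p \<cdot>\<^bsub>K\<^esub> h = f \<and> q \<cdot>\<^bsub>K\<^esub> h = g))"

locale abelian_category = preadditive_category +
  assumes ex_zero: "\<exists>Z. zero_object K Z"
    and ex_product: "\<lbrakk>X \<in> Obj K; Y \<in> Obj K\<rbrakk> \<Longrightarrow> \<exists>P p q. is_product K X Y P p q"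
    and ex_kernel: "\<lbrakk>X \<in> Obj K; Y \<in> Obj K; f \<in> Mor K X Y\<rbrakk> \<Longrightarrow> \<exists>N k. is_kernel K X Y f N k"
    and ex_cokernel: "\<lbrakk>X \<in> Obj K; Y \<in> Obj K; f \<in> Mor K X Y\<rbrakk> \<Longrightarrow> \<exists>N c. is_cokernel K X Y f N c"
    and monic_normal: "monic K X Y f \<Longrightarrow> \<exists>Z g. is_kernel K Y Z g X f"
    and epic_normal: "epic K X Y f \<Longrightarrow> \<exists>Z g. is_cokernel K Z X g Y f"

text \<open>Short exact sequences \<open>0 \<rightarrow> X \<rightarrow> Y \<rightarrow> Z \<rightarrow> 0\<close>.\<close>

definition ses :: "('o, 'm) cat \<Rightarrow> 'o \<Rightarrow> 'o \<Rightarrow> 'o \<Rightarrow> 'm \<Rightarrow> 'm \<Rightarrow> bool" where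
  "ses K X Y Z i p \<longleftrightarrow> is_kernel K Y Z p X i \<and> is_cokernel K X Y i Z p"

text \<open>Exactness of \<open>X \<rightarrow> Y \<rightarrow> Z\<close> at \<open>Y\<close>: the first map factors through the kernel of the second
  by an epimorphism.\<close>

definition exact_at :: "('o, 'm) cat \<Rightarrow> 'o \<Rightarrow> 'o \<Rightarrow> 'o \<Rightarrow> 'm \<Rightarrow> 'm \<Rightarrow> bool" where
  "exact_at K X Y Z f g \<longleftrightarrow>
     (\<exists>N k e. is_kernel K Y Z g N k \<and> epic K X N e \<and> k \<cdot>\<^bsub>K\<^esub> e = f)"


section \<open>Grothendieck categories\<close>

text \<open>Smallness is relative to a set \<open>U\<close> whose cardinality is regular and a strong limit, that is,
  strongly inaccessible or countably infinite: a set is small iff it has fewer elements than \<open>U\<close>.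
  Small index sets can then always be taken inside the type of the elements of \<open>U\<close>.\<close>

definition universe :: "'u set \<Rightarrow> bool" where
  "universe U \<longleftrightarrow> infinite U \<and>
     (\<forall>I::'u set. I \<prec> U \<longrightarrow> Pow I \<prec> U) \<and>
     (\<forall>(I::'u set) (F::'u \<Rightarrow> 'u set). I \<prec> U \<and> (\<forall>i\<in>I. F i \<prec> U) \<longrightarrow> (\<Union>i\<in>I. F i) \<prec> U)"

text \<open>Diagrams indexed by a set \<open>I\<close> preordered by \<open>r\<close>; only pairs of \<open>r\<close> inside \<open>I\<close> matter.\<close>

definition diagram ::
  "('o, 'm) cat \<Rightarrow> 'u set \<Rightarrow> 'u rel \<Rightarrow> ('u \<Rightarrow> 'o) \<Rightarrow> ('u \<Rightarrow> 'u \<Rightarrow> 'm) \<Rightarrow> bool" where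
  "diagram K I r X t \<longleftrightarrow>
     (\<forall>i\<in>I. X i \<in> Obj K \<and> t i i = Idt K (X i)) \<and>
     (\<forall>i\<in>I. \<forall>j\<in>I. (i, j) \<in> r \<longrightarrow> t i j \<in> Mor K (X i) (X j)) \<and>
     (\<forall>i\<in>I. \<forall>j\<in>I. \<forall>k\<in>I. (i, j) \<in> r \<and> (j, k) \<in> r \<longrightarrow> t j k \<cdot>\<^bsub>K\<^esub> t i j = t i k)"

definition cocone :: "('o, 'm) cat \<Rightarrow> 'u set \<Rightarrow> 'u rel \<Rightarrow> ('u \<Rightarrow> 'o) \<Rightarrow> ('u \<Rightarrow> 'u \<Rightarrow> 'm)
    \<Rightarrow> 'o \<Rightarrow> ('u \<Rightarrow> 'm) \<Rightarrow> bool" where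
  "cocone K I r X t L c \<longleftrightarrow> L \<in> Obj K \<and> (\<forall>i\<in>I. c i \<in> Mor K (X i) L) \<and>
     (\<forall>i\<in>I. \<forall>j\<in>I. (i, j) \<in> r \<longrightarrow> c j \<cdot>\<^bsub>K\<^esub> t i j = c i)"

definition is_colimit :: "('o, 'm) cat \<Rightarrow> 'u set \<Rightarrow> 'u rel \<Rightarrow> ('u \<Rightarrow> 'o) \<Rightarrow> ('u \<Rightarrow> 'u \<Rightarrow> 'm)
    \<Rightarrow> 'o \<Rightarrow> ('u \<Rightarrow> 'm) \<Rightarrow> bool" where
  "is_colimit K I r X t L c \<longleftrightarrow> cocone K I r X t L c \<and>
     (\<forall>T e. cocone K I r X t T e \<longrightarrow> (\<exists>!u. u \<in> Mor K L T \<and> (\<forall>i\<in>I. u \<cdot>\<^bsub>K\<^esub> c i = e i)))"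

definition directed :: "'u set \<Rightarrow> 'u rel \<Rightarrow> bool" where
  "directed I r \<longleftrightarrow> I \<noteq> {} \<and> (\<forall>i\<in>I. (i, i) \<in> r) \<and>
     (\<forall>i\<in>I. \<forall>j\<in>I. \<forall>k\<in>I. (i, j) \<in> r \<and> (j, k) \<in> r \<longrightarrow> (i, k) \<in> r) \<and>
     (\<forall>i\<in>I. \<forall>j\<in>I. \<exists>k\<in>I. (i, k) \<in> r \<and> (j, k) \<in> r)"

locale grothendieck_category = abelian_category K for K :: "('o, 'm) cat" (structure) +
  fixes U :: "'u set"
  assumes universe: "universe U"
    and locally_small: "\<lbrakk>X \<in> Obj K; Y \<in> Obj K\<rbrakk> \<Longrightarrow> Mor K X Y \<prec> U"
    and AB3: "\<And>I X. \<lbrakk>I \<prec> U; \<And>i. i \<in> I \<Longrightarrow> X i \<in> Obj K\<rbrakk>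
      \<Longrightarrow> \<exists>L c. is_colimit K I (Id_on I) X (\<lambda>i j. Idt K (X i)) L (c :: 'u \<Rightarrow> 'm)"
    and AB5: "\<And>(I :: 'u set) r X Y Z s t w f g LX LY LZ cX cY cZ f' g'.
      \<lbrakk>I \<prec> U; directed I r;
       diagram K I r X s; diagram K I r Y t; diagram K I r Z w;
       \<And>i. i \<in> I \<Longrightarrow> ses K (X i) (Y i) (Z i) (f i) (g i);
       \<And>i j. \<lbrakk>i \<in> I; j \<in> I; (i, j) \<in> r\<rbrakk> \<Longrightarrow> f j \<cdot> s i j = t i j \<cdot> f i;
       \<And>i j. \<lbrakk>i \<in> I; j \<in> I; (i, j) \<in> r\<rbrakk> \<Longrightarrow> g j \<cdot> t i j = w i j \<cdot> g i;
       is_colimit K I r X s LX cX; is_colimit K I r Y t LY cY; is_colimit K I r Z w LZ cZ;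
       f' \<in> Mor K LX LY; \<And>i. i \<in> I \<Longrightarrow> f' \<cdot> cX i = cY i \<cdot> f i;
       g' \<in> Mor K LY LZ; \<And>i. i \<in> I \<Longrightarrow> g' \<cdot> cY i = cZ i \<cdot> g i\<rbrakk>
      \<Longrightarrow> ses K LX LY LZ f' g'"
    and generator: "\<exists>G\<in>Obj K. \<forall>X\<in>Obj K. \<forall>Y\<in>Obj K. \<forall>f\<in>Mor K X Y. \<forall>g\<in>Mor K X Y.
      f \<noteq> g \<longrightarrow> (\<exists>h\<in>Mor K G X. f \<cdot> h \<noteq> g \<cdot> h)"


section \<open>Yoneda Ext and cotorsion pairs\<close>

text \<open>An \<open>n\<close>-extension of \<open>X\<close> by \<open>Y\<close>, for \<open>n \<ge> 1\<close>, is an exact sequence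
  \<open>0 \<rightarrow> Y = E 0 \<rightarrow> E 1 \<rightarrow> \<dots> \<rightarrow> E n \<rightarrow> E (n + 1) = X \<rightarrow> 0\<close> with maps \<open>e i : E i \<rightarrow> E (i + 1)\<close>.
  The functions are unconstrained outside this range; extensions agreeing on it are linked by an
  identity morphism and hence have the same class.\<close>

definition extensions :: "('o, 'm) cat \<Rightarrow> nat \<Rightarrow> 'o \<Rightarrow> 'o \<Rightarrow> ((nat \<Rightarrow> 'o) \<times> (nat \<Rightarrow> 'm)) set" where
  "extensions K n X Y = {(E, e). E 0 = Y \<and> E (Suc n) = X \<and>
     monic K (E 0) (E 1) (e 0) \<and> epic K (E n) (E (Suc n)) (e n) \<and>
     (\<forall>i<n. exact_at K (E i) (E (Suc i)) (E (Suc (Suc i))) (e i) (e (Suc i)))}"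

definition extension_morphism :: "('o, 'm) cat \<Rightarrow> nat \<Rightarrow> 'o \<Rightarrow> 'o
    \<Rightarrow> ((nat \<Rightarrow> 'o) \<times> (nat \<Rightarrow> 'm)) rel" where
  "extension_morphism K n X Y = {((E, e), (E', e')).
     (E, e) \<in> extensions K n X Y \<and> (E', e') \<in> extensions K n X Y \<and>
     (\<exists>\<phi>. (\<forall>i\<le>Suc n. \<phi> i \<in> Mor K (E i) (E' i)) \<and> \<phi> 0 = Idt K Y \<and> \<phi> (Suc n) = Idt K X \<and>
          (\<forall>i\<le>n. \<phi> (Suc i) \<cdot>\<^bsub>K\<^esub> e i = e' i \<cdot>\<^bsub>K\<^esub> \<phi> i))}"

text \<open>The set underlying the Yoneda group \<open>Ext\<^sup>n(X,Y)\<close>, \<open>n \<ge> 1\<close>: \<open>n\<close>-extensions modulo the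
  equivalence relation generated by morphisms of extensions. The group is zero iff this set has
  just one element.\<close>

definition Ext :: "('o, 'm) cat \<Rightarrow> nat \<Rightarrow> 'o \<Rightarrow> 'o \<Rightarrow> ((nat \<Rightarrow> 'o) \<times> (nat \<Rightarrow> 'm)) set set" where
  "Ext K n X Y = extensions K n X Y //
     (extension_morphism K n X Y \<union> (extension_morphism K n X Y)\<inverse>)\<^sup>*"

definition Ext_zero :: "('o, 'm) cat \<Rightarrow> nat \<Rightarrow> 'o \<Rightarrow> 'o \<Rightarrow> bool" where
  "Ext_zero K n X Y \<longleftrightarrow> is_singleton (Ext K n X Y)"

definition right_perp :: "('o, 'm) cat \<Rightarrow> 'o set \<Rightarrow> 'o set" where
  "right_perp K \<X> = {Y \<in> Obj K. \<forall>X\<in>\<X>. Ext_zero K 1 X Y}"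

definition left_perp :: "('o, 'm) cat \<Rightarrow> 'o set \<Rightarrow> 'o set" where
  "left_perp K \<Y> = {X \<in> Obj K. \<forall>Y\<in>\<Y>. Ext_zero K 1 X Y}"

definition cotorsion_pair :: "('o, 'm) cat \<Rightarrow> 'o set \<Rightarrow> 'o set \<Rightarrow> bool" where
  "cotorsion_pair K \<X> \<Y> \<longleftrightarrow> \<Y> = right_perp K \<X> \<and> \<X> = left_perp K \<Y>"

definition complete_cotorsion_pair :: "('o, 'm) cat \<Rightarrow> 'o set \<Rightarrow> 'o set \<Rightarrow> bool" where
  "complete_cotorsion_pair K \<X> \<Y> \<longleftrightarrow> cotorsion_pair K \<X> \<Y> \<and>
     (\<forall>A\<in>Obj K. (\<exists>Y\<in>\<Y>. \<exists>X\<in>\<X>. \<exists>i p. ses K Y X A i p) \<and>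
                 (\<exists>Y\<in>\<Y>. \<exists>X\<in>\<X>. \<exists>i p. ses K A Y X i p))"

definition hereditary_pair :: "('o, 'm) cat \<Rightarrow> 'o set \<Rightarrow> 'o set \<Rightarrow> bool" where
  "hereditary_pair K \<X> \<Y> \<longleftrightarrow> (\<forall>X\<in>\<X>. \<forall>Y\<in>\<Y>. \<forall>i\<ge>1. Ext_zero K i X Y)"


section \<open>Abelian model structures\<close>

record 'o model =
  Cof :: "'o set"
  Trv :: "'o set"
  Fib :: "'o set"

abbreviation trivially_cofibrant :: "'o model \<Rightarrow> 'o set" where
  "trivially_cofibrant M \<equiv> Cof M \<inter> Trv M"

abbreviation trivially_fibrant :: "'o model \<Rightarrow> 'o set" where
  "trivially_fibrant M \<equiv> Trv M \<inter> Fib M"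

definition thick :: "('o, 'm) cat \<Rightarrow> 'o set \<Rightarrow> bool" where
  "thick K \<W> \<longleftrightarrow> \<W> \<subseteq> Obj K \<and>
     (\<forall>X Y Z i p. ses K X Y Z i p \<longrightarrow>
        (X \<in> \<W> \<and> Y \<in> \<W> \<longrightarrow> Z \<in> \<W>) \<and>
        (X \<in> \<W> \<and> Z \<in> \<W> \<longrightarrow> Y \<in> \<W>) \<and>
        (Y \<in> \<W> \<and> Z \<in> \<W> \<longrightarrow> X \<in> \<W>))"

definition abelian_model_structure :: "('o, 'm) cat \<Rightarrow> 'o model \<Rightarrow> bool" where
  "abelian_model_structure K M \<longleftrightarrow> thick K (Trv M) \<and>
     complete_cotorsion_pair K (Cof M) (trivially_fibrant M) \<and>
     complete_cotorsion_pair K (trivially_cofibrant M) (Fib M)"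

definition hereditary_model :: "('o, 'm) cat \<Rightarrow> 'o model \<Rightarrow> bool" where
  "hereditary_model K M \<longleftrightarrow>
     hereditary_pair K (Cof M) (trivially_fibrant M) \<and>
     hereditary_pair K (trivially_cofibrant M) (Fib M)"

definition cofibrant_replacement :: "('o, 'm) cat \<Rightarrow> 'o model \<Rightarrow> 'o \<Rightarrow> 'o \<Rightarrow> 'm \<Rightarrow> bool" where
  "cofibrant_replacement K M A QA p \<longleftrightarrow>
     QA \<in> Cof M \<and> (\<exists>F\<in>trivially_fibrant M. \<exists>i. ses K F QA A i p)"

definition fibrant_replacement :: "('o, 'm) cat \<Rightarrow> 'o model \<Rightarrow> 'o \<Rightarrow> 'o \<Rightarrow> 'm \<Rightarrow> bool" where
  "fibrant_replacement K M A RA j \<longleftrightarrow>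
     RA \<in> Fib M \<and> (\<exists>C\<in>trivially_cofibrant M. \<exists>c. ses K A RA C j c)"


section \<open>Cofibrant generation\<close>

text \<open>The model category underlying an abelian model structure: (trivial) cofibrations are the
  monomorphisms with (trivially) cofibrant cokernel, (trivial) fibrations the epimorphisms with
  (trivially) fibrant kernel. An arrow is a triple (source, target, morphism).\<close>

definition arrows :: "('o, 'm) cat \<Rightarrow> ('o \<times> 'o \<times> 'm) set" where
  "arrows K = {(X, Y, f). X \<in> Obj K \<and> Y \<in> Obj K \<and> f \<in> Mor K X Y}"

definition epis_with_kernel_in :: "('o, 'm) cat \<Rightarrow> 'o set \<Rightarrow> ('o \<times> 'o \<times> 'm) set" where
  "epis_with_kernel_in K \<F> = {(X, Y, p). \<exists>F\<in>\<F>. \<exists>i. ses K F X Y i p}"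

definition RLP :: "('o, 'm) cat \<Rightarrow> ('o \<times> 'o \<times> 'm) set \<Rightarrow> ('o \<times> 'o \<times> 'm) set" where
  "RLP K I = {(X, Y, f). (X, Y, f) \<in> arrows K \<and>
     (\<forall>(A, B, i)\<in>I. \<forall>u\<in>Mor K A X. \<forall>v\<in>Mor K B Y. f \<cdot>\<^bsub>K\<^esub> u = v \<cdot>\<^bsub>K\<^esub> i \<longrightarrow>
        (\<exists>h\<in>Mor K B X. h \<cdot>\<^bsub>K\<^esub> i = u \<and> f \<cdot>\<^bsub>K\<^esub> h = v))}"

definition pushouts :: "('o, 'm) cat \<Rightarrow> ('o \<times> 'o \<times> 'm) set \<Rightarrow> ('o \<times> 'o \<times> 'm) set" where
  "pushouts K I = {(X, Y, g). (X, Y, g) \<in> arrows K \<and>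
     (\<exists>(A, B, i)\<in>I. \<exists>u\<in>Mor K A X. \<exists>v\<in>Mor K B Y. v \<cdot>\<^bsub>K\<^esub> i = g \<cdot>\<^bsub>K\<^esub> u \<and>
        (\<forall>T\<in>Obj K. \<forall>a\<in>Mor K X T. \<forall>b\<in>Mor K B T. b \<cdot>\<^bsub>K\<^esub> i = a \<cdot>\<^bsub>K\<^esub> u \<longrightarrow>
           (\<exists>!h. h \<in> Mor K Y T \<and> h \<cdot>\<^bsub>K\<^esub> g = a \<and> h \<cdot>\<^bsub>K\<^esub> v = b)))}"

text \<open>Ordinals are represented by well-orders on small sets. A sequence is continuous at limit
  elements and its maps to immediate successors lie in \<open>D\<close>.\<close>

definition transfinite_sequence :: "'u set \<Rightarrow> ('o, 'm) cat \<Rightarrow> ('o \<times> 'o \<times> 'm) set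
    \<Rightarrow> 'u set \<Rightarrow> 'u rel \<Rightarrow> ('u \<Rightarrow> 'o) \<Rightarrow> ('u \<Rightarrow> 'u \<Rightarrow> 'm) \<Rightarrow> bool" where
  "transfinite_sequence U K D S r X t \<longleftrightarrow>
     S \<prec> U \<and> S \<noteq> {} \<and> well_order_on S r \<and> diagram K S r X t \<and>
     (\<forall>b\<in>S. underS r b \<noteq> {} \<and> (\<forall>a\<in>underS r b. \<exists>a'\<in>underS r b. a' \<noteq> a \<and> (a, a') \<in> r) \<longrightarrow>
        is_colimit K (underS r b) r X t (X b) (\<lambda>a. t a b)) \<and>
     (\<forall>b\<in>S. \<forall>a\<in>underS r b. (\<forall>c\<in>underS r b. (c, a) \<in> r) \<longrightarrow> (X a, X b, t a b) \<in> D)"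

definition transfinite_compositions :: "'u set \<Rightarrow> ('o, 'm) cat \<Rightarrow> ('o \<times> 'o \<times> 'm) set
    \<Rightarrow> ('o \<times> 'o \<times> 'm) set" where
  "transfinite_compositions U K D = {(X\<^sub>0, L, f). \<exists>S r X t c z.
     transfinite_sequence U K D S r X t \<and> is_colimit K S r X t L c \<and>
     z \<in> S \<and> (\<forall>a\<in>S. (z, a) \<in> r) \<and> X\<^sub>0 = X z \<and> f = c z}"

definition cells :: "'u set \<Rightarrow> ('o, 'm) cat \<Rightarrow> ('o \<times> 'o \<times> 'm) set \<Rightarrow> ('o \<times> 'o \<times> 'm) set" where
  "cells U K I = transfinite_compositions U K (pushouts K I)"

text \<open>\<open>A\<close> is small relative to \<open>D\<close>: for some small cardinal \<open>|\<kappa>|\<close>, the functor \<open>Hom(A, -)\<close>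
  commutes with colimits of all sequences in \<open>D\<close> whose length is a \<open>|\<kappa>|\<close>-filtered ordinal, that is,
  a limit ordinal in which each subset of cardinality at most \<open>|\<kappa>|\<close> is bounded. The last two
  conjuncts say that the map from the colimit of the sets \<open>Hom(A, X a)\<close> to \<open>Hom(A, L)\<close> is onto
  and one-to-one.\<close>

definition small_relative :: "'u set \<Rightarrow> ('o, 'm) cat \<Rightarrow> ('o \<times> 'o \<times> 'm) set \<Rightarrow> 'o \<Rightarrow> bool" where
  "small_relative U K D A \<longleftrightarrow> (\<exists>\<kappa>::'u set. \<kappa> \<prec> U \<and>
     (\<forall>S r X t L c. transfinite_sequence U K D S r X t \<and>
        (\<forall>a\<in>S. \<exists>b\<in>S. a \<noteq> b \<and> (a, b) \<in> r) \<and>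
        (\<forall>T\<subseteq>S. T \<lesssim> \<kappa> \<longrightarrow> (\<exists>b\<in>S. \<forall>a\<in>T. (a, b) \<in> r)) \<and>
        is_colimit K S r X t L c \<longrightarrow>
        (\<forall>f\<in>Mor K A L. \<exists>a\<in>S. \<exists>g\<in>Mor K A (X a). c a \<cdot>\<^bsub>K\<^esub> g = f) \<and>
        (\<forall>a\<in>S. \<forall>g\<in>Mor K A (X a). \<forall>g'\<in>Mor K A (X a). c a \<cdot>\<^bsub>K\<^esub> g = c a \<cdot>\<^bsub>K\<^esub> g' \<longrightarrow>
           (\<exists>b\<in>S. (a, b) \<in> r \<and> t a b \<cdot>\<^bsub>K\<^esub> g = t a b \<cdot>\<^bsub>K\<^esub> g'))))"

definition cofibrantly_generated :: "'u set \<Rightarrow> ('o, 'm) cat \<Rightarrow> 'o model \<Rightarrow> bool" where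
  "cofibrantly_generated U K M \<longleftrightarrow> (\<exists>I J. I \<subseteq> arrows K \<and> J \<subseteq> arrows K \<and> I \<prec> U \<and> J \<prec> U \<and>
     (\<forall>(A, B, i)\<in>I. small_relative U K (cells U K I) A) \<and>
     (\<forall>(A, B, i)\<in>J. small_relative U K (cells U K J) A) \<and>
     epis_with_kernel_in K (Fib M) = RLP K J \<and>
     epis_with_kernel_in K (trivially_fibrant M) = RLP K I)"


section \<open>Chain complexes\<close>

text \<open>Homological grading: \<open>dif X n : ob X n \<rightarrow> ob X (n - 1)\<close>.\<close>

record ('o, 'm) chain =
  ob :: "int \<Rightarrow> 'o"
  dif :: "int \<Rightarrow> 'm"

definition Ch :: "('o, 'm) cat \<Rightarrow> (('o, 'm) chain, int \<Rightarrow> 'm) cat" where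
  "Ch K = \<lparr>
     Obj = {X. \<forall>n. ob X n \<in> Obj K \<and> dif X n \<in> Mor K (ob X n) (ob X (n - 1)) \<and>
                   dif X (n - 1) \<cdot>\<^bsub>K\<^esub> dif X n = Zer K (ob X n) (ob X (n - 1 - 1))},
     Mor = (\<lambda>X Y. {f. \<forall>n. f n \<in> Mor K (ob X n) (ob Y n) \<and>
                          f (n - 1) \<cdot>\<^bsub>K\<^esub> dif X n = dif Y n \<cdot>\<^bsub>K\<^esub> f n}),
     Idt = (\<lambda>X n. Idt K (ob X n)),
     Cmp = (\<lambda>g f n. g n \<cdot>\<^bsub>K\<^esub> f n),
     Pls = (\<lambda>f g n. Pls K (f n) (g n)),
     Zer = (\<lambda>X Y n. Zer K (ob X n) (ob Y n))\<rparr>"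

definition exact_complex :: "('o, 'm) cat \<Rightarrow> ('o, 'm) chain \<Rightarrow> bool" where
  "exact_complex K X \<longleftrightarrow> X \<in> Obj (Ch K) \<and>
     (\<forall>n. exact_at K (ob X (n + 1)) (ob X n) (ob X (n - 1)) (dif X (n + 1)) (dif X n))"

text \<open>Kernels are only determined up to isomorphism, so all of them are required to be in the
  class; the classes this is used for are closed under isomorphism.\<close>

definition kernels_in :: "('o, 'm) cat \<Rightarrow> 'o set \<Rightarrow> 'o \<Rightarrow> 'o \<Rightarrow> 'm \<Rightarrow> bool" where
  "kernels_in K \<X> X Y f \<longleftrightarrow> (\<forall>N k. is_kernel K X Y f N k \<longrightarrow> N \<in> \<X>)"

definition cokernels_in :: "('o, 'm) cat \<Rightarrow> 'o set \<Rightarrow> 'o \<Rightarrow> 'o \<Rightarrow> 'm \<Rightarrow> bool" where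
  "cokernels_in K \<X> X Y f \<longleftrightarrow> (\<forall>N c. is_cokernel K X Y f N c \<longrightarrow> N \<in> \<X>)"

definition exact_with_cycles_in :: "('o, 'm) cat \<Rightarrow> 'o set \<Rightarrow> ('o, 'm) chain set" where
  "exact_with_cycles_in K \<X> = {X. exact_complex K X \<and>
     (\<forall>n. kernels_in K \<X> (ob X n) (ob X (n - 1)) (dif X n))}"

definition class_C :: "('o, 'm) cat \<Rightarrow> 'o model \<Rightarrow> ('o, 'm) chain set" where
  "class_C K M = {X \<in> exact_with_cycles_in K (Cof M). \<forall>n. ob X n \<in> trivially_cofibrant M}"

definition dg_fibrant :: "('o, 'm) cat \<Rightarrow> 'o model \<Rightarrow> ('o, 'm) chain set" where
  "dg_fibrant K M = right_perp (Ch K) (exact_with_cycles_in K (trivially_cofibrant M))"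

text \<open>If this is an abelian model structure then \<open>\<V>\<close> is determined by the other two classes: it
  consists of the objects \<open>X\<close> with a short exact sequence \<open>0 \<rightarrow> X \<rightarrow> Y \<rightarrow> Z \<rightarrow> 0\<close> in which
  \<open>Y\<close> is trivially fibrant and \<open>Z\<close> trivially cofibrant.\<close>

definition Ch_model :: "('o, 'm) cat \<Rightarrow> 'o model \<Rightarrow> ('o, 'm) chain set \<Rightarrow> ('o, 'm) chain model" where
  "Ch_model K M \<V> = \<lparr>Cof = class_C K M, Trv = \<V>, Fib = dg_fibrant K M\<rparr>"

definition stalk :: "('o, 'm) cat \<Rightarrow> 'o \<Rightarrow> ('o, 'm) chain" where
  "stalk K A = (let X = (\<lambda>n::int. if n = 0 then A else (SOME Z. zero_object K Z))
     in \<lparr>ob = X, dif = (\<lambda>n. Zer K (X n) (X (n - 1)))\<rparr>)"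

text \<open>The family of morphisms from \<open>W\<close> to \<open>stalk K A\<close> that is \<open>f\<close> in degree 0.\<close>

definition to_stalk :: "('o, 'm) cat \<Rightarrow> ('o, 'm) chain \<Rightarrow> 'o \<Rightarrow> 'm \<Rightarrow> (int \<Rightarrow> 'm)" where
  "to_stalk K W A f = (\<lambda>n. if n = 0 then f else Zer K (ob W n) (ob (stalk K A) n))"


section \<open>Resolutions and Ext in the homotopy category\<close>

definition model_resolution :: "('o, 'm) cat \<Rightarrow> 'o model \<Rightarrow> 'o \<Rightarrow> ('o, 'm) chain \<Rightarrow> 'm \<Rightarrow> 'm \<Rightarrow> bool" where
  "model_resolution K M A W \<epsilon> \<eta> \<longleftrightarrow>
     exact_complex K W \<and> dif W 0 = \<eta> \<cdot>\<^bsub>K\<^esub> \<epsilon> \<and>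
     \<comment> \<open>exactness in degrees other than 0 and -1 is part of that of \<open>W\<close>\<close>
     epic K (ob W 0) A \<epsilon> \<and> exact_at K (ob W 1) (ob W 0) A (dif W 1) \<epsilon> \<and>
     (\<forall>n\<ge>0. ob W n \<in> trivially_cofibrant M) \<and>
     kernels_in K (Fib M) (ob W 0) A \<epsilon> \<and>
     (\<forall>n\<ge>1. kernels_in K (Fib M) (ob W n) (ob W (n - 1)) (dif W n)) \<and>
     monic K A (ob W (-1)) \<eta> \<and> exact_at K A (ob W (-1)) (ob W (-2)) \<eta> (dif W (-1)) \<and>
     (\<forall>n\<le>-1. ob W n \<in> trivially_fibrant M) \<and>
     cokernels_in K (Cof M) A (ob W (-1)) \<eta> \<and>
     (\<forall>n\<le>-1. cokernels_in K (Cof M) (ob W n) (ob W (n - 1)) (dif W n))"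

definition canonical_resolution ::
  "('o, 'm) cat \<Rightarrow> 'o model \<Rightarrow> 'o \<Rightarrow> ('o, 'm) chain \<Rightarrow> (int \<Rightarrow> 'm) \<Rightarrow> bool" where
  "canonical_resolution K M A W f \<longleftrightarrow> (\<exists>QA p \<epsilon> \<eta>.
     cofibrant_replacement K M A QA p \<and> model_resolution K M QA W \<epsilon> \<eta> \<and>
     f = to_stalk K W A (p \<cdot>\<^bsub>K\<^esub> \<epsilon>))"

text \<open>\<open>H\<^sup>n[Hom(W,B)]\<close>: the cochain complex has \<open>Hom(W\<^sub>n,B)\<close> in degree \<open>n\<close>, with differential
  given by precomposition with \<open>dif W (n + 1)\<close>.\<close>

definition Hom_cohomology :: "('o, 'm) cat \<Rightarrow> ('o, 'm) chain \<Rightarrow> 'o \<Rightarrow> int \<Rightarrow> 'm set monoid" where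
  "Hom_cohomology K W B n =
     (hom_group K (ob W n) B)\<lparr>carrier :=
        {f \<in> Mor K (ob W n) B. f \<cdot>\<^bsub>K\<^esub> dif W (n + 1) = Zer K (ob W (n + 1)) B}\<rparr>
     Mod {g \<cdot>\<^bsub>K\<^esub> dif W n | g. g \<in> Mor K (ob W (n - 1)) B}"

text \<open>These Ext groups are defined only up to the choice of resolutions and replacements; the
  predicates say that \<open>E\<close> is the group obtained from some choice.\<close>

definition is_Ext_model :: "('o, 'm) cat \<Rightarrow> 'o model \<Rightarrow> 'o \<Rightarrow> 'o \<Rightarrow> int \<Rightarrow> 'm set monoid \<Rightarrow> bool" where
  "is_Ext_model K M A B n E \<longleftrightarrow> A \<in> Cof M \<and> B \<in> Fib M \<and>
     (\<exists>W \<epsilon> \<eta>. model_resolution K M A W \<epsilon> \<eta> \<and> E = Hom_cohomology K W B n)"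

definition is_Ext_Ho :: "('o, 'm) cat \<Rightarrow> 'o model \<Rightarrow> 'o \<Rightarrow> 'o \<Rightarrow> int \<Rightarrow> 'm set monoid \<Rightarrow> bool" where
  "is_Ext_Ho K M A B n E \<longleftrightarrow> (\<exists>QA RQA QB RQB p j q k.
     cofibrant_replacement K M A QA p \<and> fibrant_replacement K M QA RQA j \<and>
     cofibrant_replacement K M B QB q \<and> fibrant_replacement K M QB RQB k \<and>
     is_Ext_model K M RQA RQB n E)"

end

theory Submission
  imports Defs
begin

text \<open>Exact complexes with cofibrant cycles and trivially cofibrant components are tested against
  complexes \<open>N\<close> that are cut in one degree: above it \<open>N\<close> has fibrant cycles, below it trivially fibrant
  components. Extensions of such complexes split degreewise, and a splitting chain map is found by
  lifting upwards and extending downwards from the cut. The kernel of \<open>W\<^sub>Q\<^sub>A \<rightarrow> S\<^sup>0(A)\<close> is of this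
  kind, which is the first claim.

  Two cofibrant replacements of the same complex are homotopy equivalent, so the cohomology of
  \<open>Hom(C, B)\<close> depends only on the complex that \<open>C\<close> replaces. To pass from \<open>A\<close> to \<open>RQA\<close>, embed the trivially
  cofibrant cokernel \<open>D\<close> of \<open>QA \<rightarrow> RQA\<close> into a complex \<open>Y\<close> of trivially fibrant objects replacing
  \<open>S\<^sup>0(D)\<close>. A cofibrant replacement of \<open>S\<^sup>0(RQA) \<times> Y\<close> over \<open>S\<^sup>0(D)\<close> replaces \<open>S\<^sup>0(RQA)\<close>, and the kernel of its map to
  \<open>Y\<close> replaces \<open>S\<^sup>0(A)\<close>; as \<open>Hom(Y, B)\<close> is acyclic for fibrant \<open>B\<close>, both have the same cohomology. To pass from \<open>RQB\<close>
  to \<open>RB\<close>, use the cokernel \<open>P\<close> of the composite of the trivially fibrant kernel of \<open>QB \<rightarrow> B\<close> with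
  \<open>QB \<rightarrow> RQB\<close>: it is fibrant by heredity, and it is equivalent to \<open>RB\<close> up to maps through trivially
  cofibrant objects, which induce zero in cohomology.\<close>

section \<open>Arrow algebras\<close>

text \<open>The class \<open>perp_C\<close> is available only as an orthogonal, so membership in it
  means splitting extensions by hand. A complex X in \<open>class_C\<close> offers two sources of
  vanishing: its components are orthogonal to fibrant objects, its cycles to trivially fibrant ones.
  Lifting a map out of a component of X therefore asks for fibrant cycles in the target, and
  extending a map from a cycle object of X asks for trivially fibrant components there. The two
  halves of an M-resolution supply just these, which is the origin of the cut. In the first argument
  the obstacle is that the stalk of D is not exact unless D = 0, hence not trivially cofibrant as a
  complex. The complex Y, exact with trivially cofibrant cycles, is a trivially cofibrant complex
  that stands in for it. Heredity enters through Ext^2: by dimension shifting it closes the left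
  classes under kernels of epis and the right classes under cokernels of monos. Yoneda classes are
  replaced throughout by splittings (Ext^1) and fillings (Ext^2).\<close>

text \<open>All operations are total: a composite or sum that is not defined is some element outside of
  \<open>arr\<close>, and the laws hold without side conditions. The axioms are self-dual, so that every theorem has a
  dual obtained from \<open>ringoid_op\<close> and \<open>abelian_ringoid_op\<close>.\<close>

locale ringoid =
  fixes arr :: "'a \<Rightarrow> bool" and dom cod :: "'a \<Rightarrow> 'o" and idn :: "'o \<Rightarrow> 'a"
    and comp :: "'a \<Rightarrow> 'a \<Rightarrow> 'a" (infixr "\<bullet>" 70)
    and add :: "'a \<Rightarrow> 'a \<Rightarrow> 'a" (infixr "\<oplus>" 65)
    and neg :: "'a \<Rightarrow> 'a" ("\<ominus> _" [81] 80)
  assumes arr_comp [simp]: "arr (g \<bullet> f) \<longleftrightarrow> arr g \<and> arr f \<and> dom g = cod f"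
    and dom_comp [simp]: "\<lbrakk>arr g; arr f; dom g = cod f\<rbrakk> \<Longrightarrow> dom (g \<bullet> f) = dom f"
    and cod_comp [simp]: "\<lbrakk>arr g; arr f; dom g = cod f\<rbrakk> \<Longrightarrow> cod (g \<bullet> f) = cod g"
    and comp_assoc: "(h \<bullet> g) \<bullet> f = h \<bullet> (g \<bullet> f)"
    and dom_idn [simp]: "arr (idn X) \<Longrightarrow> dom (idn X) = X"
    and cod_idn [simp]: "arr (idn X) \<Longrightarrow> cod (idn X) = X"
    and arr_idn_dom [simp]: "arr f \<Longrightarrow> arr (idn (dom f))"
    and arr_idn_cod [simp]: "arr f \<Longrightarrow> arr (idn (cod f))"
    and comp_idn [simp]: "\<lbrakk>arr f; dom f = X\<rbrakk> \<Longrightarrow> f \<bullet> idn X = f"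
    and idn_comp [simp]: "\<lbrakk>arr f; cod f = X\<rbrakk> \<Longrightarrow> idn X \<bullet> f = f"
    and arr_add [simp]: "arr (f \<oplus> g) \<longleftrightarrow> arr f \<and> arr g \<and> dom f = dom g \<and> cod f = cod g"
    and dom_add [simp]: "\<lbrakk>arr f; arr g; dom f = dom g; cod f = cod g\<rbrakk> \<Longrightarrow> dom (f \<oplus> g) = dom g"
    and cod_add [simp]: "\<lbrakk>arr f; arr g; dom f = dom g; cod f = cod g\<rbrakk> \<Longrightarrow> cod (f \<oplus> g) = cod g"
    and add_assoc: "(f \<oplus> g) \<oplus> h = f \<oplus> (g \<oplus> h)"
    and add_commute: "f \<oplus> g = g \<oplus> f"
    and comp_add: "h \<bullet> (f \<oplus> g) = h \<bullet> f \<oplus> h \<bullet> g"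
    and add_comp: "(f \<oplus> g) \<bullet> h = f \<bullet> h \<oplus> g \<bullet> h"
    and arr_neg [simp]: "arr (\<ominus> f) \<longleftrightarrow> arr f"
    and dom_neg [simp]: "arr f \<Longrightarrow> dom (\<ominus> f) = dom f"
    and cod_neg [simp]: "arr f \<Longrightarrow> cod (\<ominus> f) = cod f"
    and neg_neg [simp]: "arr f \<Longrightarrow> \<ominus> (\<ominus> f) = f"
    and neg_comp: "(\<ominus> g) \<bullet> f = \<ominus> (g \<bullet> f)"
    and comp_neg: "g \<bullet> (\<ominus> f) = \<ominus> (g \<bullet> f)"
    and neg_add: "\<ominus> (f \<oplus> g) = \<ominus> f \<oplus> \<ominus> g"
    and add_neg_cancel: "\<lbrakk>arr f; arr g; dom f = dom g; cod f = cod g\<rbrakk> \<Longrightarrow> f \<oplus> (\<ominus> f \<oplus> g) = g"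
    and ex_null: "\<lbrakk>arr (idn X); arr (idn Y)\<rbrakk> \<Longrightarrow> \<exists>z. arr z \<and> z \<oplus> z = z \<and> dom z = X \<and> cod z = Y"
begin

text \<open>In an abelian group only 0 satisfies f + f = f. Describing zero arrows as additive
  idempotents needs no zero constant for each pair of objects and is visibly self-dual.\<close>

definition nul :: "'a \<Rightarrow> bool" where
  "nul f \<longleftrightarrow> arr f \<and> f \<oplus> f = f"

text \<open>An undefined composite is not an arrow and so never null. Hence
  \<open>nul (f \<bullet> u)\<close> already forces \<open>u\<close> to be an arrow ending at
  \<open>dom f\<close>, and no typing conditions are needed.\<close>

definition ker :: "'a \<Rightarrow> 'a \<Rightarrow> bool" where
  "ker k f \<longleftrightarrow> nul (f \<bullet> k) \<and> (\<forall>u. nul (f \<bullet> u) \<longrightarrow> (\<exists>!v. k \<bullet> v = u))"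

definition coker :: "'a \<Rightarrow> 'a \<Rightarrow> bool" where
  "coker c f \<longleftrightarrow> nul (c \<bullet> f) \<and> (\<forall>u. nul (u \<bullet> f) \<longrightarrow> (\<exists>!v. v \<bullet> c = u))"

definition mono :: "'a \<Rightarrow> bool" where
  "mono m \<longleftrightarrow> arr m \<and> (\<forall>u. nul (m \<bullet> u) \<longrightarrow> nul u)"

definition epi :: "'a \<Rightarrow> bool" where
  "epi m \<longleftrightarrow> arr m \<and> (\<forall>u. nul (u \<bullet> m) \<longrightarrow> nul u)"

definition ses :: "'a \<Rightarrow> 'a \<Rightarrow> bool" where
  "ses i p \<longleftrightarrow> ker i p \<and> coker p i"

definition exact :: "'a \<Rightarrow> 'a \<Rightarrow> bool" where
  "exact f g \<longleftrightarrow> arr f \<and> (\<exists>k e. ker k g \<and> epi e \<and> k \<bullet> e = f)"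

definition biprod :: "'a \<Rightarrow> 'a \<Rightarrow> 'a \<Rightarrow> 'a \<Rightarrow> bool" where
  "biprod i j p q \<longleftrightarrow> arr i \<and> arr j \<and> p \<bullet> i = idn (dom i) \<and> q \<bullet> j = idn (dom j) \<and>
     nul (p \<bullet> j) \<and> nul (q \<bullet> i) \<and> i \<bullet> p \<oplus> j \<bullet> q = idn (cod i)"

text \<open>The elementary form of Ext^1(X, Y) = 0: every extension has a section. The link with
  Yoneda's definition is \<open>Ext_zero_iff_ext0\<close>.\<close>

definition ext0 :: "'o \<Rightarrow> 'o \<Rightarrow> bool" where
  "ext0 X Y \<longleftrightarrow> (\<forall>i p. ses i p \<and> dom i = Y \<and> cod p = X \<longrightarrow> (\<exists>s. p \<bullet> s = idn X))"

section \<open>Duality\<close>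

lemma ringoid_op: "ringoid arr cod dom idn (\<lambda>g f. f \<bullet> g) (\<oplus>) neg"
proof unfold_locales
  fix X Y assume "arr (idn X)" "arr (idn Y)"
  then show "\<exists>z. arr z \<and> z \<oplus> z = z \<and> cod z = X \<and> dom z = Y"
    using ex_null[of Y X] by blast
qed (auto simp: comp_assoc add_assoc comp_add add_comp neg_comp comp_neg neg_add
       add_neg_cancel intro: add_commute)

lemmas op_defs =
  ringoid.ker_def[OF ringoid_op] ringoid.coker_def[OF ringoid_op]
  ringoid.mono_def[OF ringoid_op] ringoid.epi_def[OF ringoid_op] ringoid.ses_def[OF ringoid_op]
  ringoid.biprod_def[OF ringoid_op]

lemma ker_op: "ringoid.ker arr (\<lambda>g f. f \<bullet> g) (\<oplus>) = (\<lambda>k f. coker k f)"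
  by (intro ext) (simp add: op_defs ker_def coker_def)

lemma coker_op: "ringoid.coker arr (\<lambda>g f. f \<bullet> g) (\<oplus>) = (\<lambda>k f. ker k f)"
  by (intro ext) (simp add: op_defs ker_def coker_def)

lemma mono_op: "ringoid.mono arr (\<lambda>g f. f \<bullet> g) (\<oplus>) = epi"
  by (intro ext) (simp add: op_defs mono_def epi_def)

lemma epi_op: "ringoid.epi arr (\<lambda>g f. f \<bullet> g) (\<oplus>) = mono"
  by (intro ext) (simp add: op_defs mono_def epi_def)

lemma ses_op: "ringoid.ses arr (\<lambda>g f. f \<bullet> g) (\<oplus>) = (\<lambda>i p. ses p i)"
  by (intro ext) (auto simp: op_defs ses_def ker_op coker_op)

lemmas op_simps = ker_op coker_op mono_op epi_op ses_op

section \<open>Zero arrows and additive calculus\<close>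

lemma nul_arr [simp]: "nul f \<Longrightarrow> arr f"
  by (simp add: nul_def)

lemma add_left_commute: "f \<oplus> (g \<oplus> h) = g \<oplus> (f \<oplus> h)"
  using add_assoc[of f g h] add_assoc[of g f h] add_commute[of f g] by simp

lemmas add_ac = add_assoc add_commute add_left_commute

lemma neg_add_cancel: "\<lbrakk>arr f; arr g; dom f = dom g; cod f = cod g\<rbrakk> \<Longrightarrow> \<ominus> f \<oplus> (f \<oplus> g) = g"
  by (subst add_left_commute) (rule add_neg_cancel)

lemma add_left_cancel:
  assumes "arr (f \<oplus> g)" "f \<oplus> g = f \<oplus> h"
  shows "g = h"
proof -
  have h: "arr (f \<oplus> h)" using assms by metis
  have "g = \<ominus> f \<oplus> (f \<oplus> g)"
    using assms(1) neg_add_cancel[of f g] by auto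
  also have "\<dots> = h"
    unfolding assms(2) using h by (auto intro: neg_add_cancel)
  finally show ?thesis .
qed

lemma nul_add:
  assumes "nul f" "arr g" "dom f = dom g" "cod f = cod g"
  shows "f \<oplus> g = g"
proof -
  have "f \<oplus> (f \<oplus> g) = f \<oplus> g"
    using assms by (simp add: nul_def flip: add_assoc)
  then show ?thesis
    using assms by (intro add_left_cancel[of f "f \<oplus> g" g]) auto
qed

lemma add_nul: "\<lbrakk>nul f; arr g; dom g = dom f; cod g = cod f\<rbrakk> \<Longrightarrow> g \<oplus> f = g"
  by (metis nul_add add_commute)

lemma nul_eq:
  assumes "nul f" "nul g" "dom f = dom g" "cod f = cod g"
  shows "f = g"
  using nul_add[of f g] nul_add[of g f] assms by (simp add: add_commute)

lemma nul_add_neg [simp]: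
  assumes "arr f"
  shows "nul (f \<oplus> \<ominus> f)"
proof -
  have "f \<oplus> (\<ominus> f \<oplus> (f \<oplus> \<ominus> f)) = f \<oplus> \<ominus> f"
    using assms by (intro add_neg_cancel) auto
  then show ?thesis
    using assms by (auto simp: nul_def add_assoc)
qed

lemma nul_compL: "\<lbrakk>nul g; arr f; dom g = cod f\<rbrakk> \<Longrightarrow> nul (g \<bullet> f)"
  by (simp add: nul_def flip: add_comp)

lemma nul_compR: "\<lbrakk>nul f; arr g; dom g = cod f\<rbrakk> \<Longrightarrow> nul (g \<bullet> f)"
  by (simp add: nul_def flip: comp_add)

lemma nul_sum: "\<lbrakk>nul f; nul g; dom f = dom g; cod f = cod g\<rbrakk> \<Longrightarrow> nul (f \<oplus> g)"
  by (simp add: nul_add)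

lemma nul_neg [simp]: "arr f \<Longrightarrow> nul (\<ominus> f) \<longleftrightarrow> nul f"
proof -
  assume f: "arr f"
  have *: "nul (\<ominus> g)" if "nul g" for g
    using that neg_add[of g g] by (simp add: nul_def)
  show ?thesis
    using *[of f] *[of "\<ominus> f"] f by auto
qed

lemma neg_nul: "nul f \<Longrightarrow> \<ominus> f = f"
  by (intro nul_eq) auto

lemma eq_iff_nul:
  assumes "arr f" "arr g" "dom f = dom g" "cod f = cod g"
  shows "nul (f \<oplus> \<ominus> g) \<longleftrightarrow> f = g"
proof
  assume "nul (f \<oplus> \<ominus> g)"
  then have "(f \<oplus> \<ominus> g) \<oplus> g = g"
    using assms by (intro nul_add) auto
  moreover have "(f \<oplus> \<ominus> g) \<oplus> g = f"
    using assms add_neg_cancel[of g f] by (simp add: add_ac)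
  ultimately show "f = g" by simp
qed (use assms in auto)

lemma add_nul_iff: "\<lbrakk>arr f; arr g; dom f = dom g; cod f = cod g\<rbrakk> \<Longrightarrow> nul (f \<oplus> g) \<longleftrightarrow> f = \<ominus> g"
  using eq_iff_nul[of f "\<ominus> g"] by simp

section \<open>Monos, epis, kernels and cokernels\<close>

lemma monoD: "\<lbrakk>mono m; m \<bullet> u = m \<bullet> v; arr u; arr v; dom m = cod u; dom m = cod v\<rbrakk> \<Longrightarrow> u = v"
proof -
  assume a: "mono m" "m \<bullet> u = m \<bullet> v" "arr u" "arr v" "dom m = cod u" "dom m = cod v"
  then have m: "arr m" by (simp add: mono_def)
  have d: "dom u = dom v"
    using a m by (metis dom_comp)
  have "nul (m \<bullet> (u \<oplus> \<ominus> v))"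
    using a m d by (simp add: comp_add comp_neg)
  then have "nul (u \<oplus> \<ominus> v)"
    using a mono_def by blast
  then show "u = v"
    using eq_iff_nul a d by auto
qed

lemma mono_nul: "\<lbrakk>mono m; nul (m \<bullet> u)\<rbrakk> \<Longrightarrow> nul u"
  by (simp add: mono_def)

lemma mono_arr [simp]: "mono m \<Longrightarrow> arr m"
  by (simp add: mono_def)

lemma mono_comp: "\<lbrakk>mono m; mono n; dom m = cod n\<rbrakk> \<Longrightarrow> mono (m \<bullet> n)"
  by (metis arr_comp comp_assoc mono_arr mono_def)

lemma mono_cancel:
  assumes "mono (m \<bullet> n)"
  shows "mono n"
  unfolding mono_def
proof (intro conjI allI impI)
  have a: "arr m" "arr n" "dom m = cod n" using mono_arr[OF assms] by auto
  then show "arr n" by simp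
  fix u assume u: "nul (n \<bullet> u)"
  then have "arr u" "dom n = cod u" using nul_arr by fastforce+
  then have "nul ((m \<bullet> n) \<bullet> u)" using a u by (simp add: comp_assoc nul_compR)
  then show "nul u" by (rule mono_nul[OF assms])
qed

lemma ker_mono: "ker k f \<Longrightarrow> mono k"
proof -
  assume k: "ker k f"
  then have a: "arr f" "arr k" "dom f = cod k" "nul (f \<bullet> k)"
    unfolding ker_def by (auto dest: nul_arr)
  show "mono k"
    unfolding mono_def
  proof (intro conjI allI impI)
    fix u assume u: "nul (k \<bullet> u)"
    then have ua: "arr u" "dom k = cod u" using nul_arr[OF u] by auto
    have "nul (f \<bullet> (k \<bullet> u))"
      using nul_compL[OF a(4)] a ua by (simp flip: comp_assoc)
    then have "\<exists>!v. k \<bullet> v = k \<bullet> u" using k ker_def by blast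
    moreover have "k \<bullet> (u \<oplus> u) = k \<bullet> u" using u by (simp add: comp_add nul_def)
    ultimately show "nul u" using ua(1) unfolding nul_def by metis
  qed fact
qed

lemma kerD: "ker k f \<Longrightarrow> nul (f \<bullet> k)" "ker k f \<Longrightarrow> arr k" "ker k f \<Longrightarrow> arr f" "ker k f \<Longrightarrow> cod k = dom f"
  unfolding ker_def by (auto dest: nul_arr)

lemma ker_lift: "\<lbrakk>ker k f; nul (f \<bullet> u)\<rbrakk> \<Longrightarrow> \<exists>v. k \<bullet> v = u \<and> arr v \<and> dom v = dom u \<and> cod v = dom k"
proof -
  assume k: "ker k f" and u: "nul (f \<bullet> u)"
  then obtain v where v: "k \<bullet> v = u" unfolding ker_def by blast
  then have "arr (k \<bullet> v)" using nul_arr[OF u] by simp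
  then show ?thesis using v by (intro exI[of _ v]) auto
qed

lemma kerI: "\<lbrakk>nul (f \<bullet> k); mono k; \<And>u. nul (f \<bullet> u) \<Longrightarrow> \<exists>v. k \<bullet> v = u\<rbrakk> \<Longrightarrow> ker k f"
  unfolding ker_def
proof (intro conjI allI impI)
  fix u assume a: "mono k" and l: "\<And>u. nul (f \<bullet> u) \<Longrightarrow> \<exists>v. k \<bullet> v = u" and u: "nul (f \<bullet> u)"
  then obtain v where v: "k \<bullet> v = u" by blast
  show "\<exists>!v. k \<bullet> v = u"
  proof (intro ex1I[of _ v] v)
    fix w assume w: "k \<bullet> w = u"
    have "arr (k \<bullet> v)" "arr (k \<bullet> w)" using nul_arr[OF u] v w by auto
    then have "arr v" "dom k = cod v" "arr w" "dom k = cod w" unfolding arr_comp by auto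
    then show "w = v" using monoD[OF a, of w v] v w by simp
  qed
qed

lemma ker_unique:
  assumes "ker k f" "ker k' f"
  shows "\<exists>u v. k \<bullet> u = k' \<and> k' \<bullet> v = k \<and> u \<bullet> v = idn (dom k) \<and> v \<bullet> u = idn (dom k')"
proof -
  obtain u where u: "k \<bullet> u = k'" "arr u" "dom u = dom k'" "cod u = dom k"
    using ker_lift[OF assms(1) kerD(1)[OF assms(2)]] kerD[OF assms(2)] by auto
  obtain v where v: "k' \<bullet> v = k" "arr v" "dom v = dom k" "cod v = dom k'"
    using ker_lift[OF assms(2) kerD(1)[OF assms(1)]] kerD[OF assms(1)] by auto
  have "u \<bullet> v = idn (dom k)"
    using u v kerD[OF assms(1)] apply -
    apply (rule monoD[OF ker_mono[OF assms(1)]]) by (simp_all flip: comp_assoc)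
  moreover have "v \<bullet> u = idn (dom k')"
    using u v kerD[OF assms(2)] apply -
    apply (rule monoD[OF ker_mono[OF assms(2)]]) by (simp_all flip: comp_assoc)
  ultimately show ?thesis using u v by blast
qed

lemmas epiD = ringoid.monoD[OF ringoid_op, unfolded op_simps]
lemmas epi_nul = ringoid.mono_nul[OF ringoid_op, unfolded op_simps]
lemmas epi_arr [simp] = ringoid.mono_arr[OF ringoid_op, unfolded op_simps]
lemmas epi_comp = ringoid.mono_comp[OF ringoid_op, unfolded op_simps]
lemmas epi_cancel = ringoid.mono_cancel[OF ringoid_op, unfolded op_simps]
lemmas coker_epi = ringoid.ker_mono[OF ringoid_op, unfolded op_simps]
lemmas cokerD = ringoid.kerD[OF ringoid_op, unfolded op_simps]
lemmas coker_lift = ringoid.ker_lift[OF ringoid_op, unfolded op_simps]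
lemmas cokerI = ringoid.kerI[OF ringoid_op, unfolded op_simps]

lemma mono_idn [simp]: "arr (idn X) \<Longrightarrow> mono (idn X)"
  unfolding mono_def by (metis arr_comp dom_idn idn_comp nul_arr)

lemmas epi_idn [simp] = ringoid.mono_idn[OF ringoid_op, unfolded op_simps]

lemma ex_nul: "\<lbrakk>arr (idn X); arr (idn Y)\<rbrakk> \<Longrightarrow> \<exists>z. nul z \<and> dom z = X \<and> cod z = Y"
  using ex_null unfolding nul_def by blast

section \<open>Short exact sequences, splittings and biproducts\<close>

lemma sesD:
  assumes "ses i p"
  shows "arr i" "arr p" "cod i = dom p" "dom p = cod i" "mono i" "epi p" "nul (p \<bullet> i)"
proof -
  have k: "ker i p" and c: "coker p i" using assms by (simp_all add: ses_def)
  show "arr i" "arr p" "cod i = dom p" "dom p = cod i" "mono i" "epi p" "nul (p \<bullet> i)"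
    using kerD[OF k] ker_mono[OF k] coker_epi[OF c] by simp_all
qed

lemma ses_lift: "\<lbrakk>ses i p; nul (p \<bullet> u)\<rbrakk> \<Longrightarrow> \<exists>v. i \<bullet> v = u \<and> arr v \<and> dom v = dom u \<and> cod v = dom i"
  unfolding ses_def using ker_lift by blast

lemma ses_colift: "\<lbrakk>ses i p; nul (u \<bullet> i)\<rbrakk> \<Longrightarrow> \<exists>v. v \<bullet> p = u \<and> arr v \<and> cod v = cod u \<and> dom v = cod p"
  unfolding ses_def using coker_lift by blast

text \<open>Any kernel is the kernel of its own cokernel: \<open>f\<close> kills \<open>m\<close>
  and so factors through \<open>c\<close>, hence whatever \<open>c\<close> kills is killed by
  \<open>f\<close> and factors through \<open>m\<close>.\<close>

lemma normal_mono:
  assumes "ker m f" "coker c m"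
  shows "ker m c"
proof (rule kerI)
  show "nul (c \<bullet> m)" using assms(2) by (rule cokerD)
  show "mono m" using assms(1) by (rule ker_mono)
  fix u assume u: "nul (c \<bullet> u)"
  obtain v where v: "v \<bullet> c = f" "arr v" "dom v = cod c"
    using coker_lift[OF assms(2) kerD(1)[OF assms(1)]] by blast
  have "nul (v \<bullet> (c \<bullet> u))"
    using u v(2,3) nul_arr[OF u] by (simp add: nul_compR)
  then have "nul (f \<bullet> u)" using v(1) by (simp flip: comp_assoc)
  then show "\<exists>v. m \<bullet> v = u" using ker_lift[OF assms(1)] by blast
qed

lemma split_biprod:
  assumes "ses i p" "p \<bullet> s = idn (cod p)"
  shows "\<exists>r. biprod i s r p"
proof -
  note [simp] = sesD(1-3)[OF assms(1)]
  have "arr (p \<bullet> s)" unfolding assms(2) by simp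
  then have s[simp]: "arr s" "cod s = dom p" by auto
  have [simp]: "dom s = cod p"
    using dom_comp[of p s] s assms(2) by simp
  have ps: "p \<bullet> s \<bullet> x = x" if "arr x" "cod x = cod p" for x
    using that assms(2) by (simp flip: comp_assoc)
  \<comment> \<open>The projection complementary to \<open>s \<bullet> p\<close>. As
    \<open>p\<close> kills it, it factors through \<open>i\<close>, and the factor \<open>r\<close>
    is the retraction.\<close>
  let ?d = "idn (dom p) \<oplus> \<ominus> (s \<bullet> p)"
  have "nul (p \<bullet> ?d)"
    by (simp add: comp_add comp_neg ps)
  then obtain r where r: "i \<bullet> r = ?d" "arr r" "dom r = dom p" "cod r = dom i"
    using ses_lift[OF assms(1), of ?d] by auto
  have pi: "nul (s \<bullet> p \<bullet> i)"
    using sesD(7)[OF assms(1)] by (simp add: nul_compR)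
  have "r \<bullet> i = idn (dom i)"
  proof (rule monoD[OF sesD(5)[OF assms(1)]])
    have "i \<bullet> (r \<bullet> i) = i \<oplus> \<ominus> (s \<bullet> p \<bullet> i)"
      by (simp add: r(1) add_comp neg_comp comp_assoc flip: comp_assoc[of i r i])
    also have "\<dots> = i" using pi by (simp add: neg_nul add_nul)
    finally show "i \<bullet> (r \<bullet> i) = i \<bullet> idn (dom i)" by simp
  qed (use r in simp_all)
  moreover have "nul (r \<bullet> s)"
  proof (rule mono_nul[OF sesD(5)[OF assms(1)]])
    have "i \<bullet> (r \<bullet> s) = s \<oplus> \<ominus> s"
      by (simp add: r(1) add_comp neg_comp comp_assoc assms(2) flip: comp_assoc[of i r s])
    then show "nul (i \<bullet> (r \<bullet> s))" by simp
  qed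
  moreover have "i \<bullet> r \<oplus> s \<bullet> p = idn (cod i)"
    by (simp add: r(1) add_assoc add_commute[of "\<ominus> (s \<bullet> p)"] add_nul)
  ultimately show ?thesis
    using assms(2) sesD(7)[OF assms(1)] by (auto simp: biprod_def)
qed

lemma biprodD:
  assumes "biprod i j p q"
  shows "arr i" "arr j" "arr p" "arr q" "cod j = cod i" "dom p = cod i" "dom q = cod i" "cod p = dom i" "cod q = dom j"
    "p \<bullet> i = idn (dom i)" "q \<bullet> j = idn (dom j)" "nul (p \<bullet> j)" "nul (q \<bullet> i)" "i \<bullet> p \<oplus> j \<bullet> q = idn (cod i)"
proof -
  note b = assms[unfolded biprod_def]
  show a: "arr i" "arr j" using b by auto
  have "arr (p \<bullet> i)" "arr (q \<bullet> j)" "arr (p \<bullet> j)"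
    using b arr_idn_dom nul_arr by metis+
  then show "arr p" "arr q" "cod j = cod i" "dom p = cod i" "dom q = cod i" by auto
  then show "cod p = dom i" "cod q = dom j"
    using a b cod_comp[of p i] cod_comp[of q j] by auto
qed (use assms biprod_def in auto)

lemma biprod_op:
  assumes "biprod i j p q"
  shows "ringoid.biprod arr cod dom idn (\<lambda>g f. f \<bullet> g) (\<oplus>) p q i j"
  using biprodD[OF assms] by (simp add: op_defs(6))

lemma biprod_ses:
  assumes "biprod i j p q"
  shows "ses i q"
proof -
  note [simp] = biprodD(1-11)[OF assms]
  have id: "i \<bullet> p \<bullet> u \<oplus> j \<bullet> q \<bullet> u = u" if "arr u" "cod u = cod i" for u
  proof -
    have "(i \<bullet> p \<oplus> j \<bullet> q) \<bullet> u = u"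
      unfolding biprodD(14)[OF assms] using that by simp
    then show ?thesis by (simp add: add_comp comp_assoc)
  qed
  have id': "u \<bullet> i \<bullet> p \<oplus> u \<bullet> j \<bullet> q = u" if "arr u" "dom u = cod i" for u
  proof -
    have "u \<bullet> (i \<bullet> p \<oplus> j \<bullet> q) = u"
      unfolding biprodD(14)[OF assms] using that by simp
    then show ?thesis by (simp add: comp_add)
  qed
  have "mono i"
    by (rule mono_cancel[of p]) simp
  have "epi q"
    by (rule epi_cancel[of _ j]) simp
  have "ker i q"
  proof (rule kerI)
    fix u assume u: "nul (q \<bullet> u)"
    then have [simp]: "arr u" "cod u = cod i" using nul_arr[OF u] by auto
    have "nul (j \<bullet> q \<bullet> u)" using u by (simp add: nul_compR)
    then have "i \<bullet> p \<bullet> u = u" using id[of u] by (simp add: add_nul)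
    then show "\<exists>v. i \<bullet> v = u" by blast
  qed (use biprodD(13)[OF assms] \<open>mono i\<close> in auto)
  moreover have "coker q i"
  proof (rule cokerI)
    fix u assume u: "nul (u \<bullet> i)"
    then have [simp]: "arr u" "dom u = cod i" using nul_arr[OF u] by auto
    have "nul (u \<bullet> i \<bullet> p)" using nul_compL[OF u, of p] by (simp add: comp_assoc)
    then have "(u \<bullet> j) \<bullet> q = u" using id'[of u] by (simp add: nul_add comp_assoc)
    then show "\<exists>v. v \<bullet> q = u" by blast
  qed (use biprodD(13)[OF assms] \<open>epi q\<close> in auto)
  ultimately show ?thesis by (simp add: ses_def)
qed

text \<open>In the opposite ringoid a retraction of \<open>i\<close> is a section, and
  \<open>split_biprod\<close> there produces the whole biproduct, including the section of
  \<open>p\<close>.\<close>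

lemma split_op:
  assumes "ses i p" "r \<bullet> i = idn (dom i)"
  shows "\<exists>s. p \<bullet> s = idn (cod p)"
proof -
  obtain s where "ringoid.biprod arr cod dom idn (\<lambda>g f. f \<bullet> g) (\<oplus>) p r s i"
    using ringoid.split_biprod[OF ringoid_op, unfolded op_simps, OF assms] by blast
  then show ?thesis unfolding op_defs(6) by auto
qed

lemma ext0_retraction:
  assumes "ext0 X Y" "ses i p" "dom i = Y" "cod p = X"
  shows "\<exists>r. r \<bullet> i = idn Y"
proof -
  obtain s where "p \<bullet> s = idn (cod p)" using assms ext0_def by blast
  then obtain r where "biprod i s r p" using split_biprod assms by blast
  then show ?thesis using biprodD(10) assms by metis
qed

text \<open>Rests on the fact that an extension has a section iff it has a retraction. This makes
  every lifting result about \<open>ext0\<close> yield an extension result for free.\<close>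

lemma ext0_op: "ringoid.ext0 arr cod dom idn (\<lambda>g f. f \<bullet> g) (\<oplus>) = (\<lambda>X Y. ext0 Y X)"
proof (intro ext iffI)
  fix X Y assume "ringoid.ext0 arr cod dom idn (\<lambda>g f. f \<bullet> g) (\<oplus>) X Y"
  then show "ext0 Y X"
    unfolding ringoid.ext0_def[OF ringoid_op] ses_op using split_op ext0_def by metis
next
  fix X Y assume "ext0 Y X"
  then show "ringoid.ext0 arr cod dom idn (\<lambda>g f. f \<bullet> g) (\<oplus>) X Y"
    unfolding ringoid.ext0_def[OF ringoid_op] ses_op using ext0_retraction by blast
qed

lemma ker_neg: "ker i p \<Longrightarrow> ker i (\<ominus> p)"
proof (rule kerI)
  assume k: "ker i p"
  show "nul (\<ominus> p \<bullet> i)" using kerD[OF k] by (simp add: neg_comp)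
  show "mono i" using k by (rule ker_mono)
  fix u assume u: "nul (\<ominus> p \<bullet> u)"
  then have "nul (\<ominus> (p \<bullet> u))" by (simp add: neg_comp)
  moreover have "arr (p \<bullet> u)" using nul_arr[OF u] kerD[OF k] by auto
  ultimately have "nul (p \<bullet> u)" by simp
  then show "\<exists>v. i \<bullet> v = u" using ker_lift[OF k] by blast
qed

lemma coker_neg:
  assumes "coker p i" shows "coker (\<ominus> p) i"
proof (rule cokerI)
  note [simp] = cokerD(2,3)[OF assms]
  have e: "epi p" using assms by (rule coker_epi)
  show "nul (\<ominus> p \<bullet> i)" using cokerD[OF assms] by (simp add: neg_comp)
  show "epi (\<ominus> p)"
    unfolding epi_def
  proof (intro conjI allI impI)
    fix u assume u: "nul (u \<bullet> \<ominus> p)"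
    then have "arr (u \<bullet> p)" using nul_arr[OF u] by auto
    then have "nul (u \<bullet> p)" using u by (simp add: comp_neg)
    then show "nul u" using epi_nul[OF e] by blast
  qed simp
  fix u assume u: "nul (u \<bullet> i)"
  then obtain v where v: "v \<bullet> p = u" "arr v" "dom v = cod p" using coker_lift[OF assms] by blast
  then have "\<ominus> v \<bullet> \<ominus> p = u" by (simp add: neg_comp comp_neg flip: v(1))
  then show "\<exists>v. v \<bullet> \<ominus> p = u" by blast
qed

lemma ses_neg: "ses i p \<Longrightarrow> ses i (\<ominus> p)"
  by (simp add: ses_def ker_neg coker_neg)

lemma ses_iso_left:
  assumes "ses i p" "u \<bullet> v = idn (dom i)" "v \<bullet> u = idn (dom u)" "arr u"
  shows "ses (i \<bullet> u) p"
proof -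
  note [simp] = sesD(1-3)[OF assms(1)] assms(4)
  have "arr (u \<bullet> v)" "arr (v \<bullet> u)" unfolding assms by auto
  then have [simp]: "arr v" "dom u = cod v" "dom v = cod u" by auto
  have [simp]: "cod u = dom i"
    using assms(2) cod_comp[of u v] by simp
  have m: "mono u" by (rule mono_cancel[of v]) (simp add: assms(3))
  have e: "epi u" by (rule epi_cancel[of _ v]) (simp add: assms(2))
  have "ker (i \<bullet> u) p"
  proof (rule kerI)
    show "nul (p \<bullet> i \<bullet> u)" using nul_compL[OF sesD(7)[OF assms(1)], of u] by (simp add: comp_assoc)
    show "mono (i \<bullet> u)" using m sesD(5)[OF assms(1)] by (simp add: mono_comp)
    fix w assume "nul (p \<bullet> w)"
    then obtain x where x: "i \<bullet> x = w" "arr x" "cod x = dom i" using ses_lift[OF assms(1)] by blast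
    have "(i \<bullet> u) \<bullet> v \<bullet> x = i \<bullet> (u \<bullet> v) \<bullet> x" by (simp add: comp_assoc)
    also have "\<dots> = w" using x by (simp add: assms(2))
    finally show "\<exists>v. (i \<bullet> u) \<bullet> v = w" by blast
  qed
  moreover have "coker p (i \<bullet> u)"
  proof (rule cokerI)
    show "nul (p \<bullet> i \<bullet> u)" using nul_compL[OF sesD(7)[OF assms(1)], of u] by (simp add: comp_assoc)
    show "epi p" using assms by (simp add: sesD)
    fix w assume "nul (w \<bullet> i \<bullet> u)"
    then have "nul (w \<bullet> i)" using epi_nul[OF e, of "w \<bullet> i"] by (simp add: comp_assoc)
    then show "\<exists>v. v \<bullet> p = w" using ses_colift[OF assms(1)] by blast
  qed
  ultimately show ?thesis by (simp add: ses_def)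
qed

lemma ext0_iso_right:
  assumes "ext0 X (dom u)" "u \<bullet> v = idn (cod u)" "v \<bullet> u = idn (dom u)" "arr u"
  shows "ext0 X (cod u)"
  unfolding ext0_def
proof (intro allI impI)
  fix i p assume a: "ses i p \<and> dom i = cod u \<and> cod p = X"
  then have "ses (i \<bullet> u) p" using assms by (intro ses_iso_left) auto
  moreover have "dom (i \<bullet> u) = dom u" using a assms sesD(1) by auto
  ultimately show "\<exists>s. p \<bullet> s = idn X" using assms(1) a unfolding ext0_def by blast
qed

lemmas ext0_iso_left = ringoid.ext0_iso_right[OF ringoid_op, unfolded ext0_op]

end

section \<open>Abelian ringoids and exactness\<close>

locale abelian_ringoid = ringoid +
  assumes ex_zero_object: "\<exists>Z. nul (idn Z)"
    and ex_biprod: "\<lbrakk>arr (idn X); arr (idn Y)\<rbrakk> \<Longrightarrow> \<exists>i j p q. biprod i j p q \<and> dom i = X \<and> dom j = Y"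
    and ex_ker: "arr f \<Longrightarrow> \<exists>k. ker k f"
    and ex_coker: "arr f \<Longrightarrow> \<exists>c. coker c f"
    and mono_normal: "mono m \<Longrightarrow> \<exists>f. ker m f"
    and epi_normal: "epi e \<Longrightarrow> \<exists>f. coker e f"
begin

lemma abelian_ringoid_op: "abelian_ringoid arr cod dom idn (\<lambda>g f. f \<bullet> g) (\<oplus>) neg"
proof (intro abelian_ringoid.intro abelian_ringoid_axioms.intro)
  show "\<exists>Z. nul (idn Z)" by (rule ex_zero_object)
  show "\<exists>i j p q. ringoid.biprod arr cod dom idn (\<lambda>g f. f \<bullet> g) (\<oplus>) i j p q \<and> cod i = X \<and> cod j = Y"
    if XY: "arr (idn X)" "arr (idn Y)" for X Y
  proof -
    obtain i j p q where b: "biprod i j p q" "dom i = X" "dom j = Y"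
      using ex_biprod[OF XY] by blast
    then show ?thesis using biprod_op[OF b(1)] biprodD(8,9)[OF b(1)] by metis
  qed
qed (simp_all only: op_simps ex_ker ex_coker mono_normal epi_normal ringoid_op)

lemma mono_ses: "\<lbrakk>mono m; coker c m\<rbrakk> \<Longrightarrow> ses m c"
  unfolding ses_def using mono_normal normal_mono by blast

lemmas epi_ses = abelian_ringoid.mono_ses[OF abelian_ringoid_op, unfolded op_simps]

lemma ex_mono_ses: "mono m \<Longrightarrow> \<exists>c. ses m c"
  using ex_coker mono_ses mono_arr by blast

lemmas ex_epi_ses = abelian_ringoid.ex_mono_ses[OF abelian_ringoid_op, unfolded op_simps]

text \<open>The cokernel \<open>c\<close> of \<open>f\<close> is null because \<open>f\<close> is
  epi, so \<open>c\<close> kills the identity; as \<open>f\<close> is the kernel of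
  \<open>c\<close>, the identity factors through \<open>f\<close>.\<close>

lemma mono_epi_iso:
  assumes "mono f" "epi f"
  shows "\<exists>g. f \<bullet> g = idn (cod f) \<and> g \<bullet> f = idn (dom f)"
proof -
  obtain c where c: "ses f c" using ex_mono_ses[OF assms(1)] by blast
  note [simp] = sesD(1-3)[OF c]
  have "nul c" using sesD(7)[OF c] epi_nul[OF assms(2)] by blast
  then have "nul (c \<bullet> idn (cod f))" by simp
  then obtain g where g: "f \<bullet> g = idn (cod f)" "arr g" "dom g = cod f" "cod g = dom f"
    using ses_lift[OF c] by fastforce
  have "g \<bullet> f = idn (dom f)"
    by (rule monoD[OF assms(1)]) (use g in \<open>simp_all flip: comp_assoc\<close>)
  with g show ?thesis by blast
qed

lemma sesI: "\<lbrakk>ker i p; epi p\<rbrakk> \<Longrightarrow> ses i p"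
  by (rule epi_ses)

lemma ker_comp_iso:
  assumes "ker k f" "u \<bullet> v = idn (dom k)" "arr u" "mono u"
  shows "ker (k \<bullet> u) f"
proof (rule kerI)
  note [simp] = kerD(2-4)[OF assms(1)] assms(3)
  have "arr (u \<bullet> v)" unfolding assms by simp
  then have [simp]: "arr v" "dom u = cod v" by auto
  have [simp]: "cod u = dom k" using assms(2) cod_comp[of u v] by simp
  show "nul (f \<bullet> k \<bullet> u)" using nul_compL[OF kerD(1)[OF assms(1)], of u] by (simp add: comp_assoc)
  show "mono (k \<bullet> u)" using assms(4) ker_mono[OF assms(1)] by (simp add: mono_comp)
  fix w assume "nul (f \<bullet> w)"
  then obtain x where x: "k \<bullet> x = w" "arr x" "cod x = dom k" using ker_lift[OF assms(1)] by blast
  have "(k \<bullet> u) \<bullet> v \<bullet> x = k \<bullet> (u \<bullet> v) \<bullet> x" by (simp add: comp_assoc)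
  also have "\<dots> = w" using x by (simp add: assms(2))
  finally show "\<exists>v. (k \<bullet> u) \<bullet> v = w" by blast
qed

lemma exactD:
  assumes "exact f g"
  shows "arr f" "arr g" "cod f = dom g" "nul (g \<bullet> f)"
proof -
  obtain k e where f: "arr f" and k: "ker k g" "epi e" "k \<bullet> e = f" using assms exact_def by auto
  note [simp] = kerD(2-4)[OF k(1)] epi_arr[OF k(2)]
  have "arr (k \<bullet> e)" unfolding k by (rule f)
  then have ke: "dom k = cod e" by simp
  show "arr g" "arr f" using f by simp_all
  show "cod f = dom g" using ke by (simp flip: k(3))
  show "nul (g \<bullet> f)"
    using nul_compL[OF kerD(1)[OF k(1)], of e] ke by (simp add: comp_assoc flip: k(3))
qed

lemma exact_epi_coker:
  assumes "exact f g" "epi g"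
  shows "coker g f"
proof (rule cokerI)
  show "nul (g \<bullet> f)" using assms(1) by (rule exactD)
  fix u assume u: "nul (u \<bullet> f)"
  obtain k e where k: "ker k g" "epi e" "k \<bullet> e = f" using assms exact_def by auto
  have "nul ((u \<bullet> k) \<bullet> e)" using u k(3) by (simp add: comp_assoc)
  then have "nul (u \<bullet> k)" by (rule epi_nul[OF k(2)])
  then show "\<exists>v. v \<bullet> g = u" using ses_colift[OF sesI[OF k(1) assms(2)]] by blast
qed fact

lemma exact_mono_ker:
  assumes "exact f g" "mono f"
  shows "ker f g"
proof -
  obtain k e where k: "ker k g" "epi e" "k \<bullet> e = f" using assms exact_def by auto
  have e: "mono e" using assms(2) k(3) mono_cancel by metis
  have "arr (k \<bullet> e)" using k(3) assms(2) by simp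
  then have ke: "cod e = dom k" by simp
  obtain v where "e \<bullet> v = idn (cod e)" using mono_epi_iso[OF e k(2)] by blast
  then show ?thesis using ker_comp_iso[OF k(1), of e v] e ke k by simp
qed

lemma exact_ses: "\<lbrakk>mono f; epi g; exact f g\<rbrakk> \<Longrightarrow> ses f g"
  by (intro sesI exact_mono_ker)

lemma ker_exact:
  assumes "ker k g"
  shows "exact k g"
  unfolding exact_def using kerD[OF assms] assms by (intro conjI exI[of _ k] exI[of _ "idn (dom k)"]) auto

lemma ses_exact: "ses i p \<Longrightarrow> exact i p"
  unfolding ses_def by (blast intro: ker_exact)

text \<open>Half of the first isomorphism theorem. Let \<open>n\<close> be the kernel of
  \<open>m\<close> and \<open>q\<close> the cokernel of \<open>n\<close>. The kernel of
  \<open>q \<bullet> c\<close> is killed by \<open>m \<bullet> c\<close>, so it factors through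
  \<open>k\<close> and is killed by \<open>c\<close>. Hence \<open>c\<close> factors through
  \<open>q \<bullet> c\<close>, which gives \<open>q\<close> a left inverse and forces
  \<open>n\<close> to be null.\<close>

lemma coimage_mono:
  assumes "ker k (m \<bullet> c)" "coker c k"
  shows "mono m"
proof -
  have "arr (m \<bullet> c)" using assms by (simp only: kerD)
  then have [simp]: "arr m" "arr c" "dom m = cod c" by auto
  obtain n where n: "ker n m" using ex_ker[of m] by auto
  note [simp] = kerD(2-4)[OF n]
  obtain q where q: "ses n q" using ex_mono_ses[OF ker_mono[OF n]] by blast
  note [simp] = sesD(1-3)[OF q]
  have qdc[simp]: "dom q = cod c" using sesD(4)[OF q] by simp
  obtain m' where m': "m' \<bullet> q = m" "arr m'" "dom m' = cod q" using ses_colift[OF q kerD(1)[OF n]] by blast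
  have c: "epi c" using assms(2) by (rule coker_epi)
  have qc: "epi (q \<bullet> c)" using c sesD(6)[OF q] by (intro epi_comp) auto
  obtain l where l: "ses l (q \<bullet> c)" using ex_epi_ses[OF qc] by blast
  note [simp] = sesD(1,2)[OF l]
  have lc[simp]: "cod l = dom c" using sesD(3)[OF l] by simp
  have "nul (m' \<bullet> q \<bullet> c \<bullet> l)" using sesD(7)[OF l] m'(2,3) by (simp add: nul_compR comp_assoc)
  then have "nul ((m \<bullet> c) \<bullet> l)" by (simp add: comp_assoc flip: m'(1))
  then obtain l' where l': "k \<bullet> l' = l" "arr l'" "cod l' = dom k" using ker_lift[OF assms(1)] by blast
  have "nul (c \<bullet> l)"
    using nul_compL[OF cokerD(1)[OF assms(2)], of l'] l' cokerD(2-4)[OF assms(2)] by (simp add: comp_assoc)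
  then obtain s where s: "s \<bullet> (q \<bullet> c) = c" "arr s" "cod s = cod c" "dom s = cod q"
    using ses_colift[OF l] by fastforce
  have "s \<bullet> q = idn (cod c)"
    by (rule epiD[OF c]) (use s in \<open>simp_all add: comp_assoc\<close>)
  then have "mono q" using mono_cancel[of s q] by simp
  then have "nul n" using sesD(7)[OF q] mono_nul by blast
  show "mono m"
    unfolding mono_def
  proof (intro conjI allI impI)
    fix u assume "nul (m \<bullet> u)"
    then obtain v where "n \<bullet> v = u" "arr v" "cod v = dom n" using ker_lift[OF n] by blast
    then show "nul u" using nul_compL[OF \<open>nul n\<close>] by metis
  qed simp
qed

text \<open>Exactness is defined through an epi onto the kernel of \<open>g\<close>; the dual form
  asks for a mono out of the cokernel of \<open>f\<close>. The cokernel \<open>c\<close> of the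
  kernel \<open>k\<close> is also one of \<open>f\<close>, and the induced map \<open>m\<close> with
  \<open>m \<bullet> c = g\<close> is mono by \<open>coimage_mono\<close>.\<close>

lemma exact_op:
  assumes "exact f g"
  shows "ringoid.exact arr (\<lambda>g f. f \<bullet> g) (\<oplus>) g f"
proof -
  obtain k e where f: "arr f" and k: "ker k g" "epi e" "k \<bullet> e = f" using assms exact_def by auto
  obtain c where c: "ses k c" using ex_mono_ses[OF ker_mono[OF k(1)]] by blast
  obtain m where m: "m \<bullet> c = g" using ses_colift[OF c kerD(1)[OF k(1)]] by blast
  have "mono m" using k(1) c by (intro coimage_mono[of k m c]) (simp_all add: m ses_def)
  moreover have "coker c f"
  proof (rule cokerI)
    have ke: "arr (k \<bullet> e)" unfolding k by (rule f)
    then have "nul ((c \<bullet> k) \<bullet> e)" using nul_compL[OF sesD(7)[OF c], of e] sesD(1-3)[OF c] by simp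
    then show "nul (c \<bullet> f)" by (simp add: comp_assoc k(3))
    show "epi c" using c by (rule sesD)
    fix u assume u: "nul (u \<bullet> f)"
    have "nul ((u \<bullet> k) \<bullet> e)" using u k(3) by (simp add: comp_assoc)
    then have "nul (u \<bullet> k)" by (rule epi_nul[OF k(2)])
    then show "\<exists>v. v \<bullet> c = u" using ses_colift[OF c] by blast
  qed
  ultimately show ?thesis
    unfolding ringoid.exact_def[OF ringoid_op] op_simps
    using m exactD(2)[OF assms] by (intro conjI exI[of _ c] exI[of _ m])
qed

section \<open>Pullbacks and pushouts of short exact sequences\<close>

lemma pullback:
  assumes s: "ses i p" and f[simp]: "arr f" "cod f = cod p"
  obtains i' p' t where "ses i' p'" "t \<bullet> i' = i" "p \<bullet> t = f \<bullet> p'" "arr t" "cod p' = dom f" "dom t = dom p'" "cod t = dom p"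
    "\<And>a b. \<lbrakk>arr (p \<bullet> a); p \<bullet> a = f \<bullet> b\<rbrakk> \<Longrightarrow> \<exists>c. t \<bullet> c = a \<and> p' \<bullet> c = b"
    "\<And>c. \<lbrakk>nul (t \<bullet> c); nul (p' \<bullet> c)\<rbrakk> \<Longrightarrow> nul c"
proof -
  note [simp] = sesD(1-3)[OF s]
  obtain i1 i2 q1 q2 where b: "biprod i1 i2 q1 q2" "dom i1 = dom p" "dom i2 = dom f"
    using ex_biprod[of "dom p" "dom f"] by auto
  note [simp] = biprodD(1-11)[OF b(1)] b(2,3)
  have id: "i1 \<bullet> q1 \<bullet> u \<oplus> i2 \<bullet> q2 \<bullet> u = u" if "arr u" "cod u = cod i1" for u
  proof -
    have "(i1 \<bullet> q1 \<oplus> i2 \<bullet> q2) \<bullet> u = u"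
      unfolding biprodD(14)[OF b(1)] using that by simp
    then show ?thesis by (simp add: add_comp comp_assoc)
  qed
  have q1i1: "q1 \<bullet> i1 \<bullet> u = u" if "arr u" "cod u = dom p" for u
    using that by (simp flip: comp_assoc)
  have q2i2: "q2 \<bullet> i2 \<bullet> u = u" if "arr u" "cod u = dom f" for u
    using that by (simp flip: comp_assoc)
  have q1i2: "nul (q1 \<bullet> i2 \<bullet> u)" if "arr u" "cod u = dom f" for u
    using that nul_compL[OF biprodD(12)[OF b(1)], of u] by (simp add: comp_assoc)
  have q2i1: "nul (q2 \<bullet> i1 \<bullet> u)" if "arr u" "cod u = dom p" for u
    using that nul_compL[OF biprodD(13)[OF b(1)], of u] by (simp add: comp_assoc)
  \<comment> \<open>The pullback is the kernel of the difference of the two maps on the biproduct of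
    \<open>dom p\<close> and \<open>dom f\<close>. Restricted along \<open>i1\<close> this
    difference is \<open>p\<close>, so it is epi.\<close>
  let ?\<phi> = "p \<bullet> q1 \<oplus> \<ominus> (f \<bullet> q2)"
  obtain k where k: "ker k ?\<phi>" using ex_ker[of ?\<phi>] by auto
  have k'[simp]: "arr k" "cod k = cod i1" using kerD(2-4)[OF k] by auto
  have mk: "mono k" using k by (rule ker_mono)
  have "?\<phi> \<bullet> i1 = p"
    using biprodD(13)[OF b(1)]
    by (simp add: add_comp neg_comp comp_assoc add_nul nul_compR)
  then have e\<phi>: "epi ?\<phi>" using epi_cancel[of ?\<phi> i1] sesD(6)[OF s] by simp
  have sk: "ses k ?\<phi>" using k e\<phi> by (rule sesI)
  define t where "t = q1 \<bullet> k"
  define p' where "p' = q2 \<bullet> k"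
  have [simp]: "arr t" "arr p'" "dom t = dom k" "dom p' = dom k" "cod t = dom p" "cod p' = dom f"
    by (simp_all add: t_def p'_def)
  have kt: "i1 \<bullet> t \<bullet> u \<oplus> i2 \<bullet> p' \<bullet> u = k \<bullet> u" if "arr u" "cod u = dom k" for u
    using that id[of "k \<bullet> u"] by (simp add: t_def p'_def comp_assoc)
  have sq: "p \<bullet> t = f \<bullet> p'"
  proof -
    have "nul (p \<bullet> t \<oplus> \<ominus> (f \<bullet> p'))"
      using kerD(1)[OF k] by (simp add: t_def p'_def add_comp neg_comp comp_assoc)
    then show ?thesis by (simp add: eq_iff_nul)
  qed
  have univ: "\<exists>c. t \<bullet> c = a \<and> p' \<bullet> c = b" if ab: "arr (p \<bullet> a)" "p \<bullet> a = f \<bullet> b" for a b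
  proof -
    have "arr (f \<bullet> b)" using ab by metis
    then have [simp]: "arr b" "cod b = dom f" "arr a" "cod a = dom p" using ab(1) by auto
    have d[simp]: "dom b = dom a" using ab(2) dom_comp[of p a] dom_comp[of f b] by simp
    have "?\<phi> \<bullet> (i1 \<bullet> a \<oplus> i2 \<bullet> b) = (p \<bullet> a \<oplus> f \<bullet> (\<ominus> (q2 \<bullet> i1 \<bullet> a))) \<oplus> (p \<bullet> q1 \<bullet> i2 \<bullet> b \<oplus> \<ominus> (f \<bullet> b))"
      by (simp add: add_comp comp_add neg_comp comp_neg comp_assoc q1i1 q2i2 add_ac)
    also have "\<dots> = p \<bullet> a \<oplus> \<ominus> (f \<bullet> b)"
      using q2i1[of a] q1i2[of b] by (simp add: add_nul nul_add nul_compR)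
    finally have "nul (?\<phi> \<bullet> (i1 \<bullet> a \<oplus> i2 \<bullet> b))" using ab by simp
    then obtain c where c: "k \<bullet> c = i1 \<bullet> a \<oplus> i2 \<bullet> b" "arr c" "cod c = dom k"
      using ker_lift[OF k] by blast
    have "t \<bullet> c = a" "p' \<bullet> c = b"
      using q1i2[of b] q2i1[of a]
      by (simp_all add: t_def p'_def comp_assoc c comp_add q1i1 q2i2 add_nul nul_add)
    then show ?thesis by blast
  qed
  have joint: "nul c" if "nul (t \<bullet> c)" "nul (p' \<bullet> c)" for c
  proof -
    have [simp]: "arr c" "cod c = dom k" using nul_arr[OF that(1)] by auto
    have "nul (i1 \<bullet> t \<bullet> c)" "nul (i2 \<bullet> p' \<bullet> c)" using that by (simp_all add: nul_compR)
    then have "nul (i1 \<bullet> t \<bullet> c \<oplus> i2 \<bullet> p' \<bullet> c)" by (simp add: nul_add)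
    then have "nul (k \<bullet> c)" by (simp only: kt \<open>arr c\<close> \<open>cod c = dom k\<close>)
    then show ?thesis using mono_nul[OF mk] by blast
  qed
  obtain z where z: "nul z" "dom z = dom i" "cod z = dom f"
    using ex_nul[of "dom i" "dom f"] arr_idn_dom[OF sesD(1)[OF s]] arr_idn_dom[OF f(1)] by blast
  have pz: "p \<bullet> i = f \<bullet> z"
    by (rule nul_eq) (use z sesD(7)[OF s] in \<open>simp_all add: nul_compR\<close>)
  obtain i' where i': "t \<bullet> i' = i" "p' \<bullet> i' = z"
    using univ[OF nul_arr[OF sesD(7)[OF s]] pz] by blast
  have "arr (t \<bullet> i')" unfolding i' by simp
  then have [simp]: "arr i'" "cod i' = dom k" by auto
  have "ker i' p'"
  proof (rule kerI)
    show "nul (p' \<bullet> i')" using i' z by simp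
    show "mono i'" using mono_cancel[of t i'] sesD(5)[OF s] i' by simp
    fix u assume u: "nul (p' \<bullet> u)"
    have [simp]: "arr u" "cod u = dom k" using nul_arr[OF u] by auto
    have "nul (p \<bullet> t \<bullet> u)"
      using u nul_compR[OF u, of f] by (simp add: sq comp_assoc flip: comp_assoc[of p t u])
    then obtain v where v: "i \<bullet> v = t \<bullet> u" "arr v" "dom v = dom u" "cod v = dom i" using ses_lift[OF s] by fastforce
    have [simp]: "dom i' = dom i" using i'(1) \<open>arr (t \<bullet> i')\<close> by (metis arr_comp dom_comp)
    \<comment> \<open>Arrows into the pullback are compared through both projections:
      \<open>t\<close> and \<open>p'\<close> are jointly mono.\<close>
    let ?d = "i' \<bullet> v \<oplus> \<ominus> u"
    have tv: "t \<bullet> i' \<bullet> v = t \<bullet> u" "p' \<bullet> i' \<bullet> v = z \<bullet> v"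
      using v(1) i' by (simp_all flip: comp_assoc)
    have "nul (t \<bullet> ?d)"
      using v by (simp add: comp_add comp_neg tv)
    moreover have "nul (p' \<bullet> ?d)"
      using v u z nul_compL[OF z(1), of v] by (simp add: comp_add comp_neg tv nul_add)
    ultimately have "nul ?d" by (rule joint)
    then have "i' \<bullet> v = u" using v by (simp add: eq_iff_nul)
    then show "\<exists>v. i' \<bullet> v = u" by blast
  qed
  \<comment> \<open>If \<open>h\<close> kills \<open>p'\<close>, then \<open>h \<bullet> q2\<close>
    kills \<open>k\<close> and so equals some \<open>g\<close> after the epi \<open>?\<phi>\<close>.
    Composing with \<open>i1\<close> gives that \<open>g \<bullet> p\<close> is null, hence so are
    \<open>g\<close> and then \<open>h\<close>.\<close>
  moreover have "epi p'"
    unfolding epi_def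
  proof (intro conjI allI impI)
    fix h assume h: "nul (h \<bullet> p')"
    have [simp]: "arr h" "dom h = dom f" using nul_arr[OF h] by auto
    have "nul ((h \<bullet> q2) \<bullet> k)" using h by (simp add: p'_def comp_assoc)
    then obtain g where g: "g \<bullet> ?\<phi> = h \<bullet> q2" "arr g" "dom g = cod p" using ses_colift[OF sk] by fastforce
    have "g \<bullet> p = (h \<bullet> q2) \<bullet> i1" using \<open>?\<phi> \<bullet> i1 = p\<close> by (simp flip: g(1) add: comp_assoc)
    then have "nul (g \<bullet> p)" using biprodD(13)[OF b(1)] by (simp add: comp_assoc nul_compR)
    then have "nul g" using epi_nul[OF sesD(6)[OF s]] by blast
    then have "nul (g \<bullet> ?\<phi>)" using g by (intro nul_compL) auto
    then have "nul (h \<bullet> q2)" by (simp only: g)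
    then have "nul ((h \<bullet> q2) \<bullet> i2)" by (rule nul_compL) simp_all
    then show "nul h" by (simp add: comp_assoc)
  qed simp
  ultimately have "ses i' p'" by (rule sesI)
  then show thesis
  proof (rule that)
    show "t \<bullet> i' = i" "p \<bullet> t = f \<bullet> p'" "arr t" "cod p' = dom f" "dom t = dom p'" "cod t = dom p"
      using i' sq by simp_all
    show "\<exists>c. t \<bullet> c = a \<and> p' \<bullet> c = b" if "arr (p \<bullet> a)" "p \<bullet> a = f \<bullet> b" for a b
      using that by (rule univ)
    show "nul c" if "nul (t \<bullet> c)" "nul (p' \<bullet> c)" for c
      using that by (rule joint)
  qed
qed

lemma pushout:
  assumes "ses i p" "arr f" "dom f = dom i"
  obtains i' p' t where "ses i' p'" "p' \<bullet> t = p" "t \<bullet> i = i' \<bullet> f" "arr t" "dom i' = cod f" "cod t = cod i'" "dom t = cod i"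
    "\<And>a b. \<lbrakk>arr (a \<bullet> i); a \<bullet> i = b \<bullet> f\<rbrakk> \<Longrightarrow> \<exists>c. c \<bullet> t = a \<and> c \<bullet> i' = b"
    "\<And>c. \<lbrakk>nul (c \<bullet> t); nul (c \<bullet> i')\<rbrakk> \<Longrightarrow> nul c"
proof (rule abelian_ringoid.pullback[OF abelian_ringoid_op, unfolded op_simps, OF assms])
  fix p' i' t
  assume *: "ses i' p'" "p' \<bullet> t = p" "t \<bullet> i = i' \<bullet> f" "arr t" "dom i' = cod f" "cod t = cod i'" "dom t = cod i"
    "\<And>a b. \<lbrakk>arr (a \<bullet> i); a \<bullet> i = b \<bullet> f\<rbrakk> \<Longrightarrow> \<exists>c. c \<bullet> t = a \<and> c \<bullet> i' = b"
    "\<And>c. \<lbrakk>nul (c \<bullet> t); nul (c \<bullet> i')\<rbrakk> \<Longrightarrow> nul c"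
  show thesis by (rule that[OF *])
qed

section \<open>Lifting and extending arrows when Ext^1 vanishes\<close>

lemma ext0_lift:
  assumes "ext0 X A" "ses i p" "dom i = A" "arr f" "dom f = X" "cod f = cod p"
  shows "\<exists>g. p \<bullet> g = f"
proof -
  \<comment> \<open>The obstruction to lifting \<open>f\<close> is the extension pulled back along
    \<open>f\<close>. It splits by hypothesis, and a section followed by \<open>t\<close> is the
    lift.\<close>
  obtain i' p' t where t: "ses i' p'" "t \<bullet> i' = i" "p \<bullet> t = f \<bullet> p'" "arr t" "cod p' = dom f"
    by (rule pullback[OF assms(2,4,6)])
  have "arr (t \<bullet> i')" using t assms sesD by simp
  then have "dom i' = A" using t(2) assms(3) by (metis arr_comp dom_comp)
  then obtain s where s: "p' \<bullet> s = idn X" using assms t ext0_def by metis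
  have "p \<bullet> t \<bullet> s = f \<bullet> p' \<bullet> s" by (simp add: t(3) flip: comp_assoc)
  also have "\<dots> = f" using s assms by simp
  finally show ?thesis by blast
qed

lemma ext0_extend:
  assumes "ext0 Y A" "ses i p" "cod p = Y" "arr f" "cod f = A" "dom f = dom i"
  shows "\<exists>g. g \<bullet> i = f"
  using abelian_ringoid.ext0_lift[OF abelian_ringoid_op, unfolded op_simps ext0_op, OF assms] .

text \<open>The map \<open>b\<close> extends to \<open>b'\<close> on the middle object of the given
  extension, since Ext^1(X, \<open>cod b\<close>) vanishes. The kernel \<open>k\<close> of
  \<open>b'\<close> is then an extension of X by \<open>dom a\<close>; a section of that one,
  followed by \<open>k\<close>, is the section wanted.\<close>

lemma ext0_middle_right:
  assumes ab: "ses a b" and X: "ext0 X (dom a)" "ext0 X (cod b)"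
  shows "ext0 X (cod a)"
  unfolding ext0_def
proof (intro allI impI)
  fix i p assume "ses i p \<and> dom i = cod a \<and> cod p = X"
  then have s: "ses i p" and di[simp]: "dom i = cod a" and cp[simp]: "cod p = X" by auto
  note [simp] = sesD(1-3)[OF s] sesD(1,2,4)[OF ab]
  obtain b' where b': "b' \<bullet> i = b"
    using ext0_extend[OF X(2) s, of b] by auto
  have "arr (b' \<bullet> i)" unfolding b' by simp
  then have [simp]: "arr b'" "dom b' = dom p" by auto
  have eb: "epi b'" using epi_cancel[of b' i] sesD(6)[OF ab] b' by simp
  obtain k where k: "ses k b'" using ex_epi_ses[OF eb] by blast
  note [simp] = sesD(1,3)[OF k]
  have "nul (b' \<bullet> i \<bullet> a)" using sesD(7)[OF ab] by (simp add: b' flip: comp_assoc)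
  then obtain a' where a': "k \<bullet> a' = i \<bullet> a" "arr a'" "cod a' = dom k" "dom a' = dom a"
    using ses_lift[OF k, of "i \<bullet> a"] by auto
  have "ker a' (p \<bullet> k)"
  proof (rule kerI)
    have "nul (p \<bullet> i \<bullet> a)" using nul_compL[OF sesD(7)[OF s], of a] by (simp add: comp_assoc)
    then show "nul ((p \<bullet> k) \<bullet> a')" by (simp add: comp_assoc a'(1))
    have "mono (i \<bullet> a)" using sesD(5)[OF s] sesD(5)[OF ab] by (intro mono_comp) auto
    then show "mono a'" using mono_cancel[of k a'] by (simp only: a')
    fix u assume "nul ((p \<bullet> k) \<bullet> u)"
    then have u: "nul (p \<bullet> k \<bullet> u)" by (simp add: comp_assoc)
    have [simp]: "arr u" "cod u = dom k" using nul_arr[OF u] by auto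
    obtain v where v: "i \<bullet> v = k \<bullet> u" "arr v" "cod v = dom i" using ses_lift[OF s u] by blast
    have "b \<bullet> v = (b' \<bullet> i) \<bullet> v" by (simp only: b')
    also have "\<dots> = (b' \<bullet> k) \<bullet> u" by (simp add: comp_assoc v(1))
    finally have "nul (b \<bullet> v)" using nul_compL[OF sesD(7)[OF k], of u] by simp
    then obtain w where w: "a \<bullet> w = v" "arr w" "cod w = dom a" using ses_lift[OF ab] by blast
    have "k \<bullet> a' \<bullet> w = (i \<bullet> a) \<bullet> w" by (simp add: a'(1) flip: comp_assoc)
    also have "\<dots> = k \<bullet> u" by (simp add: comp_assoc w v)
    finally have "a' \<bullet> w = u" using w a' by (intro monoD[OF sesD(5)[OF k], of "a' \<bullet> w" u]) auto
    then show "\<exists>v. a' \<bullet> v = u" by blast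
  qed
  moreover have "epi (p \<bullet> k)"
    unfolding epi_def
  proof (intro conjI allI impI)
    fix h assume "nul (h \<bullet> p \<bullet> k)"
    then have "nul ((h \<bullet> p) \<bullet> k)" by (simp add: comp_assoc)
    then obtain g where g: "g \<bullet> b' = h \<bullet> p" "arr g" "dom g = cod b'" using ses_colift[OF k] by blast
    have [simp]: "cod b' = cod b" using b' cod_comp[of b' i] by simp
    have "arr (g \<bullet> b')" using g(2,3) by simp
    then have "arr (h \<bullet> p)" by (simp only: g(1))
    then have [simp]: "arr h" "dom h = X" by auto
    have "g \<bullet> b = (h \<bullet> p) \<bullet> i" by (simp add: comp_assoc b' flip: g(1))
    then have "nul (g \<bullet> b)" using nul_compR[OF sesD(7)[OF s], of h] by (simp add: comp_assoc)
    then have "nul g" by (rule epi_nul[OF sesD(6)[OF ab]])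
    then have "nul (g \<bullet> b')" using nul_compL[of g b'] g(3) by simp
    then have "nul (h \<bullet> p)" by (simp only: g(1))
    then show "nul h" by (rule epi_nul[OF sesD(6)[OF s]])
  qed simp
  ultimately have "ses a' (p \<bullet> k)" by (rule sesI)
  then obtain x where "(p \<bullet> k) \<bullet> x = idn X" using X(1) a' unfolding ext0_def by fastforce
  then show "\<exists>x. p \<bullet> x = idn X" by (auto simp: comp_assoc)
qed

lemmas ext0_middle_left = abelian_ringoid.ext0_middle_right[OF abelian_ringoid_op, unfolded op_simps ext0_op]

lemma ext0_zero_right:
  assumes "nul (idn Y)"
  shows "ext0 X Y"
  unfolding ext0_def
proof (intro allI impI)
  fix i p assume "ses i p \<and> dom i = Y \<and> cod p = X"
  then have s: "ses i p" and d: "dom i = Y" "cod p = X" by auto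
  note [simp] = sesD(1-3)[OF s]
  have "mono p"
    unfolding mono_def
  proof (intro conjI allI impI)
    fix u assume "nul (p \<bullet> u)"
    then obtain v where v: "i \<bullet> v = u" "arr v" "cod v = dom i" using ses_lift[OF s] by blast
    then have "nul (i \<bullet> idn Y)" using d assms by (intro nul_compR) auto
    then have "nul i" using d by simp
    then have "nul (i \<bullet> v)" using v by (intro nul_compL) auto
    then show "nul u" using v by simp
  qed simp
  then show "\<exists>s. p \<bullet> s = idn X" using mono_epi_iso[of p] sesD(6)[OF s] d by auto
qed

lemma ext0_zero_left: "nul (idn X) \<Longrightarrow> ext0 X Y"
  using abelian_ringoid.ext0_zero_right[OF abelian_ringoid_op, unfolded ext0_op] .

text \<open>The kernel of a composite of epis is filtered by the two kernels. That \<open>b\<close>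
  is epi is seen by pulling \<open>p\<close> back along \<open>j\<close>: the pulled back epi
  \<open>p'\<close> factors as \<open>b \<bullet> c\<close>.\<close>

lemma ses_comp:
  assumes s: "ses i p" and j: "ses j q" and pq: "cod p = dom q" and k: "ker k (q \<bullet> p)"
  shows "\<exists>a b. ses a b \<and> k \<bullet> a = i \<and> p \<bullet> k = j \<bullet> b \<and> cod a = dom k \<and> dom a = dom i \<and> cod b = dom j"
proof -
  note [simp] = sesD(1-3)[OF s] sesD(1-3)[OF j] pq kerD(2)[OF k]
  have [simp]: "cod k = dom p" using kerD(4)[OF k] by simp
  have mk: "mono k" using k by (rule ker_mono)
  have "nul (q \<bullet> p \<bullet> k)" using kerD(1)[OF k] by (simp add: comp_assoc)
  then obtain b where b: "j \<bullet> b = p \<bullet> k" "arr b" "dom b = dom k" "cod b = dom j"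
    using ses_lift[OF j, of "p \<bullet> k"] by auto
  have "nul ((q \<bullet> p) \<bullet> i)" using nul_compR[OF sesD(7)[OF s], of q] by (simp add: comp_assoc)
  then obtain a where a: "k \<bullet> a = i" "arr a" "dom a = dom i" "cod a = dom k"
    using ker_lift[OF k] by blast
  have "ker a b"
  proof (rule kerI)
    have "nul (j \<bullet> b \<bullet> a)"
      using sesD(7)[OF s] by (simp add: b(1) comp_assoc a(1) flip: comp_assoc[of j])
    then show "nul (b \<bullet> a)" using mono_nul[OF sesD(5)[OF j]] by blast
    show "mono a" using mono_cancel[of k a] sesD(5)[OF s] by (simp add: a(1))
    fix u assume u: "nul (b \<bullet> u)"
    have [simp]: "arr u" "cod u = dom k" using nul_arr[OF u] b by auto
    have "nul (j \<bullet> b \<bullet> u)" using nul_compR[OF u, of j] b by simp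
    then have "nul (p \<bullet> k \<bullet> u)" by (simp add: b(1) comp_assoc flip: comp_assoc[of j])
    then obtain v where v: "i \<bullet> v = k \<bullet> u" "arr v" "cod v = dom i" using ses_lift[OF s] by blast
    have "k \<bullet> a \<bullet> v = k \<bullet> u" by (simp add: a(1) v(1) flip: comp_assoc)
    then have "a \<bullet> v = u" using v a by (intro monoD[OF mk, of "a \<bullet> v" u]) auto
    then show "\<exists>v. a \<bullet> v = u" by blast
  qed
  moreover have "epi b"
  proof -
    obtain i' p' t where t: "ses i' p'" "p \<bullet> t = j \<bullet> p'" "arr t" "cod p' = dom j" "cod t = dom p" "dom t = dom p'"
      by (rule pullback[OF s, of j]) auto
    note [simp] = sesD(1-3)[OF t(1)] t(3-6)
    have "nul (q \<bullet> p \<bullet> t)" using nul_compL[OF sesD(7)[OF j], of p'] by (simp add: t(2) comp_assoc)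
    then have "nul ((q \<bullet> p) \<bullet> t)" by (simp add: comp_assoc)
    then obtain c where c: "k \<bullet> c = t" "arr c" "cod c = dom k" "dom c = dom t" using ker_lift[OF k] by blast
    have "j \<bullet> b \<bullet> c = j \<bullet> p'" by (simp add: b(1) comp_assoc c(1) t(2) flip: comp_assoc[of j b])
    then have "b \<bullet> c = p'" using b c by (intro monoD[OF sesD(5)[OF j], of "b \<bullet> c" p']) auto
    then show "epi b" using epi_cancel[of b c] sesD(6)[OF t(1)] by simp
  qed
  ultimately have "ses a b" by (rule sesI)
  then show ?thesis using a b by metis
qed

text \<open>The row of kernels in the nine lemma; used for cycles, in \<open>class_C_ker\<close>.
  Only surjectivity of \<open>b\<close> takes a chase, and the two pullbacks in it play the role of
  choosing preimages.\<close>

lemma ses_kernels: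
  assumes s1: "ses i1 p1" and s2: "ses i2 p2"
    and e: "epi f0" "epi f1" "epi f" and sq: "f \<bullet> i1 = i2 \<bullet> f0" "f1 \<bullet> p1 = p2 \<bullet> f"
    and d: "dom f0 = dom i1" "dom f = cod i1" "dom f1 = cod p1" "cod f0 = dom i2" "cod f = cod i2" "cod f1 = cod p2"
    and k: "ker k0 f0" "ker k f" "ker k1 f1"
  shows "\<exists>a b. ses a b \<and> k \<bullet> a = i1 \<bullet> k0 \<and> k1 \<bullet> b = p1 \<bullet> k \<and> cod a = dom k \<and> dom a = dom k0 \<and> cod b = dom k1"
proof -
  note [simp] = sesD(1-3)[OF s1] sesD(1-3)[OF s2] epi_arr[OF e(1)] epi_arr[OF e(2)] epi_arr[OF e(3)] d
    kerD(2)[OF k(1)] kerD(2)[OF k(2)] kerD(2)[OF k(3)]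
  have [simp]: "cod k0 = dom i1" "cod k = dom p1" "cod k1 = cod p1"
    using kerD(4)[OF k(1)] kerD(4)[OF k(2)] kerD(4)[OF k(3)] by auto
  have mk: "mono k" "mono k1" "mono k0" using k ker_mono by blast+
  have "f \<bullet> i1 \<bullet> k0 = i2 \<bullet> f0 \<bullet> k0" by (simp add: sq flip: comp_assoc)
  then have "nul (f \<bullet> i1 \<bullet> k0)" using kerD(1)[OF k(1)] by (simp add: nul_compR)
  then obtain a where a: "k \<bullet> a = i1 \<bullet> k0" "arr a" "dom a = dom k0" "cod a = dom k"
    using ker_lift[OF k(2), of "i1 \<bullet> k0"] by auto
  have "f1 \<bullet> p1 \<bullet> k = p2 \<bullet> f \<bullet> k" by (simp add: sq flip: comp_assoc)
  then have "nul (f1 \<bullet> p1 \<bullet> k)" using kerD(1)[OF k(2)] by (simp add: nul_compR)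
  then obtain b where b: "k1 \<bullet> b = p1 \<bullet> k" "arr b" "dom b = dom k" "cod b = dom k1"
    using ker_lift[OF k(3), of "p1 \<bullet> k"] by auto
  have "ker a b"
  proof (rule kerI)
    have "k1 \<bullet> b \<bullet> a = p1 \<bullet> i1 \<bullet> k0" by (simp add: b(1) comp_assoc a(1) flip: comp_assoc[of k1])
    then have "nul (k1 \<bullet> b \<bullet> a)" using nul_compL[OF sesD(7)[OF s1], of k0] by (simp add: comp_assoc)
    then show "nul (b \<bullet> a)" by (rule mono_nul[OF mk(2)])
    have "mono (k \<bullet> a)" unfolding a(1) using sesD(5)[OF s1] mk(3) by (intro mono_comp) auto
    then show "mono a" by (rule mono_cancel)
    fix u assume u: "nul (b \<bullet> u)"
    have [simp]: "arr u" "cod u = dom k" using nul_arr[OF u] b by auto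
    have "nul (k1 \<bullet> b \<bullet> u)" using nul_compR[OF u, of k1] b by simp
    then have "nul (p1 \<bullet> k \<bullet> u)" by (simp add: b(1) comp_assoc flip: comp_assoc[of k1])
    then obtain v where v: "i1 \<bullet> v = k \<bullet> u" "arr v" "cod v = dom i1" using ses_lift[OF s1] by blast
    have "i2 \<bullet> f0 \<bullet> v = f \<bullet> i1 \<bullet> v" by (simp add: sq flip: comp_assoc)
    also have "\<dots> = (f \<bullet> k) \<bullet> u" by (simp add: v(1) comp_assoc)
    finally have "nul (i2 \<bullet> f0 \<bullet> v)" using nul_compL[OF kerD(1)[OF k(2)], of u] by simp
    then have "nul (f0 \<bullet> v)" by (rule mono_nul[OF sesD(5)[OF s2]])
    then obtain w where w: "k0 \<bullet> w = v" "arr w" "cod w = dom k0" using ker_lift[OF k(1)] by blast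
    have "k \<bullet> a \<bullet> w = i1 \<bullet> k0 \<bullet> w" by (simp add: a(1) comp_assoc flip: comp_assoc[of k])
    also have "\<dots> = k \<bullet> u" by (simp add: w v)
    finally have "a \<bullet> w = u" using w a by (intro monoD[OF mk(1), of "a \<bullet> w" u]) auto
    then show "\<exists>v. a \<bullet> v = u" by blast
  qed
  moreover have "epi b"
  proof -
    obtain i' p' t where t: "ses i' p'" "p1 \<bullet> t = k1 \<bullet> p'" "arr t" "cod p' = dom k1" "cod t = dom p1" "dom t = dom p'"
      by (rule pullback[OF s1, of k1]) auto
    note [simp] = sesD(1-3)[OF t(1)] t(3-6)
    have "p2 \<bullet> f \<bullet> t = f1 \<bullet> p1 \<bullet> t" by (simp add: sq flip: comp_assoc)
    also have "\<dots> = (f1 \<bullet> k1) \<bullet> p'" by (simp add: t(2) comp_assoc)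
    finally have "nul (p2 \<bullet> f \<bullet> t)" using nul_compL[OF kerD(1)[OF k(3)], of p'] by simp
    then obtain s where s: "i2 \<bullet> s = f \<bullet> t" "arr s" "dom s = dom t" "cod s = dom i2"
      using ses_lift[OF s2, of "f \<bullet> t"] by auto
    obtain j0 where j0: "ses j0 f0" using ex_epi_ses[OF e(1)] by blast
    obtain i'' q' t' where q: "ses i'' q'" "f0 \<bullet> t' = s \<bullet> q'" "arr t'" "cod q' = dom s" "cod t' = dom f0" "dom t' = dom q'"
      by (rule pullback[OF j0, of s]) (use s in auto)
    note [simp] = sesD(1-3)[OF q(1)] q(3-6) s(2-4)
    \<comment> \<open>\<open>t\<close> represents an element of the middle object over
      \<open>dom k1\<close>. Its image under \<open>f\<close> lies in \<open>dom i2\<close> and is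
      hit by \<open>t'\<close>, so subtracting \<open>i1 \<bullet> t'\<close> moves it into the
      kernel of \<open>f\<close> without changing its image under \<open>p1\<close>.\<close>
    let ?d = "t \<bullet> q' \<oplus> \<ominus> (i1 \<bullet> t')"
    have "f \<bullet> i1 \<bullet> t' = i2 \<bullet> s \<bullet> q'" by (simp add: sq q(2) comp_assoc flip: comp_assoc[of f i1])
    also have "\<dots> = f \<bullet> t \<bullet> q'" by (simp add: s(1) comp_assoc flip: comp_assoc[of i2])
    finally have "nul (f \<bullet> ?d)" by (simp add: comp_add comp_neg)
    then obtain c where c: "k \<bullet> c = ?d" "arr c" "cod c = dom k" "dom c = dom ?d" using ker_lift[OF k(2)] by blast
    have n: "nul (p1 \<bullet> i1 \<bullet> t')" using nul_compL[OF sesD(7)[OF s1], of t'] by (simp add: comp_assoc)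
    have "k1 \<bullet> b \<bullet> c = p1 \<bullet> ?d" by (simp add: b(1) comp_assoc c(1) flip: comp_assoc[of k1 b])
    also have "\<dots> = p1 \<bullet> t \<bullet> q'" using n by (simp add: comp_add comp_neg add_nul)
    also have "\<dots> = k1 \<bullet> p' \<bullet> q'" by (simp add: t(2) comp_assoc flip: comp_assoc[of p1 t])
    finally have "b \<bullet> c = p' \<bullet> q'" using b c by (intro monoD[OF mk(2), of "b \<bullet> c" "p' \<bullet> q'"]) auto
    moreover have "epi (p' \<bullet> q')" using sesD(6)[OF t(1)] sesD(6)[OF q(1)] by (intro epi_comp) auto
    ultimately show "epi b" using epi_cancel[of b c] by simp
  qed
  ultimately have "ses a b" by (rule sesI)
  then show ?thesis using a b by metis
qed

section \<open>Two-extensions and the vanishing of Ext^2\<close>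

definition two_extension :: "'a \<Rightarrow> 'a \<Rightarrow> 'a \<Rightarrow> bool" where
  "two_extension e0 e1 e2 \<longleftrightarrow> mono e0 \<and> epi e2 \<and> exact e0 e1 \<and> exact e1 e2"

text \<open>The 2-extension given by \<open>e0, e1, e2\<close> has trivial Yoneda class iff the object in the middle
  of \<open>e1\<close> can be filled in to a filtered object with the evident subquotients.\<close>

definition trivial2 :: "'a \<Rightarrow> 'a \<Rightarrow> 'a \<Rightarrow> bool" where
  "trivial2 e0 e1 e2 \<longleftrightarrow> (\<exists>m g. g \<bullet> m = e1 \<and> ses m (e2 \<bullet> g))"

lemma two_extension_op: "two_extension e0 e1 e2 \<Longrightarrow>
  abelian_ringoid.two_extension arr (\<lambda>g f. f \<bullet> g) (\<oplus>) e2 e1 e0"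
  unfolding abelian_ringoid.two_extension_def[OF abelian_ringoid_op] two_extension_def op_simps
  by (simp add: exact_op)

text \<open>A filling can be read from either end: \<open>m\<close> with quotient
  \<open>e2 \<bullet> g\<close>, or \<open>g\<close> with kernel \<open>m \<bullet> e0\<close>. With
  \<open>fill_dual'\<close> this makes \<open>trivial2\<close> self-dual.\<close>

lemma fill_dual:
  assumes e: "two_extension e0 e1 e2" and g: "g \<bullet> m = e1" "ses m (e2 \<bullet> g)"
  shows "ses (m \<bullet> e0) g"
proof -
  have x: "mono e0" "epi e2" "exact e0 e1" "exact e1 e2" using e by (auto simp: two_extension_def)
  have k: "ker e0 e1" using x by (intro exact_mono_ker)
  have c: "coker e2 e1" using x by (intro exact_epi_coker)
  note [simp] = exactD(1-3)[OF x(3)] exactD(1-3)[OF x(4)]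
  have "arr (g \<bullet> m)" unfolding g by simp
  then have [simp]: "arr g" "arr m" "dom g = cod m" by auto
  have [simp]: "dom m = dom e1" "cod g = cod e1" using g(1) dom_comp[of g m] cod_comp[of g m] by auto
  have "ker (m \<bullet> e0) g"
  proof (rule kerI)
    have "g \<bullet> m \<bullet> e0 = e1 \<bullet> e0" by (simp add: g(1) flip: comp_assoc)
    then show "nul (g \<bullet> m \<bullet> e0)" using exactD(4)[OF x(3)] by simp
    show "mono (m \<bullet> e0)" using sesD(5)[OF g(2)] x(1) by (intro mono_comp) auto
    fix u assume u: "nul (g \<bullet> u)"
    have [simp]: "arr u" "cod u = cod m" using nul_arr[OF u] by auto
    have "nul ((e2 \<bullet> g) \<bullet> u)" using nul_compR[OF u, of e2] by (simp add: comp_assoc)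
    then obtain v where v: "m \<bullet> v = u" "arr v" "cod v = dom m" using ses_lift[OF g(2)] by blast
    have "e1 \<bullet> v = g \<bullet> u" by (simp add: v(1) comp_assoc flip: g(1))
    then have "nul (e1 \<bullet> v)" using u by simp
    then obtain w where w: "e0 \<bullet> w = v" using ker_lift[OF k] by blast
    then have "(m \<bullet> e0) \<bullet> w = u" by (simp add: comp_assoc v)
    then show "\<exists>v. (m \<bullet> e0) \<bullet> v = u" by blast
  qed
  moreover have "epi g"
    unfolding epi_def
  proof (intro conjI allI impI)
    fix h assume h: "nul (h \<bullet> g)"
    have [simp]: "arr h" "dom h = cod e1" using nul_arr[OF h] by auto
    have "nul ((h \<bullet> g) \<bullet> m)" using nul_compL[OF h, of m] by simp
    then have "nul (h \<bullet> e1)" by (simp add: comp_assoc g)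
    then obtain h' where h': "h' \<bullet> e2 = h" "arr h'" "dom h' = cod e2" using coker_lift[OF c] by blast
    have "nul (h' \<bullet> e2 \<bullet> g)" using h by (simp add: h'(1) flip: comp_assoc)
    then have "nul h'" using epi_nul[OF sesD(6)[OF g(2)]] by blast
    then have "nul (h' \<bullet> e2)" using nul_compL[of h' e2] h'(3) by simp
    then show "nul h" by (simp only: h'(1))
  qed simp
  ultimately show ?thesis by (rule sesI)
qed

lemma fill_dual':
  assumes e: "two_extension e0 e1 e2" and g: "g \<bullet> m = e1" "ses (m \<bullet> e0) g"
  shows "ses m (e2 \<bullet> g)"
  using abelian_ringoid.fill_dual[OF abelian_ringoid_op, unfolded op_simps, OF two_extension_op[OF e] g] .

text \<open>Pushing the filling \<open>m\<close> out along \<open>f1\<close> fills the second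
  2-extension; the universal property turns \<open>f2 \<bullet> g\<close> into the new
  \<open>g'\<close>. Together with its dual \<open>trivial2_pull\<close> this shows that
  \<open>trivial2\<close> depends only on the Yoneda class.\<close>

lemma trivial2_push:
  assumes e: "two_extension e0 e1 e2" and e': "two_extension e0' e1' e2'"
    and f: "f1 \<bullet> e0 = e0'" "f2 \<bullet> e1 = e1' \<bullet> f1" "e2' \<bullet> f2 = e2"
    and f1: "arr f1" "dom f1 = cod e0"
    and t: "trivial2 e0 e1 e2"
  shows "trivial2 e0' e1' e2'"
proof -
  have x: "mono e0" "epi e2" "exact e0 e1" "exact e1 e2" using e by (auto simp: two_extension_def)
  have x': "mono e0'" "epi e2'" "exact e0' e1'" "exact e1' e2'" using e' by (auto simp: two_extension_def)
  note [simp] = exactD(1-3)[OF x(3)] exactD(1-3)[OF x(4)] exactD(1-3)[OF x'(3)] exactD(1-3)[OF x'(4)] f1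
  obtain m g where g: "g \<bullet> m = e1" "ses m (e2 \<bullet> g)" using t trivial2_def by blast
  have "arr (g \<bullet> m)" unfolding g by simp
  then have [simp]: "arr g" "arr m" "dom g = cod m" by auto
  have [simp]: "dom m = dom e1" "cod g = cod e1" using g(1) dom_comp[of g m] cod_comp[of g m] by auto
  have "arr (e2' \<bullet> f2)" unfolding f using x by simp
  then have [simp]: "arr f2" "cod f2 = dom e2'" by auto
  have [simp]: "dom f2 = dom e2" using f(3) dom_comp[of e2' f2] by simp
  have [simp]: "cod f1 = cod e0'" using f(1) cod_comp[of f1 e0] by simp
  have dm: "dom f1 = dom m" by simp
  obtain m' c t where c: "ses m' c" "c \<bullet> t = e2 \<bullet> g" "t \<bullet> m = m' \<bullet> f1" "arr t" "dom m' = cod f1"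
      "cod t = cod m'" "dom t = cod m"
    and univ: "\<And>a b. \<lbrakk>arr (a \<bullet> m); a \<bullet> m = b \<bullet> f1\<rbrakk> \<Longrightarrow> \<exists>c. c \<bullet> t = a \<and> c \<bullet> m' = b"
    and joint: "\<And>c. \<lbrakk>nul (c \<bullet> t); nul (c \<bullet> m')\<rbrakk> \<Longrightarrow> nul c"
    by (rule pushout[OF g(2) f1(1) dm]) (rule that; (assumption | blast))
  note [simp] = sesD(1-3)[OF c(1)] c(4-7)
  have a: "(f2 \<bullet> g) \<bullet> m = e1' \<bullet> f1" by (simp add: comp_assoc g f)
  have "arr ((f2 \<bullet> g) \<bullet> m)" by simp
  then obtain g' where g': "g' \<bullet> t = f2 \<bullet> g" "g' \<bullet> m' = e1'" using univ[OF _ a] by blast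
  have "arr (g' \<bullet> m')" unfolding g' by simp
  then have [simp]: "arr g'" "dom g' = cod m'" by auto
  have [simp]: "cod g' = cod e1'" using g'(2) cod_comp[of g' m'] by simp
  have [simp]: "cod c = cod e2" using c(2) cod_comp[of c t] cod_comp[of e2 g] by simp
  have [simp]: "cod e2' = cod e2" using f(3) cod_comp[of e2' f2] by simp
  have "e2' \<bullet> g' = c"
  proof -
    let ?d = "e2' \<bullet> g' \<oplus> \<ominus> c"
    have "e2' \<bullet> f2 \<bullet> g = e2 \<bullet> g" by (simp add: f(3) flip: comp_assoc)
    then have "nul (?d \<bullet> t)" by (simp add: add_comp neg_comp comp_assoc g' c(2))
    moreover have "nul (?d \<bullet> m')"
      using exactD(4)[OF x'(4)] sesD(7)[OF c(1)] by (simp add: add_comp neg_comp comp_assoc g' nul_add)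
    ultimately have "nul ?d" by (rule joint)
    then show ?thesis by (simp add: eq_iff_nul)
  qed
  then show ?thesis unfolding trivial2_def using g'(2) c(1) by blast
qed

lemma trivial2_pull:
  assumes e: "two_extension e0 e1 e2" and e': "two_extension e0' e1' e2'"
    and f: "f1 \<bullet> e0 = e0'" "f2 \<bullet> e1 = e1' \<bullet> f1" "e2' \<bullet> f2 = e2"
    and f2: "arr f2" "cod f2 = dom e2'"
    and t: "trivial2 e0' e1' e2'"
  shows "trivial2 e0 e1 e2"
proof -
  have op: "abelian_ringoid.trivial2 arr (\<lambda>g f. f \<bullet> g) (\<oplus>) z y x \<longleftrightarrow> trivial2 x y z"
    if "two_extension x y z" for x y z
    unfolding abelian_ringoid.trivial2_def[OF abelian_ringoid_op] trivial2_def op_simps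
    using fill_dual[OF that] fill_dual'[OF that] by blast
  show ?thesis
    using abelian_ringoid.trivial2_push[OF abelian_ringoid_op two_extension_op[OF e'] two_extension_op[OF e]
        f(3) f(2)[symmetric] f(1) f2] t op[OF e] op[OF e'] by simp
qed

text \<open>The 2-extension with identities at both ends and zero in the middle represents the zero
  class and is filled by the biproduct. It is the base point in \<open>Ext_zero_2\<close>.\<close>

lemma trivial2_split:
  assumes "arr e0" "arr e2" "nul e1" "cod e0 = dom e1" "dom e2 = cod e1"
    and e0: "e0 = idn (dom e0)" and e2: "e2 = idn (cod e2)"
  shows "trivial2 e0 e1 e2"
proof -
  have d: "cod e0 = dom e0" "dom e2 = cod e2"
    using e0 e2 assms(1,2) by (metis cod_idn, metis dom_idn)
  obtain i j p q where b: "biprod i j p q" "dom i = dom e1" "dom j = cod e1"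
    using ex_biprod[of "dom e1" "cod e1"] assms by fastforce
  note [simp] = biprodD(1-9)[OF b(1)] b(2,3)
  have "nul (q \<bullet> i)" using b(1) by (rule biprodD)
  then have "q \<bullet> i = e1" using assms(3) by (intro nul_eq) auto
  moreover have "e2 \<bullet> q = q" using e2 d assms by (metis biprodD(4,9)[OF b(1)] b(3) idn_comp)
  ultimately show ?thesis unfolding trivial2_def using biprod_ses[OF b(1)] by metis
qed

definition ext2 where
  "ext2 X Y \<longleftrightarrow> (\<forall>e0 e1 e2. two_extension e0 e1 e2 \<and> dom e0 = Y \<and> cod e2 = X \<longrightarrow> trivial2 e0 e1 e2)"

lemma two_extension_splice:
  assumes "ses i p" "ses j q" "cod p = dom j"
  shows "two_extension i (j \<bullet> p) q"
proof -
  note [simp] = sesD(1-3)[OF assms(1)] sesD(1-3)[OF assms(2)] assms(3)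
  have "ker i (j \<bullet> p)"
  proof (rule kerI)
    have "nul (j \<bullet> p \<bullet> i)" using sesD(7)[OF assms(1)] by (simp add: nul_compR)
    then show "nul ((j \<bullet> p) \<bullet> i)" by (simp add: comp_assoc)
    show "mono i" using assms sesD by blast
    fix u assume "nul ((j \<bullet> p) \<bullet> u)"
    then have "nul (p \<bullet> u)" using mono_nul[OF sesD(5)[OF assms(2)], of "p \<bullet> u"] by (simp add: comp_assoc)
    then show "\<exists>v. i \<bullet> v = u" using ses_lift[OF assms(1)] by blast
  qed
  then have "exact i (j \<bullet> p)" by (rule ker_exact)
  moreover have "exact (j \<bullet> p) q"
    unfolding exact_def using assms(2) sesD(6)[OF assms(1)]
    by (intro conjI exI[of _ j] exI[of _ p]) (auto simp: ses_def)
  ultimately show ?thesis using sesD(5)[OF assms(1)] sesD(6)[OF assms(2)] by (simp add: two_extension_def)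
qed

text \<open>Dimension shift: Ext^1(\<open>dom k\<close>, Y) sits between Ext^1(\<open>dom q\<close>,
  Y) and Ext^2(\<open>cod q\<close>, Y). An extension of \<open>dom k\<close> by Y is spliced with
  \<open>k, q\<close>; a filling \<open>m, g\<close> of the splice gives an extension of
  \<open>dom q\<close> by Y with kernel \<open>m \<bullet> i\<close>, and a retraction of
  \<open>m \<bullet> i\<close> composed with \<open>m\<close> is a retraction of
  \<open>i\<close>.\<close>

lemma ext0_ker:
  assumes "ses k q" "ext2 (cod q) Y" "ext0 (dom q) Y"
  shows "ext0 (dom k) Y"
  unfolding ext0_def
proof (intro allI impI)
  fix i p assume "ses i p \<and> dom i = Y \<and> cod p = dom k"
  then have s: "ses i p" and d: "dom i = Y" "cod p = dom k" by auto
  note [simp] = sesD(1-3)[OF s] sesD(1-3)[OF assms(1)] d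
  have t: "two_extension i (k \<bullet> p) q" using s assms(1) d(2) by (rule two_extension_splice)
  then obtain m g where m: "g \<bullet> m = k \<bullet> p" "ses m (q \<bullet> g)"
    using assms(2) d unfolding ext2_def trivial2_def by blast
  have s': "ses (m \<bullet> i) g" using t m by (rule fill_dual)
  have "arr (g \<bullet> m)" unfolding m by simp
  then have [simp]: "arr g" "arr m" "dom g = cod m" by auto
  have [simp]: "cod g = dom q" using m(1) cod_comp[of g m] by simp
  have "arr (m \<bullet> i)" using sesD(1)[OF s'] .
  then have "dom (m \<bullet> i) = Y" by auto
  then obtain r where "r \<bullet> m \<bullet> i = idn Y" using ext0_retraction[OF assms(3) s'] by auto
  then have "(r \<bullet> m) \<bullet> i = idn (dom i)" by (simp add: comp_assoc)
  then show "\<exists>s. p \<bullet> s = idn (dom k)" using split_op[OF s] d by metis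
qed

text \<open>The same shift in the other variable: the filling is an extension of X by
  \<open>cod a\<close>, and a section of it followed by \<open>g\<close> is a section of
  \<open>p\<close>.\<close>

lemma ext0_coker:
  assumes "ses a b" "ext2 X (dom a)" "ext0 X (cod a)"
  shows "ext0 X (cod b)"
  unfolding ext0_def
proof (intro allI impI)
  fix i p assume "ses i p \<and> dom i = cod b \<and> cod p = X"
  then have s: "ses i p" and d: "dom i = cod b" "cod p = X" by auto
  note [simp] = sesD(1-3)[OF s] sesD(1-3)[OF assms(1)] d
  have t: "two_extension a (i \<bullet> b) p" using assms(1) s d(1) by (intro two_extension_splice) simp_all
  then obtain m g where m: "g \<bullet> m = i \<bullet> b" "ses m (p \<bullet> g)"
    using assms(2) d unfolding ext2_def trivial2_def by blast
  have "arr (g \<bullet> m)" unfolding m by simp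
  then have [simp]: "arr g" "arr m" "dom g = cod m" by auto
  have "dom m = cod a" using m(1) dom_comp[of g m] by simp
  moreover have "cod (p \<bullet> g) = X" using sesD(2)[OF m(2)] by auto
  ultimately obtain x where "(p \<bullet> g) \<bullet> x = idn X" using assms(3) m(2) unfolding ext0_def by blast
  then show "\<exists>s. p \<bullet> s = idn X" by (auto simp: comp_assoc)
qed

end

section \<open>Comparing extensions\<close>

context ringoid begin

text \<open>A section of \<open>p\<close> is carried forward by \<open>f\<close>. Backwards it is
  the retraction that can be carried along \<open>f\<close>, so the argument passes from sections to
  retractions and back.\<close>

lemma section_transfer:
  assumes "ses i p" "ses i' p'" "f \<bullet> i = i'" "p = p' \<bullet> f" "cod p = X" "cod p' = X" "dom i = Y" "dom i' = Y"
  shows "(\<exists>s. p \<bullet> s = idn X) \<longleftrightarrow> (\<exists>s. p' \<bullet> s = idn X)"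
proof
  assume "\<exists>s. p \<bullet> s = idn X"
  then show "\<exists>s. p' \<bullet> s = idn X" using assms(4) by (auto simp: comp_assoc)
next
  assume "\<exists>s. p' \<bullet> s = idn X"
  then obtain t where "p' \<bullet> t = idn (cod p')" using assms(6) by auto
  then obtain r where "biprod i' t r p'" using split_biprod[OF assms(2)] by blast
  then have "(r \<bullet> f) \<bullet> i = idn (dom i)" using biprodD(10) assms(3,7,8) by (simp add: comp_assoc)
  then show "\<exists>s. p \<bullet> s = idn X" using split_op[OF assms(1)] assms(5) by metis
qed

text \<open>The direct sum maps to every split extension with the same ends: combine
  \<open>i\<close> with the section \<open>t\<close>.\<close>

lemma split_compare:
  assumes "ses i p" "p \<bullet> t = idn (cod p)" "biprod i0 j0 p0 q0" "dom i0 = dom i" "dom j0 = cod p"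
  shows "\<exists>f. f \<bullet> i0 = i \<and> p \<bullet> f = q0 \<and> arr f \<and> dom f = cod i0 \<and> cod f = cod i"
proof -
  note [simp] = sesD(1-3)[OF assms(1)] biprodD(1-11)[OF assms(3)] assms(4,5)
  have "arr (p \<bullet> t)" "dom (p \<bullet> t) = cod p" unfolding assms(2) by simp_all
  then have [simp]: "arr t" "cod t = dom p" "dom t = cod p" by auto
  let ?f = "i \<bullet> p0 \<oplus> t \<bullet> q0"
  have "?f \<bullet> i0 = i"
    using biprodD(13)[OF assms(3)] by (simp add: add_comp comp_assoc add_nul nul_compR)
  moreover have "nul (p \<bullet> i \<bullet> p0)"
    using nul_compL[OF sesD(7)[OF assms(1)], of p0] by (simp add: comp_assoc)
  moreover have "p \<bullet> t \<bullet> q0 = q0" by (simp add: assms(2) flip: comp_assoc)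
  ultimately show ?thesis by (intro exI[of _ ?f]) (simp add: comp_add nul_add)
qed

end

context abelian_ringoid begin

lemma zero_comp: "\<lbrakk>nul (idn Z); arr u; cod u = Z\<rbrakk> \<Longrightarrow> nul u"
  using nul_compL[of "idn Z" u] by simp

lemma comp_zero: "\<lbrakk>nul (idn Z); arr u; dom u = Z\<rbrakk> \<Longrightarrow> nul u"
  using nul_compR[of "idn Z" u] by simp

lemma exact_nul_mono:
  assumes "nul f" "mono g" "cod f = dom g"
  shows "exact f g"
proof -
  note [simp] = nul_arr[OF assms(1)] mono_arr[OF assms(2)]
  obtain Z where Z: "nul (idn Z)" using ex_zero_object by blast
  obtain k where k[simp]: "nul k" "dom k = Z" "cod k = dom g" using ex_nul[of Z "dom g"] Z by auto
  obtain e where e[simp]: "nul e" "dom e = dom f" "cod e = Z" using ex_nul[of "dom f" Z] Z by auto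
  have "ker k g"
  proof (rule kerI)
    show "nul (g \<bullet> k)" by (rule nul_compR) simp_all
    show "mono k"
      unfolding mono_def
    proof (intro conjI allI impI)
      fix u assume u: "nul (k \<bullet> u)"
      show "nul u" using nul_arr[OF u] by (intro zero_comp[OF Z]) auto
    qed simp
    fix u assume u: "nul (g \<bullet> u)"
    have "arr u" "cod u = dom g" using nul_arr[OF u] by auto
    moreover have "nul u" using assms(2) u by (rule mono_nul)
    moreover obtain v where v: "nul v" "dom v = dom u" "cod v = Z" using ex_nul[of "dom u" Z] Z \<open>arr u\<close> by auto
    ultimately have "k \<bullet> v = u" by (intro nul_eq) (auto intro: nul_compR)
    then show "\<exists>v. k \<bullet> v = u" by blast
  qed
  moreover have "epi e"
    unfolding epi_def
  proof (intro conjI allI impI)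
    fix u assume u: "nul (u \<bullet> e)"
    show "nul u" using nul_arr[OF u] by (intro comp_zero[OF Z]) auto
  qed simp
  moreover have "k \<bullet> e = f" using assms by (intro nul_eq) (auto intro: nul_compR)
  ultimately show ?thesis unfolding exact_def by auto
qed

lemma exact_idn_nul:
  assumes "nul g"
  shows "exact (idn (dom g)) g"
proof (rule ker_exact, rule kerI)
  show "nul (g \<bullet> idn (dom g))" using assms by simp
  show "mono (idn (dom g))" using assms by simp
  fix u assume "nul (g \<bullet> u)"
  then show "\<exists>v. idn (dom g) \<bullet> v = u" using nul_arr by (intro exI[of _ u]) fastforce
qed

end

context ringoid begin

lemma add_diff_cancel:
  assumes "arr w" "arr a" "arr b" "dom a = dom w" "dom b = dom w" "cod a = cod w" "cod b = cod w"
  shows "(w \<oplus> a) \<oplus> \<ominus> (w \<oplus> b) = a \<oplus> \<ominus> b"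
proof -
  have "(w \<oplus> a) \<oplus> \<ominus> (w \<oplus> b) = (w \<oplus> \<ominus> w) \<oplus> (a \<oplus> \<ominus> b)"
    by (simp only: neg_add add_ac)
  also have "\<dots> = a \<oplus> \<ominus> b"
    by (rule nul_add) (use assms in simp_all)
  finally show ?thesis .
qed

text \<open>The matrix is the differential of a mapping cone. This expansion leaves
  \<open>p \<bullet> w\<close> and \<open>q \<bullet> w\<close> intact as blocks, so that they can
  be rewritten when \<open>w\<close> is again such a matrix.\<close>

lemma matrix_comp:
  "(i \<bullet> (x \<bullet> p \<oplus> c \<bullet> q) \<oplus> \<ominus> (j \<bullet> y \<bullet> q)) \<bullet> w =
    i \<bullet> (x \<bullet> (p \<bullet> w) \<oplus> c \<bullet> (q \<bullet> w)) \<oplus> \<ominus> (j \<bullet> y \<bullet> (q \<bullet> w))"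
  by (simp only: add_comp neg_comp comp_assoc)

lemma diff_add: "\<lbrakk>arr f; arr g; dom f = dom g; cod f = cod g\<rbrakk> \<Longrightarrow> (f \<oplus> \<ominus> g) \<oplus> g = f"
  using neg_add_cancel[of g f] by (simp add: add_ac)

end

context abelian_ringoid begin

text \<open>In a pullback of two epis each projection is epi and inherits the kernel object of the
  opposite map. It is applied to complexes in \<open>cofr_compare\<close>.\<close>

lemma pullback_square:
  assumes s: "ses i p" and q: "ses j q" and c: "cod p = cod q"
  obtains i' j' r t where "ses j' r" "ses i' t" "cod r = dom p" "cod t = dom q" "dom j' = dom j" "dom i' = dom i" "dom r = dom t"
proof -
  note [simp] = sesD(1-3)[OF s] sesD(1-3)[OF q] c
  have pp: "arr p" "cod p = cod q" by simp_all
  obtain j' r t where P: "ses j' r" "t \<bullet> j' = j" "q \<bullet> t = p \<bullet> r" "arr t" "cod r = dom p" "dom t = dom r" "cod t = dom q"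
    and U: "\<And>a b. \<lbrakk>arr (q \<bullet> a); q \<bullet> a = p \<bullet> b\<rbrakk> \<Longrightarrow> \<exists>c. t \<bullet> c = a \<and> r \<bullet> c = b"
    and J: "\<And>c. \<lbrakk>nul (t \<bullet> c); nul (r \<bullet> c)\<rbrakk> \<Longrightarrow> nul c"
    by (rule pullback[OF q pp]) (rule that; (assumption | blast))
  note [simp] = sesD(1-3)[OF P(1)] P(4-7)
  have ji: "arr (t \<bullet> j')" "dom (t \<bullet> j') = dom j" unfolding P(2) by simp_all
  have "epi t"
    unfolding epi_def
  proof (intro conjI allI impI)
    fix u assume u: "nul (u \<bullet> t)"
    then have [simp]: "arr u" "dom u = dom q" using nul_arr[OF u] by auto
    have "nul ((u \<bullet> t) \<bullet> j')" by (rule nul_compL[OF u]) simp_all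
    then have "nul (u \<bullet> j)" by (simp add: comp_assoc P(2))
    then obtain u' where u': "u' \<bullet> q = u" "arr u'" "dom u' = cod q" using ses_colift[OF q] by blast
    have "u \<bullet> t = (u' \<bullet> p) \<bullet> r" by (simp only: comp_assoc P(3) flip: u'(1))
    then have "nul ((u' \<bullet> p) \<bullet> r)" using u by simp
    then have "nul u'" using epi_nul[OF sesD(6)[OF s]] epi_nul[OF sesD(6)[OF P(1)]] by blast
    then show "nul u" using nul_compL[of u' q] u' by simp
  qed simp
  obtain z where z: "nul z" "dom z = dom i" "cod z = dom q" using ex_nul[of "dom i" "dom q"] by auto
  have qz: "q \<bullet> z = p \<bullet> i"
    by (rule nul_eq) (use z nul_arr[OF z(1)] nul_compR[OF z(1), of q] sesD(7)[OF s] in simp_all)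
  have "arr (q \<bullet> z)" using z nul_arr[OF z(1)] by simp
  then obtain i' where i': "t \<bullet> i' = z" "r \<bullet> i' = i" using U[OF _ qz] by blast
  have "arr (r \<bullet> i')" "dom (r \<bullet> i') = dom i" unfolding i' by simp_all
  then have [simp]: "arr i'" "cod i' = dom r" "dom i' = dom i" by auto
  have "mono (r \<bullet> i')" unfolding i' using sesD(5)[OF s] .
  then have m: "mono i'" by (rule mono_cancel)
  have "ker i' t"
  proof (rule kerI[OF _ m])
    show "nul (t \<bullet> i')" unfolding i' by fact
    fix u assume u: "nul (t \<bullet> u)"
    then have [simp]: "arr u" "cod u = dom r" using nul_arr[OF u] by auto
    have "p \<bullet> r \<bullet> u = q \<bullet> t \<bullet> u" by (simp only: P(3) flip: comp_assoc)
    moreover have "nul (q \<bullet> t \<bullet> u)" by (rule nul_compR[OF u]) simp_all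
    ultimately have "nul (p \<bullet> r \<bullet> u)" by simp
    then obtain v where v: "i \<bullet> v = r \<bullet> u" "arr v" "dom v = dom u" "cod v = dom i" using ses_lift[OF s, of "r \<bullet> u"] by auto
    note [simp] = v(2-4)
    have "nul ((t \<bullet> i') \<bullet> v)" unfolding i' by (rule nul_compL[OF z(1)]) (simp_all add: z)
    then have a: "nul (t \<bullet> i' \<bullet> v)" by (simp only: comp_assoc)
    have "nul (t \<bullet> i' \<bullet> v \<oplus> \<ominus> (t \<bullet> u))" by (rule nul_sum) (use a u in simp_all)
    then have 1: "nul (t \<bullet> (i' \<bullet> v \<oplus> \<ominus> u))" by (simp only: comp_add comp_neg)
    have "r \<bullet> i' \<bullet> v = i \<bullet> v" by (simp only: i' flip: comp_assoc)
    then have "r \<bullet> i' \<bullet> v = r \<bullet> u" by (simp only: v)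
    moreover have "nul (r \<bullet> u \<oplus> \<ominus> (r \<bullet> u))" by simp
    ultimately have "nul (r \<bullet> (i' \<bullet> v \<oplus> \<ominus> u))" by (simp only: comp_add comp_neg)
    then have "nul (i' \<bullet> v \<oplus> \<ominus> u)" using J 1 by blast
    then have "i' \<bullet> v = u" using eq_iff_nul[of "i' \<bullet> v" u] by simp
    then show "\<exists>v. i' \<bullet> v = u" by blast
  qed
  then have "ses i' t" using \<open>epi t\<close> by (rule sesI)
  then show thesis using that P(1) ji by simp
qed

end

section \<open>Arrows of a preadditive category\<close>

text \<open>An arrow is represented by \<open>Some\<close> of its source, morphism and target; \<open>None\<close> stands for every
  undefined composite or sum.\<close>

definition hm :: "('o, 'm) cat \<Rightarrow> 'o \<Rightarrow> 'm \<Rightarrow> 'o \<Rightarrow> ('o \<times> 'm \<times> 'o) option" where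
  "hm K X f Y = (if X \<in> Obj K \<and> Y \<in> Obj K \<and> f \<in> Mor K X Y then Some (X, f, Y) else None)"

definition src :: "('o \<times> 'm \<times> 'o) option \<Rightarrow> 'o" where "src a = fst (the a)"
definition tgt :: "('o \<times> 'm \<times> 'o) option \<Rightarrow> 'o" where "tgt a = snd (snd (the a))"
definition mor :: "('o \<times> 'm \<times> 'o) option \<Rightarrow> 'm" where "mor a = fst (snd (the a))"

definition harr :: "('o, 'm) cat \<Rightarrow> ('o \<times> 'm \<times> 'o) option \<Rightarrow> bool" where
  "harr K a \<longleftrightarrow> (\<exists>X f Y. a = Some (X, f, Y) \<and> X \<in> Obj K \<and> Y \<in> Obj K \<and> f \<in> Mor K X Y)"

definition hidn :: "('o, 'm) cat \<Rightarrow> 'o \<Rightarrow> ('o \<times> 'm \<times> 'o) option" where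
  "hidn K X = hm K X (Idt K X) X"

definition hcmp where
  "hcmp K g f = (if harr K g \<and> harr K f \<and> src g = tgt f then Some (src f, Cmp K (mor g) (mor f), tgt g) else None)"

definition hadd where
  "hadd K f g = (if harr K f \<and> harr K g \<and> src f = src g \<and> tgt f = tgt g
     then Some (src g, Pls K (mor f) (mor g), tgt g) else None)"

definition hneg where
  "hneg K f = (if harr K f then Some (src f, inv\<^bsub>hom_group K (src f) (tgt f)\<^esub> mor f, tgt f) else None)"

section \<open>Hom-groups of a preadditive category\<close>

context preadditive_category begin

lemma Zer_Mor [simp]: "\<lbrakk>X \<in> Obj K; Y \<in> Obj K\<rbrakk> \<Longrightarrow> Zer K X Y \<in> Mor K X Y"
  using comm_group.axioms(2)[OF Mor_group, THEN group.is_monoid, THEN monoid.one_closed, of X Y]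
  by (simp add: hom_group_def)

lemma Pls_Mor: "\<lbrakk>X \<in> Obj K; Y \<in> Obj K; f \<in> Mor K X Y; g \<in> Mor K X Y\<rbrakk> \<Longrightarrow> Pls K f g \<in> Mor K X Y"
  using comm_group.axioms(2)[OF Mor_group, THEN group.is_monoid, THEN monoid.m_closed, of X Y f g]
  by (simp add: hom_group_def)

lemma Pls_assoc: "\<lbrakk>X \<in> Obj K; Y \<in> Obj K; f \<in> Mor K X Y; g \<in> Mor K X Y; h \<in> Mor K X Y\<rbrakk>
  \<Longrightarrow> Pls K (Pls K f g) h = Pls K f (Pls K g h)"
  using comm_group.axioms(2)[OF Mor_group, THEN group.is_monoid, THEN monoid.m_assoc, of X Y f g h]
  by (simp add: hom_group_def)

lemma Pls_commute: "\<lbrakk>X \<in> Obj K; Y \<in> Obj K; f \<in> Mor K X Y; g \<in> Mor K X Y\<rbrakk> \<Longrightarrow> Pls K f g = Pls K g f"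
  using comm_group.axioms(1)[OF Mor_group, THEN comm_monoid.m_comm, of X Y f g]
  by (simp add: hom_group_def)

lemma Zer_Pls: "\<lbrakk>X \<in> Obj K; Y \<in> Obj K; f \<in> Mor K X Y\<rbrakk> \<Longrightarrow> Pls K (Zer K X Y) f = f"
  using comm_group.axioms(2)[OF Mor_group, THEN group.is_monoid, THEN monoid.l_one, of X Y f]
  by (simp add: hom_group_def)

lemma inv_Mor: "\<lbrakk>X \<in> Obj K; Y \<in> Obj K; f \<in> Mor K X Y\<rbrakk> \<Longrightarrow> inv\<^bsub>hom_group K X Y\<^esub> f \<in> Mor K X Y"
  using comm_group.axioms(2)[OF Mor_group, THEN group.inv_closed, of X Y f]
  by (simp add: hom_group_def)

lemma Pls_inv: "\<lbrakk>X \<in> Obj K; Y \<in> Obj K; f \<in> Mor K X Y\<rbrakk> \<Longrightarrow> Pls K f (inv\<^bsub>hom_group K X Y\<^esub> f) = Zer K X Y"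
  using comm_group.axioms(2)[OF Mor_group, THEN group.r_inv, of X Y f]
  by (simp add: hom_group_def)

lemma inv_unique: "\<lbrakk>X \<in> Obj K; Y \<in> Obj K; f \<in> Mor K X Y; g \<in> Mor K X Y; Pls K g f = Zer K X Y\<rbrakk>
  \<Longrightarrow> inv\<^bsub>hom_group K X Y\<^esub> f = g"
  using comm_group.axioms(2)[OF Mor_group, THEN group.inv_equality, of X Y g f]
  by (simp add: hom_group_def)

lemma inv_inv: "\<lbrakk>X \<in> Obj K; Y \<in> Obj K; f \<in> Mor K X Y\<rbrakk>
  \<Longrightarrow> inv\<^bsub>hom_group K X Y\<^esub> (inv\<^bsub>hom_group K X Y\<^esub> f) = f"
  using comm_group.axioms(2)[OF Mor_group, THEN group.inv_inv, of X Y f]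
  by (simp add: hom_group_def)

lemma inv_Pls: "\<lbrakk>X \<in> Obj K; Y \<in> Obj K; f \<in> Mor K X Y; g \<in> Mor K X Y\<rbrakk>
  \<Longrightarrow> inv\<^bsub>hom_group K X Y\<^esub> (Pls K f g) = Pls K (inv\<^bsub>hom_group K X Y\<^esub> f) (inv\<^bsub>hom_group K X Y\<^esub> g)"
  using comm_group.inv_mult[OF Mor_group, of X Y f g]
  by (simp add: hom_group_def)

lemma Pls_eq_self: "\<lbrakk>X \<in> Obj K; Y \<in> Obj K; f \<in> Mor K X Y\<rbrakk> \<Longrightarrow> Pls K f f = f \<longleftrightarrow> f = Zer K X Y"
  using comm_group.axioms(2)[OF Mor_group, THEN group.l_cancel_one, of X Y f f]
  by (simp add: hom_group_def)

lemma Zer_Cmp: "\<lbrakk>X \<in> Obj K; Y \<in> Obj K; Z \<in> Obj K; f \<in> Mor K X Y\<rbrakk> \<Longrightarrow> Zer K Y Z \<cdot> f = Zer K X Z"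
  using Pls_Cmp[of X Y Z f "Zer K Y Z" "Zer K Y Z"] Zer_Pls[of Y Z "Zer K Y Z"]
    Pls_eq_self[of X Z "Zer K Y Z \<cdot> f"] Cmp_Mor[of X Y Z f "Zer K Y Z"] by simp

lemma Cmp_Zer: "\<lbrakk>X \<in> Obj K; Y \<in> Obj K; Z \<in> Obj K; g \<in> Mor K Y Z\<rbrakk> \<Longrightarrow> g \<cdot> Zer K X Y = Zer K X Z"
  using Cmp_Pls[of X Y Z "Zer K X Y" "Zer K X Y" g] Zer_Pls[of X Y "Zer K X Y"]
    Pls_eq_self[of X Z "g \<cdot> Zer K X Y"] Cmp_Mor[of X Y Z "Zer K X Y" g] by simp

lemma inv_Cmp:
  assumes "X \<in> Obj K" "Y \<in> Obj K" "Z \<in> Obj K" "f \<in> Mor K X Y" "g \<in> Mor K Y Z"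
  shows "(inv\<^bsub>hom_group K Y Z\<^esub> g) \<cdot> f = inv\<^bsub>hom_group K X Z\<^esub> (g \<cdot> f)"
proof (rule inv_unique[symmetric])
  have "Pls K (inv\<^bsub>hom_group K Y Z\<^esub> g) g = Zer K Y Z"
    using assms inv_Mor Pls_inv Pls_commute by metis
  then show "Pls K ((inv\<^bsub>hom_group K Y Z\<^esub> g) \<cdot> f) (g \<cdot> f) = Zer K X Z"
    using assms by (simp add: inv_Mor Zer_Cmp flip: Pls_Cmp)
qed (use assms in \<open>simp_all add: Cmp_Mor[of X Y Z] inv_Mor\<close>)

lemma Cmp_inv:
  assumes "X \<in> Obj K" "Y \<in> Obj K" "Z \<in> Obj K" "f \<in> Mor K X Y" "g \<in> Mor K Y Z"
  shows "g \<cdot> (inv\<^bsub>hom_group K X Y\<^esub> f) = inv\<^bsub>hom_group K X Z\<^esub> (g \<cdot> f)"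
proof (rule inv_unique[symmetric])
  have "Pls K (inv\<^bsub>hom_group K X Y\<^esub> f) f = Zer K X Y"
    using assms inv_Mor Pls_inv Pls_commute by metis
  then show "Pls K (g \<cdot> (inv\<^bsub>hom_group K X Y\<^esub> f)) (g \<cdot> f) = Zer K X Z"
    using assms by (simp add: inv_Mor Cmp_Zer flip: Cmp_Pls)
qed (use assms in \<open>simp_all add: Cmp_Mor[of X Y Z] inv_Mor\<close>)

section \<open>The ringoid of arrows of a category\<close>

lemma harr_cases:
  assumes "harr K a"
  obtains X f Y where "a = Some (X, f, Y)" "X \<in> Obj K" "Y \<in> Obj K" "f \<in> Mor K X Y"
  using assms harr_def by metis

lemma harr_Some [simp]: "harr K (Some (X, f, Y)) \<longleftrightarrow> X \<in> Obj K \<and> Y \<in> Obj K \<and> f \<in> Mor K X Y"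
  by (simp add: harr_def)

lemma harr_None [simp]: "\<not> harr K None"
  by (simp add: harr_def)

lemma Some_simps [simp]: "src (Some (X, f, Y)) = X" "tgt (Some (X, f, Y)) = Y" "mor (Some (X, f, Y)) = f"
  by (simp_all add: src_def tgt_def mor_def)

lemma hcmp_Some: "harr K (Some (X, f, Y)) \<Longrightarrow> harr K (Some (Y', g, Z)) \<Longrightarrow>
  hcmp K (Some (Y', g, Z)) (Some (X, f, Y)) = (if Y' = Y then Some (X, g \<cdot> f, Z) else None)"
  by (simp add: hcmp_def)

lemma hcmp_None: "\<not> harr K g \<Longrightarrow> hcmp K g f = None" "\<not> harr K f \<Longrightarrow> hcmp K g f = None"
  by (auto simp: hcmp_def)

lemma hadd_Some: "harr K (Some (X, f, Y)) \<Longrightarrow> harr K (Some (X', g, Y')) \<Longrightarrow>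
  hadd K (Some (X, f, Y)) (Some (X', g, Y')) = (if X = X' \<and> Y = Y' then Some (X, Pls K f g, Y) else None)"
  by (simp add: hadd_def)

lemma hadd_None: "\<not> harr K g \<Longrightarrow> hadd K g f = None" "\<not> harr K f \<Longrightarrow> hadd K g f = None"
  by (auto simp: hadd_def)

lemma hneg_Some: "harr K (Some (X, f, Y)) \<Longrightarrow> hneg K (Some (X, f, Y)) = Some (X, inv\<^bsub>hom_group K X Y\<^esub> f, Y)"
  by (simp add: hneg_def)

lemma hneg_None: "\<not> harr K g \<Longrightarrow> hneg K g = None"
  by (simp add: hneg_def)

lemmas h_simps = hcmp_Some hcmp_None hadd_Some hadd_None hneg_Some hneg_None

text \<open>Every law splits in two: either all arguments are arrows, where it is the corresponding
  law of the category once the ends match, or some argument is not and both sides are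
  \<open>None\<close>.\<close>

sublocale A: ringoid "harr K" src tgt "hidn K" "hcmp K" "hadd K" "hneg K"
proof
  fix f g h :: "('o \<times> 'm \<times> 'o) option" and X Y
  show "harr K (hcmp K g f) \<longleftrightarrow> harr K g \<and> harr K f \<and> src g = tgt f"
    by (auto simp: hcmp_def elim!: harr_cases intro: Cmp_Mor)
  show "\<lbrakk>harr K g; harr K f; src g = tgt f\<rbrakk> \<Longrightarrow> src (hcmp K g f) = src f"
    by (simp add: hcmp_def)
  show "\<lbrakk>harr K g; harr K f; src g = tgt f\<rbrakk> \<Longrightarrow> tgt (hcmp K g f) = tgt g"
    by (simp add: hcmp_def)
  show "hcmp K (hcmp K h g) f = hcmp K h (hcmp K g f)"
  proof (cases "harr K f \<and> harr K g \<and> harr K h")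
    case True
    then obtain X a Y Y' b Z Z' c W where e: "f = Some (X, a, Y)" "g = Some (Y', b, Z)" "h = Some (Z', c, W)"
      and m: "harr K f" "harr K g" "harr K h" by (metis harr_def)
    then show ?thesis
      by (auto simp: h_simps Cmp_Mor Cmp_assoc[of X Y Z W])
  qed (auto simp: h_simps)
  show "harr K (hidn K X) \<Longrightarrow> src (hidn K X) = X" "harr K (hidn K X) \<Longrightarrow> tgt (hidn K X) = X"
    by (auto simp: hidn_def hm_def split: if_splits)
  show "harr K f \<Longrightarrow> harr K (hidn K (src f))" "harr K f \<Longrightarrow> harr K (hidn K (tgt f))"
    by (auto simp: hidn_def hm_def Idt_Mor elim!: harr_cases)
  show "\<lbrakk>harr K f; src f = X\<rbrakk> \<Longrightarrow> hcmp K f (hidn K X) = f"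
    by (auto simp: hidn_def hm_def Idt_Mor h_simps Cmp_Idt elim!: harr_cases)
  show "\<lbrakk>harr K f; tgt f = X\<rbrakk> \<Longrightarrow> hcmp K (hidn K X) f = f"
    by (auto simp: hidn_def hm_def Idt_Mor h_simps Idt_Cmp elim!: harr_cases)
  show "harr K (hadd K f g) \<longleftrightarrow> harr K f \<and> harr K g \<and> src f = src g \<and> tgt f = tgt g"
    by (auto simp: hadd_def elim!: harr_cases intro: Pls_Mor)
  show "\<lbrakk>harr K f; harr K g; src f = src g; tgt f = tgt g\<rbrakk> \<Longrightarrow> src (hadd K f g) = src g"
    by (simp add: hadd_def)
  show "\<lbrakk>harr K f; harr K g; src f = src g; tgt f = tgt g\<rbrakk> \<Longrightarrow> tgt (hadd K f g) = tgt g"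
    by (simp add: hadd_def)
  show "hadd K (hadd K f g) h = hadd K f (hadd K g h)"
  proof (cases "harr K f \<and> harr K g \<and> harr K h")
    case True
    then obtain X a Y X' b Y' X'' c Y'' where e: "f = Some (X, a, Y)" "g = Some (X', b, Y')" "h = Some (X'', c, Y'')"
      and m: "harr K f" "harr K g" "harr K h" by (metis harr_def)
    then show ?thesis
      by (auto simp: h_simps Pls_Mor Pls_assoc[of X Y])
  qed (auto simp: h_simps)
  show "hadd K f g = hadd K g f"
    by (auto simp: hadd_def Pls_commute elim!: harr_cases)
  show "hcmp K h (hadd K f g) = hadd K (hcmp K h f) (hcmp K h g)"
  proof (cases "harr K f \<and> harr K g \<and> harr K h")
    case True
    then obtain X a Y X' b Y' Z c W where e: "f = Some (X, a, Y)" "g = Some (X', b, Y')" "h = Some (Z, c, W)"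
      and m: "harr K f" "harr K g" "harr K h" by (metis harr_def)
    then show ?thesis
      by (auto simp: h_simps Pls_Mor Cmp_Mor Cmp_Pls[of X Y W])
  qed (auto simp: h_simps)
  show "hcmp K (hadd K f g) h = hadd K (hcmp K f h) (hcmp K g h)"
  proof (cases "harr K f \<and> harr K g \<and> harr K h")
    case True
    then obtain X a Y X' b Y' Z c W where e: "f = Some (X, a, Y)" "g = Some (X', b, Y')" "h = Some (Z, c, W)"
      and m: "harr K f" "harr K g" "harr K h" by (metis harr_def)
    then show ?thesis
      by (auto simp: h_simps Pls_Mor Cmp_Mor Pls_Cmp[of Z X Y])
  qed (auto simp: h_simps)
  show "harr K (hneg K f) \<longleftrightarrow> harr K f"
    by (auto simp: hneg_def inv_Mor elim!: harr_cases)
  show "harr K f \<Longrightarrow> src (hneg K f) = src f" "harr K f \<Longrightarrow> tgt (hneg K f) = tgt f"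
    by (simp_all add: hneg_def)
  show "harr K f \<Longrightarrow> hneg K (hneg K f) = f"
    by (auto simp: h_simps inv_Mor inv_inv elim!: harr_cases)
  show "hcmp K (hneg K g) f = hneg K (hcmp K g f)"
  proof (cases "harr K f \<and> harr K g")
    case True
    then obtain X a Y Y' b Z where e: "f = Some (X, a, Y)" "g = Some (Y', b, Z)"
      and m: "harr K f" "harr K g" by (metis harr_def)
    then show ?thesis
      by (auto simp: h_simps Cmp_Mor inv_Mor inv_Cmp)
  qed (auto simp: h_simps)
  show "hcmp K g (hneg K f) = hneg K (hcmp K g f)"
  proof (cases "harr K f \<and> harr K g")
    case True
    then obtain X a Y Y' b Z where e: "f = Some (X, a, Y)" "g = Some (Y', b, Z)"
      and m: "harr K f" "harr K g" by (metis harr_def)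
    then show ?thesis
      by (auto simp: h_simps Cmp_Mor inv_Mor Cmp_inv)
  qed (auto simp: h_simps)
  show "hneg K (hadd K f g) = hadd K (hneg K f) (hneg K g)"
  proof (cases "harr K f \<and> harr K g")
    case True
    then obtain X a Y Y' b Z where e: "f = Some (X, a, Y)" "g = Some (Y', b, Z)"
      and m: "harr K f" "harr K g" by (metis harr_def)
    then show ?thesis
      by (auto simp: h_simps Pls_Mor inv_Mor inv_Pls)
  qed (auto simp: h_simps)
  show "\<lbrakk>harr K f; harr K g; src f = src g; tgt f = tgt g\<rbrakk> \<Longrightarrow> hadd K f (hadd K (hneg K f) g) = g"
    by (auto simp: h_simps Pls_Mor inv_Mor Pls_inv Zer_Pls simp flip: Pls_assoc elim!: harr_cases)
  show "\<lbrakk>harr K (hidn K X); harr K (hidn K Y)\<rbrakk> \<Longrightarrow> \<exists>z. harr K z \<and> hadd K z z = z \<and> src z = X \<and> tgt z = Y"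
    by (intro exI[of _ "Some (X, Zer K X Y, Y)"])
      (auto simp: hidn_def hm_def h_simps Zer_Pls split: if_splits)
qed

section \<open>Dictionary between morphisms and bundled arrows\<close>

lemma harr_hm: "harr K (hm K X f Y) \<longleftrightarrow> X \<in> Obj K \<and> Y \<in> Obj K \<and> f \<in> Mor K X Y"
  by (simp add: hm_def)

lemma hm_simps [simp]:
  assumes "harr K (hm K X f Y)"
  shows "src (hm K X f Y) = X" "tgt (hm K X f Y) = Y" "mor (hm K X f Y) = f"
  using assms by (simp_all add: hm_def split: if_splits)

lemma hm_eta: "harr K a \<Longrightarrow> hm K (src a) (mor a) (tgt a) = a"
  by (auto simp: hm_def elim: harr_cases)

lemma harrD: "harr K a \<Longrightarrow> src a \<in> Obj K" "harr K a \<Longrightarrow> tgt a \<in> Obj K" "harr K a \<Longrightarrow> mor a \<in> Mor K (src a) (tgt a)"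
  by (auto elim: harr_cases)

lemma harr_hidn [simp]: "harr K (hidn K X) \<longleftrightarrow> X \<in> Obj K"
  by (auto simp: hidn_def harr_hm Idt_Mor)

lemma hm_eqD: "\<lbrakk>hm K X f Y = hm K X g Y; harr K (hm K X f Y)\<rbrakk> \<Longrightarrow> f = g"
  by (metis hm_simps(3))

lemma hm_Cmp: "\<lbrakk>harr K (hm K X f Y); harr K (hm K Y g Z)\<rbrakk> \<Longrightarrow> hcmp K (hm K Y g Z) (hm K X f Y) = hm K X (g \<cdot> f) Z"
  by (simp add: hm_def h_simps Cmp_Mor[of X Y Z] split: if_splits)

lemma hm_Pls: "\<lbrakk>harr K (hm K X f Y); harr K (hm K X g Y)\<rbrakk> \<Longrightarrow> hadd K (hm K X f Y) (hm K X g Y) = hm K X (Pls K f g) Y"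
  by (simp add: hm_def h_simps Pls_Mor split: if_splits)

lemma nul_hm: "A.nul (hm K X f Y) \<longleftrightarrow> X \<in> Obj K \<and> Y \<in> Obj K \<and> f = Zer K X Y"
  unfolding A.nul_def by (auto simp: hm_def h_simps Pls_eq_self split: if_splits)

lemma mor_cmp: "harr K (hcmp K g f) \<Longrightarrow> mor (hcmp K g f) = mor g \<cdot> mor f"
  by (auto simp: hcmp_def split: if_splits)

text \<open>Hom-sets may overlap, so a raw morphism does not know its ends. Unique existence
  transfers because \<open>P\<close> fixes source and target, after which the bundled arrow is
  determined by its morphism.\<close>

lemma ex1_hm:
  assumes "X \<in> Obj K" "Y \<in> Obj K"
    and P: "\<And>v. P v \<Longrightarrow> harr K v \<and> src v = X \<and> tgt v = Y"
    and Q: "\<And>v. v \<in> Mor K X Y \<Longrightarrow> P (hm K X v Y) \<longleftrightarrow> Q v"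
  shows "(\<exists>!v. P v) \<longleftrightarrow> (\<exists>!v. v \<in> Mor K X Y \<and> Q v)"
proof
  assume "\<exists>!v. P v"
  then obtain v where v: "P v" "\<And>w. P w \<Longrightarrow> w = v" by blast
  have s: "harr K v" "src v = X" "tgt v = Y" using P[OF v(1)] by simp_all
  have e: "hm K X (mor v) Y = v" using s hm_eta[of v] by simp
  have m: "mor v \<in> Mor K X Y" using s harrD(3)[of v] by simp
  show "\<exists>!v. v \<in> Mor K X Y \<and> Q v"
  proof (rule ex1I[of _ "mor v"])
    show "mor v \<in> Mor K X Y \<and> Q (mor v)" using m Q[OF m] v(1) unfolding e by blast
    fix w assume w: "w \<in> Mor K X Y \<and> Q w"
    then have "P (hm K X w Y)" using Q by blast
    then have "hm K X w Y = v" by (rule v)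
    then show "w = mor v" using w assms(1,2) by (auto simp: hm_def)
  qed
next
  assume "\<exists>!v. v \<in> Mor K X Y \<and> Q v"
  then obtain v where v: "v \<in> Mor K X Y" "Q v" "\<And>w. w \<in> Mor K X Y \<Longrightarrow> Q w \<Longrightarrow> w = v" by blast
  show "\<exists>!v. P v"
  proof (rule ex1I[of _ "hm K X v Y"])
    show "P (hm K X v Y)" using v Q by blast
    fix w assume w: "P w"
    then have s: "harr K w" "src w = X" "tgt w = Y" using P by auto
    have e: "hm K X (mor w) Y = w" using s hm_eta[of w] by simp
    have m: "mor w \<in> Mor K X Y" using s harrD(3)[of w] by simp
    have "mor w = v" using v(3)[OF m] Q[OF m] e w by simp
    then show "w = hm K X v Y" using e by simp
  qed
qed

lemma all_hm:
  assumes P: "\<And>u. P u \<Longrightarrow> harr K u \<and> tgt u = X"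
  shows "(\<forall>u. P u \<longrightarrow> R u) \<longleftrightarrow> (\<forall>T\<in>Obj K. \<forall>u\<in>Mor K T X. P (hm K T u X) \<longrightarrow> R (hm K T u X))"
proof
  assume r: "\<forall>T\<in>Obj K. \<forall>u\<in>Mor K T X. P (hm K T u X) \<longrightarrow> R (hm K T u X)"
  show "\<forall>u. P u \<longrightarrow> R u"
  proof (intro allI impI)
    fix u assume u: "P u"
    then have s: "harr K u" "tgt u = X" using P by auto
    then have "hm K (src u) (mor u) X = u" "src u \<in> Obj K" "mor u \<in> Mor K (src u) X"
      using hm_eta harrD by metis+
    then show "R u" using r u by metis
  qed
qed simp

lemma all_hm':
  assumes P: "\<And>u. P u \<Longrightarrow> harr K u \<and> src u = X"
  shows "(\<forall>u. P u \<longrightarrow> R u) \<longleftrightarrow> (\<forall>T\<in>Obj K. \<forall>u\<in>Mor K X T. P (hm K X u T) \<longrightarrow> R (hm K X u T))"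
proof
  assume r: "\<forall>T\<in>Obj K. \<forall>u\<in>Mor K X T. P (hm K X u T) \<longrightarrow> R (hm K X u T)"
  show "\<forall>u. P u \<longrightarrow> R u"
  proof (intro allI impI)
    fix u assume u: "P u"
    then have s: "harr K u" "src u = X" using P by auto
    then have "hm K X (mor u) (tgt u) = u" "tgt u \<in> Obj K" "mor u \<in> Mor K X (tgt u)"
      using hm_eta harrD by metis+
    then show "R u" using r u by metis
  qed
qed simp

text \<open>Free of typing hypotheses, like its companions below, because each side already implies
  that both morphisms are well typed.\<close>

lemma ker_hm: "A.ker (hm K N k X) (hm K X f Y) \<longleftrightarrow> is_kernel K X Y f N k"
proof (cases "harr K (hm K N k X) \<and> harr K (hm K X f Y)")
  case True
  then have t: "N \<in> Obj K" "X \<in> Obj K" "Y \<in> Obj K" "k \<in> Mor K N X" "f \<in> Mor K X Y" by (auto simp: harr_hm)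
  have f: "\<And>u. A.nul (hcmp K (hm K X f Y) u) \<Longrightarrow> harr K u \<and> tgt u = X"
    using True by (auto dest!: A.nul_arr)
  have a: "(\<forall>u. A.nul (hcmp K (hm K X f Y) u) \<longrightarrow> R u) \<longleftrightarrow>
    (\<forall>T\<in>Obj K. \<forall>u\<in>Mor K T X. A.nul (hcmp K (hm K X f Y) (hm K T u X)) \<longrightarrow> R (hm K T u X))" for R
    by (rule all_hm) (rule f)
  have nz: "A.nul (hcmp K (hm K X f Y) (hm K T u X)) \<longleftrightarrow> f \<cdot> u = Zer K T Y" if "T \<in> Obj K" "u \<in> Mor K T X" for T u
    using that t by (simp add: hm_Cmp harr_hm nul_hm)
  have e: "(\<exists>!v. hcmp K (hm K N k X) v = hm K T u X) \<longleftrightarrow> (\<exists>!v. v \<in> Mor K T N \<and> k \<cdot> v = u)"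
    if "T \<in> Obj K" "u \<in> Mor K T X" for T u
  proof (rule ex1_hm)
    fix v assume v: "hcmp K (hm K N k X) v = hm K T u X"
    have "harr K (hm K T u X)" using that t by (simp add: harr_hm)
    then have "harr K (hcmp K (hm K N k X) v)" "src (hcmp K (hm K N k X) v) = T" using v by auto
    then show "harr K v \<and> src v = T \<and> tgt v = N" using True by auto
  next
    fix v assume "v \<in> Mor K T N"
    then show "hcmp K (hm K N k X) (hm K T v N) = hm K T u X \<longleftrightarrow> k \<cdot> v = u"
      using that t by (simp add: hm_Cmp harr_hm) (simp add: hm_def Cmp_Mor[of T N X])
  qed (use t that in auto)
  show ?thesis
    unfolding A.ker_def is_kernel_def a using t by (simp add: nz e)
next
  case False
  then have "\<not> A.ker (hm K N k X) (hm K X f Y)" using A.kerD(2,3) by blast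
  moreover have "\<not> is_kernel K X Y f N k" using False by (auto simp: harr_hm is_kernel_def)
  ultimately show ?thesis by simp
qed

lemma coker_hm: "A.coker (hm K Y c N) (hm K X f Y) \<longleftrightarrow> is_cokernel K X Y f N c"
proof (cases "harr K (hm K Y c N) \<and> harr K (hm K X f Y)")
  case True
  then have t: "N \<in> Obj K" "X \<in> Obj K" "Y \<in> Obj K" "c \<in> Mor K Y N" "f \<in> Mor K X Y" by (auto simp: harr_hm)
  have f: "\<And>u. A.nul (hcmp K u (hm K X f Y)) \<Longrightarrow> harr K u \<and> src u = Y"
    using True by (auto dest!: A.nul_arr)
  have a: "(\<forall>u. A.nul (hcmp K u (hm K X f Y)) \<longrightarrow> R u) \<longleftrightarrow>
    (\<forall>T\<in>Obj K. \<forall>u\<in>Mor K Y T. A.nul (hcmp K (hm K Y u T) (hm K X f Y)) \<longrightarrow> R (hm K Y u T))" for R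
    by (rule all_hm') (rule f)
  have nz: "A.nul (hcmp K (hm K Y u T) (hm K X f Y)) \<longleftrightarrow> u \<cdot> f = Zer K X T" if "T \<in> Obj K" "u \<in> Mor K Y T" for T u
    using that t by (simp add: hm_Cmp harr_hm nul_hm)
  have e: "(\<exists>!v. hcmp K v (hm K Y c N) = hm K Y u T) \<longleftrightarrow> (\<exists>!v. v \<in> Mor K N T \<and> v \<cdot> c = u)"
    if "T \<in> Obj K" "u \<in> Mor K Y T" for T u
  proof (rule ex1_hm)
    fix v assume v: "hcmp K v (hm K Y c N) = hm K Y u T"
    have "harr K (hm K Y u T)" using that t by (simp add: harr_hm)
    then have "harr K (hcmp K v (hm K Y c N))" "tgt (hcmp K v (hm K Y c N)) = T" using v by auto
    then show "harr K v \<and> src v = N \<and> tgt v = T" using True by auto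
  next
    fix v assume "v \<in> Mor K N T"
    then show "hcmp K (hm K N v T) (hm K Y c N) = hm K Y u T \<longleftrightarrow> v \<cdot> c = u"
      using that t by (simp add: hm_Cmp harr_hm) (simp add: hm_def Cmp_Mor[of Y N T])
  qed (use t that in auto)
  show ?thesis
    unfolding A.coker_def is_cokernel_def a using t by (simp add: nz e)
next
  case False
  then have "\<not> A.coker (hm K Y c N) (hm K X f Y)" using A.cokerD(2,3) by blast
  moreover have "\<not> is_cokernel K X Y f N c" using False by (auto simp: harr_hm is_cokernel_def)
  ultimately show ?thesis by simp
qed

lemma ses_hm: "A.ses (hm K X i Y) (hm K Y p Z) \<longleftrightarrow> ses K X Y Z i p"
  unfolding A.ses_def ses_def ker_hm coker_hm ..

lemma mono_hm: "A.mono (hm K X f Y) \<longleftrightarrow> monic K X Y f"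
proof (cases "harr K (hm K X f Y)")
  case True
  then have t: "X \<in> Obj K" "Y \<in> Obj K" "f \<in> Mor K X Y" by (auto simp: harr_hm)
  show ?thesis
  proof
    assume m: "A.mono (hm K X f Y)"
    show "monic K X Y f"
      unfolding monic_def
    proof (intro conjI ballI impI)
      fix T u v assume u: "T \<in> Obj K" "u \<in> Mor K T X" "v \<in> Mor K T X" "f \<cdot> u = f \<cdot> v"
      have "hm K T u X = hm K T v X"
        by (rule A.monoD[OF m]) (use u t in \<open>simp_all add: hm_Cmp harr_hm\<close>)
      then show "u = v" using u t by (auto simp: hm_def)
    qed (use t in auto)
  next
    assume m: "monic K X Y f"
    show "A.mono (hm K X f Y)"
      unfolding A.mono_def
    proof (intro conjI allI impI)
      fix u assume u: "A.nul (hcmp K (hm K X f Y) u)"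
      then have s: "harr K u" "tgt u = X" using True by (auto dest!: A.nul_arr)
      then obtain T v where v: "u = hm K T v X" "T \<in> Obj K" "v \<in> Mor K T X"
        using hm_eta harrD by metis
      then have "f \<cdot> v = Zer K T Y" using u t by (simp add: hm_Cmp harr_hm nul_hm)
      also have "\<dots> = f \<cdot> Zer K T X" using v t by (simp add: Cmp_Zer)
      finally have "v = Zer K T X" using m v t by (simp add: monic_def)
      then show "A.nul u" using v t by (simp add: nul_hm)
    qed (rule True)
  qed
next
  case False
  then have "\<not> A.mono (hm K X f Y)" using A.mono_arr by blast
  moreover have "\<not> monic K X Y f" using False by (auto simp: harr_hm monic_def)
  ultimately show ?thesis by simp
qed

lemma epi_hm: "A.epi (hm K X f Y) \<longleftrightarrow> epic K X Y f"
proof (cases "harr K (hm K X f Y)")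
  case True
  then have t: "X \<in> Obj K" "Y \<in> Obj K" "f \<in> Mor K X Y" by (auto simp: harr_hm)
  show ?thesis
  proof
    assume m: "A.epi (hm K X f Y)"
    show "epic K X Y f"
      unfolding epic_def
    proof (intro conjI ballI impI)
      fix T u v assume u: "T \<in> Obj K" "u \<in> Mor K Y T" "v \<in> Mor K Y T" "u \<cdot> f = v \<cdot> f"
      have "hm K Y u T = hm K Y v T"
        by (rule A.epiD[OF m]) (use u t in \<open>simp_all add: hm_Cmp harr_hm\<close>)
      then show "u = v" using u t by (auto simp: hm_def)
    qed (use t in auto)
  next
    assume m: "epic K X Y f"
    show "A.epi (hm K X f Y)"
      unfolding A.epi_def
    proof (intro conjI allI impI)
      fix u assume u: "A.nul (hcmp K u (hm K X f Y))"
      then have s: "harr K u" "src u = Y" using True by (auto dest!: A.nul_arr)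
      then obtain T v where v: "u = hm K Y v T" "T \<in> Obj K" "v \<in> Mor K Y T"
        using hm_eta harrD by metis
      then have "v \<cdot> f = Zer K X T" using u t by (simp add: hm_Cmp harr_hm nul_hm)
      also have "\<dots> = Zer K Y T \<cdot> f" using v t by (simp add: Zer_Cmp[of X Y])
      finally have "v = Zer K Y T" using m v t by (simp add: epic_def)
      then show "A.nul u" using v t by (simp add: nul_hm)
    qed (rule True)
  qed
next
  case False
  then have "\<not> A.epi (hm K X f Y)" using A.epi_arr by blast
  moreover have "\<not> epic K X Y f" using False by (auto simp: harr_hm epic_def)
  ultimately show ?thesis by simp
qed

lemma exact_hm: "exact_at K X Y Z f g \<longleftrightarrow> A.exact (hm K X f Y) (hm K Y g Z)"
proof
  assume "exact_at K X Y Z f g"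
  then obtain N k e where a: "is_kernel K Y Z g N k" "epic K X N e" "k \<cdot> e = f" unfolding exact_at_def by auto
  then have "hcmp K (hm K N k Y) (hm K X e N) = hm K X f Y" "harr K (hm K X f Y)"
    by (auto simp: hm_Cmp harr_hm is_kernel_def epic_def Cmp_Mor[of X N Y])
  then show "A.exact (hm K X f Y) (hm K Y g Z)"
    unfolding A.exact_def using a ker_hm epi_hm by blast
next
  assume "A.exact (hm K X f Y) (hm K Y g Z)"
  then obtain k e where a: "harr K (hm K X f Y)" "A.ker k (hm K Y g Z)" "A.epi e" "hcmp K k e = hm K X f Y"
    unfolding A.exact_def by auto
  have k: "harr K k" "harr K e" "tgt k = Y" using A.kerD[OF a(2)] a(3) by auto
  have "harr K (hcmp K k e)" "src (hcmp K k e) = X" using a by auto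
  then have "tgt e = src k" "src e = X" by auto
  then have e: "hm K (src k) (mor k) Y = k" "hm K X (mor e) (src k) = e"
    using k hm_eta by metis+
  have "is_kernel K Y Z g (src k) (mor k)" using a(2) e ker_hm by metis
  moreover have "epic K X (src k) (mor e)" using a(3) e epi_hm by metis
  moreover have "mor k \<cdot> mor e = f" using mor_cmp \<open>harr K (hcmp K k e)\<close> a(1,4) by (metis hm_simps(3))
  ultimately show "exact_at K X Y Z f g" unfolding exact_at_def by blast
qed

lemma zero_object_hidn: "zero_object K Z \<longleftrightarrow> A.nul (hidn K Z)"
proof
  assume z: "zero_object K Z"
  then have "Z \<in> Obj K" "\<exists>!f. f \<in> Mor K Z Z" by (auto simp: zero_object_def)
  then have "Idt K Z = Zer K Z Z" using Idt_Mor Zer_Mor by blast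
  then show "A.nul (hidn K Z)" using \<open>Z \<in> Obj K\<close> by (simp add: hidn_def nul_hm)
next
  assume "A.nul (hidn K Z)"
  then have z: "Z \<in> Obj K" "Idt K Z = Zer K Z Z" by (auto simp: hidn_def nul_hm)
  have "f = Zer K X Z" if "X \<in> Obj K" "f \<in> Mor K X Z" for X f
    using Idt_Cmp[OF that(1) z(1) that(2)] Zer_Cmp[OF that(1) z(1) z(1) that(2)] z(2) by simp
  moreover have "f = Zer K Z X" if "X \<in> Obj K" "f \<in> Mor K Z X" for X f
    using Cmp_Idt[OF z(1) that(1) that(2)] Cmp_Zer[OF z(1) z(1) that(1) that(2)] z(2) by simp
  ultimately show "zero_object K Z"
    unfolding zero_object_def using z(1) Zer_Mor by blast
qed

lemma biprod_product:
  assumes "A.biprod i j p q"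
  shows "is_product K (src i) (src j) (tgt i) (mor p) (mor q)"
proof -
  note [simp] = A.biprodD(1-11)[OF assms]
  have m: "mor p \<in> Mor K (tgt i) (src i)" "mor q \<in> Mor K (tgt i) (src j)"
    using harrD(3)[of p] harrD(3)[of q] by auto
  have pm: "hm K (tgt i) (mor p) (src i) = p" "hm K (tgt i) (mor q) (src j) = q"
    using hm_eta[of p] hm_eta[of q] by auto
  have id: "u = hadd K (hcmp K i (hcmp K p u)) (hcmp K j (hcmp K q u))" if "harr K u" "tgt u = tgt i" for u
  proof -
    have "hcmp K (hadd K (hcmp K i p) (hcmp K j q)) u = u"
      unfolding A.biprodD(14)[OF assms] using that by simp
    then show ?thesis by (simp add: A.add_comp A.comp_assoc)
  qed
  show ?thesis
    unfolding is_product_def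
  proof (intro conjI ballI)
    fix T f g assume t: "T \<in> Obj K" "f \<in> Mor K T (src i)" "g \<in> Mor K T (src j)"
    let ?f = "hm K T f (src i)" and ?g = "hm K T g (src j)"
    have [simp]: "harr K ?f" "harr K ?g" using t harrD(1)[of i] harrD(1)[of j] by (auto simp: harr_hm)
    have "\<exists>!h. hcmp K p h = ?f \<and> hcmp K q h = ?g"
    proof (rule ex1I)
      have pq: "hcmp K p (hcmp K i ?f) = ?f" "hcmp K q (hcmp K j ?g) = ?g"
        by (simp_all flip: A.comp_assoc)
      have "A.nul (hcmp K p (hcmp K j ?g))" "A.nul (hcmp K q (hcmp K i ?f))"
        using A.nul_compL[OF A.biprodD(12)[OF assms], of ?g] A.nul_compL[OF A.biprodD(13)[OF assms], of ?f]
        by (simp_all add: A.comp_assoc)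
      then show "hcmp K p (hadd K (hcmp K i ?f) (hcmp K j ?g)) = ?f \<and> hcmp K q (hadd K (hcmp K i ?f) (hcmp K j ?g)) = ?g"
        by (simp add: A.comp_add pq A.add_nul A.nul_add)
      fix h assume h: "hcmp K p h = ?f \<and> hcmp K q h = ?g"
      have "harr K (hcmp K p h)" using h by simp
      then have "harr K h" "tgt h = tgt i" by auto
      then show "h = hadd K (hcmp K i ?f) (hcmp K j ?g)" using id[of h] h by simp
    qed
    moreover have "(\<exists>!h. hcmp K p h = ?f \<and> hcmp K q h = ?g) \<longleftrightarrow>
      (\<exists>!h. h \<in> Mor K T (tgt i) \<and> mor p \<cdot> h = f \<and> mor q \<cdot> h = g)"
    proof (rule ex1_hm)
      fix h assume h: "hcmp K p h = ?f \<and> hcmp K q h = ?g"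
      then have "harr K (hcmp K p h)" "src (hcmp K p h) = T" by auto
      then show "harr K h \<and> src h = T \<and> tgt h = tgt i" by auto
    next
      fix v assume v: "v \<in> Mor K T (tgt i)"
      have "hcmp K p (hm K T v (tgt i)) = hm K T (mor p \<cdot> v) (src i)"
        "hcmp K q (hm K T v (tgt i)) = hm K T (mor q \<cdot> v) (src j)"
        using hm_Cmp[of T v "tgt i" "mor p" "src i"] hm_Cmp[of T v "tgt i" "mor q" "src j"] pm v t harrD(2)[of i]
        by (simp_all add: harr_hm)
      moreover have "mor p \<cdot> v \<in> Mor K T (src i)" "mor q \<cdot> v \<in> Mor K T (src j)"
        using v t m harrD[of i] harrD[of j] by (auto intro: Cmp_Mor[of T "tgt i"])
      ultimately show "hcmp K p (hm K T v (tgt i)) = ?f \<and> hcmp K q (hm K T v (tgt i)) = ?g \<longleftrightarrow> mor p \<cdot> v = f \<and> mor q \<cdot> v = g"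
        using t harrD[of i] harrD[of j] by (simp add: hm_def)
    qed (use t harrD[of i] in auto)
    ultimately show "\<exists>!h. h \<in> Mor K T (tgt i) \<and> mor p \<cdot> h = f \<and> mor q \<cdot> h = g" by blast
  qed (use m harrD[of i] in auto)
qed

text \<open>The injections are induced by the pairs (identity, zero) and (zero, identity). The sum
  \<open>i \<cdot> p\<close> + \<open>j \<cdot> q\<close> is the identity because both have the same
  two projections.\<close>

lemma product_biprod:
  assumes "is_product K X Y P p q" "X \<in> Obj K" "Y \<in> Obj K"
  shows "\<exists>i j p q. A.biprod i j p q \<and> src i = X \<and> src j = Y"
proof -
  have t: "P \<in> Obj K" "p \<in> Mor K P X" "q \<in> Mor K P Y"
    and u: "\<And>T f g. \<lbrakk>T \<in> Obj K; f \<in> Mor K T X; g \<in> Mor K T Y\<rbrakk> \<Longrightarrow>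
        (\<exists>!h. h \<in> Mor K T P \<and> p \<cdot> h = f \<and> q \<cdot> h = g)"
    using assms by (auto simp: is_product_def)
  obtain i where i: "i \<in> Mor K X P" "p \<cdot> i = Idt K X" "q \<cdot> i = Zer K X Y"
    using u[of X "Idt K X" "Zer K X Y"] assms Idt_Mor by auto
  obtain j where j: "j \<in> Mor K Y P" "p \<cdot> j = Zer K Y X" "q \<cdot> j = Idt K Y"
    using u[of Y "Zer K Y X" "Idt K Y"] assms Idt_Mor by auto
  let ?s = "Pls K (i \<cdot> p) (j \<cdot> q)"
  have ij: "i \<cdot> p \<in> Mor K P P" "j \<cdot> q \<in> Mor K P P"
    using t i j assms by (auto intro: Cmp_Mor[of P X] Cmp_Mor[of P Y])
  have s: "?s \<in> Mor K P P" using ij t by (simp add: Pls_Mor)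
  have "p \<cdot> ?s = Pls K ((p \<cdot> i) \<cdot> p) ((p \<cdot> j) \<cdot> q)"
    using t i(1) j(1) ij assms by (simp add: Cmp_Pls[of P P X] Cmp_assoc[of P X P X] Cmp_assoc[of P Y P X])
  also have "\<dots> = p" using t i j assms
    by (simp add: Idt_Cmp[of P X] Zer_Cmp[of P Y X] Pls_commute[of P X p] Zer_Pls)
  finally have p: "p \<cdot> ?s = p" .
  have "q \<cdot> ?s = Pls K ((q \<cdot> i) \<cdot> p) ((q \<cdot> j) \<cdot> q)"
    using t i(1) j(1) ij assms by (simp add: Cmp_Pls[of P P Y] Cmp_assoc[of P X P Y] Cmp_assoc[of P Y P Y])
  also have "\<dots> = q" using t i j assms
    by (simp add: Idt_Cmp[of P Y] Zer_Cmp[of P X Y] Zer_Pls)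
  finally have q: "q \<cdot> ?s = q" .
  have "?s = Idt K P"
    using u[OF t] s p q t Idt_Mor[of P] Cmp_Idt[of P X p] Cmp_Idt[of P Y q] assms by metis
  then have "A.biprod (hm K X i P) (hm K Y j P) (hm K P p X) (hm K P q Y)"
    unfolding A.biprod_def using t i j assms ij
    by (simp add: harr_hm hm_Cmp hm_Pls hidn_def nul_hm)
  then show ?thesis using t i j assms
    by (intro exI[of _ "hm K X i P"] exI[of _ "hm K Y j P"] exI[of _ "hm K P p X"] exI[of _ "hm K P q Y"])
      (simp add: harr_hm)
qed

text \<open>The way back from the ringoid to the category, by which complexes are shown to form an
  abelian category.\<close>

lemma abelian_categoryI:
  assumes "abelian_ringoid (harr K) src tgt (hidn K) (hcmp K) (hadd K) (hneg K)"
  shows "abelian_category K"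
proof (intro abelian_category.intro abelian_category_axioms.intro)
  interpret A: abelian_ringoid "harr K" src tgt "hidn K" "hcmp K" "hadd K" "hneg K" by fact
  show "preadditive_category K" by (rule preadditive_category_axioms)
  show "\<exists>Z. zero_object K Z" using A.ex_zero_object zero_object_hidn by blast
  show "\<exists>P p q. is_product K X Y P p q" if "X \<in> Obj K" "Y \<in> Obj K" for X Y
    using A.ex_biprod[of X Y] that biprod_product by (metis harr_hidn)
  show "\<exists>N k. is_kernel K X Y f N k" if t: "X \<in> Obj K" "Y \<in> Obj K" "f \<in> Mor K X Y" for X Y f
  proof -
    obtain k where k: "A.ker k (hm K X f Y)" using A.ex_ker[of "hm K X f Y"] t by (auto simp: harr_hm)
    have "harr K k" "tgt k = X" using A.kerD[OF k] by auto
    then have "hm K (src k) (mor k) X = k" using hm_eta by metis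
    then show ?thesis using k ker_hm by metis
  qed
  show "\<exists>N c. is_cokernel K X Y f N c" if t: "X \<in> Obj K" "Y \<in> Obj K" "f \<in> Mor K X Y" for X Y f
  proof -
    obtain k where k: "A.coker k (hm K X f Y)" using A.ex_coker[of "hm K X f Y"] t by (auto simp: harr_hm)
    have "harr K k" "src k = Y" using A.cokerD[OF k] by auto
    then have "hm K Y (mor k) (tgt k) = k" using hm_eta by metis
    then show ?thesis using k coker_hm by metis
  qed
  show "\<exists>Z g. is_kernel K Y Z g X f" if m: "monic K X Y f" for X Y f
  proof -
    obtain g where g: "A.ker (hm K X f Y) g" using A.mono_normal m mono_hm by blast
    have "harr K g" "src g = Y" using A.kerD[OF g] by auto
    then have "hm K Y (mor g) (tgt g) = g" using hm_eta by metis
    then show ?thesis using g ker_hm by metis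
  qed
  show "\<exists>Z g. is_cokernel K Z X g Y f" if m: "epic K X Y f" for X Y f
  proof -
    obtain g where g: "A.coker (hm K X f Y) g" using A.epi_normal m epi_hm by blast
    have "harr K g" "tgt g = X" using A.cokerD[OF g] by auto
    then have "hm K (src g) (mor g) X = g" using hm_eta by metis
    then show ?thesis using g coker_hm by metis
  qed
qed

end

section \<open>Yoneda Ext in terms of splittings and fillings\<close>

lemma Ext_zero_invariant:
  assumes "Ext_zero K n X Y" and "x \<in> extensions K n X Y" "y \<in> extensions K n X Y"
    and P: "\<And>x y. (x, y) \<in> extension_morphism K n X Y \<Longrightarrow> P x \<longleftrightarrow> P y" and "P x"
  shows "P y"
proof -
  let ?R = "(extension_morphism K n X Y \<union> (extension_morphism K n X Y)\<inverse>)\<^sup>*"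
  obtain c where c: "Ext K n X Y = {c}" using assms(1) by (auto simp: Ext_zero_def is_singleton_def)
  have "?R `` {x} \<in> Ext K n X Y" "?R `` {y} \<in> Ext K n X Y"
    using assms(2,3) by (auto simp: Ext_def intro: quotientI)
  then have "?R `` {x} = ?R `` {y}" using c by auto
  \<comment> \<open>With a single class, any two extensions are joined by a zigzag of morphisms,
    along which \<open>P\<close> is transported.\<close>
  then have "(x, y) \<in> ?R" by blast
  then show "P y"
  proof (induction rule: rtrancl_induct)
    case (step y z)
    then show ?case using P by blast
  qed fact
qed

context abelian_category begin

sublocale A: abelian_ringoid "harr K" src tgt "hidn K" "hcmp K" "hadd K" "hneg K"
proof
  show "\<exists>Z. A.nul (hidn K Z)" using ex_zero zero_object_hidn by blast
  show "\<exists>i j p q. A.biprod i j p q \<and> src i = X \<and> src j = Y"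
    if "harr K (hidn K X)" "harr K (hidn K Y)" for X Y
  proof -
    have "X \<in> Obj K" "Y \<in> Obj K" using that by auto
    then show ?thesis using ex_product[of X Y] product_biprod by blast
  qed
  fix f assume "harr K f"
  then have f: "f = hm K (src f) (mor f) (tgt f)" "src f \<in> Obj K" "tgt f \<in> Obj K" "mor f \<in> Mor K (src f) (tgt f)"
    using hm_eta harrD by auto
  show "\<exists>k. A.ker k f" using ex_kernel[OF f(2-4)] f(1) ker_hm by metis
  show "\<exists>k. A.coker k f" using ex_cokernel[OF f(2-4)] f(1) coker_hm by metis
next
  fix f assume f: "A.mono f"
  then have "hm K (src f) (mor f) (tgt f) = f" using hm_eta A.mono_arr by blast
  then show "\<exists>g. A.ker f g" using f monic_normal mono_hm ker_hm by metis
next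
  fix f assume f: "A.epi f"
  then have "hm K (src f) (mor f) (tgt f) = f" using hm_eta A.epi_arr by blast
  then show "\<exists>g. A.coker f g" using f epic_normal epi_hm coker_hm by metis
qed

lemma extensions_1:
  "(E, e) \<in> extensions K 1 X Y \<longleftrightarrow> E 0 = Y \<and> E 2 = X \<and> A.ses (hm K (E 0) (e 0) (E 1)) (hm K (E 1) (e 1) (E 2))"
proof -
  have "A.ses a b \<longleftrightarrow> A.mono a \<and> A.epi b \<and> A.exact a b" for a b
    using A.exact_ses A.sesD(5,6) A.ses_exact by blast
  then show ?thesis
    by (auto simp: extensions_def mono_hm epi_hm exact_hm numeral_2_eq_2)
qed

lemma extensions_2:
  assumes "(E, e) \<in> extensions K 2 X Y"
  shows "E 0 = Y" "E 3 = X" "A.two_extension (hm K (E 0) (e 0) (E 1)) (hm K (E 1) (e 1) (E 2)) (hm K (E 2) (e 2) (E 3))"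
proof -
  have "exact_at K (E 0) (E 1) (E 2) (e 0) (e 1)" "exact_at K (E 1) (E 2) (E 3) (e 1) (e 2)"
    using assms by (auto simp: extensions_def numeral_2_eq_2 numeral_3_eq_3 dest: spec[of _ 0] spec[of _ 1])
  then show "A.two_extension (hm K (E 0) (e 0) (E 1)) (hm K (E 1) (e 1) (E 2)) (hm K (E 2) (e 2) (E 3))"
    using assms by (auto simp: A.two_extension_def extensions_def mono_hm epi_hm exact_hm numeral_2_eq_2 numeral_3_eq_3)
qed (use assms in \<open>auto simp: extensions_def numeral_2_eq_2 numeral_3_eq_3\<close>)

lemma extensions_2I:
  assumes "A.two_extension a b c"
  shows "((\<lambda>i. if i = 0 then src a else if i = 1 then src b else if i = 2 then src c else tgt c),
    (\<lambda>i. if i = 0 then mor a else if i = 1 then mor b else mor c)) \<in> extensions K 2 (tgt c) (src a)"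
proof -
  have x: "A.mono a" "A.epi c" "A.exact a b" "A.exact b c" using assms by (auto simp: A.two_extension_def)
  have t: "tgt a = src b" "tgt b = src c" using A.exactD x by auto
  have e: "hm K (src a) (mor a) (src b) = a" "hm K (src b) (mor b) (src c) = b" "hm K (src c) (mor c) (tgt c) = c"
    using hm_eta[OF A.exactD(1)[OF x(3)]] hm_eta[OF A.exactD(1)[OF x(4)]] hm_eta[OF A.exactD(2)[OF x(4)]] t by auto
  have "monic K (src a) (src b) (mor a)" "epic K (src c) (tgt c) (mor c)"
    "exact_at K (src a) (src b) (src c) (mor a) (mor b)" "exact_at K (src b) (src c) (tgt c) (mor b) (mor c)"
    using x e by (simp_all add: exact_hm flip: mono_hm epi_hm)
  then show ?thesis
    by (auto simp: extensions_def numeral_2_eq_2 less_Suc_eq)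
qed

lemma extension_morphism_hm:
  assumes m: "((E, e), (E', e')) \<in> extension_morphism K n X Y"
  obtains \<phi> where "\<phi> 0 = hidn K Y" "\<phi> (Suc n) = hidn K X"
    "\<And>i. i \<le> Suc n \<Longrightarrow> E i \<in> Obj K \<Longrightarrow> E' i \<in> Obj K \<Longrightarrow> harr K (\<phi> i) \<and> src (\<phi> i) = E i \<and> tgt (\<phi> i) = E' i"
    "\<And>i. i \<le> n \<Longrightarrow> harr K (hm K (E i) (e i) (E (Suc i))) \<Longrightarrow> harr K (hm K (E' i) (e' i) (E' (Suc i))) \<Longrightarrow>
      hcmp K (\<phi> (Suc i)) (hm K (E i) (e i) (E (Suc i))) = hcmp K (hm K (E' i) (e' i) (E' (Suc i))) (\<phi> i)"
proof -
  obtain f where f: "\<And>i. i \<le> Suc n \<Longrightarrow> f i \<in> Mor K (E i) (E' i)" "f 0 = Idt K Y" "f (Suc n) = Idt K X"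
    "\<And>i. i \<le> n \<Longrightarrow> f (Suc i) \<cdot> e i = e' i \<cdot> f i"
    and E: "(E, e) \<in> extensions K n X Y" "(E', e') \<in> extensions K n X Y"
    using m unfolding extension_morphism_def by auto
  have ends: "E 0 = Y" "E' 0 = Y" "E (Suc n) = X" "E' (Suc n) = X" using E by (auto simp: extensions_def)
  show thesis
  proof (rule that[of "\<lambda>i. hm K (E i) (f i) (E' i)"])
    show "hm K (E 0) (f 0) (E' 0) = hidn K Y" "hm K (E (Suc n)) (f (Suc n)) (E' (Suc n)) = hidn K X"
      by (simp_all add: ends f hidn_def)
    show *: "harr K (hm K (E i) (f i) (E' i)) \<and> src (hm K (E i) (f i) (E' i)) = E i \<and> tgt (hm K (E i) (f i) (E' i)) = E' i"
      if "i \<le> Suc n" "E i \<in> Obj K" "E' i \<in> Obj K" for i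
    proof -
      have "harr K (hm K (E i) (f i) (E' i))" using that f(1) by (simp add: harr_hm)
      then show ?thesis by simp
    qed
    fix i assume i: "i \<le> n" and h: "harr K (hm K (E i) (e i) (E (Suc i)))" "harr K (hm K (E' i) (e' i) (E' (Suc i)))"
    then have "harr K (hm K (E i) (f i) (E' i))" "harr K (hm K (E (Suc i)) (f (Suc i)) (E' (Suc i)))"
      using f(1)[of i] f(1)[of "Suc i"] by (auto simp: harr_hm)
    then show "hcmp K (hm K (E (Suc i)) (f (Suc i)) (E' (Suc i))) (hm K (E i) (e i) (E (Suc i))) =
        hcmp K (hm K (E' i) (e' i) (E' (Suc i))) (hm K (E i) (f i) (E' i))"
      using h f(4)[OF i] by (simp add: hm_Cmp)
  qed
qed

text \<open>If there is one class only, splitting spreads from the direct sum to all extensions,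
  being invariant under morphisms. Conversely a split extension receives a morphism from the direct
  sum, so it lies in the class of the latter; the direct sum also shows that the set of classes is
  not empty.\<close>

lemma Ext_zero_iff_ext0:
  assumes XY: "X \<in> Obj K" "Y \<in> Obj K"
  shows "Ext_zero K 1 X Y \<longleftrightarrow> A.ext0 X Y"
proof -
  obtain i j p q where b: "A.biprod i j p q" "src i = Y" "src j = X" using A.ex_biprod[of Y X] XY by auto
  note [simp] = A.biprodD(1-9)[OF b(1)] b(2,3)
  have sb: "A.ses i q" using b(1) by (rule A.biprod_ses)
  have hb: "hm K Y (mor i) (tgt i) = i" "hm K (tgt i) (mor q) X = q" "harr K i" "harr K q"
    "hm K X (mor j) (tgt i) = j"
    using hm_eta[of i] hm_eta[of q] hm_eta[of j] by simp_all
  define E0 where "E0 = (\<lambda>k::nat. if k = 0 then Y else if k = 1 then tgt i else X)"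
  define e0 where "e0 = (\<lambda>k::nat. if k = 0 then mor i else mor q)"
  have in0: "(E0, e0) \<in> extensions K 1 X Y"
    unfolding extensions_1 using sb hb by (simp add: E0_def e0_def)
  show ?thesis
  proof
    assume z: "Ext_zero K 1 X Y"
    define P where "P = (\<lambda>(E, e). \<exists>s. hcmp K (hm K (E 1) (e (1::nat)) (E (2::nat))) s = hidn K X)"
    have inv: "P x \<longleftrightarrow> P y" if m: "(x, y) \<in> extension_morphism K 1 X Y" for x y
    proof -
      obtain E e E' e' where xy: "x = (E, e)" "y = (E', e')" by (metis surj_pair)
      have ex: "(E, e) \<in> extensions K 1 X Y" "(E', e') \<in> extensions K 1 X Y"
        using m xy by (auto simp: extension_morphism_def)
      obtain \<phi> where \<phi>: "\<phi> 0 = hidn K Y" "\<phi> (Suc 1) = hidn K X"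
        "\<And>i. i \<le> Suc 1 \<Longrightarrow> E i \<in> Obj K \<Longrightarrow> E' i \<in> Obj K \<Longrightarrow> harr K (\<phi> i) \<and> src (\<phi> i) = E i \<and> tgt (\<phi> i) = E' i"
        "\<And>i. i \<le> 1 \<Longrightarrow> harr K (hm K (E i) (e i) (E (Suc i))) \<Longrightarrow> harr K (hm K (E' i) (e' i) (E' (Suc i))) \<Longrightarrow>
      hcmp K (\<phi> (Suc i)) (hm K (E i) (e i) (E (Suc i))) = hcmp K (hm K (E' i) (e' i) (E' (Suc i))) (\<phi> i)"
        using extension_morphism_hm[OF m[unfolded xy]] by metis
      let ?i = "hm K (E 0) (e 0) (E 1)" and ?p = "hm K (E 1) (e 1) (E 2)"
      let ?i' = "hm K (E' 0) (e' 0) (E' 1)" and ?p' = "hm K (E' 1) (e' 1) (E' 2)"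
      have s: "A.ses ?i ?p" "A.ses ?i' ?p'" and ends: "E 0 = Y" "E' 0 = Y" "E 2 = X" "E' 2 = X"
        using ex unfolding extensions_1 by auto
      have h: "harr K ?i" "harr K ?p" "harr K ?i'" "harr K ?p'" using s A.sesD by blast+
      have o: "E 1 \<in> Obj K" "E' 1 \<in> Obj K" using h by (auto simp: harr_hm)
      have f1: "harr K (\<phi> 1)" "src (\<phi> 1) = E 1" "tgt (\<phi> 1) = E' 1" using \<phi>(3)[of 1] o by auto
      have c1: "hcmp K (\<phi> 1) ?i = ?i'" using \<phi>(4)[of 0] h ends by (simp add: \<phi>(1))
      have c2: "?p = hcmp K ?p' (\<phi> 1)" using \<phi>(4)[of 1] h ends \<phi>(2) by (simp add: numeral_2_eq_2)
      show ?thesis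
        unfolding P_def xy prod.case
        by (rule A.section_transfer[OF s c1 c2, of X Y]) (use h ends in simp_all)
    qed
    have P0: "P (E0, e0)"
      unfolding P_def using hb A.biprodD(11)[OF b(1)] by (auto simp: E0_def e0_def)
    show "A.ext0 X Y"
      unfolding A.ext0_def
    proof (intro allI impI)
      fix a c assume a: "A.ses a c \<and> src a = Y \<and> tgt c = X"
      define E where "E = (\<lambda>k::nat. if k = 0 then Y else if k = 1 then tgt a else X)"
      define e where "e = (\<lambda>k::nat. if k = 0 then mor a else mor c)"
      have h: "harr K a" "harr K c" "tgt a = src c" using a A.sesD by auto
      then have ac: "hm K Y (mor a) (tgt a) = a" "hm K (tgt a) (mor c) X = c"
        using hm_eta[of a] hm_eta[of c] a by simp_all
      then have "(E, e) \<in> extensions K 1 X Y"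
        unfolding extensions_1 using a by (simp add: E_def e_def)
      then have "P (E, e)" using Ext_zero_invariant[where P = P, OF z in0 _ inv P0] by blast
      then show "\<exists>s. hcmp K c s = hidn K X" unfolding P_def using ac by (auto simp: E_def e_def)
    qed
  next
    assume z: "A.ext0 X Y"
    let ?m = "extension_morphism K 1 X Y"
    have mor0: "((E0, e0), (E, e)) \<in> ?m" if Ee: "(E, e) \<in> extensions K 1 X Y" for E e
    proof -
      let ?i = "hm K (E 0) (e 0) (E 1)" and ?p = "hm K (E 1) (e 1) (E 2)"
      have s: "A.ses ?i ?p" and ends: "E 0 = Y" "E 2 = X" using Ee unfolding extensions_1 by auto
      have h: "harr K ?i" "harr K ?p" using A.sesD s by auto
      then obtain t where t: "hcmp K ?p t = hidn K X" using z s ends unfolding A.ext0_def by (metis hm_simps(1,2))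
      have "hcmp K ?p t = hidn K (tgt ?p)" using t h ends by simp
      then obtain f where f: "hcmp K f i = ?i" "hcmp K ?p f = q" "harr K f" "src f = tgt i" "tgt f = E 1"
        using A.split_compare[OF s _ b(1)] h ends by auto
      have f1: "mor f \<cdot> mor i = e 0"
        using mor_cmp[of f i] h(1) unfolding f(1) by simp
      have f2: "e 1 \<cdot> mor f = mor q"
        using mor_cmp[of ?p f] h(2) hb(4) unfolding f(2) by simp
      let ?\<phi> = "\<lambda>k::nat. if k = 0 then Idt K Y else if k = 1 then mor f else Idt K X"
      have m: "mor f \<in> Mor K (tgt i) (E 1)" using f(3-5) harrD(3)[of f] by simp
      have mi: "mor i \<in> Mor K Y (tgt i)" "mor q \<in> Mor K (tgt i) X" "tgt i \<in> Obj K"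
        using harrD[of i] harrD[of q] by simp_all
      have me: "e 0 \<in> Mor K Y (E 1)" "e 1 \<in> Mor K (E 1) X" "E 1 \<in> Obj K"
        using h ends by (auto simp: harr_hm)
      have ids: "e 0 \<cdot> Idt K Y = e 0" "Idt K X \<cdot> mor q = mor q"
        using me mi XY Cmp_Idt[of Y "E 1" "e 0"] Idt_Cmp[of "tgt i" X "mor q"] by auto
      show ?thesis
        unfolding extension_morphism_def
        using in0 Ee m mi me f1 f2 ends XY ids
        by (auto intro!: exI[of _ ?\<phi>] simp: E0_def e0_def Idt_Mor less_Suc_eq le_Suc_eq numeral_2_eq_2)
    qed
    let ?R = "(?m \<union> ?m\<inverse>)\<^sup>*"
    have "sym ?R" by (intro sym_rtrancl) (auto simp: sym_def)
    have "?R `` {x} = ?R `` {(E0, e0)}" if x: "x \<in> extensions K 1 X Y" for x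
    proof -
      have "((E0, e0), x) \<in> ?R" using mor0[of "fst x" "snd x"] x by auto
      moreover from this \<open>sym ?R\<close> have "(x, (E0, e0)) \<in> ?R" by (meson symD)
      ultimately show ?thesis by (auto intro: rtrancl_trans)
    qed
    then have "(\<lambda>x. ?R `` {x}) ` extensions K 1 X Y = (\<lambda>x. ?R `` {(E0, e0)}) ` extensions K 1 X Y"
      by (rule image_cong[OF refl])
    also have "\<dots> = {?R `` {(E0, e0)}}" by (rule image_constant[OF in0])
    finally have "Ext K 1 X Y = {?R `` {(E0, e0)}}"
      unfolding Ext_def quotient_def by (simp only: UNION_singleton_eq_range)
    then show "Ext_zero K 1 X Y" by (simp add: Ext_zero_def)
  qed
qed

text \<open>Fillability is invariant under morphisms of 2-extensions and holds for the one with
  identities at the ends and zero in the middle, so with a single class it holds for all.\<close>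

lemma Ext_zero_2:
  assumes XY: "X \<in> Obj K" "Y \<in> Obj K" and z: "Ext_zero K 2 X Y"
  shows "A.ext2 X Y"
proof -
  define P where "P = (\<lambda>(E, e). A.trivial2 (hm K (E 0) (e 0) (E 1)) (hm K (E 1) (e (1::nat)) (E (2::nat))) (hm K (E 2) (e 2) (E 3)))"
  have inv: "P x \<longleftrightarrow> P y" if m: "(x, y) \<in> extension_morphism K 2 X Y" for x y
  proof -
    obtain E e E' e' where xy: "x = (E, e)" "y = (E', e')" by (metis surj_pair)
    have ex: "(E, e) \<in> extensions K 2 X Y" "(E', e') \<in> extensions K 2 X Y"
      using m xy by (auto simp: extension_morphism_def)
    obtain \<phi> where \<phi>: "\<phi> 0 = hidn K Y" "\<phi> (Suc 2) = hidn K X"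
      "\<And>i. i \<le> Suc 2 \<Longrightarrow> E i \<in> Obj K \<Longrightarrow> E' i \<in> Obj K \<Longrightarrow> harr K (\<phi> i) \<and> src (\<phi> i) = E i \<and> tgt (\<phi> i) = E' i"
      "\<And>i. i \<le> 2 \<Longrightarrow> harr K (hm K (E i) (e i) (E (Suc i))) \<Longrightarrow> harr K (hm K (E' i) (e' i) (E' (Suc i))) \<Longrightarrow>
    hcmp K (\<phi> (Suc i)) (hm K (E i) (e i) (E (Suc i))) = hcmp K (hm K (E' i) (e' i) (E' (Suc i))) (\<phi> i)"
      using extension_morphism_hm[OF m[unfolded xy]] by metis
    let ?a = "hm K (E 0) (e 0) (E 1)" and ?b = "hm K (E 1) (e 1) (E 2)" and ?c = "hm K (E 2) (e 2) (E 3)"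
    let ?a' = "hm K (E' 0) (e' 0) (E' 1)" and ?b' = "hm K (E' 1) (e' 1) (E' 2)" and ?c' = "hm K (E' 2) (e' 2) (E' 3)"
    note t = extensions_2[OF ex(1)] extensions_2[OF ex(2)]
    have ex: "A.exact ?a ?b" "A.exact ?b ?c" "A.exact ?a' ?b'" "A.exact ?b' ?c'"
      using t by (auto simp: A.two_extension_def)
    have h: "harr K ?a" "harr K ?b" "harr K ?c" "harr K ?a'" "harr K ?b'" "harr K ?c'"
      using A.exactD(1,2)[OF ex(1)] A.exactD(1,2)[OF ex(2)] A.exactD(1,2)[OF ex(3)] A.exactD(1,2)[OF ex(4)] by simp_all
    have o: "E 1 \<in> Obj K" "E' 1 \<in> Obj K" "E 2 \<in> Obj K" "E' 2 \<in> Obj K" using h by (auto simp: harr_hm)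
    have f1: "harr K (\<phi> 1)" "src (\<phi> 1) = E 1" "tgt (\<phi> 1) = E' 1" using \<phi>(3)[of 1] o by auto
    have f2: "harr K (\<phi> 2)" "src (\<phi> 2) = E 2" "tgt (\<phi> 2) = E' 2" using \<phi>(3)[of 2] o by auto
    have c0: "hcmp K (\<phi> 1) ?a = ?a'" using \<phi>(4)[of 0] h t by (simp add: \<phi>(1))
    have c1: "hcmp K (\<phi> 2) ?b = hcmp K ?b' (\<phi> 1)" using \<phi>(4)[of 1] h by (simp add: numeral_2_eq_2)
    have c2: "hcmp K ?c' (\<phi> 2) = ?c" using \<phi>(4)[of 2] h t \<phi>(2) by (simp add: numeral_2_eq_2 numeral_3_eq_3)
    show ?thesis
      unfolding P_def xy prod.case
      using A.trivial2_push[OF t(3) t(6) c0 c1 c2] A.trivial2_pull[OF t(3) t(6) c0 c1 c2] f1 f2 h by auto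
  qed
  obtain n where n: "A.nul n" "src n = Y" "tgt n = X" using A.ex_nul[of Y X] XY by auto
  have t0: "A.two_extension (hidn K Y) n (hidn K X)"
    unfolding A.two_extension_def using XY n A.exact_idn_nul[OF n(1)] by (auto intro: A.exact_nul_mono)
  have P_iff: "P ((\<lambda>i. if i = 0 then src a else if i = 1 then src b else if i = 2 then src c else tgt c),
    (\<lambda>i. if i = 0 then mor a else if i = 1 then mor b else mor c)) \<longleftrightarrow> A.trivial2 a b c"
    if "A.two_extension a b c" for a b c
  proof -
    have x: "A.exact a b" "A.exact b c" using that by (auto simp: A.two_extension_def)
    have t: "tgt a = src b" "tgt b = src c" using A.exactD x by auto
    have e: "hm K (src a) (mor a) (src b) = a" "hm K (src b) (mor b) (src c) = b" "hm K (src c) (mor c) (tgt c) = c"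
      using hm_eta[OF A.exactD(1)[OF x(1)]] hm_eta[OF A.exactD(1)[OF x(2)]] hm_eta[OF A.exactD(2)[OF x(2)]] t by auto
    show ?thesis unfolding P_def by (simp add: e)
  qed
  have "A.trivial2 (hidn K Y) n (hidn K X)" using XY n by (intro A.trivial2_split) auto
  then have P0: "P ((\<lambda>i. if i = 0 then src (hidn K Y) else if i = 1 then src n else if i = 2 then src (hidn K X) else tgt (hidn K X)),
    (\<lambda>i. if i = 0 then mor (hidn K Y) else if i = 1 then mor n else mor (hidn K X)))"
    using P_iff[OF t0] by blast
  have in0: "((\<lambda>i. if i = 0 then src (hidn K Y) else if i = 1 then src n else if i = 2 then src (hidn K X) else tgt (hidn K X)),
    (\<lambda>i. if i = 0 then mor (hidn K Y) else if i = 1 then mor n else mor (hidn K X))) \<in> extensions K 2 X Y"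
    using extensions_2I[OF t0] XY by simp
  show ?thesis
    unfolding A.ext2_def
  proof (intro allI impI)
    fix a b c assume t: "A.two_extension a b c \<and> src a = Y \<and> tgt c = X"
    then have "A.two_extension a b c" by blast
    from Ext_zero_invariant[where P = P, OF z in0 _ inv P0] extensions_2I[OF this] P_iff[OF this] t
    show "A.trivial2 a b c" by blast
  qed
qed

end

section \<open>The abelian category of chain complexes\<close>

lemma Ch_simps:
  "Obj (Ch K) = {X. \<forall>n. ob X n \<in> Obj K \<and> dif X n \<in> Mor K (ob X n) (ob X (n - 1)) \<and>
                   Cmp K (dif X (n - 1)) (dif X n) = Zer K (ob X n) (ob X (n - 1 - 1))}"
  "Mor (Ch K) X Y = {f. \<forall>n. f n \<in> Mor K (ob X n) (ob Y n) \<and> Cmp K (f (n - 1)) (dif X n) = Cmp K (dif Y n) (f n)}"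
  "Idt (Ch K) X = (\<lambda>n. Idt K (ob X n))"
  "Cmp (Ch K) g f = (\<lambda>n. Cmp K (g n) (f n))"
  "Pls (Ch K) g f = (\<lambda>n. Pls K (g n) (f n))"
  "Zer (Ch K) X Y = (\<lambda>n. Zer K (ob X n) (ob Y n))"
  by (simp_all add: Ch_def)

text \<open>Differentials here, and components in \<open>cpt\<close>, are bundled as arrows of
  \<open>K\<close>: computations with complexes then take place in the ringoid of \<open>K\<close>,
  where no membership side conditions arise.\<close>

definition dff :: "('o, 'm) cat \<Rightarrow> ('o, 'm) chain \<Rightarrow> int \<Rightarrow> ('o \<times> 'm \<times> 'o) option" where
  "dff K X n = hm K (ob X n) (dif X n) (ob X (n - 1))"

definition cpt :: "('o, 'm) cat \<Rightarrow> int \<Rightarrow> (('o, 'm) chain \<times> (int \<Rightarrow> 'm) \<times> ('o, 'm) chain) option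
    \<Rightarrow> ('o \<times> 'm \<times> 'o) option" where
  "cpt K n a = hm K (ob (src a) n) (mor a n) (ob (tgt a) n)"

context preadditive_category begin

lemma Ch_preadditive: "preadditive_category (Ch K)"
proof (rule preadditive_category.intro)
  fix X Y Z T :: "('o, 'm) chain" and f g h f' g' :: "int \<Rightarrow> 'm"
  note [simp] = Ch_simps
  show "Idt (Ch K) X \<in> Mor (Ch K) X X" if "X \<in> Obj (Ch K)"
  proof -
    have "Idt K (ob X (n - 1)) \<cdot> dif X n = dif X n \<cdot> Idt K (ob X n)" for n
      using that Idt_Cmp[of "ob X n" "ob X (n - 1)" "dif X n"] Cmp_Idt[of "ob X n" "ob X (n - 1)" "dif X n"] by simp
    then show ?thesis using that by (simp add: Idt_Mor)
  qed
  show "\<lbrakk>X \<in> Obj (Ch K); Y \<in> Obj (Ch K); f \<in> Mor (Ch K) X Y\<rbrakk> \<Longrightarrow> f \<cdot>\<^bsub>Ch K\<^esub> Idt (Ch K) X = f"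
    by (auto intro!: ext Cmp_Idt[of "ob X _" "ob Y _"])
  show "\<lbrakk>X \<in> Obj (Ch K); Y \<in> Obj (Ch K); f \<in> Mor (Ch K) X Y\<rbrakk> \<Longrightarrow> Idt (Ch K) Y \<cdot>\<^bsub>Ch K\<^esub> f = f"
    by (auto intro!: ext Idt_Cmp[of "ob X _" "ob Y _"])
  show "g \<cdot>\<^bsub>Ch K\<^esub> f \<in> Mor (Ch K) X Z"
    if a: "X \<in> Obj (Ch K)" "Y \<in> Obj (Ch K)" "Z \<in> Obj (Ch K)" "f \<in> Mor (Ch K) X Y" "g \<in> Mor (Ch K) Y Z"
  proof -
    have "(g (n - 1) \<cdot> f (n - 1)) \<cdot> dif X n = dif Z n \<cdot> g n \<cdot> f n" for n
    proof -
      have o: "ob X n \<in> Obj K" "ob X (n - 1) \<in> Obj K" "ob Y n \<in> Obj K" "ob Y (n - 1) \<in> Obj K"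
          "ob Z n \<in> Obj K" "ob Z (n - 1) \<in> Obj K"
        and m: "dif X n \<in> Mor K (ob X n) (ob X (n - 1))" "dif Y n \<in> Mor K (ob Y n) (ob Y (n - 1))"
          "dif Z n \<in> Mor K (ob Z n) (ob Z (n - 1))" "f n \<in> Mor K (ob X n) (ob Y n)" "g n \<in> Mor K (ob Y n) (ob Z n)"
          "f (n - 1) \<in> Mor K (ob X (n - 1)) (ob Y (n - 1))" "g (n - 1) \<in> Mor K (ob Y (n - 1)) (ob Z (n - 1))"
        and e: "f (n - 1) \<cdot> dif X n = dif Y n \<cdot> f n" "g (n - 1) \<cdot> dif Y n = dif Z n \<cdot> g n"
        using a by auto
      have "(g (n - 1) \<cdot> f (n - 1)) \<cdot> dif X n = (g (n - 1) \<cdot> dif Y n) \<cdot> f n"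
        using Cmp_assoc[OF o(1,2,4,6) m(1,6,7)] Cmp_assoc[OF o(1,3,4,6) m(4,2,7)] e by simp
      also have "\<dots> = dif Z n \<cdot> g n \<cdot> f n"
        using Cmp_assoc[OF o(1,3,5,6) m(4,5,3)] e by simp
      finally show ?thesis .
    qed
    moreover have "g n \<cdot> f n \<in> Mor K (ob X n) (ob Z n)" for n
      using a Cmp_Mor[of "ob X n" "ob Y n" "ob Z n" "f n" "g n"] by simp
    ultimately show "g \<cdot>\<^bsub>Ch K\<^esub> f \<in> Mor (Ch K) X Z"
      by simp
  qed
  show "\<lbrakk>X \<in> Obj (Ch K); Y \<in> Obj (Ch K); Z \<in> Obj (Ch K); T \<in> Obj (Ch K);
    f \<in> Mor (Ch K) X Y; g \<in> Mor (Ch K) Y Z; h \<in> Mor (Ch K) Z T\<rbrakk>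
    \<Longrightarrow> (h \<cdot>\<^bsub>Ch K\<^esub> g) \<cdot>\<^bsub>Ch K\<^esub> f = h \<cdot>\<^bsub>Ch K\<^esub> g \<cdot>\<^bsub>Ch K\<^esub> f"
    by (auto intro!: ext Cmp_assoc[of "ob X _" "ob Y _" "ob Z _" "ob T _"])
  show "\<lbrakk>X \<in> Obj (Ch K); Y \<in> Obj (Ch K); Z \<in> Obj (Ch K); f \<in> Mor (Ch K) X Y; f' \<in> Mor (Ch K) X Y; g \<in> Mor (Ch K) Y Z\<rbrakk>
    \<Longrightarrow> g \<cdot>\<^bsub>Ch K\<^esub> Pls (Ch K) f f' = Pls (Ch K) (g \<cdot>\<^bsub>Ch K\<^esub> f) (g \<cdot>\<^bsub>Ch K\<^esub> f')"
    by (auto intro!: ext Cmp_Pls[of "ob X _" "ob Y _" "ob Z _"])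
  show "\<lbrakk>X \<in> Obj (Ch K); Y \<in> Obj (Ch K); Z \<in> Obj (Ch K); f \<in> Mor (Ch K) X Y; g \<in> Mor (Ch K) Y Z; g' \<in> Mor (Ch K) Y Z\<rbrakk>
    \<Longrightarrow> Pls (Ch K) g g' \<cdot>\<^bsub>Ch K\<^esub> f = Pls (Ch K) (g \<cdot>\<^bsub>Ch K\<^esub> f) (g' \<cdot>\<^bsub>Ch K\<^esub> f)"
    by (auto intro!: ext Pls_Cmp[of "ob X _" "ob Y _" "ob Z _"])
  show "comm_group (hom_group (Ch K) X Y)" if XY: "X \<in> Obj (Ch K)" "Y \<in> Obj (Ch K)"
  proof (rule comm_groupI)
    have o: "ob X n \<in> Obj K" "ob Y n \<in> Obj K" "dif X n \<in> Mor K (ob X n) (ob X (n - 1))"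
      "dif Y n \<in> Mor K (ob Y n) (ob Y (n - 1))" for n using XY by auto
    have carr: "x \<in> carrier (hom_group (Ch K) X Y) \<longleftrightarrow>
        (\<forall>n. x n \<in> Mor K (ob X n) (ob Y n) \<and> x (n - 1) \<cdot> dif X n = dif Y n \<cdot> x n)" for x
      by (simp add: hom_group_def)
    have m: "x \<otimes>\<^bsub>hom_group (Ch K) X Y\<^esub> y = (\<lambda>n. Pls K (x n) (y n))" for x y
      by (simp add: hom_group_def)
    have z: "\<one>\<^bsub>hom_group (Ch K) X Y\<^esub> = (\<lambda>n. Zer K (ob X n) (ob Y n))"
      by (simp add: hom_group_def)
    show "x \<otimes>\<^bsub>hom_group (Ch K) X Y\<^esub> y \<in> carrier (hom_group (Ch K) X Y)"
      if xy: "x \<in> carrier (hom_group (Ch K) X Y)" "y \<in> carrier (hom_group (Ch K) X Y)" for x y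
      unfolding m carr
    proof
      fix n
      have "x n \<in> Mor K (ob X n) (ob Y n)" "y n \<in> Mor K (ob X n) (ob Y n)"
        "x (n - 1) \<in> Mor K (ob X (n - 1)) (ob Y (n - 1))" "y (n - 1) \<in> Mor K (ob X (n - 1)) (ob Y (n - 1))"
        "x (n - 1) \<cdot> dif X n = dif Y n \<cdot> x n" "y (n - 1) \<cdot> dif X n = dif Y n \<cdot> y n"
        using xy unfolding carr by blast+
      then show "Pls K (x n) (y n) \<in> Mor K (ob X n) (ob Y n) \<and>
          Pls K (x (n - 1)) (y (n - 1)) \<cdot> dif X n = dif Y n \<cdot> Pls K (x n) (y n)"
        using o[of n] o[of "n - 1"] Pls_Cmp[of "ob X n" "ob X (n - 1)" "ob Y (n - 1)" "dif X n" "x (n - 1)" "y (n - 1)"]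
          Cmp_Pls[of "ob X n" "ob Y n" "ob Y (n - 1)" "x n" "y n" "dif Y n"] by (simp add: Pls_Mor)
    qed
    show "\<one>\<^bsub>hom_group (Ch K) X Y\<^esub> \<in> carrier (hom_group (Ch K) X Y)"
      unfolding z carr
    proof
      fix n
      show "Zer K (ob X n) (ob Y n) \<in> Mor K (ob X n) (ob Y n) \<and>
        Zer K (ob X (n - 1)) (ob Y (n - 1)) \<cdot> dif X n = dif Y n \<cdot> Zer K (ob X n) (ob Y n)"
        using o[of n] o[of "n - 1"] Zer_Cmp[of "ob X n" "ob X (n - 1)" "ob Y (n - 1)" "dif X n"]
          Cmp_Zer[of "ob X n" "ob Y n" "ob Y (n - 1)" "dif Y n"] by simp
    qed
    show "\<exists>y\<in>carrier (hom_group (Ch K) X Y). y \<otimes>\<^bsub>hom_group (Ch K) X Y\<^esub> x = \<one>\<^bsub>hom_group (Ch K) X Y\<^esub>"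
      if x: "x \<in> carrier (hom_group (Ch K) X Y)" for x
    proof (rule bexI[of _ "\<lambda>n. inv\<^bsub>hom_group K (ob X n) (ob Y n)\<^esub> x n"])
      have xn: "x n \<in> Mor K (ob X n) (ob Y n)" "x (n - 1) \<cdot> dif X n = dif Y n \<cdot> x n" for n
        using x unfolding carr by blast+
      show "(\<lambda>n. inv\<^bsub>hom_group K (ob X n) (ob Y n)\<^esub> x n) \<in> carrier (hom_group (Ch K) X Y)"
        unfolding carr
      proof
        fix n
        show "inv\<^bsub>hom_group K (ob X n) (ob Y n)\<^esub> x n \<in> Mor K (ob X n) (ob Y n) \<and>
          (inv\<^bsub>hom_group K (ob X (n - 1)) (ob Y (n - 1))\<^esub> x (n - 1)) \<cdot> dif X n =
          dif Y n \<cdot> (inv\<^bsub>hom_group K (ob X n) (ob Y n)\<^esub> x n)"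
          using xn[of n] xn(1)[of "n - 1"] o[of n] o[of "n - 1"]
            inv_Cmp[of "ob X n" "ob X (n - 1)" "ob Y (n - 1)" "dif X n" "x (n - 1)"]
            Cmp_inv[of "ob X n" "ob Y n" "ob Y (n - 1)" "x n" "dif Y n"] by (simp add: inv_Mor)
      qed
      show "(\<lambda>n. inv\<^bsub>hom_group K (ob X n) (ob Y n)\<^esub> x n) \<otimes>\<^bsub>hom_group (Ch K) X Y\<^esub> x = \<one>\<^bsub>hom_group (Ch K) X Y\<^esub>"
        unfolding m z
      proof
        fix n
        show "Pls K (inv\<^bsub>hom_group K (ob X n) (ob Y n)\<^esub> x n) (x n) = Zer K (ob X n) (ob Y n)"
          using xn(1)[of n] o(1,2)[of n] Pls_inv[of "ob X n" "ob Y n" "x n"] inv_Mor[of "ob X n" "ob Y n" "x n"]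
            Pls_commute[of "ob X n" "ob Y n" "x n" "inv\<^bsub>hom_group K (ob X n) (ob Y n)\<^esub> x n"] by simp
      qed
    qed
    show "x \<otimes>\<^bsub>hom_group (Ch K) X Y\<^esub> y = y \<otimes>\<^bsub>hom_group (Ch K) X Y\<^esub> x"
      if "x \<in> carrier (hom_group (Ch K) X Y)" "y \<in> carrier (hom_group (Ch K) X Y)" for x y
      using that o unfolding m carr by (intro ext Pls_commute[of "ob X _" "ob Y _"]) auto
    show "x \<otimes>\<^bsub>hom_group (Ch K) X Y\<^esub> y \<otimes>\<^bsub>hom_group (Ch K) X Y\<^esub> w =
        x \<otimes>\<^bsub>hom_group (Ch K) X Y\<^esub> (y \<otimes>\<^bsub>hom_group (Ch K) X Y\<^esub> w)"
      if "x \<in> carrier (hom_group (Ch K) X Y)" "y \<in> carrier (hom_group (Ch K) X Y)" "w \<in> carrier (hom_group (Ch K) X Y)"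
      for x y w
      using that o unfolding m carr by (intro ext Pls_assoc[of "ob X _" "ob Y _"]) auto
    show "\<one>\<^bsub>hom_group (Ch K) X Y\<^esub> \<otimes>\<^bsub>hom_group (Ch K) X Y\<^esub> x = x"
      if "x \<in> carrier (hom_group (Ch K) X Y)" for x
      using that o unfolding m z carr by (intro ext Zer_Pls) auto
  qed
qed

section \<open>Chain maps by components\<close>

interpretation Ch: preadditive_category "Ch K" by (rule Ch_preadditive)

lemma dff_simps [simp]:
  assumes "X \<in> Obj (Ch K)"
  shows "harr K (dff K X n)" "src (dff K X n) = ob X n" "tgt (dff K X n) = ob X (n - 1)"
proof -
  show "harr K (dff K X n)" using assms by (simp add: dff_def harr_hm Ch_simps)
  then show "src (dff K X n) = ob X n" "tgt (dff K X n) = ob X (n - 1)" by (simp_all add: dff_def)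
qed

lemma ob_Obj [simp]: "X \<in> Obj (Ch K) \<Longrightarrow> ob X n \<in> Obj K"
  by (simp add: Ch_simps)

lemma dff_dff:
  assumes "X \<in> Obj (Ch K)"
  shows "A.nul (hcmp K (dff K X (n - 1)) (dff K X n))"
proof -
  have "hcmp K (dff K X (n - 1)) (dff K X n) = hm K (ob X n) (dif X (n - 1) \<cdot> dif X n) (ob X (n - 1 - 1))"
    using hm_Cmp[OF dff_simps(1)[OF assms, of n, unfolded dff_def] dff_simps(1)[OF assms, of "n - 1", unfolded dff_def]]
    unfolding dff_def .
  moreover have "dif X (n - 1) \<cdot> dif X n = Zer K (ob X n) (ob X (n - 1 - 1))" "ob X n \<in> Obj K" "ob X (n - 1 - 1) \<in> Obj K"
    using assms unfolding Ch_simps by blast+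
  ultimately show ?thesis by (simp only: nul_hm)
qed

lemma dff_dff': "X \<in> Obj (Ch K) \<Longrightarrow> A.nul (hcmp K (dff K X n) (dff K X (n + 1)))"
  using dff_dff[of X "n + 1"] by simp

lemma cpt_simps [simp]:
  assumes "harr (Ch K) a"
  shows "harr K (cpt K n a)" "src (cpt K n a) = ob (src a) n" "tgt (cpt K n a) = ob (tgt a) n"
proof -
  have "src a \<in> Obj (Ch K)" "tgt a \<in> Obj (Ch K)" "mor a \<in> Mor (Ch K) (src a) (tgt a)"
    using Ch.harrD assms by auto
  then have "ob (src a) n \<in> Obj K" "ob (tgt a) n \<in> Obj K" "mor a n \<in> Mor K (ob (src a) n) (ob (tgt a) n)"
    unfolding Ch_simps by blast+
  then show "harr K (cpt K n a)" by (simp add: cpt_def harr_hm)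
  note h = this[unfolded cpt_def]
  show "src (cpt K n a) = ob (src a) n" "tgt (cpt K n a) = ob (tgt a) n"
    unfolding cpt_def by (fact hm_simps(1)[OF h], fact hm_simps(2)[OF h])
qed

lemma Ch_harrD [simp]: "harr (Ch K) a \<Longrightarrow> src a \<in> Obj (Ch K)" "harr (Ch K) a \<Longrightarrow> tgt a \<in> Obj (Ch K)"
  by (fact Ch.harrD(1), fact Ch.harrD(2))

lemma cpt_dff:
  assumes a: "harr (Ch K) a"
  shows "hcmp K (cpt K (n - 1) a) (dff K (src a) n) = hcmp K (dff K (tgt a) n) (cpt K n a)"
proof -
  have h: "harr K (cpt K n a)" "harr K (cpt K (n - 1) a)" "harr K (dff K (src a) n)" "harr K (dff K (tgt a) n)"
    using a by simp_all
  have "mor a \<in> Mor (Ch K) (src a) (tgt a)" using Ch.harrD a by auto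
  then have "mor a (n - 1) \<cdot> dif (src a) n = dif (tgt a) n \<cdot> mor a n" by (simp add: Ch_simps)
  then show ?thesis using h by (simp add: cpt_def dff_def hm_Cmp)
qed

lemma cpt_cmp:
  assumes "harr (Ch K) g" "harr (Ch K) f" "src g = tgt f"
  shows "cpt K n (hcmp (Ch K) g f) = hcmp K (cpt K n g) (cpt K n f)"
proof -
  have gf: "harr (Ch K) (hcmp (Ch K) g f)" using assms by simp
  have h: "harr K (cpt K n f)" "harr K (cpt K n g)" using assms by simp_all
  have "mor (hcmp (Ch K) g f) = mor g \<cdot>\<^bsub>Ch K\<^esub> mor f" using gf by (rule Ch.mor_cmp)
  then show ?thesis using assms h by (simp add: cpt_def Ch_simps hm_Cmp)
qed

lemma cpt_add:
  assumes "harr (Ch K) g" "harr (Ch K) f" "src g = src f" "tgt g = tgt f"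
  shows "cpt K n (hadd (Ch K) g f) = hadd K (cpt K n g) (cpt K n f)"
proof -
  have h: "harr K (cpt K n f)" "harr K (cpt K n g)" using assms by simp_all
  have "mor (hadd (Ch K) g f) = Pls (Ch K) (mor g) (mor f)" using assms by (simp add: hadd_def)
  then show ?thesis using assms h by (simp add: cpt_def Ch_simps hm_Pls)
qed

lemma cpt_idn: "X \<in> Obj (Ch K) \<Longrightarrow> cpt K n (hidn (Ch K) X) = hidn K (ob X n)"
proof -
  assume X: "X \<in> Obj (Ch K)"
  then have "hidn (Ch K) X = Some (X, Idt (Ch K) X, X)" by (simp add: hidn_def hm_def Ch.Idt_Mor)
  then show ?thesis unfolding cpt_def by (simp add: Ch_simps(3) hidn_def[of K])
qed

lemma Ch_nul: "Ch.A.nul a \<longleftrightarrow> harr (Ch K) a \<and> (\<forall>n. A.nul (cpt K n a))"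
proof (cases "harr (Ch K) a")
  case True
  then have "hm (Ch K) (src a) (mor a) (tgt a) = a" by (rule Ch.hm_eta)
  moreover have "Ch.A.nul (hm (Ch K) (src a) (mor a) (tgt a)) \<longleftrightarrow> mor a = Zer (Ch K) (src a) (tgt a)"
    using True by (simp add: Ch.nul_hm)
  moreover have "A.nul (cpt K n a) \<longleftrightarrow> mor a n = Zer K (ob (src a) n) (ob (tgt a) n)" for n
    using True by (simp add: cpt_def nul_hm)
  ultimately show ?thesis using True by (simp add: Ch_simps fun_eq_iff)
next
  case False
  then show ?thesis using Ch.A.nul_arr by blast
qed

lemma Ch_eq:
  assumes "harr (Ch K) a" "harr (Ch K) b" "src a = src b" "tgt a = tgt b" and c: "\<And>n. cpt K n a = cpt K n b"
  shows "a = b"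
proof -
  have "mor a n = mor b n" for n
    using c[of n] assms cpt_simps(1)[OF assms(1), of n] hm_eqD unfolding cpt_def by metis
  then have "mor a = mor b" by auto
  then show ?thesis using assms(1-4) Ch.hm_eta by metis
qed

text \<open>Taking components is additive and additive inverses are unique, so the inverse in the
  hom-group of \<open>Ch K\<close> need not be unfolded.\<close>

lemma cpt_neg:
  assumes "harr (Ch K) a"
  shows "cpt K n (hneg (Ch K) a) = hneg K (cpt K n a)"
proof -
  have "Ch.A.nul (hadd (Ch K) (hneg (Ch K) a) a)" using assms by (simp add: Ch.A.add_commute[of _ a])
  then have "A.nul (hadd K (cpt K n (hneg (Ch K) a)) (cpt K n a))"
    using assms by (simp add: Ch_nul cpt_add)
  then show ?thesis using assms by (simp add: A.add_nul_iff)
qed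

lemma Ch_arrI:
  assumes XY: "X \<in> Obj (Ch K)" "Y \<in> Obj (Ch K)"
    and f: "\<And>n. harr K (f n)" "\<And>n. src (f n) = ob X n" "\<And>n. tgt (f n) = ob Y n"
    and c: "\<And>n. hcmp K (f (n - 1)) (dff K X n) = hcmp K (dff K Y n) (f n)"
  obtains a where "harr (Ch K) a" "src a = X" "tgt a = Y" "\<And>n. cpt K n a = f n"
proof -
  have fm: "hm K (ob X n) (mor (f n)) (ob Y n) = f n" for n using hm_eta f by metis
  have "(\<lambda>n. mor (f n)) \<in> Mor (Ch K) X Y"
  proof -
    have "mor (f (n - 1)) \<cdot> dif X n = dif Y n \<cdot> mor (f n)" for n
    proof -
      have "mor (hcmp K (f (n - 1)) (dff K X n)) = mor (hcmp K (dff K Y n) (f n))" using c by simp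
      moreover have "mor (dff K X n) = dif X n" "mor (dff K Y n) = dif Y n"
        using dff_simps(1)[of X n] dff_simps(1)[of Y n] XY unfolding dff_def by simp_all
      ultimately show ?thesis using f XY by (simp add: mor_cmp)
    qed
    moreover have "mor (f n) \<in> Mor K (ob X n) (ob Y n)" for n using harrD(3)[OF f(1)[of n]] f by simp
    ultimately show ?thesis by (simp add: Ch_simps)
  qed
  then have h: "harr (Ch K) (hm (Ch K) X (\<lambda>n. mor (f n)) Y)" using XY by (simp add: Ch.harr_hm)
  show thesis
  proof (rule that[OF h])
    show "src (hm (Ch K) X (\<lambda>n. mor (f n)) Y) = X" "tgt (hm (Ch K) X (\<lambda>n. mor (f n)) Y) = Y"
      using h by (rule Ch.hm_simps)+
    then show "cpt K n (hm (Ch K) X (\<lambda>n. mor (f n)) Y) = f n" for n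
      unfolding cpt_def using Ch.hm_simps(3)[OF h] fm by simp
  qed
qed

lemma Ch_objI:
  assumes d: "\<And>n. harr K (d n)" "\<And>n. tgt (d n) = src (d (n - 1))" "\<And>n. A.nul (hcmp K (d (n - 1)) (d n))"
  obtains X where "X \<in> Obj (Ch K)" "\<And>n. ob X n = src (d n)" "\<And>n. dff K X n = d n"
proof -
  let ?X = "\<lparr>ob = \<lambda>n. src (d n), dif = \<lambda>n. mor (d n)\<rparr>"
  have e: "hm K (src (d n)) (mor (d n)) (src (d (n - 1))) = d n" for n using hm_eta d by metis
  have m: "mor (d n) \<in> Mor K (src (d n)) (src (d (n - 1)))" for n using harrD(3) d by metis
  have z: "mor (d (n - 1)) \<cdot> mor (d n) = Zer K (src (d n)) (src (d (n - 1 - 1)))" for n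
  proof -
    have "hcmp K (d (n - 1)) (d n) = hm K (src (d n)) (mor (d (n - 1)) \<cdot> mor (d n)) (src (d (n - 1 - 1)))"
      using e[of n] e[of "n - 1"] d(1)[of n] d(1)[of "n - 1"] hm_Cmp by metis
    then show ?thesis using d(3)[of n] by (simp add: nul_hm)
  qed
  have "\<forall>n. src (d n) \<in> Obj K" using harrD(1)[OF d(1)] by blast
  then have "?X \<in> Obj (Ch K)" using m z unfolding Ch_simps by simp
  moreover have "dff K ?X n = d n" for n using e[of n] unfolding dff_def by simp
  ultimately show thesis using that[of ?X] by (metis chain.select_convs(1))
qed

abbreviation kcmp (infixr "\<bullet>" 70) where "g \<bullet> f \<equiv> hcmp K g f"
abbreviation kadd (infixr "\<oplus>" 65) where "f \<oplus> g \<equiv> hadd K f g"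
abbreviation kneg ("\<ominus> _" [81] 80) where "\<ominus> f \<equiv> hneg K f"
abbreviation ccmp (infixr "\<star>" 70) where "g \<star> f \<equiv> hcmp (Ch K) g f"

interpretation Ch: preadditive_category "Ch K" by (rule Ch_preadditive)

section \<open>Kernels, cokernels and exactness degree by degree\<close>

lemma Ch_monoI:
  assumes "harr (Ch K) a" "\<And>n. A.mono (cpt K n a)"
  shows "Ch.A.mono a"
  unfolding Ch.A.mono_def
proof (intro conjI allI impI)
  fix u assume u: "Ch.A.nul (a \<star> u)"
  have h: "harr (Ch K) u" "src a = tgt u" using Ch.A.nul_arr[OF u] by auto
  have "A.nul (cpt K n a \<bullet> cpt K n u)" for n using u h assms by (simp add: Ch_nul cpt_cmp)
  then have "A.nul (cpt K n u)" for n using A.mono_nul assms(2) by blast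
  then show "Ch.A.nul u" using h by (simp add: Ch_nul)
qed fact

lemma Ch_epiI:
  assumes "harr (Ch K) a" "\<And>n. A.epi (cpt K n a)"
  shows "Ch.A.epi a"
  unfolding Ch.A.epi_def
proof (intro conjI allI impI)
  fix u assume u: "Ch.A.nul (u \<star> a)"
  have h: "harr (Ch K) u" "src u = tgt a" using Ch.A.nul_arr[OF u] by auto
  have "A.nul (cpt K n u \<bullet> cpt K n a)" for n using u h assms by (simp add: Ch_nul cpt_cmp)
  then have "A.nul (cpt K n u)" for n using A.epi_nul assms(2) by blast
  then show "Ch.A.nul u" using h by (simp add: Ch_nul)
qed fact

text \<open>The degreewise factors form a chain map because the required squares commute after
  composing with the components of \<open>k\<close>, which are mono.\<close>

lemma Ch_kerI:
  assumes [simp]: "harr (Ch K) a" "harr (Ch K) k" "tgt k = src a" and k: "\<And>n. A.ker (cpt K n k) (cpt K n a)"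
  shows "Ch.A.ker k a"
proof (rule Ch.A.kerI)
  show "Ch.A.nul (a \<star> k)" using A.kerD(1)[OF k] by (simp add: Ch_nul cpt_cmp)
  have m: "A.mono (cpt K n k)" for n using A.ker_mono k by blast
  then show "Ch.A.mono k" by (intro Ch_monoI) auto
  fix u assume u: "Ch.A.nul (a \<star> u)"
  have h[simp]: "harr (Ch K) u" "tgt u = src a" using Ch.A.nul_arr[OF u] by auto
  have "\<forall>n. \<exists>v. cpt K n k \<bullet> v = cpt K n u \<and> harr K v \<and> src v = ob (src u) n \<and> tgt v = ob (src k) n"
  proof
    fix n
    have "A.nul (cpt K n a \<bullet> cpt K n u)" using u by (simp add: Ch_nul cpt_cmp)
    then show "\<exists>v. cpt K n k \<bullet> v = cpt K n u \<and> harr K v \<and> src v = ob (src u) n \<and> tgt v = ob (src k) n"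
      using A.ker_lift[OF k[of n], of "cpt K n u"] by simp
  qed
  then obtain v where v: "\<And>n. cpt K n k \<bullet> v n = cpt K n u" and
    v'[simp]: "\<And>n. harr K (v n)" "\<And>n. src (v n) = ob (src u) n" "\<And>n. tgt (v n) = ob (src k) n"
    by (metis choice)
  have "v (n - 1) \<bullet> dff K (src u) n = dff K (src k) n \<bullet> v n" for n
  proof (rule A.monoD[OF m[of "n - 1"]])
    have "cpt K (n - 1) k \<bullet> v (n - 1) \<bullet> dff K (src u) n = dff K (src a) n \<bullet> cpt K n u"
      by (simp add: v cpt_dff flip: A.comp_assoc)
    also have "\<dots> = (dff K (tgt k) n \<bullet> cpt K n k) \<bullet> v n" by (simp add: v A.comp_assoc)
    also have "\<dots> = (cpt K (n - 1) k \<bullet> dff K (src k) n) \<bullet> v n" by (simp only: cpt_dff[OF assms(2)])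
    also have "\<dots> = cpt K (n - 1) k \<bullet> dff K (src k) n \<bullet> v n" by (simp only: A.comp_assoc)
    finally show "cpt K (n - 1) k \<bullet> v (n - 1) \<bullet> dff K (src u) n = cpt K (n - 1) k \<bullet> dff K (src k) n \<bullet> v n" .
  qed simp_all
  then obtain w where w: "harr (Ch K) w" "src w = src u" "tgt w = src k" "\<And>n. cpt K n w = v n"
    using Ch_arrI[of "src u" "src k" v] by auto
  have "k \<star> w = u" by (rule Ch_eq) (use w in \<open>simp_all add: cpt_cmp v\<close>)
  then show "\<exists>v. k \<star> v = u" by blast
qed

lemma Ch_cokerI:
  assumes [simp]: "harr (Ch K) a" "harr (Ch K) c" "src c = tgt a" and c: "\<And>n. A.coker (cpt K n c) (cpt K n a)"
  shows "Ch.A.coker c a"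
proof (rule Ch.A.cokerI)
  show "Ch.A.nul (c \<star> a)" using A.cokerD(1)[OF c] by (simp add: Ch_nul cpt_cmp)
  have m: "A.epi (cpt K n c)" for n using A.coker_epi c by blast
  then show "Ch.A.epi c" by (intro Ch_epiI) auto
  fix u assume u: "Ch.A.nul (u \<star> a)"
  have h[simp]: "harr (Ch K) u" "src u = tgt a" using Ch.A.nul_arr[OF u] by auto
  have "\<forall>n. \<exists>v. v \<bullet> cpt K n c = cpt K n u \<and> harr K v \<and> tgt v = ob (tgt u) n \<and> src v = ob (tgt c) n"
  proof
    fix n
    have "A.nul (cpt K n u \<bullet> cpt K n a)" using u by (simp add: Ch_nul cpt_cmp)
    then show "\<exists>v. v \<bullet> cpt K n c = cpt K n u \<and> harr K v \<and> tgt v = ob (tgt u) n \<and> src v = ob (tgt c) n"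
      using A.coker_lift[OF c[of n], of "cpt K n u"] by simp
  qed
  then obtain v where v: "\<And>n. v n \<bullet> cpt K n c = cpt K n u" and
    v'[simp]: "\<And>n. harr K (v n)" "\<And>n. tgt (v n) = ob (tgt u) n" "\<And>n. src (v n) = ob (tgt c) n"
    by (metis choice)
  have "v (n - 1) \<bullet> dff K (tgt c) n = dff K (tgt u) n \<bullet> v n" for n
  proof (rule A.epiD[OF m[of n]])
    have "(v (n - 1) \<bullet> dff K (tgt c) n) \<bullet> cpt K n c = v (n - 1) \<bullet> cpt K (n - 1) c \<bullet> dff K (src c) n"
      by (simp only: A.comp_assoc cpt_dff[OF assms(2)])
    also have "\<dots> = cpt K (n - 1) u \<bullet> dff K (src u) n" by (simp add: v flip: A.comp_assoc)
    also have "\<dots> = dff K (tgt u) n \<bullet> cpt K n u" by (simp only: cpt_dff[OF h(1)])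
    also have "\<dots> = (dff K (tgt u) n \<bullet> v n) \<bullet> cpt K n c" by (simp add: v A.comp_assoc)
    finally show "(v (n - 1) \<bullet> dff K (tgt c) n) \<bullet> cpt K n c = (dff K (tgt u) n \<bullet> v n) \<bullet> cpt K n c" .
  qed simp_all
  then obtain w where w: "harr (Ch K) w" "src w = tgt c" "tgt w = tgt u" "\<And>n. cpt K n w = v n"
    using Ch_arrI[of "tgt c" "tgt u" v] by auto
  have "w \<star> c = u" by (rule Ch_eq) (use w in \<open>simp_all add: cpt_cmp v\<close>)
  then show "\<exists>v. v \<star> c = u" by blast
qed

lemma Ch_sesI:
  assumes "harr (Ch K) i" "harr (Ch K) p" "tgt i = src p" "\<And>n. A.ses (cpt K n i) (cpt K n p)"
  shows "Ch.A.ses i p"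
  unfolding Ch.A.ses_def using assms by (intro conjI Ch_kerI Ch_cokerI) (simp_all add: A.ses_def)

end

context abelian_category begin

interpretation Ch: preadditive_category "Ch K" by (rule Ch_preadditive)

text \<open>Degreewise kernels carry the restricted differential; that it squares to zero can be
  tested after the monos \<open>k\<close>.\<close>

lemma Ch_ex_ker:
  assumes a[simp]: "harr (Ch K) a"
  obtains k where "harr (Ch K) k" "tgt k = src a" "\<And>n. A.ker (cpt K n k) (cpt K n a)"
proof -
  have "\<forall>n. \<exists>k. A.ker k (cpt K n a)" using A.ex_ker by simp
  then obtain k where k: "\<And>n. A.ker (k n) (cpt K n a)" by metis
  have k'[simp]: "\<And>n. harr K (k n)" "\<And>n. tgt (k n) = ob (src a) n" using A.kerD(2,4)[OF k] by simp_all
  have m: "A.mono (k n)" for n using A.ker_mono k by blast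
  have "\<forall>n. \<exists>d. k (n - 1) \<bullet> d = dff K (src a) n \<bullet> k n \<and> harr K d \<and> src d = src (k n) \<and> tgt d = src (k (n - 1))"
  proof
    fix n
    have "cpt K (n - 1) a \<bullet> dff K (src a) n \<bullet> k n = (cpt K (n - 1) a \<bullet> dff K (src a) n) \<bullet> k n"
      by (simp only: A.comp_assoc)
    also have "\<dots> = dff K (tgt a) n \<bullet> cpt K n a \<bullet> k n" by (simp only: cpt_dff a A.comp_assoc)
    finally have "A.nul (cpt K (n - 1) a \<bullet> dff K (src a) n \<bullet> k n)"
      using A.kerD(1)[OF k[of n]] by (simp add: A.nul_compR)
    then show "\<exists>d. k (n - 1) \<bullet> d = dff K (src a) n \<bullet> k n \<and> harr K d \<and> src d = src (k n) \<and> tgt d = src (k (n - 1))"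
      using A.ker_lift[OF k[of "n - 1"]] by fastforce
  qed
  then obtain d where d: "\<And>n. k (n - 1) \<bullet> d n = dff K (src a) n \<bullet> k n" and
    d'[simp]: "\<And>n. harr K (d n)" "\<And>n. src (d n) = src (k n)" "\<And>n. tgt (d n) = src (k (n - 1))" by metis
  have "A.nul (d (n - 1) \<bullet> d n)" for n
  proof (rule A.mono_nul[OF m[of "n - 1 - 1"]])
    have "k (n - 1 - 1) \<bullet> d (n - 1) \<bullet> d n = (k (n - 1 - 1) \<bullet> d (n - 1)) \<bullet> d n" by (simp only: A.comp_assoc)
    also have "\<dots> = dff K (src a) (n - 1) \<bullet> k (n - 1) \<bullet> d n" by (simp only: d A.comp_assoc)
    also have "\<dots> = (dff K (src a) (n - 1) \<bullet> dff K (src a) n) \<bullet> k n" by (simp only: d A.comp_assoc)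
    finally show "A.nul (k (n - 1 - 1) \<bullet> d (n - 1) \<bullet> d n)"
      using A.nul_compL[OF dff_dff[of "src a" n], of "k n"] by simp
  qed
  then obtain N where N: "N \<in> Obj (Ch K)" "\<And>n. ob N n = src (d n)" "\<And>n. dff K N n = d n"
    using Ch_objI[of d] by auto
  obtain \<kappa> where "harr (Ch K) \<kappa>" "src \<kappa> = N" "tgt \<kappa> = src a" "\<And>n. cpt K n \<kappa> = k n"
    using Ch_arrI[of N "src a" k] N d by auto
  then show thesis using that[of \<kappa>] k by simp
qed

lemma Ch_ex_coker:
  assumes a[simp]: "harr (Ch K) a"
  obtains k where "harr (Ch K) k" "src k = tgt a" "\<And>n. A.coker (cpt K n k) (cpt K n a)"
proof -
  have "\<forall>n. \<exists>k. A.coker k (cpt K n a)" using A.ex_coker by simp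
  then obtain k where k: "\<And>n. A.coker (k n) (cpt K n a)" by metis
  have k'[simp]: "\<And>n. harr K (k n)" "\<And>n. src (k n) = ob (tgt a) n" using A.cokerD(2,4)[OF k] by simp_all
  have m: "A.epi (k n)" for n using A.coker_epi k by blast
  have "\<forall>n. \<exists>d. d \<bullet> k n = k (n - 1) \<bullet> dff K (tgt a) n \<and> harr K d \<and> tgt d = tgt (k (n - 1)) \<and> src d = tgt (k n)"
  proof
    fix n
    have "(k (n - 1) \<bullet> dff K (tgt a) n) \<bullet> cpt K n a = k (n - 1) \<bullet> cpt K (n - 1) a \<bullet> dff K (src a) n"
      by (simp only: A.comp_assoc cpt_dff a)
    also have "\<dots> = (k (n - 1) \<bullet> cpt K (n - 1) a) \<bullet> dff K (src a) n" by (simp only: A.comp_assoc)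
    finally have "A.nul ((k (n - 1) \<bullet> dff K (tgt a) n) \<bullet> cpt K n a)"
      using A.nul_compL[OF A.cokerD(1)[OF k[of "n - 1"]], of "dff K (src a) n"] by simp
    then show "\<exists>d. d \<bullet> k n = k (n - 1) \<bullet> dff K (tgt a) n \<and> harr K d \<and> tgt d = tgt (k (n - 1)) \<and> src d = tgt (k n)"
      using A.coker_lift[OF k[of n]] by fastforce
  qed
  then obtain d where d: "\<And>n. d n \<bullet> k n = k (n - 1) \<bullet> dff K (tgt a) n" and
    d'[simp]: "\<And>n. harr K (d n)" "\<And>n. src (d n) = tgt (k n)" "\<And>n. tgt (d n) = tgt (k (n - 1))" by metis
  have "A.nul (d (n - 1) \<bullet> d n)" for n
  proof (rule A.epi_nul[OF m[of n]])
    have "(d (n - 1) \<bullet> d n) \<bullet> k n = d (n - 1) \<bullet> k (n - 1) \<bullet> dff K (tgt a) n" by (simp only: A.comp_assoc d)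
    also have "\<dots> = (d (n - 1) \<bullet> k (n - 1)) \<bullet> dff K (tgt a) n" by (simp only: A.comp_assoc)
    also have "\<dots> = k (n - 1 - 1) \<bullet> dff K (tgt a) (n - 1) \<bullet> dff K (tgt a) n" by (simp only: d A.comp_assoc)
    finally show "A.nul ((d (n - 1) \<bullet> d n) \<bullet> k n)"
      using A.nul_compR[OF dff_dff[of "tgt a" n], of "k (n - 1 - 1)"] by simp
  qed
  then obtain N where N: "N \<in> Obj (Ch K)" "\<And>n. ob N n = src (d n)" "\<And>n. dff K N n = d n"
    using Ch_objI[of d] by auto
  obtain \<kappa> where "harr (Ch K) \<kappa>" "src \<kappa> = tgt a" "tgt \<kappa> = N" "\<And>n. cpt K n \<kappa> = k n"
    using Ch_arrI[of "tgt a" N k] N d by auto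
  then show thesis using that[of \<kappa>] k by simp
qed

lemma nul_ker_mono:
  assumes "A.ker k f" "A.nul k"
  shows "A.mono f"
  unfolding A.mono_def
proof (intro conjI allI impI)
  show "harr K f" using assms A.kerD by blast
  fix u assume "A.nul (f \<bullet> u)"
  then obtain v where "k \<bullet> v = u" "harr K v" "tgt v = src k" using A.ker_lift[OF assms(1)] by blast
  then show "A.nul u" using A.nul_compL[OF assms(2), of v] by simp
qed

lemma nul_coker_epi:
  assumes "A.coker k f" "A.nul k"
  shows "A.epi f"
  unfolding A.epi_def
proof (intro conjI allI impI)
  show "harr K f" using assms A.cokerD by blast
  fix u assume "A.nul (u \<bullet> f)"
  then obtain v where "v \<bullet> k = u" "harr K v" "src v = tgt k" using A.coker_lift[OF assms(1)] by blast
  then show "A.nul u" using A.nul_compR[OF assms(2), of v] by simp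
qed

text \<open>The degreewise kernel of \<open>a\<close> is a kernel in \<open>Ch K\<close>, hence null
  when \<open>a\<close> is mono, and an arrow with null kernel is mono.\<close>

lemma Ch_mono_cpt: 
  assumes "Ch.A.mono a"
  shows "A.mono (cpt K n a)"
proof -
  have a: "harr (Ch K) a" using assms by simp
  obtain k where k: "harr (Ch K) k" "tgt k = src a" "\<And>n. A.ker (cpt K n k) (cpt K n a)" using Ch_ex_ker[OF a] by blast
  have "Ch.A.nul (a \<star> k)" using Ch.A.kerD(1)[OF Ch_kerI[OF a k]] .
  then have "Ch.A.nul k" using assms Ch.A.mono_nul by blast
  then have "A.nul (cpt K n k)" by (simp add: Ch_nul)
  then show ?thesis by (rule nul_ker_mono[OF k(3)[of n]])
qed

lemma Ch_epi_cpt: 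
  assumes "Ch.A.epi a"
  shows "A.epi (cpt K n a)"
proof -
  have a: "harr (Ch K) a" using assms by simp
  obtain k where k: "harr (Ch K) k" "src k = tgt a" "\<And>n. A.coker (cpt K n k) (cpt K n a)" using Ch_ex_coker[OF a] by blast
  have "Ch.A.nul (k \<star> a)" using Ch.A.cokerD(1)[OF Ch_cokerI[OF a k]] .
  then have "Ch.A.nul k" using assms Ch.A.epi_nul by blast
  then have "A.nul (cpt K n k)" unfolding Ch_nul by blast
  then show ?thesis by (rule nul_coker_epi[OF k(3)[of n]])
qed

lemma cpt_id_iff:
  assumes X: "X \<in> Obj (Ch K)"
  shows "a = hidn (Ch K) X \<longleftrightarrow>
    harr (Ch K) a \<and> src a = X \<and> tgt a = X \<and> (\<forall>n. cpt K n a = hidn K (ob X n))" (is "_ \<longleftrightarrow> ?R")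
proof
  assume ?R
  then show "a = hidn (Ch K) X" using Ch_eq[of a "hidn (Ch K) X"] X by (simp add: cpt_idn)
next
  have "harr (Ch K) (hidn (Ch K) X)" using X by simp
  then show "a = hidn (Ch K) X \<Longrightarrow> ?R" using X Ch.A.dom_idn Ch.A.cod_idn cpt_idn by blast
qed

lemma Ch_ex_biprod:
  assumes XY[simp]: "X \<in> Obj (Ch K)" "Y \<in> Obj (Ch K)"
  shows "\<exists>i j p q. Ch.A.biprod i j p q \<and> src i = X \<and> src j = Y"
proof -
  have "\<forall>n. \<exists>i j p q. A.biprod i j p q \<and> src i = ob X n \<and> src j = ob Y n" using A.ex_biprod by simp
  then obtain i j p q where b: "\<And>n. A.biprod (i n) (j n) (p n) (q n)" "\<And>n. src (i n) = ob X n" "\<And>n. src (j n) = ob Y n"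
    by metis
  note bD = A.biprodD[OF b(1)]
  note [simp] = bD(1-11) b(2,3)
  \<comment> \<open>The diagonal differential; the four equations below say that injections and
    projections are chain maps for it.\<close>
  let ?d = "\<lambda>n. i (n - 1) \<bullet> dff K X n \<bullet> p n \<oplus> j (n - 1) \<bullet> dff K Y n \<bullet> q n"
  have d[simp]: "harr K (?d n)" "src (?d n) = tgt (i n)" "tgt (?d n) = tgt (i (n - 1))" for n by simp_all
  have pi: "p n \<bullet> i n \<bullet> u = u" if "harr K u" "tgt u = ob X n" for u n
    using that by (simp flip: A.comp_assoc)
  have qj: "q n \<bullet> j n \<bullet> v = v" if "harr K v" "tgt v = ob Y n" for v n
    using that by (simp flip: A.comp_assoc)
  have pj: "A.nul (p n \<bullet> j n \<bullet> v)" if "harr K v" "tgt v = ob Y n" for v n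
    using that A.nul_compL[OF bD(12), of v] by (simp add: A.comp_assoc)
  have qi: "A.nul (q n \<bullet> i n \<bullet> v)" if "harr K v" "tgt v = ob X n" for v n
    using that A.nul_compL[OF bD(13), of v] by (simp add: A.comp_assoc)
  have pd: "p (n - 1) \<bullet> ?d n = dff K X n \<bullet> p n" for n
    using pj[of "dff K Y n \<bullet> q n" "n - 1"] by (simp add: A.comp_add pi A.add_nul)
  have qd: "q (n - 1) \<bullet> ?d n = dff K Y n \<bullet> q n" for n
    using qi[of "dff K X n \<bullet> p n" "n - 1"] by (simp add: A.comp_add qj A.nul_add)
  have di: "?d n \<bullet> i n = i (n - 1) \<bullet> dff K X n" for n
  proof -
    have "A.nul (j (n - 1) \<bullet> dff K Y n \<bullet> q n \<bullet> i n)" 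
      using A.nul_compR[OF A.nul_compR[OF bD(13)[of n], of "dff K Y n"], of "j (n - 1)"] by simp
    then show ?thesis by (simp add: A.add_comp A.comp_assoc A.add_nul)
  qed
  have dj: "?d n \<bullet> j n = j (n - 1) \<bullet> dff K Y n" for n
  proof -
    have "A.nul (i (n - 1) \<bullet> dff K X n \<bullet> p n \<bullet> j n)" 
      using A.nul_compR[OF A.nul_compR[OF bD(12)[of n], of "dff K X n"], of "i (n - 1)"] by simp
    then show ?thesis by (simp add: A.add_comp A.comp_assoc A.nul_add)
  qed
  have "A.nul (?d (n - 1) \<bullet> ?d n)" for n
  proof -
    have "?d (n - 1) \<bullet> ?d n = i (n - 1 - 1) \<bullet> dff K X (n - 1) \<bullet> (p (n - 1) \<bullet> ?d n) \<oplus> j (n - 1 - 1) \<bullet> dff K Y (n - 1) \<bullet> (q (n - 1) \<bullet> ?d n)"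
      by (simp only: A.add_comp A.comp_assoc)
    also have "\<dots> = i (n - 1 - 1) \<bullet> (dff K X (n - 1) \<bullet> dff K X n) \<bullet> p n \<oplus> j (n - 1 - 1) \<bullet> (dff K Y (n - 1) \<bullet> dff K Y n) \<bullet> q n"
      by (simp only: pd qd A.comp_assoc)
    finally show ?thesis
      using dff_dff[of X n] dff_dff[of Y n] by (simp add: A.nul_sum A.nul_compL A.nul_compR)
  qed
  then obtain P where P[simp]: "P \<in> Obj (Ch K)" "\<And>n. ob P n = tgt (i n)" "\<And>n. dff K P n = ?d n"
    using Ch_objI[of ?d] d by (metis (no_types, lifting))
  obtain I where I[simp]: "harr (Ch K) I" "src I = X" "tgt I = P" "\<And>n. cpt K n I = i n"
    using Ch_arrI[of X P i] di by auto
  obtain J where J[simp]: "harr (Ch K) J" "src J = Y" "tgt J = P" "\<And>n. cpt K n J = j n"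
    using Ch_arrI[of Y P j] dj by auto
  obtain p' where p'[simp]: "harr (Ch K) p'" "src p' = P" "tgt p' = X" "\<And>n. cpt K n p' = p n"
    using Ch_arrI[of P X p] pd by auto
  obtain q' where q'[simp]: "harr (Ch K) q'" "src q' = P" "tgt q' = Y" "\<And>n. cpt K n q' = q n"
    using Ch_arrI[of P Y q] qd by auto
  have "Ch.A.biprod I J p' q'"
    unfolding Ch.A.biprod_def
    using bD(12-14) by (simp add: cpt_id_iff cpt_cmp cpt_add Ch_nul)
  then show ?thesis by (metis I(2) J(2))
qed

text \<open>Normality is inherited degree by degree: a mono is degreewise mono, hence in every
  degree the kernel of its degreewise cokernel, and such a family is a kernel in
  \<open>Ch K\<close>. Dually for epis.\<close>

lemma Ch_abelian: "abelian_category (Ch K)"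
proof (rule Ch.abelian_categoryI)
  show "abelian_ringoid (harr (Ch K)) src tgt (hidn (Ch K)) (hcmp (Ch K)) (hadd (Ch K)) (hneg (Ch K))"
  proof
    obtain Z where Z: "A.nul (hidn K Z)" using A.ex_zero_object by blast
    have hz: "harr K (hidn K Z)" using Z by (rule A.nul_arr)
    have n: "A.nul (hidn K Z \<bullet> hidn K Z)"
      by (rule A.nul_compL[OF Z hz]) (simp add: A.dom_idn[OF hz] A.cod_idn[OF hz])
    obtain X where "X \<in> Obj (Ch K)" "\<And>n. ob X n = src (hidn K Z)" "\<And>n. dff K X n = hidn K Z"
      by (rule Ch_objI[of "\<lambda>_. hidn K Z"]) (use n hz A.dom_idn[OF hz] A.cod_idn[OF hz] in auto)
    then have "Ch.A.nul (hidn (Ch K) X)" using Z A.dom_idn[OF hz] by (simp add: Ch_nul cpt_idn)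
    then show "\<exists>Z. Ch.A.nul (hidn (Ch K) Z)" by blast
    show "\<exists>i j p q. Ch.A.biprod i j p q \<and> src i = X \<and> src j = Y"
      if "harr (Ch K) (hidn (Ch K) X)" "harr (Ch K) (hidn (Ch K) Y)" for X Y
      using that by (intro Ch_ex_biprod) simp_all
    fix a
    show "\<exists>k. Ch.A.ker k a" if "harr (Ch K) a" using Ch_ex_ker[OF that] Ch_kerI[OF that] by metis
    show "\<exists>k. Ch.A.coker k a" if "harr (Ch K) a" using Ch_ex_coker[OF that] Ch_cokerI[OF that] by metis
    show "\<exists>f. Ch.A.ker a f" if m: "Ch.A.mono a"
    proof -
      have a: "harr (Ch K) a" using m by simp
      obtain c where c: "harr (Ch K) c" "src c = tgt a" "\<And>n. A.coker (cpt K n c) (cpt K n a)"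
        using Ch_ex_coker[OF a] by blast
      have "A.ker (cpt K n a) (cpt K n c)" for n
        using A.mono_ses[OF Ch_mono_cpt[OF m] c(3)] by (simp add: A.ses_def)
      then have "Ch.A.ker a c" using Ch_kerI[OF c(1) a] c(2) by simp
      then show ?thesis by blast
    qed
    show "\<exists>f. Ch.A.coker a f" if m: "Ch.A.epi a"
    proof -
      have a: "harr (Ch K) a" using m by simp
      obtain c where c: "harr (Ch K) c" "tgt c = src a" "\<And>n. A.ker (cpt K n c) (cpt K n a)"
        using Ch_ex_ker[OF a] by blast
      have "A.coker (cpt K n a) (cpt K n c)" for n
        using A.epi_ses[OF Ch_epi_cpt[OF m] c(3)] by (simp add: A.ses_def)
      then have "Ch.A.coker a c" using Ch_cokerI[OF c(1) a] c(2) by simp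
      then show ?thesis by blast
    qed
  qed
qed

interpretation Ch: abelian_category "Ch K" by (rule Ch_abelian)

text \<open>The kernel \<open>i\<close> differs by an isomorphism of complexes from the kernel built
  degreewise, so its components are kernels as well.\<close>

lemma Ch_ses_cpt:
  assumes s: "Ch.A.ses i p"
  shows "A.ses (cpt K n i) (cpt K n p)"
proof -
  have h: "harr (Ch K) i" "harr (Ch K) p" "tgt i = src p" using Ch.A.sesD[OF s] by auto
  obtain k where k: "harr (Ch K) k" "tgt k = src p" "\<And>n. A.ker (cpt K n k) (cpt K n p)"
    using Ch_ex_ker[OF h(2)] by blast
  have kk: "Ch.A.ker k p" using Ch_kerI[OF h(2) k] .
  have ki: "Ch.A.ker i p" using s by (simp add: Ch.A.ses_def)
  obtain u v where u: "k \<star> u = i" "i \<star> v = k" "u \<star> v = hidn (Ch K) (src k)" "v \<star> u = hidn (Ch K) (src i)"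
    using Ch.A.ker_unique[OF kk ki] by blast
  have "harr (Ch K) (k \<star> u)" "harr (Ch K) (i \<star> v)" unfolding u by (fact h k)+
  then have a: "harr (Ch K) u" "harr (Ch K) v" "src k = tgt u" "src i = tgt v" by auto
  have "src (k \<star> u) = src i" "src (i \<star> v) = src k" unfolding u by simp_all
  then have b: "src u = src i" "src v = src k" using a h k by simp_all
  have ci: "cpt K n k \<bullet> cpt K n u = cpt K n i" using cpt_cmp[of k u n] a k u(1) by simp
  have uv: "cpt K n u \<bullet> cpt K n v = hidn K (src (cpt K n k))"
    using cpt_cmp[of u v n] a b k u(3) by (simp add: cpt_idn)
  have "cpt K n v \<bullet> cpt K n u = hidn K (src (cpt K n i))"
    using cpt_cmp[of v u n] a b h u(4) by (simp add: cpt_idn)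
  moreover have "harr K (hidn K (src (cpt K n i)))" using h by simp
  ultimately have "A.mono (cpt K n u)" using A.mono_cancel[of "cpt K n v" "cpt K n u"] by simp
  then have "A.ker (cpt K n i) (cpt K n p)"
    using A.ker_comp_iso[OF k(3) uv] a ci by simp
  moreover have "A.epi (cpt K n p)" using Ch.A.sesD(6)[OF s] by (rule Ch_epi_cpt)
  ultimately show ?thesis by (rule A.sesI)
qed

section \<open>Exact complexes\<close>

text \<open>An exact complex cut into short exact sequences: \<open>z n\<close> is the inclusion of
  the cycles in degree n, and \<open>e n\<close> is the differential seen as an epi onto the cycles
  in degree n - 1.\<close>

definition spliced where
  "spliced X z e \<longleftrightarrow> X \<in> Obj (Ch K) \<and> (\<forall>n. A.ses (z n) (e n) \<and> dff K X n = z (n - 1) \<bullet> e n)"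

lemma splicedD:
  assumes "spliced X z e"
  shows "X \<in> Obj (Ch K)" "A.ses (z n) (e n)" "dff K X n = z (n - 1) \<bullet> e n"
    "harr K (z n)" "harr K (e n)" "tgt (z n) = ob X n" "src (e n) = ob X n" "tgt (e n) = src (z (n - 1))"
proof -
  have x: "X \<in> Obj (Ch K)" "\<And>n. A.ses (z n) (e n)" "\<And>n. dff K X n = z (n - 1) \<bullet> e n"
    using assms by (auto simp: spliced_def)
  then show "X \<in> Obj (Ch K)" "A.ses (z n) (e n)" "dff K X n = z (n - 1) \<bullet> e n" by auto
  show h: "harr K (z n)" "harr K (e n)" using A.sesD[OF x(2)] by auto
  have "harr K (z (n - 1) \<bullet> e n)" "src (z (n - 1) \<bullet> e n) = ob X n"
    using dff_simps(1,2)[OF x(1), of n] unfolding x(3) by auto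
  then show "src (e n) = ob X n" "tgt (e n) = src (z (n - 1))" by auto
  then show "tgt (z n) = ob X n" using A.sesD(3)[OF x(2)[of n]] by simp
qed

lemma ker_mono_comp:
  assumes "A.mono m" "src m = tgt f"
  shows "A.ker k (m \<bullet> f) \<longleftrightarrow> A.ker k f"
proof -
  have "A.nul (m \<bullet> f \<bullet> u) \<longleftrightarrow> A.nul (f \<bullet> u)" for u
  proof
    assume n: "A.nul (f \<bullet> u)"
    have "harr K f" "harr K u" "src f = tgt u" using A.nul_arr[OF n] by auto
    then show "A.nul (m \<bullet> f \<bullet> u)"
      using A.nul_compR[OF n, of m] assms by simp
  qed (rule A.mono_nul[OF assms(1)])
  then show ?thesis unfolding A.ker_def A.comp_assoc by simp
qed

lemma spliced_ker:
  assumes "spliced X z e"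
  shows "A.ker (z n) (dff K X n)"
  unfolding splicedD(3)[OF assms]
  using splicedD[OF assms] A.sesD(5)[OF splicedD(2)[OF assms, of "n - 1"]]
  by (subst ker_mono_comp) (auto simp: A.ses_def)

lemma dff_hm: "dff K X (n + 1) = hm K (ob X (n + 1)) (dif X (n + 1)) (ob X n)"
  by (simp add: dff_def)

lemma exact_dff: "exact_at K (ob X (n + 1)) (ob X n) (ob X (n - 1)) (dif X (n + 1)) (dif X n) \<longleftrightarrow>
    A.exact (dff K X (n + 1)) (dff K X n)"
  unfolding exact_hm dff_hm dff_def[of K X n] ..

lemma exact_spliced:
  assumes "exact_complex K X"
  shows "\<exists>z e. spliced X z e"
proof -
  have X: "X \<in> Obj (Ch K)" using assms by (simp add: exact_complex_def)
  have "A.exact (dff K X (n + 1)) (dff K X n)" for n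
    using assms unfolding exact_complex_def exact_dff by blast
  then have "\<forall>n. \<exists>k e. A.ker k (dff K X n) \<and> A.epi e \<and> k \<bullet> e = dff K X (n + 1)"
    unfolding A.exact_def by blast
  then obtain k e where k: "\<And>n. A.ker (k n) (dff K X n)" "\<And>n. A.epi (e n)" "\<And>n. k n \<bullet> e n = dff K X (n + 1)"
    by metis
  have d: "dff K X n = k (n - 1) \<bullet> e (n - 1)" for n using k(3)[of "n - 1"] by simp
  have "A.ses (k n) (e (n - 1))" for n
  proof (rule A.sesI)
    have m: "A.mono (k (n - 1))" using k(1) by (rule A.ker_mono)
    have "harr K (k (n - 1) \<bullet> e (n - 1))" using dff_simps(1)[OF X, of n] d[of n] by simp
    then have s: "src (k (n - 1)) = tgt (e (n - 1))" unfolding A.arr_comp by blast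
    show "A.ker (k n) (e (n - 1))"
      using k(1)[of n] unfolding d[of n] ker_mono_comp[OF m s] .
  qed (rule k)
  \<comment> \<open>The epi that exactness at n provides starts in degree n + 1, while in
    \<open>spliced\<close> the index is that of the source; hence the shift.\<close>
  then have "spliced X k (\<lambda>n. e (n - 1))" using X d by (simp add: spliced_def)
  then show ?thesis by blast
qed

lemma spliced_exact:
  assumes s: "spliced X z e"
  shows "exact_complex K X"
proof -
  have X: "X \<in> Obj (Ch K)" using s by (rule splicedD)
  have "A.exact (dff K X (n + 1)) (dff K X n)" for n
    unfolding A.exact_def
  proof (intro conjI exI)
    show "harr K (dff K X (n + 1))" using X by simp
    show "A.ker (z n) (dff K X n)" using s by (rule spliced_ker)
    show "A.epi (e (n + 1))" using splicedD(2)[OF s] A.sesD by blast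
    show "z n \<bullet> e (n + 1) = dff K X (n + 1)" using splicedD(3)[OF s, of "n + 1"] by simp
  qed
  then show ?thesis using X unfolding exact_complex_def exact_dff by blast
qed

section \<open>Classes closed under isomorphism\<close>

definition iso_closed where
  "iso_closed \<X> \<longleftrightarrow> (\<forall>u v. harr K u \<and> u \<bullet> v = hidn K (tgt u) \<and> v \<bullet> u = hidn K (src u) \<and> src u \<in> \<X> \<longrightarrow> tgt u \<in> \<X>)"

lemma ker_iso_closed:
  assumes "iso_closed \<X>" "A.ker k f" "A.ker k' f" "src k \<in> \<X>"
  shows "src k' \<in> \<X>"
proof -
  obtain u v where u: "k' \<bullet> u = k" "k \<bullet> v = k'" "u \<bullet> v = hidn K (src k')" "v \<bullet> u = hidn K (src k)"
    using A.ker_unique[OF assms(3,2)] by blast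
  have k: "harr K k" "harr K k'" using assms A.kerD by blast+
  have "harr K (k' \<bullet> u)" "src (k' \<bullet> u) = src k" unfolding u using k by auto
  then have "harr K u" "tgt u = src k'" "src u = src k" by auto
  then show ?thesis using assms(1,4) u unfolding iso_closed_def by metis
qed

lemma coker_iso_closed:
  assumes "iso_closed \<X>" "A.coker k f" "A.coker k' f" "tgt k \<in> \<X>"
  shows "tgt k' \<in> \<X>"
proof -
  obtain u v where u: "u \<bullet> k = k'" "v \<bullet> k' = k" "v \<bullet> u = hidn K (tgt k)" "u \<bullet> v = hidn K (tgt k')"
    using ringoid.ker_unique[OF A.ringoid_op, unfolded A.op_simps, OF assms(2,3)] by blast
  have k: "harr K k" "harr K k'" using assms A.cokerD by blast+
  have "harr K (u \<bullet> k)" "tgt (u \<bullet> k) = tgt k'" unfolding u using k by auto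
  then have "harr K u" "tgt u = tgt k'" "src u = tgt k" by auto
  then show ?thesis using assms(1,4) u unfolding iso_closed_def by metis
qed

text \<open>Kernels of one arrow are isomorphic, so for a class closed under isomorphism the
  condition on all kernels can be tested on a single chosen one.\<close>

lemma kernels_in_iff:
  assumes c: "iso_closed \<X>" and k: "A.ker k (hm K X f Y)"
  shows "kernels_in K \<X> X Y f \<longleftrightarrow> src k \<in> \<X>"
proof
  have h: "harr K k" "tgt k = X" using A.kerD[OF k] by auto
  then have e: "hm K (src k) (mor k) X = k" using hm_eta by metis
  show "kernels_in K \<X> X Y f \<Longrightarrow> src k \<in> \<X>"
    using k e ker_hm unfolding kernels_in_def by metis
  assume s: "src k \<in> \<X>"
  show "kernels_in K \<X> X Y f"
    unfolding kernels_in_def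
  proof (intro allI impI)
    fix N k' assume "is_kernel K X Y f N k'"
    then have k': "A.ker (hm K N k' X) (hm K X f Y)" by (simp add: ker_hm)
    then have "src (hm K N k' X) = N" using A.kerD(2) hm_simps(1) by blast
    then show "N \<in> \<X>" using ker_iso_closed[OF c k k' s] by simp
  qed
qed

lemma cokernels_in_iff:
  assumes c: "iso_closed \<X>" and k: "A.coker k (hm K X f Y)"
  shows "cokernels_in K \<X> X Y f \<longleftrightarrow> tgt k \<in> \<X>"
proof
  have h: "harr K k" "src k = Y" using A.cokerD[OF k] by auto
  then have e: "hm K Y (mor k) (tgt k) = k" using hm_eta by metis
  show "cokernels_in K \<X> X Y f \<Longrightarrow> tgt k \<in> \<X>"
    using k e coker_hm unfolding cokernels_in_def by metis
  assume s: "tgt k \<in> \<X>"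
  show "cokernels_in K \<X> X Y f"
    unfolding cokernels_in_def
  proof (intro allI impI)
    fix N k' assume "is_cokernel K X Y f N k'"
    then have k': "A.coker (hm K Y k' N) (hm K X f Y)" by (simp add: coker_hm)
    then have "tgt (hm K Y k' N) = N" using A.cokerD(2) hm_simps(2) by blast
    then show "N \<in> \<X>" using coker_iso_closed[OF c k k' s] by simp
  qed
qed

lemma exact_with_cycles_iff:
  assumes c: "iso_closed \<X>"
  shows "X \<in> exact_with_cycles_in K \<X> \<longleftrightarrow> (\<exists>z e. spliced X z e \<and> (\<forall>n. src (z n) \<in> \<X>))"
proof -
  have "(\<forall>n. kernels_in K \<X> (ob X n) (ob X (n - 1)) (dif X n)) \<longleftrightarrow> (\<forall>n. src (z n) \<in> \<X>)" if s: "spliced X z e" for z e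
    using kernels_in_iff[OF c spliced_ker[OF s, unfolded dff_def]] by blast
  then show ?thesis
    unfolding exact_with_cycles_in_def using exact_spliced spliced_exact by blast
qed

text \<open>Acyclicity of Hom(X, F). A cocycle \<open>f\<close> vanishes on boundaries, which by
  exactness are the cycles \<open>z n\<close>, so it factors through the cycles in degree n - 1.
  From there it extends to \<open>ob X (n - 1)\<close>, because the quotient is again a cycle object
  and so orthogonal to F.\<close>

lemma spliced_factor:
  assumes s: "spliced X z e" and F: "\<And>n. A.ext0 (src (z n)) F"
    and f: "tgt f = F" "A.nul (f \<bullet> dff K X (n + 1))"
  shows "\<exists>g. g \<bullet> dff K X n = f \<and> harr K g \<and> src g = ob X (n - 1) \<and> tgt g = F"
proof -
  note D = splicedD[OF s]
  have X: "X \<in> Obj (Ch K)" using s by (rule splicedD)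
  note [simp] = dff_simps[OF X]
  have h[simp]: "harr K f" "src f = ob X n" using A.nul_arr[OF f(2)] by auto
  have "A.nul ((f \<bullet> z n) \<bullet> e (n + 1))" using f(2) D(3)[of "n + 1"] by (simp add: A.comp_assoc)
  then have "A.nul (f \<bullet> z n)" using A.epi_nul[OF A.sesD(6)[OF D(2)]] by blast
  then obtain k where k: "k \<bullet> e n = f" "harr K k" "tgt k = tgt f" "src k = tgt (e n)"
    using A.ses_colift[OF D(2)] by blast
  have t: "tgt (e (n - 1)) = src (z (n - 1 - 1))" by (rule D(8))
  have "A.ext0 (tgt (e (n - 1))) F" unfolding t by (rule F)
  then obtain g where g: "g \<bullet> z (n - 1) = k"
    using A.ext0_extend[of "tgt (e (n - 1))" F "z (n - 1)" "e (n - 1)" k] D(2)[of "n - 1"] k f D(8)[of n] by auto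
  have "harr K (g \<bullet> z (n - 1))" "tgt (g \<bullet> z (n - 1)) = F" unfolding g using k f by auto
  then have "harr K g" "src g = ob X (n - 1)" "tgt g = F" using D(6)[of "n - 1"] by auto
  moreover have "g \<bullet> dff K X n = f" unfolding D(3)[of n] using g k by (simp flip: A.comp_assoc)
  ultimately show ?thesis by blast
qed

text \<open>An extension that splits in each degree is classified by a cocycle \<delta> of degree -1
  with values in N, and it splits as a complex once \<delta> is a coboundary: the degreewise section
  minus the image of \<open>h\<close> is then a chain map.\<close>

lemma Ch_ext0I:
  assumes X: "X \<in> Obj (Ch K)" and N: "N \<in> Obj (Ch K)"
    and E: "\<And>n. A.ext0 (ob X n) (ob N n)"
    and H: "\<And>\<delta>. \<lbrakk>\<And>n. harr K (\<delta> n); \<And>n. src (\<delta> n) = ob X n; \<And>n. tgt (\<delta> n) = ob N (n - 1);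
        \<And>n. dff K N (n - 1) \<bullet> \<delta> n = \<ominus> (\<delta> (n - 1) \<bullet> dff K X n)\<rbrakk> \<Longrightarrow>
      \<exists>h. \<forall>n. harr K (h n) \<and> src (h n) = ob X n \<and> tgt (h n) = ob N n \<and>
        dff K N n \<bullet> h n = \<delta> n \<oplus> h (n - 1) \<bullet> dff K X n"
  shows "Ch.A.ext0 X N"
  unfolding Ch.A.ext0_def
proof (intro allI impI)
  fix i p assume "Ch.A.ses i p \<and> src i = N \<and> tgt p = X"
  then have s: "Ch.A.ses i p" and ip[simp]: "src i = N" "tgt p = X" by auto
  have h[simp]: "harr (Ch K) i" "harr (Ch K) p" "tgt i = src p" using Ch.A.sesD[OF s] by auto
  have sn: "A.ses (cpt K n i) (cpt K n p)" for n using s by (rule Ch_ses_cpt)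
  note [simp] = dff_simps[OF X] dff_simps[OF N]
  let ?E = "src p"
  have EO: "?E \<in> Obj (Ch K)" by simp
  have "\<forall>n. \<exists>t. cpt K n p \<bullet> t = hidn K (ob X n)"
    using E sn unfolding A.ext0_def by fastforce
  then obtain t where t: "\<And>n. cpt K n p \<bullet> t n = hidn K (ob X n)" by metis
  have th[simp]: "harr K (t n)" "src (t n) = ob X n" "tgt (t n) = ob ?E n" for n
  proof -
    have "harr K (cpt K n p \<bullet> t n)" "src (cpt K n p \<bullet> t n) = ob X n" unfolding t using X by simp_all
    then show "harr K (t n)" "src (t n) = ob X n" "tgt (t n) = ob ?E n" by auto
  qed
  have pd: "cpt K (n - 1) p \<bullet> dff K ?E n = dff K X n \<bullet> cpt K n p" for n using cpt_dff[of p n] by simp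
  have id: "cpt K (n - 1) i \<bullet> dff K N n = dff K ?E n \<bullet> cpt K n i" for n using cpt_dff[of i n] by simp
  \<comment> \<open>The failure of the degreewise section \<open>t\<close> to be a chain map. It is
    killed by \<open>p\<close>, and \<delta> is its factor through \<open>i\<close>.\<close>
  let ?w = "\<lambda>n. dff K ?E n \<bullet> t n \<oplus> \<ominus> (t (n - 1) \<bullet> dff K X n)"
  have "\<forall>n. \<exists>\<delta>. cpt K (n - 1) i \<bullet> \<delta> = ?w n \<and> harr K \<delta> \<and> src \<delta> = ob X n \<and> tgt \<delta> = ob N (n - 1)"
  proof
    fix n
    have "cpt K (n - 1) p \<bullet> dff K ?E n \<bullet> t n = dff K X n \<bullet> cpt K n p \<bullet> t n"
      by (simp only: pd flip: A.comp_assoc)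
    also have "\<dots> = dff K X n" by (simp add: t)
    finally have 1: "cpt K (n - 1) p \<bullet> dff K ?E n \<bullet> t n = dff K X n" .
    have "cpt K (n - 1) p \<bullet> t (n - 1) \<bullet> dff K X n = dff K X n"
      by (simp add: t flip: A.comp_assoc)
    then have "A.nul (cpt K (n - 1) p \<bullet> ?w n)" using 1 by (simp add: A.comp_add A.comp_neg)
    then show "\<exists>\<delta>. cpt K (n - 1) i \<bullet> \<delta> = ?w n \<and> harr K \<delta> \<and> src \<delta> = ob X n \<and> tgt \<delta> = ob N (n - 1)"
      using A.ses_lift[OF sn[of "n - 1"], of "?w n"] by simp
  qed
  then obtain \<delta> where \<delta>: "\<And>n. cpt K (n - 1) i \<bullet> \<delta> n = ?w n"
    and \<delta>h[simp]: "\<And>n. harr K (\<delta> n)" "\<And>n. src (\<delta> n) = ob X n" "\<And>n. tgt (\<delta> n) = ob N (n - 1)" by metis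
  have anti: "dff K N (n - 1) \<bullet> \<delta> n = \<ominus> (\<delta> (n - 1) \<bullet> dff K X n)" for n
  proof (rule A.monoD[OF A.sesD(5)[OF sn[of "n - 1 - 1"]]])
    let ?m = "n - 1"
    have n1: "A.nul (dff K ?E ?m \<bullet> dff K ?E n \<bullet> t n)"
      using A.nul_compL[OF dff_dff[OF EO, of n], of "t n"] EO by (simp add: A.comp_assoc)
    have n2: "A.nul (t (?m - 1) \<bullet> dff K X ?m \<bullet> dff K X n)"
      using A.nul_compR[OF dff_dff[OF X, of n], of "t (?m - 1)"] by simp
    have "cpt K (?m - 1) i \<bullet> dff K N ?m \<bullet> \<delta> n = dff K ?E ?m \<bullet> cpt K ?m i \<bullet> \<delta> n"
      by (simp only: id flip: A.comp_assoc)
    also have "\<dots> = dff K ?E ?m \<bullet> ?w n" by (simp only: \<delta>)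
    also have "\<dots> = \<ominus> (dff K ?E ?m \<bullet> t ?m \<bullet> dff K X n)"
      using n1 EO by (simp add: A.comp_add A.comp_neg A.nul_add)
    finally have a: "cpt K (?m - 1) i \<bullet> dff K N ?m \<bullet> \<delta> n = \<ominus> (dff K ?E ?m \<bullet> t ?m \<bullet> dff K X n)" .
    have "cpt K (?m - 1) i \<bullet> \<delta> ?m \<bullet> dff K X n = ?w ?m \<bullet> dff K X n"
      by (simp only: \<delta> flip: A.comp_assoc)
    also have "\<dots> = dff K ?E ?m \<bullet> t ?m \<bullet> dff K X n \<oplus> \<ominus> (t (?m - 1) \<bullet> dff K X ?m \<bullet> dff K X n)"
      by (simp only: A.add_comp A.neg_comp A.comp_assoc)
    also have "\<dots> = dff K ?E ?m \<bullet> t ?m \<bullet> dff K X n"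
      using n2 EO by (simp add: A.add_nul)
    finally show "cpt K (?m - 1) i \<bullet> dff K N ?m \<bullet> \<delta> n = cpt K (?m - 1) i \<bullet> \<ominus> (\<delta> ?m \<bullet> dff K X n)"
      unfolding a by (simp only: A.comp_neg)
  qed simp_all
  obtain k where k: "\<And>n. harr K (k n)" "\<And>n. src (k n) = ob X n" "\<And>n. tgt (k n) = ob N n"
    and kd: "\<And>n. dff K N n \<bullet> k n = \<delta> n \<oplus> k (n - 1) \<bullet> dff K X n"
    using H[of \<delta>] anti by auto
  note [simp] = k
  let ?s = "\<lambda>n. t n \<oplus> \<ominus> (cpt K n i \<bullet> k n)"
  have "?s (n - 1) \<bullet> dff K X n = dff K ?E n \<bullet> ?s n" for n
  proof -
    have wn: "dff K ?E n \<bullet> t n = ?w n \<oplus> t (n - 1) \<bullet> dff K X n"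
      using EO by (simp add: A.add_assoc A.add_commute[of "\<ominus> (t (n - 1) \<bullet> dff K X n)"] A.add_nul)
    have "dff K ?E n \<bullet> cpt K n i \<bullet> k n = cpt K (n - 1) i \<bullet> dff K N n \<bullet> k n"
      by (simp only: id flip: A.comp_assoc)
    also have "\<dots> = ?w n \<oplus> cpt K (n - 1) i \<bullet> k (n - 1) \<bullet> dff K X n"
      by (simp only: kd A.comp_add \<delta>)
    finally have e: "dff K ?E n \<bullet> cpt K n i \<bullet> k n = ?w n \<oplus> cpt K (n - 1) i \<bullet> k (n - 1) \<bullet> dff K X n" .
    have "dff K ?E n \<bullet> ?s n = dff K ?E n \<bullet> t n \<oplus> \<ominus> (dff K ?E n \<bullet> cpt K n i \<bullet> k n)"
      by (simp only: A.comp_add A.comp_neg)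
    also have "\<dots> = (?w n \<oplus> t (n - 1) \<bullet> dff K X n) \<oplus> \<ominus> (?w n \<oplus> cpt K (n - 1) i \<bullet> k (n - 1) \<bullet> dff K X n)"
      by (rule arg_cong2[where f = "hadd K", OF wn arg_cong[where f = "hneg K", OF e]])
    also have "\<dots> = t (n - 1) \<bullet> dff K X n \<oplus> \<ominus> (cpt K (n - 1) i \<bullet> k (n - 1) \<bullet> dff K X n)"
    proof (rule A.add_diff_cancel)
      have "harr K (dff K ?E n)" "src (dff K ?E n) = ob ?E n" "tgt (dff K ?E n) = ob ?E (n - 1)"
        using EO by simp_all
      then show "harr K (?w n)" "harr K (t (n - 1) \<bullet> dff K X n)" "harr K (cpt K (n - 1) i \<bullet> k (n - 1) \<bullet> dff K X n)"
        "src (t (n - 1) \<bullet> dff K X n) = src (?w n)" "src (cpt K (n - 1) i \<bullet> k (n - 1) \<bullet> dff K X n) = src (?w n)"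
        "tgt (t (n - 1) \<bullet> dff K X n) = tgt (?w n)" "tgt (cpt K (n - 1) i \<bullet> k (n - 1) \<bullet> dff K X n) = tgt (?w n)"
        by simp_all
    qed
    also have "\<dots> = ?s (n - 1) \<bullet> dff K X n" by (simp only: A.add_comp A.neg_comp A.comp_assoc)
    finally show ?thesis by (rule sym)
  qed
  then obtain a where a: "harr (Ch K) a" "src a = X" "tgt a = ?E" "\<And>n. cpt K n a = ?s n"
    using Ch_arrI[of X ?E ?s] X EO by auto
  have "p \<star> a = hidn (Ch K) X"
    unfolding cpt_id_iff[OF X]
  proof (intro conjI allI)
    fix n
    have "A.nul (cpt K n p \<bullet> cpt K n i \<bullet> k n)"
      using A.nul_compL[OF A.sesD(7)[OF sn[of n]], of "k n"] by (simp add: A.comp_assoc)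
    then have "cpt K n p \<bullet> ?s n = hidn K (ob X n)"
      using X by (simp add: A.comp_add A.comp_neg t A.add_nul)
    then show "cpt K n (p \<star> a) = hidn K (ob X n)"
      using a by (simp add: cpt_cmp)
  qed (use a in simp_all)
  then show "\<exists>s. p \<star> s = hidn (Ch K) X" by blast
qed

end

section \<open>Families of choices indexed by the integers\<close>

lemma int_choice_up:
  fixes b :: int
  assumes "P b x" and step: "\<And>n x. \<lbrakk>n \<ge> b; P n x\<rbrakk> \<Longrightarrow> \<exists>y. P (n + 1) y \<and> Q n x y"
  shows "\<exists>h. h b = x \<and> (\<forall>n\<ge>b. P n (h n) \<and> Q n (h n) (h (n + 1)))"
proof -
  have "\<exists>f. \<forall>k. (P (b + int k) (f k) \<and> (k = 0 \<longrightarrow> f k = x)) \<and> Q (b + int k) (f k) (f (Suc k))"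
  proof (rule dependent_nat_choice)
    show "\<exists>y. P (b + int 0) y \<and> (0 = (0::nat) \<longrightarrow> y = x)" using assms(1) by simp
    fix y k assume "P (b + int k) y \<and> (k = 0 \<longrightarrow> y = x)"
    then have "\<exists>w. P (b + int k + 1) w \<and> Q (b + int k) y w" by (intro step) auto
    then show "\<exists>w. (P (b + int (Suc k)) w \<and> (Suc k = 0 \<longrightarrow> w = x)) \<and> Q (b + int k) y w"
      by (simp add: algebra_simps)
  qed
  then obtain f where f: "\<And>k. P (b + int k) (f k)" "f 0 = x" "\<And>k. Q (b + int k) (f k) (f (Suc k))" by auto
  have "P n (f (nat (n - b))) \<and> Q n (f (nat (n - b))) (f (nat (n + 1 - b)))" if "n \<ge> b" for n
    using f(1)[of "nat (n - b)"] f(3)[of "nat (n - b)"] that by (simp add: Suc_nat_eq_nat_zadd1 algebra_simps)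
  then show ?thesis using f(2) by (intro exI[of _ "\<lambda>n. f (nat (n - b))"]) simp
qed

lemma int_choice_down:
  fixes b :: int
  assumes "P b x" and step: "\<And>n x. \<lbrakk>n \<le> b; P n x\<rbrakk> \<Longrightarrow> \<exists>y. P (n - 1) y \<and> Q n x y"
  shows "\<exists>h. h b = x \<and> (\<forall>n\<le>b. P n (h n) \<and> Q n (h n) (h (n - 1)))"
proof -
  have "\<exists>h. h (- b) = x \<and> (\<forall>n\<ge>- b. P (- n) (h n) \<and> Q (- n) (h n) (h (n + 1)))"
  proof (rule int_choice_up)
    show "P (- (- b)) x" using assms(1) by simp
    fix n x assume "- b \<le> n" "P (- n) x"
    then show "\<exists>y. P (- (n + 1)) y \<and> Q (- n) x y" using step[of "- n" x] by simp
  qed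
  then obtain h where h: "h (- b) = x" "\<And>n. n \<ge> - b \<Longrightarrow> P (- n) (h n) \<and> Q (- n) (h n) (h (n + 1))" by auto
  have "P n (h (- n)) \<and> Q n (h (- n)) (h (- (n - 1)))" if "n \<le> b" for n
    using h(2)[of "- n"] that by (simp add: algebra_simps)
  then show ?thesis using h(1) by (intro exI[of _ "\<lambda>n. h (- n)"]) simp
qed

text \<open>Two one-sided recursions glued at their common start. The invariants \<open>P\<close>
  and \<open>P'\<close> are separate because what must be carried upwards in \<open>pivot\<close>
  differs from what must be carried downwards.\<close>

lemma int_choice:
  fixes b :: int
  assumes "P b x" "P' b x"
    and "\<And>n x. \<lbrakk>n \<ge> b; P n x\<rbrakk> \<Longrightarrow> \<exists>y. P (n + 1) y \<and> Q n x y"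
    and "\<And>n x. \<lbrakk>n \<le> b; P' n x\<rbrakk> \<Longrightarrow> \<exists>y. P' (n - 1) y \<and> Q' n x y"
  shows "\<exists>h. (\<forall>n\<ge>b. P n (h n) \<and> Q n (h n) (h (n + 1))) \<and> (\<forall>n\<le>b. P' n (h n) \<and> Q' n (h n) (h (n - 1)))"
proof -
  obtain f where f: "f b = x" "\<And>n. n \<ge> b \<Longrightarrow> P n (f n) \<and> Q n (f n) (f (n + 1))"
    using int_choice_up[of P b x Q] assms(1,3) by blast
  obtain g where g: "g b = x" "\<And>n. n \<le> b \<Longrightarrow> P' n (g n) \<and> Q' n (g n) (g (n - 1))"
    using int_choice_down[of P' b x Q'] assms(2,4) by blast
  let ?h = "\<lambda>n. if n \<ge> b then f n else g n"
  have 1: "\<forall>n\<ge>b. P n (?h n) \<and> Q n (?h n) (?h (n + 1))"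
    using f(2) by simp
  have 2: "\<forall>n\<le>b. P' n (?h n) \<and> Q' n (?h n) (?h (n - 1))"
  proof (intro allI impI)
    fix n assume "n \<le> b"
    then show "P' n (?h n) \<and> Q' n (?h n) (?h (n - 1))" using g(2)[of n] f(1) g(1) by (cases "n = b") auto
  qed
  show ?thesis by (rule exI[of _ ?h], rule conjI[OF 1 2])
qed

section \<open>Splitting extensions of complexes and null homotopies\<close>

context abelian_category begin

interpretation Ch: abelian_category "Ch K" by (rule Ch_abelian)

lemma spliced_ext0_ob:
  assumes s: "spliced X z e" and E: "\<And>n. A.ext0 (src (z n)) Y"
  shows "A.ext0 (ob X n) Y"
proof -
  have "A.ext0 (tgt (e n)) Y" unfolding splicedD(8)[OF s] by (rule E)
  then show ?thesis
    using A.ext0_middle_left[OF splicedD(2)[OF s, of n]] E unfolding splicedD(7)[OF s] by blast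
qed

text \<open>The splitting is constructed upwards from degree \<open>b\<close> by lifting along \<open>eN\<close>, and downwards by
  the acyclicity of \<open>Hom(X, N m)\<close>. The object \<open>tgt eF\<close> is what \<open>N b\<close> has in excess of the exact complex
  above it.\<close>

lemma pivot:
  assumes s: "spliced X z e" and N: "N \<in> Obj (Ch K)"
    and up: "\<And>n. n > b \<Longrightarrow> A.ses (zN n) (eN n)" "\<And>n. n > b \<Longrightarrow> dff K N n = zN (n - 1) \<bullet> eN n"
    and pv: "A.ses (zN b) eF" "A.nul (dff K N b \<bullet> zN b)"
    and E1: "\<And>n m. m \<ge> b \<Longrightarrow> A.ext0 (ob X n) (src (zN m))"
    and E2: "\<And>n. A.ext0 (src (z n)) (tgt eF)"
    and E3: "\<And>n m. m < b \<Longrightarrow> A.ext0 (src (z n)) (ob N m)"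
  shows "Ch.A.ext0 X N"
proof (rule Ch_ext0I)
  show X: "X \<in> Obj (Ch K)" using s by (rule splicedD)
  show "N \<in> Obj (Ch K)" by fact
  note [simp] = dff_simps[OF X] dff_simps[OF N] add.commute[of "1::int"]
  have up': "harr K (zN n)" "harr K (eN n)" "tgt (zN n) = ob N n" "src (eN n) = ob N n" "tgt (eN n) = src (zN (n - 1))"
    if "n > b" for n
  proof -
    show h: "harr K (zN n)" "harr K (eN n)" using A.sesD[OF up(1)[OF that]] by auto
    have "harr K (zN (n - 1) \<bullet> eN n)" "src (zN (n - 1) \<bullet> eN n) = ob N n"
      unfolding up(2)[OF that, symmetric] by simp_all
    then show "src (eN n) = ob N n" "tgt (eN n) = src (zN (n - 1))" by auto
    then show "tgt (zN n) = ob N n" using A.sesD(3)[OF up(1)[OF that]] by simp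
  qed
  have pv': "harr K (zN b)" "harr K eF" "tgt (zN b) = ob N b" "src eF = ob N b"
    using A.sesD[OF pv(1)] A.nul_arr[OF pv(2)] by auto
  have zb: "harr K (zN n)" "tgt (zN n) = ob N n" "A.mono (zN n)" if "n \<ge> b" for n
    using that up'(1,3)[of n] pv'(1,3) A.sesD(5)[OF up(1)[of n]] A.sesD(5)[OF pv(1)] by (cases "n = b"; simp)+
  show "A.ext0 (ob X n) (ob N n)" for n
  proof (cases "n > b")
    case True
    have "A.ext0 (ob X n) (tgt (eN n))"
      using E1[of "n - 1"] True unfolding up'(5)[OF True] by simp
    then show ?thesis using A.ext0_middle_right[OF up(1)[OF True]] E1[of n n] True up'(3)[OF True] by simp
  next
    case False
    show ?thesis
    proof (cases "n = b")
      case True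
      have "A.ext0 (ob X b) (tgt eF)" using s E2 by (rule spliced_ext0_ob)
      then show ?thesis using A.ext0_middle_right[OF pv(1)] E1[of b b] True pv'(3) by simp
    next
      case n: False
      show ?thesis using s by (rule spliced_ext0_ob) (use E3 False n in simp)
    qed
  qed
  fix \<delta> assume \<delta>[simp]: "\<And>n. harr K (\<delta> n)" "\<And>n. src (\<delta> n) = ob X n" "\<And>n. tgt (\<delta> n) = ob N (n - 1)"
    and anti: "\<And>n. dff K N (n - 1) \<bullet> \<delta> n = \<ominus> (\<delta> (n - 1) \<bullet> dff K X n)"
  let ?T = "\<lambda>n h. harr K h \<and> src h = ob X n \<and> tgt h = ob N n"
  \<comment> \<open>Upwards, the prescribed value for degree n + 1 has to lie in the cycles of N, so
    that it can be lifted. Downwards (\<open>?P'\<close>), the defect in degree n has to vanish on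
    the boundaries of X, so that it factors through \<open>dff K X n\<close>.\<close>
  let ?P = "\<lambda>n h. ?T n h \<and> (\<exists>t. zN n \<bullet> t = \<delta> (n + 1) \<oplus> h \<bullet> dff K X (n + 1))"
  let ?P' = "\<lambda>n h. ?T n h \<and> A.nul ((dff K N n \<bullet> h \<oplus> \<ominus> (\<delta> n)) \<bullet> dff K X (n + 1))"
  let ?Q = "\<lambda>n x y. dff K N (n + 1) \<bullet> y = \<delta> (n + 1) \<oplus> x \<bullet> dff K X (n + 1)"
  let ?Q' = "\<lambda>n x y. dff K N n \<bullet> x = \<delta> n \<oplus> y \<bullet> dff K X n"
  have anti': "dff K N n \<bullet> \<delta> (n + 1) = \<ominus> (\<delta> n \<bullet> dff K X (n + 1))" for n
    using anti[of "n + 1"] by simp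
  \<comment> \<open>At the cut, \<open>eF \<bullet> \<delta> (b + 1)\<close> is a cocycle of the
    acyclic complex Hom(X, \<open>tgt eF\<close>), so it equals some \<open>f\<close> after the
    differential. Lifting -f along \<open>eF\<close> gives \<open>h0\<close> with \<delta> + h0 d in
    the kernel \<open>zN b\<close> of \<open>eF\<close>: the upward invariant. As
    \<open>dff K N b\<close> kills \<open>zN b\<close>, the same \<open>h0\<close> satisfies the
    downward one.\<close>
  obtain h0 where "?P b h0" "?P' b h0"
  proof -
    note [simp] = pv'
    have dz: "dff K N (b + 1) = zN b \<bullet> eN (b + 1)" using up(2)[of "b + 1"] by simp
    have e1[simp]: "harr K (eN (b + 1))" "src (eN (b + 1)) = ob N (b + 1)" "tgt (eN (b + 1)) = src (zN b)"
      using up'(2,4,5)[of "b + 1"] by simp_all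
    have "A.nul (eF \<bullet> dff K N (b + 1) \<bullet> \<delta> (b + 1 + 1))"
      using A.nul_compL[OF A.sesD(7)[OF pv(1)], of "eN (b + 1) \<bullet> \<delta> (b + 1 + 1)"]
      by (simp add: dz A.comp_assoc)
    then have "A.nul (\<ominus> (eF \<bullet> \<delta> (b + 1) \<bullet> dff K X (b + 1 + 1)))"
      unfolding anti' A.comp_neg .
    then have "A.nul ((eF \<bullet> \<delta> (b + 1)) \<bullet> dff K X (b + 1 + 1))"
      by (simp add: A.comp_assoc)
    then obtain f where f: "f \<bullet> dff K X (b + 1) = eF \<bullet> \<delta> (b + 1)" "harr K f" "src f = ob X b" "tgt f = tgt eF"
      using spliced_factor[OF s E2, of "eF \<bullet> \<delta> (b + 1)" "b + 1"] by auto
    obtain h0 where h0: "eF \<bullet> h0 = \<ominus> f"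
      using A.ext0_lift[OF E1[of b b] pv(1), of "\<ominus> f"] f by auto
    have "harr K (eF \<bullet> h0)" "src (eF \<bullet> h0) = ob X b" unfolding h0 using f by simp_all
    then have [simp]: "harr K h0" "src h0 = ob X b" "tgt h0 = ob N b" by auto
    let ?w = "\<delta> (b + 1) \<oplus> h0 \<bullet> dff K X (b + 1)"
    have "eF \<bullet> h0 \<bullet> dff K X (b + 1) = \<ominus> (eF \<bullet> \<delta> (b + 1))"
      by (simp only: h0 A.neg_comp f(1) flip: A.comp_assoc)
    then have "A.nul (eF \<bullet> ?w)" by (simp add: A.comp_add)
    then obtain t where t: "zN b \<bullet> t = ?w" "harr K t" "tgt t = src (zN b)" using A.ses_lift[OF pv(1)] by blast
    have "dff K N b \<bullet> ?w = (dff K N b \<bullet> zN b) \<bullet> t" by (simp add: t(1) A.comp_assoc)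
    then have "A.nul (dff K N b \<bullet> ?w)" using A.nul_compL[OF pv(2), of t] t by simp
    moreover have "(dff K N b \<bullet> h0 \<oplus> \<ominus> (\<delta> b)) \<bullet> dff K X (b + 1) = dff K N b \<bullet> ?w"
      by (simp only: A.add_comp A.comp_add A.neg_comp A.comp_assoc anti' A.add_commute)
    ultimately show thesis using t(1) by (intro that[of h0]) auto
  qed
  then have "\<exists>h. (\<forall>n\<ge>b. ?P n (h n) \<and> ?Q n (h n) (h (n + 1))) \<and> (\<forall>n\<le>b. ?P' n (h n) \<and> ?Q' n (h n) (h (n - 1)))"
  proof (rule int_choice[where b = b and P = ?P and Q = ?Q and P' = ?P' and Q' = ?Q'])
    fix n x assume n: "b \<le> n" and "?P n x"
    then obtain t where x[simp]: "harr K x" "src x = ob X n" "tgt x = ob N n"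
      and t: "zN n \<bullet> t = \<delta> (n + 1) \<oplus> x \<bullet> dff K X (n + 1)" by blast
    note [simp] = zb(1,2)[OF n]
    have e1[simp]: "harr K (eN (n + 1))" "src (eN (n + 1)) = ob N (n + 1)" "tgt (eN (n + 1)) = src (zN n)"
      "harr K (zN (n + 1))" "tgt (zN (n + 1)) = ob N (n + 1)"
      using up'[of "n + 1"] n by simp_all
    have dz: "dff K N (n + 1) = zN n \<bullet> eN (n + 1)" using up(2)[of "n + 1"] n by simp
    have "harr K (zN n \<bullet> t)" "src (zN n \<bullet> t) = ob X (n + 1)" unfolding t by simp_all
    then have [simp]: "harr K t" "tgt t = src (zN n)" "src t = ob X (n + 1)" by auto
    \<comment> \<open>Lifting out of a component of X: the kernel of \<open>eN (n + 1)\<close> is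
      the cycle object covered by \<open>E1\<close>.\<close>
    obtain y where y: "eN (n + 1) \<bullet> y = t"
      using A.ext0_lift[OF E1[of "n + 1" "n + 1"] up(1)[of "n + 1"], of t] n by auto
    have "harr K (eN (n + 1) \<bullet> y)" "src (eN (n + 1) \<bullet> y) = ob X (n + 1)" unfolding y by simp_all
    then have [simp]: "harr K y" "src y = ob X (n + 1)" "tgt y = ob N (n + 1)" by auto
    have Q: "dff K N (n + 1) \<bullet> y = \<delta> (n + 1) \<oplus> x \<bullet> dff K X (n + 1)"
      by (simp only: dz A.comp_assoc y t)
    let ?w = "\<delta> (n + 1 + 1) \<oplus> y \<bullet> dff K X (n + 1 + 1)"
    have "zN n \<bullet> eN (n + 1) \<bullet> ?w = dff K N (n + 1) \<bullet> ?w" by (simp only: dz A.comp_assoc)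
    also have "\<dots> = \<ominus> (\<delta> (n + 1) \<bullet> dff K X (n + 1 + 1)) \<oplus> (dff K N (n + 1) \<bullet> y) \<bullet> dff K X (n + 1 + 1)"
      by (simp only: A.comp_add anti' A.comp_assoc)
    also have "\<dots> = \<ominus> (\<delta> (n + 1) \<bullet> dff K X (n + 1 + 1)) \<oplus>
        (\<delta> (n + 1) \<bullet> dff K X (n + 1 + 1) \<oplus> x \<bullet> dff K X (n + 1) \<bullet> dff K X (n + 1 + 1))"
      by (simp only: Q A.add_comp A.comp_assoc)
    also have "\<dots> = x \<bullet> dff K X (n + 1) \<bullet> dff K X (n + 1 + 1)"
      by (rule A.neg_add_cancel) simp_all
    finally have "A.nul (zN n \<bullet> eN (n + 1) \<bullet> ?w)"
      using A.nul_compR[OF dff_dff'[OF X, of "n + 1"], of x] by simp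
    then have "A.nul (eN (n + 1) \<bullet> ?w)" by (rule A.mono_nul[OF zb(3)[OF n]])
    then have "\<exists>t. zN (n + 1) \<bullet> t = ?w" using A.ses_lift[OF up(1)[of "n + 1"]] n by auto
    then show "\<exists>y. ?P (n + 1) y \<and> ?Q n x y" using Q by (intro exI[of _ y]) simp
  next
    fix n x assume n: "n \<le> b" and "?P' n x"
    then have x[simp]: "harr K x" "src x = ob X n" "tgt x = ob N n"
      and w0: "A.nul ((dff K N n \<bullet> x \<oplus> \<ominus> (\<delta> n)) \<bullet> dff K X (n + 1))" by blast+
    let ?w = "dff K N n \<bullet> x \<oplus> \<ominus> (\<delta> n)"
    \<comment> \<open>Here the cycles of X are used: Hom(X, \<open>ob N (n - 1)\<close>) is acyclic
      by \<open>E3\<close>.\<close>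
    obtain y where y: "y \<bullet> dff K X n = ?w" and [simp]: "harr K y" "src y = ob X (n - 1)" "tgt y = ob N (n - 1)"
      using spliced_factor[OF s E3[of "n - 1"], of ?w n] w0 n by auto
    have Q: "dff K N n \<bullet> x = \<delta> n \<oplus> y \<bullet> dff K X n"
      unfolding y A.add_commute[of "dff K N n \<bullet> x"] by (rule A.add_neg_cancel[symmetric]) simp_all
    have "(dff K N (n - 1) \<bullet> y \<oplus> \<ominus> (\<delta> (n - 1))) \<bullet> dff K X n = dff K N (n - 1) \<bullet> ?w \<oplus> dff K N (n - 1) \<bullet> \<delta> n"
      by (simp only: A.add_comp A.neg_comp A.comp_assoc y anti)
    also have "\<dots> = dff K N (n - 1) \<bullet> (\<delta> n \<oplus> (\<ominus> (\<delta> n) \<oplus> dff K N n \<bullet> x))"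
      by (simp only: A.add_commute A.comp_add)
    also have "\<dots> = dff K N (n - 1) \<bullet> dff K N n \<bullet> x"
      by (subst A.add_neg_cancel) simp_all
    finally have "A.nul ((dff K N (n - 1) \<bullet> y \<oplus> \<ominus> (\<delta> (n - 1))) \<bullet> dff K X n)"
      using A.nul_compL[OF dff_dff[OF N, of n], of x] by (simp add: A.comp_assoc)
    then show "\<exists>y. ?P' (n - 1) y \<and> ?Q' n x y" using Q by (intro exI[of _ y]) simp
  qed
  then obtain h where hu: "\<And>n. n \<ge> b \<Longrightarrow> ?P n (h n) \<and> ?Q n (h n) (h (n + 1))"
    and hd: "\<And>n. n \<le> b \<Longrightarrow> ?P' n (h n) \<and> ?Q' n (h n) (h (n - 1))" by blast
  have "?T n (h n) \<and> dff K N n \<bullet> h n = \<delta> n \<oplus> h (n - 1) \<bullet> dff K X n" for n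
  proof (cases "n \<le> b")
    case True
    then show ?thesis using hd[OF True] by blast
  next
    case False
    then show ?thesis using hu[of n] hu[of "n - 1"] by simp
  qed
  then show "\<exists>h. \<forall>n. harr K (h n) \<and> src (h n) = ob X n \<and> tgt (h n) = ob N n \<and>
        dff K N n \<bullet> h n = \<delta> n \<oplus> h (n - 1) \<bullet> dff K X n" by blast
qed

text \<open>The extension of the suspension \<open>SX\<close> that is split here is the mapping cone of \<open>g\<close>.\<close>

lemma ext0_null_homotopic:
  assumes SX: "SX \<in> Obj (Ch K)" and X: "X \<in> Obj (Ch K)" and N: "N \<in> Obj (Ch K)"
    and so: "\<And>n. ob SX n = ob X (n - 1)" and sd: "\<And>n. dff K SX n = \<ominus> (dff K X (n - 1))"
    and E: "Ch.A.ext0 SX N"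
    and g[simp]: "harr (Ch K) g" "src g = X" "tgt g = N"
  shows "\<exists>h. \<forall>n. harr K (h n) \<and> src (h n) = ob X n \<and> tgt (h n) = ob N (n + 1) \<and>
    cpt K n g = dff K N (n + 1) \<bullet> h n \<oplus> h (n - 1) \<bullet> dff K X n"
proof -
  note [simp] = dff_simps[OF X] dff_simps[OF N] so
  have "\<forall>n. \<exists>i j p q. A.biprod i j p q \<and> src i = ob N n \<and> src j = ob X (n - 1)" using A.ex_biprod N X by simp
  then obtain i j p q where b: "\<And>n. A.biprod (i n) (j n) (p n) (q n)" "\<And>n. src (i n) = ob N n" "\<And>n. src (j n) = ob X (n - 1)"
    by metis
  note bD = A.biprodD[OF b(1)]
  note [simp] = bD(1-11) b(2,3)
  \<comment> \<open>The cone differential: \<open>dff K N\<close> and \<open>g\<close> in the row of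
    N, minus \<open>dff K X\<close> (shifted) in the row of the suspension.\<close>
  let ?d = "\<lambda>n. i (n - 1) \<bullet> (dff K N n \<bullet> p n \<oplus> cpt K (n - 1) g \<bullet> q n) \<oplus> \<ominus> (j (n - 1) \<bullet> dff K X (n - 1) \<bullet> q n)"
  have d[simp]: "harr K (?d n)" "src (?d n) = tgt (i n)" "tgt (?d n) = tgt (i (n - 1))" for n by simp_all
  have pi: "p n \<bullet> i n \<bullet> u = u" if "harr K u" "tgt u = ob N n" for u n
    using that by (simp flip: A.comp_assoc)
  have qj: "q n \<bullet> j n \<bullet> v = v" if "harr K v" "tgt v = ob X (n - 1)" for v n
    using that by (simp flip: A.comp_assoc)
  have pj: "A.nul (p n \<bullet> j n \<bullet> v)" if "harr K v" "tgt v = ob X (n - 1)" for v n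
    using that A.nul_compL[OF bD(12), of v] by (simp add: A.comp_assoc)
  have qi: "A.nul (q n \<bullet> i n \<bullet> v)" if "harr K v" "tgt v = ob N n" for v n
    using that A.nul_compL[OF bD(13), of v] by (simp add: A.comp_assoc)
  have pd: "p (n - 1) \<bullet> ?d n = dff K N n \<bullet> p n \<oplus> cpt K (n - 1) g \<bullet> q n" for n
  proof -
    have "p (n - 1) \<bullet> ?d n = p (n - 1) \<bullet> i (n - 1) \<bullet> (dff K N n \<bullet> p n \<oplus> cpt K (n - 1) g \<bullet> q n) \<oplus>
        \<ominus> (p (n - 1) \<bullet> j (n - 1) \<bullet> dff K X (n - 1) \<bullet> q n)"
      by (simp only: A.comp_add A.comp_neg)
    also have "\<dots> = p (n - 1) \<bullet> i (n - 1) \<bullet> (dff K N n \<bullet> p n \<oplus> cpt K (n - 1) g \<bullet> q n)"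
      by (rule A.add_nul) (use pj[of "dff K X (n - 1) \<bullet> q n" "n - 1"] in simp_all)
    also have "\<dots> = dff K N n \<bullet> p n \<oplus> cpt K (n - 1) g \<bullet> q n" by (rule pi) simp_all
    finally show ?thesis .
  qed
  have qd: "q (n - 1) \<bullet> ?d n = \<ominus> (dff K X (n - 1) \<bullet> q n)" for n
  proof -
    have "q (n - 1) \<bullet> ?d n = q (n - 1) \<bullet> i (n - 1) \<bullet> (dff K N n \<bullet> p n \<oplus> cpt K (n - 1) g \<bullet> q n) \<oplus>
        \<ominus> (q (n - 1) \<bullet> j (n - 1) \<bullet> dff K X (n - 1) \<bullet> q n)"
      by (simp only: A.comp_add A.comp_neg)
    also have "\<dots> = \<ominus> (q (n - 1) \<bullet> j (n - 1) \<bullet> dff K X (n - 1) \<bullet> q n)"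
      by (rule A.nul_add) (use qi[of "dff K N n \<bullet> p n \<oplus> cpt K (n - 1) g \<bullet> q n" "n - 1"] in simp_all)
    also have "\<dots> = \<ominus> (dff K X (n - 1) \<bullet> q n)" by (subst qj) simp_all
    finally show ?thesis .
  qed
  have di: "?d n \<bullet> i n = i (n - 1) \<bullet> dff K N n" for n
  proof -
    have 1: "A.nul (i (n - 1) \<bullet> cpt K (n - 1) g \<bullet> q n \<bullet> i n)"
      using A.nul_compR[OF A.nul_compR[OF bD(13)[of n], of "cpt K (n - 1) g"], of "i (n - 1)"] by simp
    have 2: "A.nul (j (n - 1) \<bullet> dff K X (n - 1) \<bullet> q n \<bullet> i n)"
      using A.nul_compR[OF A.nul_compR[OF bD(13)[of n], of "dff K X (n - 1)"], of "j (n - 1)"] by simp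
    show ?thesis using 1 2 by (simp add: A.add_comp A.neg_comp A.comp_assoc A.comp_add A.add_nul)
  qed
  have cg: "cpt K (n - 1) g \<bullet> dff K X n = dff K N n \<bullet> cpt K n g" for n using cpt_dff[OF g(1), of n] by simp
  have dd: "A.nul (?d (n - 1) \<bullet> ?d n)" for n
  proof -
    let ?m = "n - 1"
    have 1: "A.nul (dff K N ?m \<bullet> dff K N n \<bullet> p n)"
      using A.nul_compL[OF dff_dff[OF N, of n], of "p n"] by (simp add: A.comp_assoc)
    have 2: "A.nul (dff K X (?m - 1) \<bullet> dff K X ?m \<bullet> q n)"
      using A.nul_compL[OF dff_dff[OF X, of ?m], of "q n"] by (simp add: A.comp_assoc)
    have 3: "cpt K (?m - 1) g \<bullet> dff K X ?m \<bullet> q n = dff K N ?m \<bullet> cpt K ?m g \<bullet> q n"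
      by (simp only: cg flip: A.comp_assoc)
    have 4: "A.nul ((dff K N ?m \<bullet> dff K N n \<bullet> p n \<oplus> dff K N ?m \<bullet> cpt K ?m g \<bullet> q n) \<oplus> \<ominus> (dff K N ?m \<bullet> cpt K ?m g \<bullet> q n))"
      using 1 by (simp add: A.nul_add)
    have "?d ?m \<bullet> ?d n = i (?m - 1) \<bullet> (dff K N ?m \<bullet> (p ?m \<bullet> ?d n) \<oplus> cpt K (?m - 1) g \<bullet> (q ?m \<bullet> ?d n)) \<oplus>
        \<ominus> (j (?m - 1) \<bullet> dff K X (?m - 1) \<bullet> (q ?m \<bullet> ?d n))"
      by (rule A.matrix_comp)
    also have "\<dots> = i (?m - 1) \<bullet> (dff K N ?m \<bullet> (dff K N n \<bullet> p n \<oplus> cpt K ?m g \<bullet> q n) \<oplus>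
        cpt K (?m - 1) g \<bullet> \<ominus> (dff K X ?m \<bullet> q n)) \<oplus> \<ominus> (j (?m - 1) \<bullet> dff K X (?m - 1) \<bullet> \<ominus> (dff K X ?m \<bullet> q n))"
      by (simp only: pd qd)
    also have "\<dots> = i (?m - 1) \<bullet> ((dff K N ?m \<bullet> dff K N n \<bullet> p n \<oplus> dff K N ?m \<bullet> cpt K ?m g \<bullet> q n) \<oplus> \<ominus> (dff K N ?m \<bullet> cpt K ?m g \<bullet> q n)) \<oplus>
        \<ominus> (\<ominus> (j (?m - 1) \<bullet> dff K X (?m - 1) \<bullet> dff K X ?m \<bullet> q n))"
      by (simp only: A.comp_add A.comp_neg 3)
    finally have e: "?d ?m \<bullet> ?d n = \<dots>" .
    show ?thesis
      unfolding e
    proof (rule A.nul_sum)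
      show "A.nul (i (?m - 1) \<bullet> ((dff K N ?m \<bullet> dff K N n \<bullet> p n \<oplus> dff K N ?m \<bullet> cpt K ?m g \<bullet> q n) \<oplus> \<ominus> (dff K N ?m \<bullet> cpt K ?m g \<bullet> q n)))"
        using A.nul_compR[OF 4, of "i (?m - 1)"] by simp
      show "A.nul (\<ominus> (\<ominus> (j (?m - 1) \<bullet> dff K X (?m - 1) \<bullet> dff K X ?m \<bullet> q n)))"
        using A.nul_compR[OF 2, of "j (?m - 1)"] by simp
    qed simp_all
  qed
  obtain P where P: "P \<in> Obj (Ch K)" "\<And>n. ob P n = tgt (i n)" "\<And>n. dff K P n = ?d n"
  proof (rule Ch_objI[of ?d])
    fix Y assume *: "Y \<in> Obj (Ch K)" "\<And>n. ob Y n = src (?d n)" "\<And>n. dff K Y n = ?d n"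
    show thesis by (rule that[OF *(1) _ *(3)]) (use *(2) d(2) in metis)
  next
    show "harr K (?d n)" "A.nul (?d (n - 1) \<bullet> ?d n)" for n by (fact d(1), fact dd)
    show "tgt (?d n) = src (?d (n - 1))" for n using d(2)[of "n - 1"] d(3)[of n] by simp
  qed
  obtain I where I: "harr (Ch K) I" "src I = N" "tgt I = P" "\<And>n. cpt K n I = i n"
  proof (rule Ch_arrI[OF N P(1), of i])
    show "i (n - 1) \<bullet> dff K N n = dff K P n \<bullet> i n" for n using di P(3) by simp
  qed (use P(2) in simp_all)
  obtain R where R: "harr (Ch K) R" "src R = P" "tgt R = SX" "\<And>n. cpt K n R = q n"
  proof (rule Ch_arrI[OF P(1) SX, of q])
    show "q (n - 1) \<bullet> dff K P n = dff K SX n \<bullet> q n" for n using qd P(3) by (simp add: sd A.neg_comp)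
  qed (use P(2) in simp_all)
  have "Ch.A.ses I R"
    using I(1) R(1) by (rule Ch_sesI) (use I R A.biprod_ses[OF b(1)] in simp_all)
  then obtain S where S: "R \<star> S = hidn (Ch K) SX" using E I R unfolding Ch.A.ext0_def by blast
  have "harr (Ch K) (R \<star> S)" "src (R \<star> S) = SX" unfolding S using SX by simp_all
  then have Sh: "harr (Ch K) S" "src S = SX" "tgt S = P" using R by auto
  have qS: "q n \<bullet> cpt K n S = hidn K (ob X (n - 1))" for n
    using cpt_cmp[of R S n] R Sh S SX by (simp add: cpt_idn)
  have cS[simp]: "harr K (cpt K n S)" "src (cpt K n S) = ob X (n - 1)" "tgt (cpt K n S) = tgt (i n)" for n
    using Sh P(2) by simp_all
  \<comment> \<open>The component of the section \<open>S\<close> in N. Compatibility of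
    \<open>S\<close> with the differentials, read in the row of N, is the homotopy identity for the
    negative of \<open>?k\<close>.\<close>
  let ?k = "\<lambda>n. p (n + 1) \<bullet> cpt K (n + 1) S"
  have main: "\<ominus> (?k (n - 1) \<bullet> dff K X n) = dff K N (n + 1) \<bullet> ?k n \<oplus> cpt K n g" for n
  proof -
    have "cpt K n S \<bullet> dff K SX (n + 1) = dff K P (n + 1) \<bullet> cpt K (n + 1) S"
      using cpt_dff[OF Sh(1), of "n + 1"] Sh by simp
    then have "\<ominus> (cpt K n S \<bullet> dff K X n) = ?d (n + 1) \<bullet> cpt K (n + 1) S"
      using P(3)[of "n + 1"] sd[of "n + 1"] by (simp add: A.comp_neg)
    then have "p n \<bullet> \<ominus> (cpt K n S \<bullet> dff K X n) = (p n \<bullet> ?d (n + 1)) \<bullet> cpt K (n + 1) S"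
      by (simp only: A.comp_assoc)
    also have "\<dots> = dff K N (n + 1) \<bullet> ?k n \<oplus> cpt K n g \<bullet> q (n + 1) \<bullet> cpt K (n + 1) S"
      using pd[of "n + 1"] by (simp add: A.add_comp A.comp_assoc)
    also have "\<dots> = dff K N (n + 1) \<bullet> ?k n \<oplus> cpt K n g" unfolding qS by simp
    finally show ?thesis by (simp add: A.comp_neg A.comp_assoc)
  qed
  have "cpt K n g = dff K N (n + 1) \<bullet> \<ominus> (?k n) \<oplus> \<ominus> (?k (n - 1)) \<bullet> dff K X n" for n
    unfolding A.neg_comp main A.comp_neg by (rule A.neg_add_cancel[symmetric]) simp_all
  then show ?thesis by (intro exI[of _ "\<lambda>n. \<ominus> (?k n)"]) simp
qed

end

section \<open>Cohomology of Hom complexes\<close>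

text \<open>The first isomorphism theorem for \<phi> followed by the quotient map, so \<phi> has to
  be onto only modulo \<open>N'\<close>.\<close>

lemma FactGroup_iso_of_hom:
  assumes G: "group G" and N': "N' \<lhd> G'" and \<phi>: "\<phi> \<in> hom G G'"
    and N: "N = {x \<in> carrier G. \<phi> x \<in> N'}"
    and surj: "\<And>y. y \<in> carrier G' \<Longrightarrow> \<exists>x\<in>carrier G. \<exists>n\<in>N'. y = n \<otimes>\<^bsub>G'\<^esub> \<phi> x"
  shows "G Mod N \<cong> G' Mod N'"
proof -
  interpret N': normal N' G' by (rule N')
  let ?h = "\<lambda>x. N' #>\<^bsub>G'\<^esub> \<phi> x"
  have \<phi>c: "\<phi> x \<in> carrier G'" if "x \<in> carrier G" for x using \<phi> that by (rule hom_in_carrier)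
  have "?h \<in> hom G (G' Mod N')"
    using hom_compose[OF \<phi> N'.r_coset_hom_Mod] by (simp add: comp_def)
  then have gh: "group_hom G (G' Mod N') ?h"
    using G N'.factorgroup_is_group by (simp add: group_hom_def group_hom_axioms_def)
  have "kernel G (G' Mod N') ?h = N"
    unfolding kernel_def N
    using N'.coset_join1[OF _ \<phi>c N'.subgroup_axioms] N'.coset_join2[OF \<phi>c N'.subgroup_axioms] by auto
  moreover have "?h ` carrier G = carrier (G' Mod N')"
  proof
    show "?h ` carrier G \<subseteq> carrier (G' Mod N')" using \<phi>c by (auto simp: FactGroup_def RCOSETS_def)
    show "carrier (G' Mod N') \<subseteq> ?h ` carrier G"
    proof
      fix c assume "c \<in> carrier (G' Mod N')"
      then obtain y where y: "y \<in> carrier G'" "c = N' #>\<^bsub>G'\<^esub> y" by (auto simp: FactGroup_def RCOSETS_def)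
      obtain x n where x: "x \<in> carrier G" "n \<in> N'" "y = n \<otimes>\<^bsub>G'\<^esub> \<phi> x" using surj[OF y(1)] by blast
      have n: "n \<in> carrier G'" using x(2) N'.subset by blast
      have "c = (N' #>\<^bsub>G'\<^esub> n) #>\<^bsub>G'\<^esub> \<phi> x"
        unfolding y(2) x(3) by (rule N'.coset_mult_assoc[symmetric]) (use N'.subset n \<phi>c x in auto)
      also have "N' #>\<^bsub>G'\<^esub> n = N'" using N'.coset_join2[OF n N'.subgroup_axioms x(2)] .
      finally show "c \<in> ?h ` carrier G" using x(1) by blast
    qed
  qed
  ultimately show ?thesis using group_hom.FactGroup_iso[OF gh] by simp
qed

section \<open>Cocycles, coboundaries and maps between cohomology groups\<close>

context abelian_category begin

interpretation Ch: abelian_category "Ch K" by (rule Ch_abelian)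

definition cocycle where
  "cocycle W B n f \<longleftrightarrow> tgt f = B \<and> A.nul (f \<bullet> dff K W (n + 1))"

definition coboundary where
  "coboundary W B n f \<longleftrightarrow> harr K f \<and> tgt f = B \<and> (\<exists>g. g \<bullet> dff K W n = f)"

lemma cocycleD:
  assumes "W \<in> Obj (Ch K)" "cocycle W B n f"
  shows "harr K f" "src f = ob W n" "tgt f = B" "A.nul (f \<bullet> dff K W (n + 1))"
proof -
  show *: "tgt f = B" "A.nul (f \<bullet> dff K W (n + 1))" using assms(2) by (auto simp: cocycle_def)
  show "harr K f" "src f = ob W n" using A.nul_arr[OF *(2)] dff_simps[OF assms(1), of "n + 1"] by auto
qed

lemma coboundaryD:
  assumes "W \<in> Obj (Ch K)" "coboundary W B n f"
  shows "harr K f" "src f = ob W n" "tgt f = B"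
    and "\<exists>g. g \<bullet> dff K W n = f \<and> harr K g \<and> src g = ob W (n - 1) \<and> tgt g = B"
proof -
  obtain g where g: "harr K f" "tgt f = B" "g \<bullet> dff K W n = f" using assms(2) by (auto simp: coboundary_def)
  have "harr K (g \<bullet> dff K W n)" "tgt (g \<bullet> dff K W n) = B" unfolding g(3) by fact+
  then have h: "harr K g" "src g = ob W (n - 1)" "tgt g = B" using dff_simps[OF assms(1), of n] by auto
  then show "\<exists>g. g \<bullet> dff K W n = f \<and> harr K g \<and> src g = ob W (n - 1) \<and> tgt g = B" using g by blast
  show "harr K f" "tgt f = B" by fact+
  have "src (g \<bullet> dff K W n) = ob W n" using h dff_simps[OF assms(1), of n] by simp
  then show "src f = ob W n" by (simp only: g(3))
qed

lemma coboundary_cocycle: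
  assumes W: "W \<in> Obj (Ch K)" and "coboundary W B n f"
  shows "cocycle W B n f"
proof -
  obtain g where g: "g \<bullet> dff K W n = f" "harr K g" "src g = ob W (n - 1)" "tgt g = B"
    using coboundaryD(4)[OF assms] by blast
  have "A.nul (g \<bullet> dff K W n \<bullet> dff K W (n + 1))"
    using A.nul_compR[OF dff_dff'[OF W, of n], of g] g dff_simps[OF W] by simp
  then have "A.nul (f \<bullet> dff K W (n + 1))" by (simp add: g(1) flip: A.comp_assoc)
  then show ?thesis using coboundaryD(3)[OF assms] by (simp add: cocycle_def)
qed

text \<open>The numerator in \<open>Hom_cohomology\<close>, written so that unfolding both
  definitions gives a literal quotient of this group.\<close>

definition cocycle_group where
  "cocycle_group W B n = (hom_group K (ob W n) B)\<lparr>carrier :=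
        {f \<in> Mor K (ob W n) B. f \<cdot> dif W (n + 1) = Zer K (ob W (n + 1)) B}\<rparr>"

lemma cocycle_group_carrier:
  assumes W: "W \<in> Obj (Ch K)" and B: "B \<in> Obj K"
  shows "f \<in> carrier (cocycle_group W B n) \<longleftrightarrow> harr K (hm K (ob W n) f B) \<and> cocycle W B n (hm K (ob W n) f B)"
proof (cases "harr K (hm K (ob W n) f B)")
  case True
  then have f: "f \<in> Mor K (ob W n) B" by (simp add: harr_hm)
  have d: "harr K (hm K (ob W (n + 1)) (dif W (n + 1)) (ob W n))" using dff_simps(1)[OF W, of "n + 1"] by (simp only: dff_hm)
  have "hm K (ob W n) f B \<bullet> dff K W (n + 1) = hm K (ob W (n + 1)) (f \<cdot> dif W (n + 1)) B"
    unfolding dff_hm using hm_Cmp[OF d True] .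
  then have "cocycle W B n (hm K (ob W n) f B) \<longleftrightarrow> f \<cdot> dif W (n + 1) = Zer K (ob W (n + 1)) B"
    unfolding cocycle_def using True W B by (simp add: nul_hm)
  then show ?thesis using True f by (simp add: cocycle_group_def)
next
  case False
  then have "f \<notin> Mor K (ob W n) B" using W B by (simp add: harr_hm)
  then show ?thesis using False by (simp add: cocycle_group_def)
qed

lemma coboundaries_iff:
  assumes W: "W \<in> Obj (Ch K)" and B: "B \<in> Obj K"
  shows "f \<in> {g \<cdot> dif W n | g. g \<in> Mor K (ob W (n - 1)) B} \<longleftrightarrow>
    harr K (hm K (ob W n) f B) \<and> coboundary W B n (hm K (ob W n) f B)"
proof -
  have d: "harr K (hm K (ob W n) (dif W n) (ob W (n - 1)))" using dff_simps(1)[OF W, of n] by (simp only: dff_def)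
  have c: "hm K (ob W (n - 1)) g B \<bullet> dff K W n = hm K (ob W n) (g \<cdot> dif W n) B"
    if "g \<in> Mor K (ob W (n - 1)) B" for g
    unfolding dff_def using hm_Cmp[OF d] that W B by (simp add: harr_hm)
  have m: "g \<cdot> dif W n \<in> Mor K (ob W n) B" if "g \<in> Mor K (ob W (n - 1)) B" for g
    using that d W B Cmp_Mor[of "ob W n" "ob W (n - 1)" B] by (simp add: harr_hm)
  show ?thesis
  proof
    assume "f \<in> {g \<cdot> dif W n | g. g \<in> Mor K (ob W (n - 1)) B}"
    then obtain g where g: "g \<in> Mor K (ob W (n - 1)) B" "f = g \<cdot> dif W n" by blast
    have "harr K (hm K (ob W n) f B)" using m[OF g(1)] g W B by (simp add: harr_hm)
    then show "harr K (hm K (ob W n) f B) \<and> coboundary W B n (hm K (ob W n) f B)"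
      unfolding coboundary_def using c[OF g(1)] g(2) by auto
  next
    assume h: "harr K (hm K (ob W n) f B) \<and> coboundary W B n (hm K (ob W n) f B)"
    then obtain g where g: "g \<bullet> dff K W n = hm K (ob W n) f B" "harr K g" "src g = ob W (n - 1)" "tgt g = B"
      using coboundaryD(4)[OF W] by blast
    have e: "hm K (ob W (n - 1)) (mor g) B = g" using g hm_eta[of g] by simp
    have mg: "mor g \<in> Mor K (ob W (n - 1)) B" using harrD(3)[OF g(2)] g by simp
    have "f = mor g \<cdot> dif W n"
      using c[OF mg] g(1) e h hm_eqD by metis
    then show "f \<in> {g \<cdot> dif W n | g. g \<in> Mor K (ob W (n - 1)) B}" using mg by blast
  qed
qed

lemma cocycle_add:
  assumes W: "W \<in> Obj (Ch K)" and "cocycle W B n f" "cocycle W B n g"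
  shows "cocycle W B n (f \<oplus> g)" "cocycle W B n (\<ominus> f)"
proof -
  note [simp] = cocycleD(1-3)[OF W assms(2)] cocycleD(1-3)[OF W assms(3)]
  have "A.nul (f \<bullet> dff K W (n + 1))" "A.nul (g \<bullet> dff K W (n + 1))" using assms(2,3) by (auto simp: cocycle_def)
  then show "cocycle W B n (f \<oplus> g)" "cocycle W B n (\<ominus> f)"
    using dff_simps[OF W, of "n + 1"] by (simp_all add: cocycle_def A.add_comp A.neg_comp A.nul_add)
qed

lemma coboundary_add:
  assumes W: "W \<in> Obj (Ch K)" and "coboundary W B n f" "coboundary W B n g"
  shows "coboundary W B n (f \<oplus> g)" "coboundary W B n (\<ominus> f)"
proof -
  note [simp] = coboundaryD(1-3)[OF W assms(2)] coboundaryD(1-3)[OF W assms(3)]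
  obtain a b where ab: "a \<bullet> dff K W n = f" "b \<bullet> dff K W n = g"
    using assms(2,3) by (auto simp: coboundary_def)
  have "(a \<oplus> b) \<bullet> dff K W n = f \<oplus> g" by (simp only: A.add_comp ab)
  then show "coboundary W B n (f \<oplus> g)" unfolding coboundary_def by (intro conjI exI) simp_all
  have "\<ominus> a \<bullet> dff K W n = \<ominus> f" by (simp only: A.neg_comp ab)
  then show "coboundary W B n (\<ominus> f)" unfolding coboundary_def by (intro conjI exI) simp_all
qed

lemma cocycle_group_comm:
  assumes W: "W \<in> Obj (Ch K)" and B: "B \<in> Obj K"
  shows "comm_group (cocycle_group W B n)"
    "subgroup {g \<cdot> dif W n | g. g \<in> Mor K (ob W (n - 1)) B} (cocycle_group W B n)"
proof -
  let ?H = "hom_group K (ob W n) B" and ?Z = "carrier (cocycle_group W B n)"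
  let ?N = "{g \<cdot> dif W n | g. g \<in> Mor K (ob W (n - 1)) B}"
  have H: "comm_group ?H" using W B by (intro Mor_group) simp_all
  then interpret H: comm_group ?H .
  have z: "?Z \<subseteq> carrier ?H" by (auto simp: cocycle_group_def hom_group_def)
  have hH: "harr K (hm K (ob W n) f B) \<longleftrightarrow> f \<in> carrier ?H" for f using W B by (simp add: harr_hm hom_group_def)
  have ad: "hm K (ob W n) (f \<otimes>\<^bsub>?H\<^esub> g) B = hm K (ob W n) f B \<oplus> hm K (ob W n) g B"
    if "f \<in> carrier ?H" "g \<in> carrier ?H" for f g
    using hm_Pls[of "ob W n" f B g] that hH by (simp add: hom_group_def)
  have ng: "hm K (ob W n) (inv\<^bsub>?H\<^esub> f) B = \<ominus> (hm K (ob W n) f B)" if "f \<in> carrier ?H" for f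
  proof -
    have "f \<in> Mor K (ob W n) B" "ob W n \<in> Obj K" using that W by (auto simp: hom_group_def)
    then show ?thesis using B inv_Mor by (simp add: hm_def hneg_Some)
  qed
  have nz: "A.nul (hm K (ob W n) \<one>\<^bsub>?H\<^esub> B)" using W B by (simp add: nul_hm hom_group_def)
  have zero: "cocycle W B n (hm K (ob W n) \<one>\<^bsub>?H\<^esub> B)" "coboundary W B n (hm K (ob W n) \<one>\<^bsub>?H\<^esub> B)"
  proof -
    obtain y where y: "A.nul y" "src y = ob W (n - 1)" "tgt y = B" using A.ex_nul[of "ob W (n - 1)" B] W B by auto
    have "y \<bullet> dff K W n = hm K (ob W n) \<one>\<^bsub>?H\<^esub> B"
      by (rule A.nul_eq) (use y nz W A.nul_arr[OF nz] in \<open>simp_all add: A.nul_compL\<close>)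
    then show c: "coboundary W B n (hm K (ob W n) \<one>\<^bsub>?H\<^esub> B)"
      unfolding coboundary_def using A.nul_arr[OF nz] by auto
    show "cocycle W B n (hm K (ob W n) \<one>\<^bsub>?H\<^esub> B)" using W c by (rule coboundary_cocycle)
  qed
  have sZ: "subgroup ?Z ?H"
  proof (rule subgroup.intro)
    show "\<one>\<^bsub>?H\<^esub> \<in> ?Z" unfolding cocycle_group_carrier[OF W B] using zero(1) nz by simp
    fix x assume x: "x \<in> ?Z"
    then have xH: "x \<in> carrier ?H" using z by blast
    show "inv\<^bsub>?H\<^esub> x \<in> ?Z"
      using x xH cocycle_add(2)[OF W] unfolding cocycle_group_carrier[OF W B] hH by (auto simp: ng)
    fix y assume y: "y \<in> ?Z"
    then have yH: "y \<in> carrier ?H" using z by blast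
    show "x \<otimes>\<^bsub>?H\<^esub> y \<in> ?Z"
      using x y xH yH cocycle_add(1)[OF W] unfolding cocycle_group_carrier[OF W B] hH by (auto simp: ad)
  qed (rule z)
  have e: "cocycle_group W B n = ?H\<lparr>carrier := ?Z\<rparr>" by (simp add: cocycle_group_def)
  have nH: "?N \<subseteq> carrier ?H" unfolding subset_iff coboundaries_iff[OF W B] hH by blast
  have sN: "subgroup ?N ?H"
  proof (rule subgroup.intro)
    show "\<one>\<^bsub>?H\<^esub> \<in> ?N" unfolding coboundaries_iff[OF W B] using zero(2) nz by simp
    fix x assume x: "x \<in> ?N"
    then have xH: "x \<in> carrier ?H" using nH by blast
    show "inv\<^bsub>?H\<^esub> x \<in> ?N"
      using x xH coboundary_add(2)[OF W] unfolding coboundaries_iff[OF W B] hH by (auto simp: ng)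
    fix y assume y: "y \<in> ?N"
    then have yH: "y \<in> carrier ?H" using nH by blast
    show "x \<otimes>\<^bsub>?H\<^esub> y \<in> ?N"
      using x y xH yH coboundary_add(1)[OF W] unfolding coboundaries_iff[OF W B] hH by (auto simp: ad)
  qed (rule nH)
  have NZ: "?N \<subseteq> ?Z"
    unfolding subset_iff coboundaries_iff[OF W B] cocycle_group_carrier[OF W B] using coboundary_cocycle[OF W] by blast
  have "comm_group (?H\<lparr>carrier := ?Z\<rparr>)"
  proof (rule group.group_comm_groupI)
    show "group (?H\<lparr>carrier := ?Z\<rparr>)" using sZ H.group_axioms by (rule subgroup.subgroup_is_group)
    show "x \<otimes>\<^bsub>?H\<lparr>carrier := ?Z\<rparr>\<^esub> y = y \<otimes>\<^bsub>?H\<lparr>carrier := ?Z\<rparr>\<^esub> x"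
      if "x \<in> carrier (?H\<lparr>carrier := ?Z\<rparr>)" "y \<in> carrier (?H\<lparr>carrier := ?Z\<rparr>)" for x y
    proof -
      have "x \<in> carrier ?H" "y \<in> carrier ?H" using that z by auto
      then show ?thesis using H.m_comm by simp
    qed
  qed
  then show "comm_group (cocycle_group W B n)" by (subst e)
  have "subgroup ?N (?H\<lparr>carrier := ?Z\<rparr>)" using sN sZ NZ by (rule H.subgroup_incl)
  then show "subgroup ?N (cocycle_group W B n)" by (subst e)
qed

text \<open>Used in place of an explicit inverse on cohomology. The equivalence \<open>T_inj\<close>
  covers both well-definedness and injectivity, and corrections by coboundaries are allowed in
  \<open>T_surj\<close>.\<close>

lemma Hom_cohomology_iso:
  assumes W: "W \<in> Obj (Ch K)" "W' \<in> Obj (Ch K)" and B: "B \<in> Obj K" "B' \<in> Obj K"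
    and T: "\<And>f. cocycle W B n f \<Longrightarrow> cocycle W' B' n (T f)"
    and T_add: "\<And>f g. \<lbrakk>cocycle W B n f; cocycle W B n g\<rbrakk> \<Longrightarrow> T (f \<oplus> g) = T f \<oplus> T g"
    and T_inj: "\<And>f. cocycle W B n f \<Longrightarrow> coboundary W' B' n (T f) \<longleftrightarrow> coboundary W B n f"
    and T_surj: "\<And>f'. cocycle W' B' n f' \<Longrightarrow> \<exists>f c. cocycle W B n f \<and> coboundary W' B' n c \<and> f' = c \<oplus> T f"
  shows "Hom_cohomology K W B n \<cong> Hom_cohomology K W' B' n"
proof -
  let ?G = "cocycle_group W B n" and ?G' = "cocycle_group W' B' n"
  let ?N = "{g \<cdot> dif W n | g. g \<in> Mor K (ob W (n - 1)) B}" and ?N' = "{g \<cdot> dif W' n | g. g \<in> Mor K (ob W' (n - 1)) B'}"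
  let ?\<phi> = "\<lambda>f. mor (T (hm K (ob W n) f B))"
  interpret G: comm_group ?G using cocycle_group_comm(1)[OF W(1) B(1)] .
  interpret G': comm_group ?G' using cocycle_group_comm(1)[OF W(2) B(2)] .
  note cG = cocycle_group_carrier[OF W(1) B(1)] and cG' = cocycle_group_carrier[OF W(2) B(2)]
  note cN = coboundaries_iff[OF W(1) B(1)] and cN' = coboundaries_iff[OF W(2) B(2)]
  have e: "hm K (ob W' n) (?\<phi> f) B' = T (hm K (ob W n) f B)" "cocycle W B n (hm K (ob W n) f B)"
    "cocycle W' B' n (T (hm K (ob W n) f B))" "harr K (hm K (ob W n) f B)" if "f \<in> carrier ?G" for f
  proof -
    show "cocycle W B n (hm K (ob W n) f B)" "harr K (hm K (ob W n) f B)" using that cG by blast+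
    then show c: "cocycle W' B' n (T (hm K (ob W n) f B))" using T by blast
    show "hm K (ob W' n) (?\<phi> f) B' = T (hm K (ob W n) f B)"
      using cocycleD[OF W(2) c] hm_eta by metis
  qed
  have m: "x \<otimes>\<^bsub>?G\<^esub> y = Pls K x y" "x' \<otimes>\<^bsub>?G'\<^esub> y' = Pls K x' y'" for x y x' y'
    by (simp_all add: cocycle_group_def hom_group_def)
  have ad': "hm K (ob W' n) (x \<otimes>\<^bsub>?G'\<^esub> y) B' = hm K (ob W' n) x B' \<oplus> hm K (ob W' n) y B'"
    if "x \<in> carrier ?G'" "y \<in> carrier ?G'" for x y
    unfolding m using that cG' hm_Pls by metis
  have "?G Mod ?N \<cong> ?G' Mod ?N'"
  proof (rule FactGroup_iso_of_hom)
    show "group ?G" by (rule G.group_axioms)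
    show "?N' \<lhd> ?G'" using cocycle_group_comm(2)[OF W(2) B(2)] by (rule G'.subgroup_imp_normal)
    have c: "?\<phi> x \<in> carrier ?G'" if "x \<in> carrier ?G" for x
      unfolding cG' e(1)[OF that] using e(3)[OF that] cocycleD[OF W(2)] by blast
    show "?\<phi> \<in> hom ?G ?G'"
    proof (rule homI)
      fix x y assume xy: "x \<in> carrier ?G" "y \<in> carrier ?G"
      have "hm K (ob W n) (x \<otimes>\<^bsub>?G\<^esub> y) B = hm K (ob W n) x B \<oplus> hm K (ob W n) y B"
        unfolding m using xy e(4) hm_Pls by metis
      then have "hm K (ob W' n) (?\<phi> (x \<otimes>\<^bsub>?G\<^esub> y)) B' = hm K (ob W' n) (?\<phi> x \<otimes>\<^bsub>?G'\<^esub> ?\<phi> y) B'"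
        using ad'[OF c c] e[OF G.m_closed[OF xy]] e[OF xy(1)] e[OF xy(2)] xy T_add by simp
      then show "?\<phi> (x \<otimes>\<^bsub>?G\<^esub> y) = ?\<phi> x \<otimes>\<^bsub>?G'\<^esub> ?\<phi> y"
        using hm_eqD c[OF G.m_closed[OF xy]] cG' by blast
    qed (rule c)
    have "x \<in> ?N \<longleftrightarrow> x \<in> carrier ?G \<and> ?\<phi> x \<in> ?N'" for x
    proof (cases "x \<in> carrier ?G")
      case True
      then show ?thesis unfolding cN cN' e(1)[OF True] using e[OF True] T_inj cocycleD[OF W(2)] by blast
    next
      case False
      then show ?thesis unfolding cN using cG coboundary_cocycle[OF W(1)] by blast
    qed
    then show "?N = {x \<in> carrier ?G. ?\<phi> x \<in> ?N'}" by blast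
    fix y assume y: "y \<in> carrier ?G'"
    then have y': "harr K (hm K (ob W' n) y B')" "cocycle W' B' n (hm K (ob W' n) y B')" using cG' by blast+
    obtain f b where f: "cocycle W B n f" "coboundary W' B' n b" "hm K (ob W' n) y B' = b \<oplus> T f"
      using T_surj[OF y'(2)] by blast
    have f': "hm K (ob W n) (mor f) B = f" "hm K (ob W' n) (mor b) B' = b"
      using cocycleD[OF W(1) f(1)] coboundaryD[OF W(2) f(2)] hm_eta by metis+
    have x: "mor f \<in> carrier ?G" unfolding cG f' using f(1) cocycleD[OF W(1)] by blast
    have bN: "mor b \<in> ?N'" unfolding cN' f' using f(2) coboundaryD[OF W(2)] by blast
    have bG: "mor b \<in> carrier ?G'" unfolding cG' f' using coboundary_cocycle[OF W(2) f(2)] coboundaryD(1)[OF W(2) f(2)] by blast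
    have "hm K (ob W' n) (mor b \<otimes>\<^bsub>?G'\<^esub> ?\<phi> (mor f)) B' = b \<oplus> T f"
      using ad'[OF bG c[OF x]] e(1)[OF x] f' by simp
    then have "y = mor b \<otimes>\<^bsub>?G'\<^esub> ?\<phi> (mor f)" using hm_eqD y'(1) f(3) by metis
    then show "\<exists>x\<in>carrier ?G. \<exists>n\<in>?N'. y = n \<otimes>\<^bsub>?G'\<^esub> ?\<phi> x" using x bN by blast
  qed
  then show ?thesis by (simp add: Hom_cohomology_def cocycle_group_def)
qed

text \<open>A cocycle \<open>f\<close> kills \<open>dff K X (n + 1)\<close>, so of the two terms of
  the homotopy only \<open>h (n - 1)\<close> after the differential survives. The homotopy identity
  enters in degree n alone.\<close>

lemma homotopy_cocycle:
  assumes X: "X \<in> Obj (Ch K)"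
    and w: "harr K w" "src w = ob X n" "tgt w = ob X n"
    and h: "\<And>n. harr K (h n)" "\<And>n. src (h n) = ob X n" "\<And>n. tgt (h n) = ob X (n + 1)"
    "w \<oplus> \<ominus> (hidn K (ob X n)) = dff K X (n + 1) \<bullet> h n \<oplus> h (n - 1) \<bullet> dff K X n"
    and f: "cocycle X B n f"
  shows "coboundary X B n (f \<bullet> w \<oplus> \<ominus> f)"
proof -
  note [simp] = dff_simps[OF X] w h(1-3) cocycleD(1-3)[OF X f]
  have "f \<bullet> w \<oplus> \<ominus> f = f \<bullet> (w \<oplus> \<ominus> (hidn K (ob X n)))"
    using X by (simp add: A.comp_add A.comp_neg)
  also have "\<dots> = f \<bullet> dff K X (n + 1) \<bullet> h n \<oplus> f \<bullet> h (n - 1) \<bullet> dff K X n"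
    by (simp only: h(4) A.comp_add)
  also have "\<dots> = (f \<bullet> h (n - 1)) \<bullet> dff K X n"
  proof -
    have "A.nul (f \<bullet> dff K X (n + 1) \<bullet> h n)"
      using A.nul_compL[OF cocycleD(4)[OF X f], of "h n"] by (simp add: A.comp_assoc)
    then show ?thesis using h(3)[of "n - 1"] by (simp add: A.nul_add A.comp_assoc)
  qed
  finally have e: "(f \<bullet> h (n - 1)) \<bullet> dff K X n = f \<bullet> w \<oplus> \<ominus> f" by (rule sym)
  show ?thesis unfolding coboundary_def using e by auto
qed

lemma cocycle_chain_map:
  assumes u[simp]: "harr (Ch K) u"
  shows "cocycle (tgt u) B n f \<Longrightarrow> cocycle (src u) B n (f \<bullet> cpt K n u)"
    "coboundary (tgt u) B n f \<Longrightarrow> coboundary (src u) B n (f \<bullet> cpt K n u)"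
proof -
  have O: "src u \<in> Obj (Ch K)" "tgt u \<in> Obj (Ch K)" by simp_all
  note [simp] = dff_simps[OF O(1)] dff_simps[OF O(2)]
  { assume f: "cocycle (tgt u) B n f"
    note [simp] = cocycleD(1-3)[OF O(2) f]
    have "(f \<bullet> cpt K n u) \<bullet> dff K (src u) (n + 1) = (f \<bullet> dff K (tgt u) (n + 1)) \<bullet> cpt K (n + 1) u"
      using cpt_dff[OF u, of "n + 1"] by (simp add: A.comp_assoc)
    then show "cocycle (src u) B n (f \<bullet> cpt K n u)"
      using A.nul_compL[OF cocycleD(4)[OF O(2) f], of "cpt K (n + 1) u"] by (simp add: cocycle_def) }
  { assume f: "coboundary (tgt u) B n f"
    note [simp] = coboundaryD(1-3)[OF O(2) f]
    obtain g where g: "g \<bullet> dff K (tgt u) n = f" using coboundaryD(4)[OF O(2) f] by blast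
    have "(g \<bullet> cpt K (n - 1) u) \<bullet> dff K (src u) n = f \<bullet> cpt K n u"
      by (simp add: A.comp_assoc cpt_dff flip: g)
    then show "coboundary (src u) B n (f \<bullet> cpt K n u)"
      unfolding coboundary_def by auto }
qed

section \<open>Cotorsion pairs\<close>

lemma cotorsion_Obj:
  assumes "cotorsion_pair K \<X> \<Y>"
  shows "\<X> \<subseteq> Obj K" "\<Y> \<subseteq> Obj K"
proof -
  have "left_perp K \<Y> = \<X>" "right_perp K \<X> = \<Y>" using assms unfolding cotorsion_pair_def by blast+
  moreover have "left_perp K \<Y> \<subseteq> Obj K" "right_perp K \<X> \<subseteq> Obj K"
    unfolding left_perp_def right_perp_def by blast+
  ultimately show "\<X> \<subseteq> Obj K" "\<Y> \<subseteq> Obj K" by simp_all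
qed

lemma cotorsion_left:
  assumes "cotorsion_pair K \<X> \<Y>"
  shows "X \<in> \<X> \<longleftrightarrow> X \<in> Obj K \<and> (\<forall>Y\<in>\<Y>. A.ext0 X Y)"
proof -
  have "left_perp K \<Y> = \<X>" using assms unfolding cotorsion_pair_def by blast
  then have "X \<in> \<X> \<longleftrightarrow> X \<in> left_perp K \<Y>" by simp
  also have "\<dots> \<longleftrightarrow> X \<in> Obj K \<and> (\<forall>Y\<in>\<Y>. Ext_zero K 1 X Y)" by (simp add: left_perp_def)
  finally show ?thesis using cotorsion_Obj[OF assms] Ext_zero_iff_ext0 by blast
qed

lemma cotorsion_right:
  assumes "cotorsion_pair K \<X> \<Y>"
  shows "Y \<in> \<Y> \<longleftrightarrow> Y \<in> Obj K \<and> (\<forall>X\<in>\<X>. A.ext0 X Y)"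
proof -
  have "right_perp K \<X> = \<Y>" using assms unfolding cotorsion_pair_def by blast
  then have "Y \<in> \<Y> \<longleftrightarrow> Y \<in> right_perp K \<X>" by simp
  also have "\<dots> \<longleftrightarrow> Y \<in> Obj K \<and> (\<forall>X\<in>\<X>. Ext_zero K 1 X Y)" by (simp add: right_perp_def)
  finally show ?thesis using cotorsion_Obj[OF assms] Ext_zero_iff_ext0 by blast
qed

lemma cotorsion_ext0: "\<lbrakk>cotorsion_pair K \<X> \<Y>; X \<in> \<X>; Y \<in> \<Y>\<rbrakk> \<Longrightarrow> A.ext0 X Y"
  using cotorsion_left by blast

section \<open>Closure properties of cotorsion pairs and thick classes\<close>

lemma ses_Obj:
  assumes "A.ses a b"
  shows "src a \<in> Obj K" "tgt a \<in> Obj K" "tgt b \<in> Obj K" "src b = tgt a"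
  using A.sesD(1-4)[OF assms] harrD by blast+

lemma cotorsion_left_ext:
  "\<lbrakk>cotorsion_pair K \<X> \<Y>; A.ses a b; src a \<in> \<X>; tgt b \<in> \<X>\<rbrakk> \<Longrightarrow> tgt a \<in> \<X>"
  using A.ext0_middle_left[of a b] ses_Obj(2,4)[of a b] unfolding cotorsion_left by metis

lemma cotorsion_right_ext:
  "\<lbrakk>cotorsion_pair K \<X> \<Y>; A.ses a b; src a \<in> \<Y>; tgt b \<in> \<Y>\<rbrakk> \<Longrightarrow> tgt a \<in> \<Y>"
  using A.ext0_middle_right[of a b] ses_Obj(2)[of a b] unfolding cotorsion_right by blast

lemma cotorsion_zero:
  assumes "cotorsion_pair K \<X> \<Y>" "A.nul (hidn K Z)"
  shows "Z \<in> \<X>" "Z \<in> \<Y>"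
proof -
  have "Z \<in> Obj K" using A.nul_arr[OF assms(2)] by simp
  then show "Z \<in> \<X>" "Z \<in> \<Y>"
    unfolding cotorsion_left[OF assms(1)] cotorsion_right[OF assms(1)]
    using A.ext0_zero_left[OF assms(2)] A.ext0_zero_right[OF assms(2)] by blast+
qed

lemma cotorsion_iso_closed:
  assumes c: "cotorsion_pair K \<X> \<Y>"
  shows "iso_closed \<X>" "iso_closed \<Y>"
proof -
  show "iso_closed \<Y>"
    unfolding iso_closed_def cotorsion_right[OF c]
  proof (intro allI impI conjI ballI)
    fix u v X assume a: "harr K u \<and> u \<bullet> v = hidn K (tgt u) \<and> v \<bullet> u = hidn K (src u) \<and>
      src u \<in> Obj K \<and> (\<forall>X\<in>\<X>. A.ext0 X (src u))"
    show "tgt u \<in> Obj K" using a harrD(2) by blast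
    assume "X \<in> \<X>"
    then show "A.ext0 X (tgt u)" using A.ext0_iso_right[of X u v] a by simp
  qed
  have *: "A.ext0 (tgt u) Y" if "harr K u" "u \<bullet> v = hidn K (tgt u)" "v \<bullet> u = hidn K (src u)" "A.ext0 (src u) Y" for u v Y
  proof -
    have "harr K (v \<bullet> u)" "harr K (u \<bullet> v)" unfolding that using that(1) harrD(1,2) by auto
    then have "harr K v" "src v = tgt u" "tgt v = src u" by auto
    then show ?thesis using A.ext0_iso_left[of v Y u] that by simp
  qed
  then show "iso_closed \<X>"
    unfolding iso_closed_def cotorsion_left[OF c]
  proof (intro allI impI conjI ballI)
    fix u v Y assume a: "harr K u \<and> u \<bullet> v = hidn K (tgt u) \<and> v \<bullet> u = hidn K (src u) \<and>
      src u \<in> Obj K \<and> (\<forall>Y\<in>\<Y>. A.ext0 (src u) Y)"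
    show "tgt u \<in> Obj K" using a harrD(2) by blast
    assume "Y \<in> \<Y>"
    then show "A.ext0 (tgt u) Y" using * a by blast
  qed
qed

text \<open>Dimension shift \<open>ext0_ker\<close>: orthogonality of \<open>tgt q\<close> to the
  right class in degree 2 and of \<open>src q\<close> in degree 1 gives that of the kernel in degree
  1.\<close>

lemma hereditary_ker:
  assumes c: "cotorsion_pair K \<X> \<Y>" and h: "hereditary_pair K \<X> \<Y>"
    and s: "A.ses k q" "tgt q \<in> \<X>" "src q \<in> \<X>"
  shows "src k \<in> \<X>"
  unfolding cotorsion_left[OF c]
proof (intro conjI ballI)
  show "src k \<in> Obj K" using s(1) by (rule ses_Obj)
  fix Y assume Y: "Y \<in> \<Y>"
  have "Ext_zero K 2 (tgt q) Y" using h s(2) Y by (auto simp: hereditary_pair_def)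
  then have "A.ext2 (tgt q) Y" using Ext_zero_2 ses_Obj(3)[OF s(1)] Y cotorsion_Obj[OF c] by blast
  then show "A.ext0 (src k) Y" using A.ext0_ker[OF s(1)] cotorsion_ext0[OF c s(3) Y] by blast
qed

lemma hereditary_coker:
  assumes c: "cotorsion_pair K \<X> \<Y>" and h: "hereditary_pair K \<X> \<Y>"
    and s: "A.ses a b" "src a \<in> \<Y>" "tgt a \<in> \<Y>"
  shows "tgt b \<in> \<Y>"
  unfolding cotorsion_right[OF c]
proof (intro conjI ballI)
  show "tgt b \<in> Obj K" using s(1) by (rule ses_Obj)
  fix X assume X: "X \<in> \<X>"
  have "Ext_zero K 2 X (src a)" using h s(2) X by (auto simp: hereditary_pair_def)
  then have "A.ext2 X (src a)" using Ext_zero_2 ses_Obj(1)[OF s(1)] X cotorsion_Obj[OF c] by blast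
  then show "A.ext0 X (tgt b)" using A.ext0_coker[OF s(1)] cotorsion_ext0[OF c X s(3)] by blast
qed

lemma thickD:
  assumes "thick K \<W>" "A.ses a b"
  shows "src a \<in> \<W> \<Longrightarrow> tgt a \<in> \<W> \<Longrightarrow> tgt b \<in> \<W>"
    "src a \<in> \<W> \<Longrightarrow> tgt b \<in> \<W> \<Longrightarrow> tgt a \<in> \<W>"
    "tgt a \<in> \<W> \<Longrightarrow> tgt b \<in> \<W> \<Longrightarrow> src a \<in> \<W>"
proof -
  have "hm K (src a) (mor a) (tgt a) = a" "hm K (tgt a) (mor b) (tgt b) = b"
    using A.sesD(1-4)[OF assms(2)] hm_eta by metis+
  then have "ses K (src a) (tgt a) (tgt b) (mor a) (mor b)"
    using assms(2) ses_hm by metis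
  then show "src a \<in> \<W> \<Longrightarrow> tgt a \<in> \<W> \<Longrightarrow> tgt b \<in> \<W>"
    "src a \<in> \<W> \<Longrightarrow> tgt b \<in> \<W> \<Longrightarrow> tgt a \<in> \<W>"
    "tgt a \<in> \<W> \<Longrightarrow> tgt b \<in> \<W> \<Longrightarrow> src a \<in> \<W>"
    using assms(1) unfolding thick_def by blast+
qed

lemma ses_arrowE:
  assumes "ses K X Y Z i p"
  obtains a b where "A.ses a b" "src a = X" "tgt a = Y" "src b = Y" "tgt b = Z" "a = hm K X i Y" "b = hm K Y p Z"
proof -
  have s: "A.ses (hm K X i Y) (hm K Y p Z)" using assms by (simp add: ses_hm)
  then have "harr K (hm K X i Y)" "harr K (hm K Y p Z)" by (auto simp: A.sesD)
  then show thesis using that[OF s] by simp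
qed

lemma complete_cotorsionE:
  assumes "complete_cotorsion_pair K \<X> \<Y>" "A \<in> Obj K"
  obtains a b where "A.ses a b" "src a \<in> \<Y>" "tgt a \<in> \<X>" "tgt b = A"
proof -
  obtain Y X i p where "Y \<in> \<Y>" "X \<in> \<X>" "ses K Y X A i p"
    using assms unfolding complete_cotorsion_pair_def by blast
  then show thesis using ses_arrowE that by metis
qed

lemma complete_cotorsionE':
  assumes "complete_cotorsion_pair K \<X> \<Y>" "A \<in> Obj K"
  obtains a b where "A.ses a b" "src a = A" "tgt a \<in> \<Y>" "tgt b \<in> \<X>"
proof -
  obtain Y X i p where "Y \<in> \<Y>" "X \<in> \<X>" "ses K A Y X i p"
    using assms unfolding complete_cotorsion_pair_def by blast
  then show thesis using ses_arrowE that by metis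
qed

end

section \<open>Cofibrant replacements of complexes\<close>

text \<open>Becker's theorem enters as the assumption \<open>becker\<close>; it acts through
  \<open>Ch_pair\<close>, the complete cotorsion pair formed by \<open>class_C K M\<close> and
  \<open>perp_C\<close>.\<close>

locale hereditary_model_category = abelian_category K for K :: "('o, 'm) cat" (structure) +
  fixes M :: "'o model" and \<V> :: "('o, 'm) chain set"
  assumes model: "abelian_model_structure K M"
    and hereditary: "hereditary_model K M"
    and becker: "abelian_model_structure (Ch K) (Ch_model K M \<V>)"
begin

interpretation Ch: abelian_category "Ch K" by (rule Ch_abelian)

lemma pairs:
  "complete_cotorsion_pair K (Cof M) (trivially_fibrant M)"
  "complete_cotorsion_pair K (trivially_cofibrant M) (Fib M)"
  "cotorsion_pair K (Cof M) (trivially_fibrant M)"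
  "cotorsion_pair K (trivially_cofibrant M) (Fib M)"
  "hereditary_pair K (Cof M) (trivially_fibrant M)"
  "hereditary_pair K (trivially_cofibrant M) (Fib M)"
  "thick K (Trv M)"
  using model hereditary
  by (simp_all add: abelian_model_structure_def hereditary_model_def complete_cotorsion_pair_def)

text \<open>Although written with \<V>, this class is the right orthogonal of
  \<open>class_C K M\<close>, by \<open>Ch_pair\<close>, and it is handled only in that
  form.\<close>

abbreviation perp_C where
  "perp_C \<equiv> trivially_fibrant (Ch_model K M \<V>)"

lemma Ch_pair:
  "complete_cotorsion_pair (Ch K) (class_C K M) perp_C" "cotorsion_pair (Ch K) (class_C K M) perp_C"
  using becker by (simp_all add: abelian_model_structure_def complete_cotorsion_pair_def Ch_model_def)

section \<open>The cofibrant complexes: suspension, null homotopies, kernels\<close>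

lemma class_C_iff: "X \<in> class_C K M \<longleftrightarrow>
  (\<exists>z e. spliced X z e \<and> (\<forall>n. src (z n) \<in> Cof M) \<and> (\<forall>n. ob X n \<in> trivially_cofibrant M))"
  unfolding class_C_def mem_Collect_eq exact_with_cycles_iff[OF cotorsion_iso_closed(1)[OF pairs(3)]] by blast

text \<open>Null homotopies of maps out of X come from extensions of the suspension of X, so the
  class must contain the suspension. The sign on the differential is the one of the mapping
  cone.\<close>

lemma class_C_suspension:
  assumes "X \<in> class_C K M"
  obtains SX where "SX \<in> class_C K M" "\<And>n. ob SX n = ob X (n - 1)" "\<And>n. dff K SX n = \<ominus> (dff K X (n - 1))"
proof -
  obtain z e where s: "spliced X z e" and z: "\<And>n. src (z n) \<in> Cof M" "\<And>n. ob X n \<in> trivially_cofibrant M"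
    using assms class_C_iff by auto
  have X: "X \<in> Obj (Ch K)" using s by (rule splicedD)
  note [simp] = dff_simps[OF X]
  obtain SX where SX: "SX \<in> Obj (Ch K)" "\<And>n. ob SX n = src (\<ominus> (dff K X (n - 1)))" "\<And>n. dff K SX n = \<ominus> (dff K X (n - 1))"
  proof (rule Ch_objI[of "\<lambda>n. \<ominus> (dff K X (n - 1))"])
    fix n
    show "A.nul (\<ominus> (dff K X (n - 1 - 1)) \<bullet> \<ominus> (dff K X (n - 1)))"
      using dff_dff[OF X, of "n - 1"] by (simp add: A.neg_comp A.comp_neg)
  qed simp_all
  have "spliced SX (\<lambda>n. z (n - 1)) (\<lambda>n. \<ominus> (e (n - 1)))"
    unfolding spliced_def
  proof (intro conjI allI)
    fix n
    show "A.ses (z (n - 1)) (\<ominus> (e (n - 1)))" using splicedD(2)[OF s] by (rule A.ses_neg)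
    show "dff K SX n = z (n - 1 - 1) \<bullet> \<ominus> (e (n - 1))"
      unfolding SX(3) splicedD(3)[OF s] A.comp_neg ..
  qed (rule SX)
  moreover have o: "ob SX n = ob X (n - 1)" for n using SX(2) by simp
  ultimately have "SX \<in> class_C K M" unfolding class_C_iff using z by metis
  then show thesis using that o SX(3) by blast
qed

lemma class_C_Obj: "X \<in> class_C K M \<Longrightarrow> X \<in> Obj (Ch K)"
  using Ch.cotorsion_Obj(1)[OF Ch_pair(2)] by blast

lemma class_C_null_homotopic:
  assumes X: "X \<in> class_C K M" and N: "N \<in> perp_C"
    and g: "harr (Ch K) g" "src g = X" "tgt g = N"
  obtains h where "\<And>n. harr K (h n)" "\<And>n. src (h n) = ob X n" "\<And>n. tgt (h n) = ob N (n + 1)"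
    "\<And>n. cpt K n g = dff K N (n + 1) \<bullet> h n \<oplus> h (n - 1) \<bullet> dff K X n"
proof -
  obtain SX where SX: "SX \<in> class_C K M" "\<And>n. ob SX n = ob X (n - 1)" "\<And>n. dff K SX n = \<ominus> (dff K X (n - 1))"
    using class_C_suspension[OF X] by blast
  have N': "N \<in> Obj (Ch K)" using Ch.cotorsion_Obj(2)[OF Ch_pair(2)] N by blast
  have "Ch.A.ext0 SX N" using Ch.cotorsion_ext0[OF Ch_pair(2) SX(1) N] .
  then show thesis
    using ext0_null_homotopic[OF class_C_Obj[OF SX(1)] class_C_Obj[OF X] N' SX(2,3) _ g] that by blast
qed

text \<open>The nine lemma on cycles makes the kernel complex exact, with the kernels of the induced
  maps \<zeta> as cycle objects. Heredity of the two cotorsion pairs then keeps the cycles cofibrant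
  and the components trivially cofibrant.\<close>

lemma class_C_ker:
  assumes s: "Ch.A.ses \<kappa> \<pi>" and B: "src \<pi> \<in> class_C K M" and Y: "tgt \<pi> \<in> class_C K M"
  shows "src \<kappa> \<in> class_C K M"
proof -
  obtain zB eB where sB: "spliced (src \<pi>) zB eB" and zB: "\<And>n. src (zB n) \<in> Cof M" "\<And>n. ob (src \<pi>) n \<in> trivially_cofibrant M"
    using B class_C_iff by auto
  obtain zY eY where sY: "spliced (tgt \<pi>) zY eY" and zY: "\<And>n. src (zY n) \<in> Cof M" "\<And>n. ob (tgt \<pi>) n \<in> trivially_cofibrant M"
    using Y class_C_iff by auto
  note [simp] = splicedD(4-8)[OF sB] splicedD(4-8)[OF sY]
  have h[simp]: "harr (Ch K) \<kappa>" "harr (Ch K) \<pi>" "tgt \<kappa> = src \<pi>" using Ch.A.sesD[OF s] by auto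
  have sn: "A.ses (cpt K n \<kappa>) (cpt K n \<pi>)" for n using s by (rule Ch_ses_cpt)
  let ?f = "\<lambda>n. cpt K n \<pi>"
  have mY: "A.mono (zY n)" for n using A.sesD(5)[OF splicedD(2)[OF sY]] .
  have fd: "?f (n - 1) \<bullet> zB (n - 1) \<bullet> eB n = zY (n - 1) \<bullet> eY n \<bullet> ?f n" for n
    using cpt_dff[OF h(2), of n] unfolding splicedD(3)[OF sB] splicedD(3)[OF sY] A.comp_assoc .
  have "\<exists>\<zeta>. zY n \<bullet> \<zeta> = ?f n \<bullet> zB n \<and> harr K \<zeta> \<and> src \<zeta> = src (zB n) \<and> tgt \<zeta> = src (zY n)" for n
  proof -
    have "zY (n - 1) \<bullet> eY n \<bullet> ?f n \<bullet> zB n = (zY (n - 1) \<bullet> eY n \<bullet> ?f n) \<bullet> zB n" by (simp only: A.comp_assoc)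
    also have "\<dots> = (?f (n - 1) \<bullet> zB (n - 1)) \<bullet> eB n \<bullet> zB n" by (simp only: A.comp_assoc flip: fd)
    finally have "A.nul (zY (n - 1) \<bullet> eY n \<bullet> ?f n \<bullet> zB n)"
      using A.nul_compR[OF A.sesD(7)[OF splicedD(2)[OF sB, of n]], of "?f (n - 1) \<bullet> zB (n - 1)"] by simp
    then have "A.nul (eY n \<bullet> ?f n \<bullet> zB n)" by (rule A.mono_nul[OF mY])
    then show ?thesis using A.ses_lift[OF splicedD(2)[OF sY], of n "?f n \<bullet> zB n"] by simp
  qed
  then obtain \<zeta> where \<zeta>: "\<And>n. zY n \<bullet> \<zeta> n = ?f n \<bullet> zB n"
    and [simp]: "\<And>n. harr K (\<zeta> n)" "\<And>n. src (\<zeta> n) = src (zB n)" "\<And>n. tgt (\<zeta> n) = src (zY n)" by metis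
  have \<zeta>e: "\<zeta> (n - 1) \<bullet> eB n = eY n \<bullet> ?f n" for n
  proof (rule A.monoD[OF mY[of "n - 1"]])
    have "zY (n - 1) \<bullet> \<zeta> (n - 1) \<bullet> eB n = ?f (n - 1) \<bullet> zB (n - 1) \<bullet> eB n" by (simp only: \<zeta> flip: A.comp_assoc)
    then show "zY (n - 1) \<bullet> \<zeta> (n - 1) \<bullet> eB n = zY (n - 1) \<bullet> eY n \<bullet> ?f n" unfolding fd .
  qed simp_all
  \<comment> \<open>Surjectivity on cycles comes from exactness of the target: a cycle there is a
    boundary, and \<pi> is onto one degree higher.\<close>
  have epi: "A.epi (\<zeta> n)" for n
  proof -
    have "A.epi (eY (n + 1) \<bullet> ?f (n + 1))"
      using A.sesD(6)[OF splicedD(2)[OF sY]] A.sesD(6)[OF sn] by (intro A.epi_comp) simp_all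
    then have "A.epi (\<zeta> n \<bullet> eB (n + 1))" using \<zeta>e[of "n + 1"] by simp
    then show ?thesis by (rule A.epi_cancel)
  qed
  have "\<forall>n. \<exists>k. A.ses k (\<zeta> n)" using A.ex_epi_ses[OF epi] by blast
  then obtain k where k: "\<And>n. A.ses (k n) (\<zeta> n)" by metis
  have "\<exists>a b. A.ses a b \<and> cpt K n \<kappa> \<bullet> a = zB n \<bullet> k n \<and> k (n - 1) \<bullet> b = eB n \<bullet> cpt K n \<kappa> \<and>
      tgt a = src (cpt K n \<kappa>) \<and> src a = src (k n) \<and> tgt b = src (k (n - 1))" for n
  proof (rule A.ses_kernels[OF splicedD(2)[OF sB] splicedD(2)[OF sY] epi epi A.sesD(6)[OF sn]])
    show "A.ker (k n) (\<zeta> n)" "A.ker (k (n - 1)) (\<zeta> (n - 1))" "A.ker (cpt K n \<kappa>) (?f n)"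
      using k sn by (simp_all add: A.ses_def)
  qed (simp_all add: \<zeta> \<zeta>e)
  then have "\<forall>n. \<exists>ab. A.ses (fst ab) (snd ab) \<and> cpt K n \<kappa> \<bullet> fst ab = zB n \<bullet> k n \<and> k (n - 1) \<bullet> snd ab = eB n \<bullet> cpt K n \<kappa> \<and>
      tgt (fst ab) = src (cpt K n \<kappa>) \<and> src (fst ab) = src (k n) \<and> tgt (snd ab) = src (k (n - 1))" by force
  then obtain ab where ab: "\<forall>n. A.ses (fst (ab n)) (snd (ab n)) \<and> cpt K n \<kappa> \<bullet> fst (ab n) = zB n \<bullet> k n \<and>
      k (n - 1) \<bullet> snd (ab n) = eB n \<bullet> cpt K n \<kappa> \<and>
      tgt (fst (ab n)) = src (cpt K n \<kappa>) \<and> src (fst (ab n)) = src (k n) \<and> tgt (snd (ab n)) = src (k (n - 1))"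
    by metis
  define a b where "a = (\<lambda>n. fst (ab n))" and "b = (\<lambda>n. snd (ab n))"
  have a: "A.ses (a n) (b n)" "cpt K n \<kappa> \<bullet> a n = zB n \<bullet> k n" "k (n - 1) \<bullet> b n = eB n \<bullet> cpt K n \<kappa>"
      "tgt (a n) = src (cpt K n \<kappa>)" "src (a n) = src (k n)" "tgt (b n) = src (k (n - 1))" for n
    using ab unfolding a_def b_def by blast+
  have ah[simp]: "harr K (a n)" "harr K (b n)" "src (b n) = ob (src \<kappa>) n" for n
    using A.sesD(1-3)[OF a(1)[of n]] a(4)[of n] by simp_all
  have N: "src \<kappa> \<in> Obj (Ch K)" by simp
  have "dff K (src \<kappa>) n = a (n - 1) \<bullet> b n" for n
  proof (rule A.monoD[OF A.sesD(5)[OF sn[of "n - 1"]]])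
    have "cpt K (n - 1) \<kappa> \<bullet> a (n - 1) \<bullet> b n = (zB (n - 1) \<bullet> k (n - 1)) \<bullet> b n"
      by (simp only: a(2) flip: A.comp_assoc)
    also have "\<dots> = (zB (n - 1) \<bullet> eB n) \<bullet> cpt K n \<kappa>" by (simp only: a(3) A.comp_assoc)
    also have "\<dots> = dff K (tgt \<kappa>) n \<bullet> cpt K n \<kappa>" by (simp only: splicedD(3)[OF sB] h(3))
    also have "\<dots> = cpt K (n - 1) \<kappa> \<bullet> dff K (src \<kappa>) n" by (rule cpt_dff[OF h(1), symmetric])
    finally show "cpt K (n - 1) \<kappa> \<bullet> dff K (src \<kappa>) n = cpt K (n - 1) \<kappa> \<bullet> a (n - 1) \<bullet> b n" by (rule sym)
  qed (use a(4-6) N dff_simps[OF N] in simp_all)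
  then have "spliced (src \<kappa>) a b" using a(1) N by (simp add: spliced_def)
  moreover have "src (a n) \<in> Cof M" for n
    unfolding a(5) using hereditary_ker[OF pairs(3,5) k[of n]] zB zY by simp
  moreover have "ob (src \<kappa>) n \<in> trivially_cofibrant M" for n
    using hereditary_ker[OF pairs(4,6) sn[of n]] zB zY by simp
  ultimately show ?thesis unfolding class_C_iff by blast
qed

section \<open>Uniqueness of cofibrant replacements up to homotopy\<close>

definition cofr where
  "cofr S q \<longleftrightarrow> src q \<in> class_C K M \<and> tgt q = S \<and> (\<exists>i. Ch.A.ses i q \<and> src i \<in> perp_C)"

text \<open>The difference of \<open>w\<close> and the identity is killed by \<open>q\<close>, so it
  factors through the kernel of \<open>q\<close>. That kernel lies in \<open>perp_C\<close>, where
  every map from \<open>src q\<close> is null-homotopic.\<close>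

lemma cofr_homotopy:
  assumes i: "Ch.A.ses i q" "src i \<in> perp_C" and X: "src q \<in> class_C K M"
    and w: "harr (Ch K) w" "src w = src q" "tgt w = src q" "q \<star> w = q"
  obtains h where "\<And>n. harr K (h n)" "\<And>n. src (h n) = ob (src q) n" "\<And>n. tgt (h n) = ob (src q) (n + 1)"
    "\<And>n. cpt K n w \<oplus> \<ominus> (hidn K (ob (src q) n)) = dff K (src q) (n + 1) \<bullet> h n \<oplus> h (n - 1) \<bullet> dff K (src q) n"
proof -
  let ?X = "src q"
  have XO: "?X \<in> Obj (Ch K)" using class_C_Obj X by blast
  note [simp] = w(1-3) dff_simps[OF XO]
  have ih[simp]: "harr (Ch K) i" "harr (Ch K) q" "tgt i = src q" using Ch.A.sesD[OF i(1)] by auto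
  let ?d = "hadd (Ch K) w (hneg (Ch K) (hidn (Ch K) ?X))"
  have d[simp]: "harr (Ch K) ?d" "src ?d = ?X" "tgt ?d = ?X" using XO by simp_all
  have "q \<star> ?d = hadd (Ch K) q (hneg (Ch K) q)"
    by (simp add: Ch.A.comp_add Ch.A.comp_neg w(4))
  then have "Ch.A.nul (q \<star> ?d)" using Ch.A.nul_add_neg[OF ih(2)] by (simp only:)
  then obtain g where g: "i \<star> g = ?d" "harr (Ch K) g" "src g = ?X" "tgt g = src i"
    using Ch.A.ses_lift[OF i(1)] d by metis
  obtain h where h: "\<And>n. harr K (h n)" "\<And>n. src (h n) = ob ?X n" "\<And>n. tgt (h n) = ob (src i) (n + 1)"
    "\<And>n. cpt K n g = dff K (src i) (n + 1) \<bullet> h n \<oplus> h (n - 1) \<bullet> dff K ?X n"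
    using class_C_null_homotopic[OF X i(2) g(2-4)] by blast
  note [simp] = h(1-3)
  have "cpt K n w \<oplus> \<ominus> (hidn K (ob ?X n)) = dff K ?X (n + 1) \<bullet> (cpt K (n + 1) i \<bullet> h n) \<oplus> (cpt K n i \<bullet> h (n - 1)) \<bullet> dff K ?X n" for n
  proof -
    have "cpt K n w \<oplus> \<ominus> (hidn K (ob ?X n)) = cpt K n ?d"
      using XO by (simp add: cpt_add cpt_neg cpt_idn)
    also have "\<dots> = cpt K n i \<bullet> cpt K n g" using cpt_cmp[OF ih(1) g(2), of n] g by simp
    also have "\<dots> = (cpt K n i \<bullet> dff K (src i) (n + 1)) \<bullet> h n \<oplus> cpt K n i \<bullet> h (n - 1) \<bullet> dff K ?X n"
      by (simp only: h(4) A.comp_add A.comp_assoc)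
    also have "cpt K n i \<bullet> dff K (src i) (n + 1) = dff K ?X (n + 1) \<bullet> cpt K (n + 1) i"
      using cpt_dff[OF ih(1), of "n + 1"] by simp
    finally show ?thesis by (simp only: A.comp_assoc)
  qed
  then show thesis by (intro that[of "\<lambda>n. cpt K (n + 1) i \<bullet> h n"]) simp_all
qed

text \<open>Orthogonality lifts each replacement through the other, giving \<open>u\<close> and
  \<open>v\<close>. Both composites cover the identity of S, hence are homotopic to identities and
  act as such on cohomology.\<close>

lemma cofr_cohomology:
  assumes q: "cofr S q" and q': "cofr S q'" and B: "B \<in> Obj K"
  shows "Hom_cohomology K (src q') B n \<cong> Hom_cohomology K (src q) B n"
proof -
  obtain i where i: "Ch.A.ses i q" "src i \<in> perp_C" and X: "src q \<in> class_C K M" "tgt q = S" using q by (auto simp: cofr_def)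
  obtain i' where i': "Ch.A.ses i' q'" "src i' \<in> perp_C" and X': "src q' \<in> class_C K M" "tgt q' = S" using q' by (auto simp: cofr_def)
  have h[simp]: "harr (Ch K) q" "harr (Ch K) q'" using Ch.A.sesD[OF i(1)] Ch.A.sesD[OF i'(1)] by auto
  obtain u where u: "q' \<star> u = q"
    using Ch.A.ext0_lift[OF Ch.cotorsion_ext0[OF Ch_pair(2) X(1) i'(2)] i'(1), of q] X(2) X'(2) h by metis
  obtain v where v: "q \<star> v = q'"
    using Ch.A.ext0_lift[OF Ch.cotorsion_ext0[OF Ch_pair(2) X'(1) i(2)] i(1), of q'] X(2) X'(2) h by metis
  have "harr (Ch K) (q' \<star> u)" "src (q' \<star> u) = src q" "harr (Ch K) (q \<star> v)" "src (q \<star> v) = src q'"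
    unfolding u v by simp_all
  then have uv[simp]: "harr (Ch K) u" "src u = src q" "tgt u = src q'" "harr (Ch K) v" "src v = src q'" "tgt v = src q" by auto
  have O: "src q \<in> Obj (Ch K)" "src q' \<in> Obj (Ch K)" by simp_all
  have w: "q \<star> (v \<star> u) = q" "q' \<star> (u \<star> v) = q'" by (simp_all add: u v flip: Ch.A.comp_assoc)
  obtain k where k: "\<And>n. harr K (k n)" "\<And>n. src (k n) = ob (src q) n" "\<And>n. tgt (k n) = ob (src q) (n + 1)"
    "\<And>n. cpt K n (v \<star> u) \<oplus> \<ominus> (hidn K (ob (src q) n)) = dff K (src q) (n + 1) \<bullet> k n \<oplus> k (n - 1) \<bullet> dff K (src q) n"
    using cofr_homotopy[OF i X(1), of "v \<star> u"] w(1) by auto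
  obtain l where l: "\<And>n. harr K (l n)" "\<And>n. src (l n) = ob (src q') n" "\<And>n. tgt (l n) = ob (src q') (n + 1)"
    "\<And>n. cpt K n (u \<star> v) \<oplus> \<ominus> (hidn K (ob (src q') n)) = dff K (src q') (n + 1) \<bullet> l n \<oplus> l (n - 1) \<bullet> dff K (src q') n"
    using cofr_homotopy[OF i' X'(1), of "u \<star> v"] w(2) by auto
  have vu: "coboundary (src q) B n ((f \<bullet> cpt K n v) \<bullet> cpt K n u \<oplus> \<ominus> f)" if "cocycle (src q) B n f" for f
    using homotopy_cocycle[OF O(1) _ _ _ k(1-3) k(4)[of n] that] by (simp add: cpt_cmp A.comp_assoc)
  have uv': "coboundary (src q') B n ((f \<bullet> cpt K n u) \<bullet> cpt K n v \<oplus> \<ominus> f)" if "cocycle (src q') B n f" for f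
    using homotopy_cocycle[OF O(2) _ _ _ l(1-3) l(4)[of n] that] by (simp add: cpt_cmp A.comp_assoc)
  show ?thesis
  proof (rule Hom_cohomology_iso[OF O(2,1) B B, where T = "\<lambda>f. f \<bullet> cpt K n u"])
    show "cocycle (src q) B n (f \<bullet> cpt K n u)" if "cocycle (src q') B n f" for f
      using cocycle_chain_map(1)[of u B n f] that by simp
    show "(f \<oplus> g) \<bullet> cpt K n u = f \<bullet> cpt K n u \<oplus> g \<bullet> cpt K n u" for f g by (rule A.add_comp)
    show "coboundary (src q) B n (f \<bullet> cpt K n u) \<longleftrightarrow> coboundary (src q') B n f" if f: "cocycle (src q') B n f" for f
    proof
      assume c: "coboundary (src q) B n (f \<bullet> cpt K n u)"
      let ?g = "(f \<bullet> cpt K n u) \<bullet> cpt K n v"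
      have 1: "coboundary (src q') B n ?g" using cocycle_chain_map(2)[of v B n "f \<bullet> cpt K n u"] c by simp
      have 2: "coboundary (src q') B n (\<ominus> (?g \<oplus> \<ominus> f))" using coboundary_add(2)[OF O(2) uv'[OF f] uv'[OF f]] .
      have "\<ominus> (?g \<oplus> \<ominus> f) \<oplus> ?g = f"
      proof -
        note [simp] = coboundaryD(1-3)[OF O(2) 1] cocycleD(1-3)[OF O(2) f]
        have "\<ominus> (?g \<oplus> \<ominus> f) \<oplus> ?g = \<ominus> ?g \<oplus> (?g \<oplus> f)" by (simp only: A.neg_add A.neg_neg A.add_ac \<open>harr K f\<close>)
        also have "\<dots> = f" by (rule A.neg_add_cancel) (simp_all only: coboundaryD(1-3)[OF O(2) 1] cocycleD(1-3)[OF O(2) f])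
        finally show ?thesis .
      qed
      then show "coboundary (src q') B n f" using coboundary_add(1)[OF O(2) 2 1] by simp
    next
      assume "coboundary (src q') B n f"
      then show "coboundary (src q) B n (f \<bullet> cpt K n u)" using cocycle_chain_map(2)[of u B n f] by simp
    qed
    show "\<exists>f c. cocycle (src q') B n f \<and> coboundary (src q) B n c \<and> f' = c \<oplus> f \<bullet> cpt K n u" if f': "cocycle (src q) B n f'" for f'
    proof (intro exI conjI)
      let ?g = "(f' \<bullet> cpt K n v) \<bullet> cpt K n u"
      show f: "cocycle (src q') B n (f' \<bullet> cpt K n v)" using cocycle_chain_map(1)[of v B n f'] f' by simp
      show "coboundary (src q) B n (\<ominus> (?g \<oplus> \<ominus> f'))" using coboundary_add(2)[OF O(1) vu[OF f'] vu[OF f']] .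
      have g: "cocycle (src q) B n ?g" using cocycle_chain_map(1)[of u B n "f' \<bullet> cpt K n v"] f by simp
      have "\<ominus> (?g \<oplus> \<ominus> f') \<oplus> ?g = \<ominus> ?g \<oplus> (?g \<oplus> f')"
        by (simp only: A.neg_add A.neg_neg A.add_ac cocycleD(1)[OF O(1) f'])
      also have "\<dots> = f'" by (rule A.neg_add_cancel) (simp_all only: cocycleD(1-3)[OF O(1) g] cocycleD(1-3)[OF O(1) f'])
      finally show "f' = \<ominus> (?g \<oplus> \<ominus> f') \<oplus> ?g" by (rule sym)
    qed
  qed
qed

end

context abelian_category begin

interpretation Ch: abelian_category "Ch K" by (rule Ch_abelian)

section \<open>Canonical resolutions\<close>

lemma coker_epi_comp:
  assumes "A.epi p" "tgt p = src f"
  shows "A.coker c (f \<bullet> p) \<longleftrightarrow> A.coker c f"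
proof -
  have "A.nul (u \<bullet> f \<bullet> p) \<longleftrightarrow> A.nul (u \<bullet> f)" for u
  proof
    assume n: "A.nul (u \<bullet> f)"
    have "harr K f" "harr K u" "src u = tgt f" using A.nul_arr[OF n] by auto
    then show "A.nul (u \<bullet> f \<bullet> p)"
      using A.nul_compL[OF n, of p] assms A.epi_arr[OF assms(1)] by (simp add: A.comp_assoc)
  next
    assume "A.nul (u \<bullet> f \<bullet> p)"
    then have "A.nul ((u \<bullet> f) \<bullet> p)" by (simp only: A.comp_assoc)
    then show "A.nul (u \<bullet> f)" by (rule A.epi_nul[OF assms(1)])
  qed
  then show ?thesis unfolding A.coker_def by simp
qed

lemma spliced_coker:
  assumes "spliced X z e"
  shows "A.coker (e n) (dff K X (n + 1))"
  unfolding splicedD(3)[OF assms]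
  using splicedD[OF assms] A.sesD(6)[OF splicedD(2)[OF assms, of "n + 1"]]
  by (subst coker_epi_comp) (auto simp: A.ses_def)

lemma zero_epi:
  assumes "harr K u" "A.nul (hidn K (tgt u))"
  shows "A.epi u"
  unfolding A.epi_def
proof (intro conjI allI impI)
  fix v assume "A.nul (v \<bullet> u)"
  from A.nul_arr[OF this] have "harr K v" "src v = tgt u" by auto
  then show "A.nul v" using A.comp_zero assms(2) by metis
qed fact

lemma zero_ses:
  assumes "harr K u" "A.nul (hidn K (tgt u))"
  shows "A.ses (hidn K (src u)) u"
proof (rule A.sesI)
  have "A.nul u" using A.zero_comp[OF assms(2,1)] by simp
  then have "A.exact (hidn K (src u)) u" by (rule A.exact_idn_nul)
  then show "A.ker (hidn K (src u)) u"
    by (rule A.exact_mono_ker) (use assms(1) harrD(1) in simp)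
  show "A.epi u" using assms by (rule zero_epi)
qed

lemma stalk_ob:
  assumes A: "A \<in> Obj K"
  shows "ob (stalk K A) 0 = A" "n \<noteq> 0 \<Longrightarrow> A.nul (hidn K (ob (stalk K A) n))"
    "A.nul (dff K (stalk K A) n)" "stalk K A \<in> Obj (Ch K)"
proof -
  obtain Z where "A.nul (hidn K Z)" using A.ex_zero_object by blast
  then have Z: "zero_object K Z" by (simp add: zero_object_hidn)
  show o: "ob (stalk K A) 0 = A" by (simp add: stalk_def Let_def)
  show z: "A.nul (hidn K (ob (stalk K A) n))" if "n \<noteq> 0" for n
    using someI[of "zero_object K", OF Z] that by (simp add: stalk_def Let_def zero_object_hidn)
  have O: "ob (stalk K A) n \<in> Obj K" for n
    using o z[of n] A A.nul_arr[of "hidn K (ob (stalk K A) n)"] by (cases "n = 0") auto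
  have d: "dif (stalk K A) n = Zer K (ob (stalk K A) n) (ob (stalk K A) (n - 1))" for n
    by (simp add: stalk_def Let_def)
  show "A.nul (dff K (stalk K A) n)" by (simp add: dff_def nul_hm d O)
  have "Zer K (ob (stalk K A) (n - 1)) (ob (stalk K A) (n - 1 - 1)) \<cdot> Zer K (ob (stalk K A) n) (ob (stalk K A) (n - 1)) =
      Zer K (ob (stalk K A) n) (ob (stalk K A) (n - 1 - 1))" for n
    using O by (intro Zer_Cmp Zer_Mor)
  then show "stalk K A \<in> Obj (Ch K)" using O Zer_Mor unfolding Ch_simps mem_Collect_eq d by blast
qed

text \<open>Being a chain map is a condition only on the square leaving degree 1: the differentials
  of the stalk are null, and \<open>to_stalk\<close> is null outside degree 0.\<close>

lemma to_stalk_arr: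
  assumes W: "W \<in> Obj (Ch K)" and A: "A \<in> Obj K"
    and g: "src g = ob W 0" "tgt g = A" "A.nul (g \<bullet> dff K W 1)"
  defines "q \<equiv> hm (Ch K) W (to_stalk K W A (mor g)) (stalk K A)"
  shows "harr (Ch K) q" "src q = W" "tgt q = stalk K A" "cpt K 0 q = g"
proof -
  have h: "harr K g" using A.nul_arr[OF g(3)] by auto
  let ?f = "\<lambda>n. hm K (ob W n) (to_stalk K W A (mor g) n) (ob (stalk K A) n)"
  note S = stalk_ob[OF A]
  note [simp] = dff_simps[OF W] dff_simps[OF S(4)] S(1)
  have f0: "?f 0 = g" using hm_eta[OF h] g by (simp add: to_stalk_def)
  have fn: "A.nul (?f n)" if "n \<noteq> 0" for n using that W S(4) by (simp add: to_stalk_def nul_hm)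
  have f: "harr K (?f n)" for n using f0 fn[of n] h A.nul_arr by (cases "n = 0") auto
  then have fs: "src (?f n) = ob W n" "tgt (?f n) = ob (stalk K A) n" for n by simp_all
  have c: "?f (n - 1) \<bullet> dff K W n = dff K (stalk K A) n \<bullet> ?f n" for n
  proof -
    have 1: "A.nul (dff K (stalk K A) n \<bullet> ?f n)" using A.nul_compL[OF S(3), of "?f n"] f fs by simp
    have 2: "A.nul (?f (n - 1) \<bullet> dff K W n)"
    proof (cases "n = 1")
      case True
      then show ?thesis using f0 g(3) by simp
    next
      case False
      then show ?thesis using A.nul_compL[OF fn[of "n - 1"], of "dff K W n"] fs f by simp
    qed
    show ?thesis
      by (rule A.nul_eq[OF 2 1]) (use f fs in simp_all)
  qed
  obtain a where a: "harr (Ch K) a" "src a = W" "tgt a = stalk K A" "\<And>n. cpt K n a = ?f n"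
    using Ch_arrI[OF W S(4), of ?f, OF f fs c] by blast
  have "mor a n = to_stalk K W A (mor g) n" for n
    using a(4)[of n] f[of n] hm_eqD[of "ob W n" "mor a n" "ob (stalk K A) n"] unfolding cpt_def a(2,3) by metis
  then have m: "mor a = to_stalk K W A (mor g)" by auto
  then have "q = a" using Ch.hm_eta[OF a(1)] a unfolding q_def by simp
  then show "harr (Ch K) q" "src q = W" "tgt q = stalk K A" "cpt K 0 q = g" using a f0 by simp_all
qed

end

section \<open>Trivially fibrant complexes and resolutions\<close>

context hereditary_model_category begin

interpretation Ch: abelian_category "Ch K" by (rule Ch_abelian)

lemma trivially_cofibrant_iff: "X \<in> trivially_cofibrant M \<longleftrightarrow> X \<in> Cof M \<and> X \<in> Trv M"
  and trivially_fibrant_iff: "X \<in> trivially_fibrant M \<longleftrightarrow> X \<in> Fib M \<and> X \<in> Trv M"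
  by auto

text \<open>Feeds \<open>pivot\<close> from the two cotorsion pairs: the trivially cofibrant
  components of X face the fibrant objects of \<open>E1\<close>, the cofibrant cycles of X face the
  trivially fibrant ones of \<open>E2\<close> and \<open>E3\<close>.\<close>

lemma perp_CI:
  assumes N: "N \<in> Obj (Ch K)"
    and up: "\<And>n. n > b \<Longrightarrow> A.ses (zN n) (eN n)" "\<And>n. n > b \<Longrightarrow> dff K N n = zN (n - 1) \<bullet> eN n"
    and pv: "A.ses (zN b) eF" "A.nul (dff K N b \<bullet> zN b)"
    and E1: "\<And>m. m \<ge> b \<Longrightarrow> src (zN m) \<in> Fib M"
    and E2: "tgt eF \<in> trivially_fibrant M"
    and E3: "\<And>m. m < b \<Longrightarrow> ob N m \<in> trivially_fibrant M"
  shows "N \<in> perp_C"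
  unfolding Ch.cotorsion_right[OF Ch_pair(2)]
proof (intro conjI ballI)
  fix X assume "X \<in> class_C K M"
  then obtain z e where s: "spliced X z e" and z: "\<And>n. src (z n) \<in> Cof M" "\<And>n. ob X n \<in> trivially_cofibrant M"
    using class_C_iff by auto
  show "Ch.A.ext0 X N"
  proof (rule pivot[OF s N up pv])
    show "A.ext0 (ob X n) (src (zN m))" if "m \<ge> b" for n m
      using cotorsion_ext0[OF pairs(4) z(2) E1[OF that]] .
    show "A.ext0 (src (z n)) (tgt eF)" for n using cotorsion_ext0[OF pairs(3) z(1) E2] .
    show "A.ext0 (src (z n)) (ob N m)" if "m < b" for n m using cotorsion_ext0[OF pairs(3) z(1) E3[OF that]] .
  qed
qed fact

text \<open>The cut is placed at degree 1, where the complex already vanishes; from there on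
  identities of zero objects serve as inclusions of cycles.\<close>

lemma perp_C_bounded:
  assumes N: "N \<in> Obj (Ch K)" and neg: "\<And>n. n \<le> 0 \<Longrightarrow> ob N n \<in> trivially_fibrant M"
    and pos: "\<And>n. n > 0 \<Longrightarrow> A.nul (hidn K (ob N n))"
  shows "N \<in> perp_C"
proof (rule perp_CI[where b = 1 and zN = "\<lambda>n. hidn K (ob N n)" and eN = "dff K N" and eF = "hidn K (ob N 1)", OF N])
  note [simp] = dff_simps[OF N]
  have O: "ob N n \<in> Obj K" for n using N by simp
  show "A.ses (hidn K (ob N n)) (dff K N n)" if "n > 1" for n
    using zero_ses[of "dff K N n"] pos[of "n - 1"] that by simp
  show "dff K N n = hidn K (ob N (n - 1)) \<bullet> dff K N n" for n by simp
  show "A.ses (hidn K (ob N 1)) (hidn K (ob N 1))"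
    using zero_ses[of "hidn K (ob N 1)"] pos[of 1] O by simp
  have "A.nul (dff K N 1)" by (rule A.comp_zero[OF pos[of 1]]) simp_all
  then show "A.nul (dff K N 1 \<bullet> hidn K (ob N 1))" by simp
  show "src (hidn K (ob N m)) \<in> Fib M" if "m \<ge> 1" for m
    using cotorsion_zero(2)[OF pairs(4) pos[of m]] that O by simp
  show "tgt (hidn K (ob N 1)) \<in> trivially_fibrant M"
    using cotorsion_zero(2)[OF pairs(3) pos[of 1]] O by simp
  show "ob N m \<in> trivially_fibrant M" if "m < 1" for m using neg that by simp
qed

text \<open>Each half of a resolution states only part of what \<open>class_C\<close> asks. In
  degrees n \<ge> 0 the cycles are cofibrant by heredity, descending from the cofibrant object A; in
  degrees n < 0 the components are trivial by assumption and cofibrant as extensions of cofibrant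
  cycles.\<close>

lemma resolutionE:
  assumes "model_resolution K M A W \<epsilon> \<eta>" "A \<in> Cof M"
  obtains z e where "spliced W z e" "W \<in> class_C K M" "A.ses (z 0) (hm K (ob W 0) \<epsilon> A)"
    "\<And>n. n \<ge> 0 \<Longrightarrow> src (z n) \<in> Fib M" "\<And>n. n < 0 \<Longrightarrow> ob W n \<in> trivially_fibrant M"
    "A.nul (hm K (ob W 0) \<epsilon> A \<bullet> dff K W 1)"
proof -
  let ?E = "hm K (ob W 0) \<epsilon> A" and ?H = "hm K A \<eta> (ob W (-1))"
  have r: "exact_complex K W" "dif W 0 = \<eta> \<cdot> \<epsilon>" "A.epi ?E" "exact_at K (ob W 1) (ob W 0) A (dif W 1) \<epsilon>"
    "\<And>n. n \<ge> 0 \<Longrightarrow> ob W n \<in> trivially_cofibrant M" "kernels_in K (Fib M) (ob W 0) A \<epsilon>"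
    "\<And>n. n \<ge> 1 \<Longrightarrow> kernels_in K (Fib M) (ob W n) (ob W (n - 1)) (dif W n)"
    "A.mono ?H" "exact_at K A (ob W (-1)) (ob W (-2)) \<eta> (dif W (-1))"
    "\<And>n. n \<le> -1 \<Longrightarrow> ob W n \<in> trivially_fibrant M"
    "cokernels_in K (Cof M) A (ob W (-1)) \<eta>"
    "\<And>n. n \<le> -1 \<Longrightarrow> cokernels_in K (Cof M) (ob W n) (ob W (n - 1)) (dif W n)"
    using assms(1) unfolding model_resolution_def mono_hm epi_hm by auto
  obtain z e where s: "spliced W z e" using exact_spliced[OF r(1)] by blast
  note D = splicedD[OF s]
  note [simp] = D(4-8)
  have d1: "hm K (ob W 1) (dif W 1) (ob W 0) = dff K W 1" "hm K (ob W (-1)) (dif W (-1)) (ob W (-2)) = dff K W (-1)"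
    by (simp_all add: dff_def)
  have ex: "A.exact (dff K W 1) ?E" "A.exact ?H (dff K W (-1))" using r(4,9) unfolding exact_hm d1 by auto
  have h[simp]: "harr K ?E" "harr K ?H" using A.exactD[OF ex(1)] A.exactD[OF ex(2)] by auto
  have d0: "dff K W 0 = ?H \<bullet> ?E" using hm_Cmp[OF h] r(2) by (simp add: dff_def)
  have z0: "A.ses (z 0) ?E"
  proof (rule A.sesI)
    have "A.ker (z 0) (?H \<bullet> ?E)" using spliced_ker[OF s, of 0] unfolding d0 .
    then show "A.ker (z 0) ?E" using ker_mono_comp[OF r(8)] h by simp
  qed (rule r)
  note ic = cotorsion_iso_closed(1)[OF pairs(3)] cotorsion_iso_closed(2)[OF pairs(4)] cotorsion_iso_closed(2)[OF pairs(3)]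
  have f: "src (z n) \<in> Fib M" if "n \<ge> 0" for n
  proof (cases "n = 0")
    case True
    have "A.ker (z 0) ?E" using z0 by (simp add: A.ses_def)
    then show ?thesis using kernels_in_iff[OF ic(2)] r(6) True by blast
  next
    case False
    then show ?thesis
      using kernels_in_iff[OF ic(2) spliced_ker[OF s, of n, unfolded dff_def]] r(7)[of n] that by simp
  qed
  have c1: "src (z (-1)) \<in> Cof M"
  proof (rule ker_iso_closed[OF ic(1)])
    show "A.ker ?H (dff K W (-1))" using ex(2) r(8) by (rule A.exact_mono_ker)
    show "A.ker (z (-1)) (dff K W (-1))" using s by (rule spliced_ker)
    show "src ?H \<in> Cof M" using assms(2) by simp
  qed
  \<comment> \<open>The cycles in degree n are the cokernel of the differential out of degree n + 2.
    For n = -2 this differential is \<eta> after the epi \<epsilon>, so its cokernel is that of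
    \<eta>.\<close>
  have c2: "src (z n) \<in> Cof M" if "n \<le> -2" for n
  proof (cases "n = -2")
    case True
    have "A.coker (e (-1)) (?H \<bullet> ?E)" using spliced_coker[OF s, of "-1"] d0 by simp
    then have "A.coker (e (-1)) ?H" using coker_epi_comp[OF r(3)] by simp
    then have "tgt (e (-1)) \<in> Cof M" using cokernels_in_iff[OF ic(1)] r(11) by blast
    then show ?thesis using True D(8)[of "-1"] by simp
  next
    case False
    have "A.coker (e (n + 1)) (hm K (ob W (n + 1 + 1)) (dif W (n + 1 + 1)) (ob W (n + 1 + 1 - 1)))"
      using spliced_coker[OF s, of "n + 1"] unfolding dff_def .
    then have "tgt (e (n + 1)) \<in> Cof M"
      using cokernels_in_iff[OF ic(1)] r(12)[of "n + 1 + 1"] False that by simp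
    then show ?thesis using D(8)[of "n + 1"] by simp
  qed
  have c0: "src (z 0) \<in> Cof M"
    using hereditary_ker[OF pairs(3,5) z0] assms(2) r(5)[of 0] by (simp add: trivially_cofibrant_iff)
  \<comment> \<open>Induction upwards from degree 0: the cycles in degree n + 1 are the kernel of an
    epi from a cofibrant component onto the cycles in degree n.\<close>
  have "src (z (int n)) \<in> Cof M" for n :: nat
  proof (induction n)
    case (Suc n)
    have "src (z (int (Suc n) - 1)) \<in> Cof M" using Suc by simp
    then show ?case
      using hereditary_ker[OF pairs(3,5) D(2)[of "int (Suc n)"]] r(5)[of "int (Suc n)"] D(7,8)[of "int (Suc n)"]
      by (simp only: trivially_cofibrant_iff of_nat_0_le_iff)
  qed (use c0 in simp)
  then have cp: "src (z n) \<in> Cof M" if "n \<ge> 0" for n using that nat_0_le[of n] by metis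
  have c: "src (z n) \<in> Cof M" for n
  proof -
    consider "n \<ge> 0" | "n = -1" | "n \<le> -2" by linarith
    then show ?thesis using c1 c2[of n] cp[of n] by cases simp_all
  qed
  have o: "ob W n \<in> trivially_cofibrant M" for n
  proof (cases "n \<ge> 0")
    case False
    then have "ob W n \<in> Trv M" using r(10)[of n] by (simp add: trivially_fibrant_iff)
    moreover have "tgt (z n) \<in> Cof M"
      using cotorsion_left_ext[OF pairs(3) D(2)[of n]] c[of n] c[of "n - 1"] by simp
    ultimately show ?thesis by (simp add: trivially_cofibrant_iff)
  qed (rule r)
  have W: "W \<in> class_C K M" unfolding class_C_iff using s c o by blast
  have "A.nul (?E \<bullet> dff K W 1)" using ex(1) by (rule A.exactD)
  show thesis
  proof (rule that[OF s W z0])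
    show "src (z n) \<in> Fib M" if "n \<ge> 0" for n using that by (rule f)
    show "ob W n \<in> trivially_fibrant M" if "n < 0" for n by (rule r(10)) (use that in simp)
  qed fact
qed

text \<open>Stated for any epi \<open>p\<close> out of A with trivially fibrant kernel, so as to
  serve twice: with a cofibrant replacement for canonical resolutions, and with the identity for the
  stalk of A itself. The kernel of the map to the stalk agrees with W outside degree 0 up to
  isomorphism and has its cut at 0.\<close>

lemma resolution_cofr:
  assumes r: "model_resolution K M A W \<epsilon> \<eta>" "A \<in> Cof M"
    and p: "A.ses i p" "src p = A" "src i \<in> trivially_fibrant M"
  shows "cofr (stalk K (tgt p)) (hm (Ch K) W (to_stalk K W (tgt p) (mor (p \<bullet> hm K (ob W 0) \<epsilon> A))) (stalk K (tgt p)))"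
proof -
  let ?E = "hm K (ob W 0) \<epsilon> A" and ?S = "stalk K (tgt p)"
  obtain z e where s: "spliced W z e" and W: "W \<in> class_C K M" and z0: "A.ses (z 0) ?E"
    and F: "\<And>n. n \<ge> 0 \<Longrightarrow> src (z n) \<in> Fib M" and R: "\<And>n. n < 0 \<Longrightarrow> ob W n \<in> trivially_fibrant M"
    and Ed: "A.nul (?E \<bullet> dff K W 1)"
    using resolutionE[OF r] by blast
  note D = splicedD[OF s]
  note [simp] = D(4-8) dff_simps[OF D(1)] A.sesD(1-3)[OF p(1)] p(2) A.sesD(2)[OF z0]
  have T: "tgt p \<in> Obj K" using harrD(2) by simp
  note S = stalk_ob[OF T]
  define q where "q = hm (Ch K) W (to_stalk K W (tgt p) (mor (p \<bullet> ?E))) ?S"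
  have "A.nul (p \<bullet> ?E \<bullet> dff K W 1)" using A.nul_compR[OF Ed, of p] by simp
  then have q: "harr (Ch K) q" "src q = W" "tgt q = ?S" "cpt K 0 q = p \<bullet> ?E"
    unfolding q_def using to_stalk_arr[OF D(1) T, of "p \<bullet> ?E"] by (simp_all add: A.comp_assoc)
  note [simp] = q(1-3)
  have qn: "A.nul (hidn K (tgt (cpt K n q)))" if "n \<noteq> 0" for n using S(2)[OF that] by simp
  have "A.epi (cpt K n q)" for n
  proof (cases "n = 0")
    case True
    then show ?thesis using q(4) A.epi_comp[of ?E p] A.sesD(6)[OF p(1)] A.sesD(6)[OF z0] by simp
  next
    case False
    then show ?thesis using zero_epi qn by simp
  qed
  then have "Ch.A.epi q" using Ch_epiI[OF q(1)] by blast
  then obtain k where k: "Ch.A.ses k q" using Ch.A.ex_epi_ses by blast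
  have [simp]: "harr (Ch K) k" "tgt k = W" using Ch.A.sesD[OF k] by auto
  have N: "src k \<in> Obj (Ch K)" by simp
  note [simp] = dff_simps[OF N]
  have kn: "A.ses (cpt K n k) (cpt K n q)" for n using k by (rule Ch_ses_cpt)
  have kk: "A.ker (cpt K n k) (cpt K n q)" for n using kn by (simp add: A.ses_def)
  \<comment> \<open>Above degree 0 the map \<open>q\<close> is null, and \<open>cpt K n k\<close> is
    an isomorphism; applying \<open>ses_comp\<close> to \<open>e n\<close> followed by the map to a
    zero object transports the cycles of W to the kernel complex.\<close>
  have up: "\<exists>a b. A.ses a b \<and> cpt K n k \<bullet> a = z n \<and> b = e n \<bullet> cpt K n k \<and> tgt a = ob (src k) n \<and> src a = src (z n)"
    if n: "n > 0" for n
  proof -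
    obtain w where w: "A.nul w" "src w = src (z (n - 1))" "tgt w = ob ?S n"
      using A.ex_nul[of "src (z (n - 1))" "ob ?S n"] D(4)[of "n - 1"] S(4) harrD(1) by auto
    have wh: "harr K w" using A.nul_arr[OF w(1)] by simp
    have we: "w \<bullet> e n = cpt K n q"
    proof (rule A.nul_eq)
      show "A.nul (w \<bullet> e n)" using A.nul_compL[OF w(1), of "e n"] w wh by simp
      show "A.nul (cpt K n q)" using A.zero_comp[OF qn[of n]] n by simp
    qed (use w wh in simp_all)
    have "A.ses (hidn K (src w)) w" using zero_ses[OF wh] w(3) S(2)[of n] n by simp
    then obtain a b where ab: "A.ses a b" "cpt K n k \<bullet> a = z n" "e n \<bullet> cpt K n k = hidn K (src w) \<bullet> b"
      "tgt a = src (cpt K n k)" "src a = src (z n)" "tgt b = src (hidn K (src w))"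
      using A.ses_comp[OF D(2)[of n], of "hidn K (src w)" w "cpt K n k"] kk[of n] w we by auto
    have "b = e n \<bullet> cpt K n k" using ab(3,6) A.sesD(2)[OF ab(1)] wh harrD(1) by simp
    then show ?thesis using ab by auto
  qed
  \<comment> \<open>In degree 0 the kernel of \<open>p\<close> after \<epsilon> is an extension of
    \<open>src i\<close> by the cycles of W. The trivially fibrant \<open>src i\<close> is the
    excess at the cut.\<close>
  obtain a0 b0 where ab0: "A.ses a0 b0" "cpt K 0 k \<bullet> a0 = z 0" "tgt a0 = ob (src k) 0" "src a0 = src (z 0)" "tgt b0 = src i"
    using A.ses_comp[OF z0 p(1), of "cpt K 0 k"] kk[of 0] q(4) by auto
  \<comment> \<open>Degrees n < 0 are left unconstrained. In degree 0 the choice is pinned to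
    \<open>a0\<close>, because its sequence with \<open>b0\<close> is needed later.\<close>
  have "\<forall>n. \<exists>a. n \<ge> 0 \<longrightarrow> cpt K n k \<bullet> a = z n \<and> src a = src (z n) \<and> tgt a = ob (src k) n \<and>
      (n > 0 \<longrightarrow> A.ses a (e n \<bullet> cpt K n k)) \<and> (n = 0 \<longrightarrow> a = a0)"
  proof
    fix n :: int
    show "\<exists>a. n \<ge> 0 \<longrightarrow> cpt K n k \<bullet> a = z n \<and> src a = src (z n) \<and> tgt a = ob (src k) n \<and>
      (n > 0 \<longrightarrow> A.ses a (e n \<bullet> cpt K n k)) \<and> (n = 0 \<longrightarrow> a = a0)"
    proof (cases "n > 0")
      case True
      then show ?thesis using up[OF True] by auto
    next
      case False
      then show ?thesis using ab0 by (intro exI[of _ a0]) auto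
    qed
  qed
  then obtain a where a: "\<And>n. n \<ge> 0 \<Longrightarrow> cpt K n k \<bullet> a n = z n \<and> src (a n) = src (z n) \<and> tgt (a n) = ob (src k) n \<and>
      (n > 0 \<longrightarrow> A.ses (a n) (e n \<bullet> cpt K n k)) \<and> (n = 0 \<longrightarrow> a n = a0)" by metis
  have ah: "harr K (a n)" if "n \<ge> 0" for n
  proof -
    have "harr K (cpt K n k \<bullet> a n)" using a[OF that] by simp
    then show ?thesis by simp
  qed
  have "src k \<in> perp_C"
  proof (rule perp_CI[where b = 0 and zN = a and eN = "\<lambda>n. e n \<bullet> cpt K n k" and eF = b0, OF N])
    show "A.ses (a n) (e n \<bullet> cpt K n k)" if "n > 0" for n using a[of n] that by simp
    show "dff K (src k) n = a (n - 1) \<bullet> e n \<bullet> cpt K n k" if n: "n > 0" for n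
    proof -
      have an: "cpt K (n - 1) k \<bullet> a (n - 1) = z (n - 1)" "harr K (a (n - 1))"
        "src (a (n - 1)) = src (z (n - 1))" "tgt (a (n - 1)) = ob (src k) (n - 1)"
        using a[of "n - 1"] ah[of "n - 1"] n by auto
      show ?thesis
      proof (rule A.monoD[OF A.sesD(5)[OF kn[of "n - 1"]]])
      have "cpt K (n - 1) k \<bullet> dff K (src k) n = dff K W n \<bullet> cpt K n k" using cpt_dff[of k n] by simp
      also have "\<dots> = (cpt K (n - 1) k \<bullet> a (n - 1)) \<bullet> e n \<bullet> cpt K n k" unfolding D(3)[of n] an(1) A.comp_assoc ..
      finally show "cpt K (n - 1) k \<bullet> dff K (src k) n = cpt K (n - 1) k \<bullet> a (n - 1) \<bullet> e n \<bullet> cpt K n k"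
        by (simp only: A.comp_assoc)
      qed (use an in simp_all)
    qed
    show "A.ses (a 0) b0" using a[of 0] ab0 by simp
    show "A.nul (dff K (src k) 0 \<bullet> a 0)"
    proof (rule A.mono_nul[OF A.sesD(5)[OF kn[of "-1"]]])
      have "cpt K (-1) k \<bullet> dff K (src k) 0 \<bullet> a 0 = (dff K W 0 \<bullet> cpt K 0 k) \<bullet> a 0"
        using cpt_dff[of k 0] by (simp flip: A.comp_assoc)
      also have "\<dots> = dff K W 0 \<bullet> z 0" unfolding A.comp_assoc a[of 0, OF order_refl, THEN conjunct1] ..
      finally show "A.nul (cpt K (-1) k \<bullet> dff K (src k) 0 \<bullet> a 0)"
        using A.kerD(1)[OF spliced_ker[OF s, of 0]] by (simp only:)
    qed
    show "src (a m) \<in> Fib M" if "m \<ge> 0" for m using a[OF that] F[OF that] by simp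
    show "tgt b0 \<in> trivially_fibrant M" using ab0 p(3) by simp
    show "ob (src k) m \<in> trivially_fibrant M" if m: "m < 0" for m
    proof -
      \<comment> \<open>Below degree 0 the map \<open>q\<close> ends at a zero object, so its kernel
        is isomorphic to the trivially fibrant component of W.\<close>
      have "A.ker (hidn K (ob W m)) (cpt K m q)" using zero_ses[of "cpt K m q"] qn[of m] m by (simp add: A.ses_def)
      then have "src (cpt K m k) \<in> trivially_fibrant M"
        by (rule ker_iso_closed[OF cotorsion_iso_closed(2)[OF pairs(3)] _ kk]) (use R[OF m] D(1) in simp)
      then show ?thesis by simp
    qed
  qed
  then have "cofr ?S q" unfolding cofr_def using k W by auto
  then show ?thesis unfolding q_def .
qed

lemma cofr_iff: "cofr S (hm (Ch K) X q S) \<longleftrightarrow> cofibrant_replacement (Ch K) (Ch_model K M \<V>) S X q"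
proof
  assume "cofr S (hm (Ch K) X q S)"
  then obtain i where c: "src (hm (Ch K) X q S) \<in> class_C K M" and i: "Ch.A.ses i (hm (Ch K) X q S)" "src i \<in> perp_C"
    unfolding cofr_def by blast
  have h: "harr (Ch K) (hm (Ch K) X q S)" "harr (Ch K) i" "tgt i = src (hm (Ch K) X q S)" using Ch.A.sesD[OF i(1)] by auto
  have x: "src (hm (Ch K) X q S) = X" using Ch.hm_simps(1)[OF h(1)] .
  have "hm (Ch K) (src i) (mor i) X = i" using Ch.hm_eta[OF h(2)] h(3) x by simp
  then have "ses (Ch K) (src i) X S (mor i) q" using i(1) Ch.ses_hm by metis
  then show "cofibrant_replacement (Ch K) (Ch_model K M \<V>) S X q"
    unfolding cofibrant_replacement_def using i(2) c x by (auto simp: Ch_model_def)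
next
  assume "cofibrant_replacement (Ch K) (Ch_model K M \<V>) S X q"
  then obtain F i where F: "F \<in> perp_C" "ses (Ch K) F X S i q" and X: "X \<in> class_C K M"
    unfolding cofibrant_replacement_def by (auto simp: Ch_model_def)
  have s: "Ch.A.ses (hm (Ch K) F i X) (hm (Ch K) X q S)" using F(2) by (simp only: Ch.ses_hm)
  have "harr (Ch K) (hm (Ch K) F i X)" "harr (Ch K) (hm (Ch K) X q S)" using Ch.A.sesD[OF s] by auto
  then show "cofr S (hm (Ch K) X q S)" unfolding cofr_def using F(1) X s by (metis Ch.hm_simps(1,2))
qed

lemma canonical_resolution_cofibrant:
  assumes "canonical_resolution K M A W f"
  shows "cofibrant_replacement (Ch K) (Ch_model K M \<V>) (stalk K A) W f"
proof -
  obtain QA p \<epsilon> \<eta> where c: "cofibrant_replacement K M A QA p" and r: "model_resolution K M QA W \<epsilon> \<eta>"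
    and f: "f = to_stalk K W A (p \<cdot> \<epsilon>)" using assms unfolding canonical_resolution_def by blast
  obtain F i where Q: "QA \<in> Cof M" and F: "F \<in> trivially_fibrant M" "ses K F QA A i p"
    using c unfolding cofibrant_replacement_def by blast
  obtain a b where ab: "A.ses a b" "src a = F" "src b = QA" "tgt b = A" "b = hm K QA p A" using ses_arrowE[OF F(2)] by metis
  have "cofr (stalk K (tgt b)) (hm (Ch K) W (to_stalk K W (tgt b) (mor (b \<bullet> hm K (ob W 0) \<epsilon> QA))) (stalk K (tgt b)))"
    using resolution_cofr[OF r Q ab(1,3)] ab(2) F(1) by simp
  moreover have "mor (b \<bullet> hm K (ob W 0) \<epsilon> QA) = p \<cdot> \<epsilon>"
  proof -
    have 1: "harr K (hm K (ob W 0) \<epsilon> QA)" by (rule resolutionE[OF r Q]) (erule A.sesD(2))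
    have 2: "harr K (hm K QA p A)" using A.sesD(2)[OF ab(1)] ab(5) by simp
    have "harr K (hm K QA p A \<bullet> hm K (ob W 0) \<epsilon> QA)" using 1 2 by simp
    then show ?thesis unfolding ab(5) using 1 2 mor_cmp by simp
  qed
  ultimately show ?thesis unfolding cofr_iff[symmetric] f using ab(4) by simp
qed

end

context abelian_category begin

interpretation Ch: abelian_category "Ch K" by (rule Ch_abelian)

section \<open>Replacing the first argument\<close>

lemma zero_objects_ses:
  assumes h: "harr K i" "harr K p" "tgt i = src p"
    and z: "A.nul (hidn K (src i))" "A.nul (hidn K (src p))" "A.nul (hidn K (tgt p))"
  shows "A.ses i p"
proof -
  obtain v where v: "A.nul v" "src v = src p" "tgt v = src i" using A.ex_nul[of "src p" "src i"] h harrD by auto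
  note [simp] = h v(2,3) A.nul_arr[OF v(1)]
  have s: "A.ses (hidn K (src p)) p" using h(2) z(3) by (rule zero_ses)
  have o: "src p \<in> Obj K" "src i \<in> Obj K" using h harrD by blast+
  have "A.ses (hidn K (src p) \<bullet> i) p"
  proof (rule A.ses_iso_left[OF s, of i v])
    show "i \<bullet> v = hidn K (src (hidn K (src p)))"
      by (rule A.nul_eq) (use A.nul_compR[OF v(1), of i] z o in simp_all)
    show "v \<bullet> i = hidn K (src i)"
      by (rule A.nul_eq) (use A.nul_compL[OF v(1), of i] z o in simp_all)
  qed (rule h)
  then show ?thesis by simp
qed

lemma stalk_map:
  assumes a: "harr K a"
  obtains \<alpha> where "harr (Ch K) \<alpha>" "src \<alpha> = stalk K (src a)" "tgt \<alpha> = stalk K (tgt a)" "cpt K 0 \<alpha> = a"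
proof -
  have o: "src a \<in> Obj K" "tgt a \<in> Obj K" using a harrD by blast+
  note S = stalk_ob[OF o(1)]
  have "A.nul (a \<bullet> dff K (stalk K (src a)) 1)"
    by (rule A.nul_compR[OF S(3)]) (use a dff_simps[OF S(4), of 1] S(1) in simp_all)
  then show thesis using to_stalk_arr[OF S(4) o(2), of a] S(1) that by simp
qed

text \<open>The components in degree 0 give the original sequence, and in every other degree all
  three objects are zero.\<close>

lemma stalk_ses:
  assumes s: "A.ses a b"
  obtains \<alpha> \<beta> where "Ch.A.ses \<alpha> \<beta>" "src \<alpha> = stalk K (src a)" "tgt \<alpha> = stalk K (tgt a)" "tgt \<beta> = stalk K (tgt b)"
proof -
  have h: "harr K a" "harr K b" "tgt a = src b" using A.sesD[OF s] by auto
  obtain \<alpha> where \<alpha>: "harr (Ch K) \<alpha>" "src \<alpha> = stalk K (src a)" "tgt \<alpha> = stalk K (tgt a)" "cpt K 0 \<alpha> = a"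
    using stalk_map[OF h(1)] by blast
  obtain \<beta> where \<beta>: "harr (Ch K) \<beta>" "src \<beta> = stalk K (src b)" "tgt \<beta> = stalk K (tgt b)" "cpt K 0 \<beta> = b"
    using stalk_map[OF h(2)] by blast
  have o: "src a \<in> Obj K" "src b \<in> Obj K" "tgt b \<in> Obj K" using h harrD by blast+
  have "Ch.A.ses \<alpha> \<beta>"
  proof (rule Ch_sesI)
    fix n
    show "A.ses (cpt K n \<alpha>) (cpt K n \<beta>)"
    proof (cases "n = 0")
      case True
      then show ?thesis using \<alpha>(4) \<beta>(4) s by simp
    next
      case False
      then show ?thesis
        by (intro zero_objects_ses) (use \<alpha> \<beta> h stalk_ob(2)[OF o(1)] stalk_ob(2)[OF o(2)] stalk_ob(2)[OF o(3)] in simp_all)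
    qed
  qed (use \<alpha> \<beta> h in simp_all)
  then show thesis using that \<alpha> \<beta> by simp
qed

lemma spliced_build:
  assumes s: "\<And>n. A.ses (z n) (e n)" and t: "\<And>n. tgt (e n) = src (z (n - 1))"
  obtains X where "spliced X z e" "\<And>n. ob X n = src (e n)"
proof -
  have h[simp]: "harr K (z n)" "harr K (e n)" "tgt (z n) = src (e n)" for n using A.sesD(1-3)[OF s] by auto
  have 1: "harr K (z (n - 1) \<bullet> e n)" "tgt (z (n - 1) \<bullet> e n) = src (z (n - 1 - 1) \<bullet> e (n - 1))" for n
    using t by simp_all
  have 2: "A.nul ((z (n - 1 - 1) \<bullet> e (n - 1)) \<bullet> z (n - 1) \<bullet> e n)" for n
  proof -
    have "A.nul (z (n - 1 - 1) \<bullet> (e (n - 1) \<bullet> z (n - 1)) \<bullet> e n)"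
      by (rule A.nul_compR[OF A.nul_compL[OF A.sesD(7)[OF s]]]) (simp_all add: t)
    then show ?thesis by (simp only: A.comp_assoc)
  qed
  obtain X where X: "X \<in> Obj (Ch K)" "\<And>n. ob X n = src (z (n - 1) \<bullet> e n)" "\<And>n. dff K X n = z (n - 1) \<bullet> e n"
    using Ch_objI[of "\<lambda>n. z (n - 1) \<bullet> e n", OF 1 2] by blast
  then have "spliced X z e" using s by (simp add: spliced_def)
  then show thesis using that X(2) t by simp
qed

lemma nul_coboundary:
  assumes W: "W \<in> Obj (Ch K)" and f: "A.nul f" "src f = ob W n" "tgt f = B"
  shows "coboundary W B n f"
proof -
  have B: "B \<in> Obj K" using A.nul_arr[OF f(1)] f(3) harrD(2) by blast
  obtain g where g: "A.nul g" "src g = ob W (n - 1)" "tgt g = B" using A.ex_nul[of "ob W (n - 1)" B] W B by auto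
  have "g \<bullet> dff K W n = f"
    by (rule A.nul_eq) (use A.nul_compL[OF g(1), of "dff K W n"] A.nul_arr[OF g(1)] g f dff_simps[OF W] in simp_all)
  then show ?thesis unfolding coboundary_def using A.nul_arr[OF f(1)] f(3) by blast
qed

text \<open>Apply Hom(-, B) to the short exact sequence of complexes. The components of
  \<open>tgt \<pi>\<close> are orthogonal to B, so the sequence stays exact in each degree; its
  cycles are orthogonal to B too, so the subcomplex of cochains vanishing on
  \<open>src \<kappa>\<close> is acyclic. Hence restriction along \<kappa> is a
  quasi-isomorphism.\<close>

lemma restriction_cohomology:
  assumes s: "Ch.A.ses \<kappa> \<pi>" and Y: "spliced (tgt \<pi>) z e" and E: "\<And>n. A.ext0 (src (z n)) B" and B: "B \<in> Obj K"
  shows "Hom_cohomology K (src \<pi>) B n \<cong> Hom_cohomology K (src \<kappa>) B n"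
proof -
  let ?W = "src \<pi>" and ?C = "src \<kappa>" and ?Y = "tgt \<pi>"
  have [simp]: "harr (Ch K) \<kappa>" "harr (Ch K) \<pi>" "tgt \<kappa> = ?W" using Ch.A.sesD[OF s] by auto
  have W: "?W \<in> Obj (Ch K)" and C: "?C \<in> Obj (Ch K)" and YO: "?Y \<in> Obj (Ch K)" by simp_all
  note [simp] = dff_simps[OF W] dff_simps[OF C] dff_simps[OF YO]
  have sn: "A.ses (cpt K m \<kappa>) (cpt K m \<pi>)" for m using s by (rule Ch_ses_cpt)
  have dk: "cpt K (m - 1) \<kappa> \<bullet> dff K ?C m = dff K ?W m \<bullet> cpt K m \<kappa>" for m using cpt_dff[of \<kappa> m] by simp
  have dp: "cpt K (m - 1) \<pi> \<bullet> dff K ?W m = dff K ?Y m \<bullet> cpt K m \<pi>" for m using cpt_dff[of \<pi> m] by simp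
  have dk': "cpt K m \<kappa> \<bullet> dff K ?C (m + 1) = dff K ?W (m + 1) \<bullet> cpt K (m + 1) \<kappa>" for m using dk[of "m + 1"] by simp
  have dp': "cpt K m \<pi> \<bullet> dff K ?W (m + 1) = dff K ?Y (m + 1) \<bullet> cpt K (m + 1) \<pi>" for m using dp[of "m + 1"] by simp
  have extend: "\<exists>g. g \<bullet> cpt K m \<kappa> = f \<and> harr K g \<and> src g = ob ?W m \<and> tgt g = B"
    if f: "harr K f" "src f = ob ?C m" "tgt f = B" for f m
  proof -
    obtain g where g: "g \<bullet> cpt K m \<kappa> = f"
      using A.ext0_extend[OF spliced_ext0_ob[OF Y E, of m] sn[of m], of f] f by auto
    have "harr K (g \<bullet> cpt K m \<kappa>)" "tgt (g \<bullet> cpt K m \<kappa>) = B" unfolding g by fact+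
    then show ?thesis using g by auto
  qed
  \<comment> \<open>A cocycle vanishing on the subcomplex comes from a cocycle on
    \<open>tgt \<pi>\<close>, and there it is a coboundary.\<close>
  have quotient: "\<exists>l. harr K l \<and> src l = ob ?Y (m - 1) \<and> tgt l = B \<and> f = l \<bullet> dff K ?Y m \<bullet> cpt K m \<pi>"
    if f: "harr K f" "src f = ob ?W m" "tgt f = B" "A.nul (f \<bullet> cpt K m \<kappa>)" "A.nul (f \<bullet> dff K ?W (m + 1))" for f m
  proof -
    obtain h where h: "h \<bullet> cpt K m \<pi> = f" "harr K h" "tgt h = B" "src h = ob ?Y m"
      using A.ses_colift[OF sn f(4)] f(3) by auto
    have "(h \<bullet> dff K ?Y (m + 1)) \<bullet> cpt K (m + 1) \<pi> = h \<bullet> cpt K m \<pi> \<bullet> dff K ?W (m + 1)" by (simp only: A.comp_assoc dp')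
    also have "\<dots> = f \<bullet> dff K ?W (m + 1)" by (simp only: h(1) flip: A.comp_assoc)
    finally have "A.nul ((h \<bullet> dff K ?Y (m + 1)) \<bullet> cpt K (m + 1) \<pi>)" using f(5) by simp
    then have "A.nul (h \<bullet> dff K ?Y (m + 1))" by (rule A.epi_nul[OF A.sesD(6)[OF sn]])
    then obtain l where l: "l \<bullet> dff K ?Y m = h" "harr K l" "src l = ob ?Y (m - 1)" "tgt l = B"
      using spliced_factor[OF Y E h(3)] by blast
    then show ?thesis using h(1) by (metis A.comp_assoc)
  qed
  show ?thesis
  proof (rule Hom_cohomology_iso[OF W C B B, where T = "\<lambda>f. f \<bullet> cpt K n \<kappa>"])
    show "cocycle ?C B n (f \<bullet> cpt K n \<kappa>)" if "cocycle ?W B n f" for f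
      using cocycle_chain_map(1)[of \<kappa> B n f] that by simp
    show "(f \<oplus> g) \<bullet> cpt K n \<kappa> = f \<bullet> cpt K n \<kappa> \<oplus> g \<bullet> cpt K n \<kappa>" for f g by (rule A.add_comp)
    fix f assume f: "cocycle ?W B n f"
    note fD = cocycleD[OF W f]
    note [simp] = fD(1-3)
    show "coboundary ?C B n (f \<bullet> cpt K n \<kappa>) \<longleftrightarrow> coboundary ?W B n f"
    proof
      assume "coboundary ?C B n (f \<bullet> cpt K n \<kappa>)"
      then obtain g where g: "g \<bullet> dff K ?C n = f \<bullet> cpt K n \<kappa>" "harr K g" "src g = ob ?C (n - 1)" "tgt g = B"
        using coboundaryD(4)[OF C] by blast
      obtain g' where g': "g' \<bullet> cpt K (n - 1) \<kappa> = g" "harr K g'" "src g' = ob ?W (n - 1)" "tgt g' = B"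
        using extend[OF g(2-4)] by blast
      note [simp] = g'(2-4)
      have "g' \<bullet> dff K ?W n \<bullet> cpt K n \<kappa> = f \<bullet> cpt K n \<kappa>"
        by (simp only: dk[symmetric] g' g flip: A.comp_assoc)
      then have 1: "A.nul ((f \<oplus> \<ominus> (g' \<bullet> dff K ?W n)) \<bullet> cpt K n \<kappa>)"
        by (simp add: A.add_comp A.neg_comp A.comp_assoc)
      have "A.nul (g' \<bullet> dff K ?W n \<bullet> dff K ?W (n + 1))" using A.nul_compR[OF dff_dff'[OF W, of n], of g'] by simp
      then have 2: "A.nul ((f \<oplus> \<ominus> (g' \<bullet> dff K ?W n)) \<bullet> dff K ?W (n + 1))"
        using fD(4) by (simp add: A.add_comp A.neg_comp A.comp_assoc A.nul_sum)
      obtain l where l: "harr K l" "src l = ob ?Y (n - 1)" "tgt l = B"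
        "f \<oplus> \<ominus> (g' \<bullet> dff K ?W n) = l \<bullet> dff K ?Y n \<bullet> cpt K n \<pi>"
        using quotient[OF _ _ _ 1 2] by auto
      have "(l \<bullet> cpt K (n - 1) \<pi> \<oplus> g') \<bullet> dff K ?W n = (f \<oplus> \<ominus> (g' \<bullet> dff K ?W n)) \<oplus> g' \<bullet> dff K ?W n"
        by (simp only: A.add_comp A.comp_assoc dp l(4))
      also have "\<dots> = f" by (rule A.diff_add) simp_all
      finally show "coboundary ?W B n f" unfolding coboundary_def by auto
    next
      assume "coboundary ?W B n f"
      then show "coboundary ?C B n (f \<bullet> cpt K n \<kappa>)" using cocycle_chain_map(2)[of \<kappa> B n f] by simp
    qed
  next
    fix f assume f: "cocycle ?C B n f"
    note fD = cocycleD[OF C f]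
    obtain g where g: "g \<bullet> cpt K n \<kappa> = f" "harr K g" "src g = ob ?W n" "tgt g = B" using extend[OF fD(1-3)] by blast
    note [simp] = g(2-4) fD(1-3)
    \<comment> \<open>An extension \<open>g\<close> of the cocycle \<open>f\<close> need not be a
      cocycle. Its coboundary vanishes on the subcomplex, so it is the coboundary of some
      \<open>l \<bullet> cpt K n \<pi>\<close>, and subtracting this corrects \<open>g\<close>
      without changing its restriction.\<close>
    let ?h = "g \<bullet> dff K ?W (n + 1)"
    have "?h \<bullet> cpt K (n + 1) \<kappa> = f \<bullet> dff K ?C (n + 1)"
      by (simp only: A.comp_assoc dk'[symmetric]) (simp only: g(1) flip: A.comp_assoc)
    then have 1: "A.nul (?h \<bullet> cpt K (n + 1) \<kappa>)" using fD(4) by simp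
    have 2: "A.nul (?h \<bullet> dff K ?W (n + 1 + 1))"
      unfolding A.comp_assoc by (rule A.nul_compR[OF dff_dff'[OF W]]) (simp_all add: add.commute[of "1::int"])
    obtain l where l: "harr K l" "src l = ob ?Y n" "tgt l = B" "?h = l \<bullet> dff K ?Y (n + 1) \<bullet> cpt K (n + 1) \<pi>"
      using quotient[OF _ _ _ 1 2] by auto
    note [simp] = l(1-3)
    let ?g = "g \<oplus> \<ominus> (l \<bullet> cpt K n \<pi>)"
    have "?g \<bullet> dff K ?W (n + 1) = ?h \<oplus> \<ominus> ?h"
      by (simp only: A.add_comp A.neg_comp A.comp_assoc dp' l(4))
    then have c: "cocycle ?W B n ?g" by (simp add: cocycle_def)
    have ll: "A.nul (l \<bullet> cpt K n \<pi> \<bullet> cpt K n \<kappa>)" using A.nul_compR[OF A.sesD(7)[OF sn[of n]], of l] by simp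
    have Tg: "?g \<bullet> cpt K n \<kappa> = f"
      using ll by (simp add: A.add_comp A.neg_comp A.comp_assoc g(1) A.add_nul)
    obtain c0 where c0: "A.nul c0" "src c0 = ob ?C n" "tgt c0 = B" using A.ex_nul[of "ob ?C n" B] C B by auto
    have "f = c0 \<oplus> ?g \<bullet> cpt K n \<kappa>" unfolding Tg using A.nul_add[OF c0(1), of f] c0 by simp
    then show "\<exists>g c. cocycle ?W B n g \<and> coboundary ?C B n c \<and> f = c \<oplus> g \<bullet> cpt K n \<kappa>"
      using c nul_coboundary[OF C c0] by blast
  qed
qed

end

section \<open>Replacements of stalk complexes\<close>

context hereditary_model_category begin

interpretation Ch: abelian_category "Ch K" by (rule Ch_abelian)

lemma stalk_perp_C: "F \<in> trivially_fibrant M \<Longrightarrow> stalk K F \<in> perp_C"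
proof -
  assume F: "F \<in> trivially_fibrant M"
  have O: "F \<in> Obj K" using cotorsion_Obj(2)[OF pairs(3)] F by blast
  show ?thesis
  proof (rule perp_C_bounded[OF stalk_ob(4)[OF O]])
    show "ob (stalk K F) n \<in> trivially_fibrant M" if "n \<le> 0" for n
    proof (cases "n = 0")
      case True
      then show ?thesis using F stalk_ob(1)[OF O] by simp
    next
      case False
      then show ?thesis using cotorsion_zero(2)[OF pairs(3) stalk_ob(2)[OF O]] by blast
    qed
    show "A.nul (hidn K (ob (stalk K F) n))" if "n > 0" for n using stalk_ob(2)[OF O] that by simp
  qed
qed

text \<open>The kernel of the composite is an extension of the kernel of \<open>r\<close> by that of
  \<open>w\<close>, and \<open>perp_C\<close> is closed under extensions.\<close>

lemma cofr_comp:
  assumes w: "cofr E w" and r: "Ch.A.ses \<nu> r" "src \<nu> \<in> perp_C" "src r = E"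
  shows "cofr (tgt r) (r \<star> w)"
proof -
  obtain c where c: "Ch.A.ses c w" "src c \<in> perp_C" "src w \<in> class_C K M" "tgt w = E" using w by (auto simp: cofr_def)
  have h: "harr (Ch K) w" "harr (Ch K) r" using Ch.A.sesD(2)[OF c(1)] Ch.A.sesD(2)[OF r(1)] by auto
  have "Ch.A.epi (r \<star> w)"
    using Ch.A.epi_comp[of w r] Ch.A.sesD(6)[OF c(1)] Ch.A.sesD(6)[OF r(1)] c(4) r(3) by simp
  then obtain k where k: "Ch.A.ses k (r \<star> w)" using Ch.A.ex_epi_ses by blast
  then have kk: "Ch.A.ker k (r \<star> w)" by (simp add: Ch.A.ses_def)
  obtain a b where ab: "Ch.A.ses a b" "tgt a = src k" "src a = src c" "tgt b = src \<nu>"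
    using Ch.A.ses_comp[OF c(1) r(1) _ kk] c(4) r(3) by auto
  have "tgt a \<in> perp_C"
    using Ch.cotorsion_right_ext[OF Ch_pair(2) ab(1)] ab c(2) r(2) by simp
  then show ?thesis unfolding cofr_def using k ab(2) c h r(3) by auto
qed

text \<open>The case of \<open>resolution_cofr\<close> in which \<open>p\<close> is the identity,
  whose kernel is a zero object and so trivially fibrant.\<close>

lemma resolution_cofr_self:
  assumes "model_resolution K M A W \<epsilon> \<eta>" "A \<in> Cof M"
  obtains q where "cofr (stalk K A) q" "src q = W"
proof -
  have A: "A \<in> Obj K" using cotorsion_Obj(1)[OF pairs(3)] assms(2) by blast
  then have "A.epi (hidn K A)" by simp
  then obtain c where c: "A.ses c (hidn K A)" using A.ex_epi_ses by blast
  have h: "harr K c" "tgt c = A" using A.sesD(1,3)[OF c] A by auto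
  have "A.nul c" using A.sesD(7)[OF c] h by simp
  then have "A.nul (c \<bullet> hidn K (src c))" using h by simp
  then have "A.nul (hidn K (src c))" by (rule A.mono_nul[OF A.sesD(5)[OF c]])
  then have z: "src c \<in> trivially_fibrant M" using cotorsion_zero(2)[OF pairs(3)] by blast
  let ?q = "hm (Ch K) W (to_stalk K W A (mor (hidn K A \<bullet> hm K (ob W 0) \<epsilon> A))) (stalk K A)"
  have q: "cofr (stalk K A) ?q" using resolution_cofr[OF assms c _ z] A by simp
  then obtain i where "Ch.A.ses i ?q" unfolding cofr_def by blast
  then have "harr (Ch K) ?q" by (rule Ch.A.sesD)
  then have "src ?q = W" by (rule Ch.hm_simps)
  then show thesis using that q by blast
qed

text \<open>Embed D into a trivially fibrant object with cofibrant cokernel and repeat. Thickness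
  makes each cokernel trivially cofibrant, so the step can be iterated and all cycles of Y are
  trivially cofibrant. With D in degree 0, the kernel of the map to the stalk is the negative part,
  where the components are trivially fibrant.\<close>

lemma injective_stalk_replacement:
  assumes D: "D \<in> trivially_cofibrant M"
  obtains Y z e q where "spliced Y z e" "\<And>n. src (z n) \<in> trivially_cofibrant M" "Y \<in> class_C K M"
    "cofr (stalk K D) q" "src q = Y"
proof -
  have "\<exists>a b. A.ses a b \<and> src a = X \<and> tgt a \<in> trivially_fibrant M \<and> tgt b \<in> trivially_cofibrant M \<and> tgt a \<in> Cof M"
    if X: "X \<in> trivially_cofibrant M" for X
  proof -
    have XO: "X \<in> Obj K" using cotorsion_Obj(1)[OF pairs(4)] X by blast
    obtain a b where ab: "A.ses a b" "src a = X" "tgt a \<in> trivially_fibrant M" "tgt b \<in> Cof M"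
      using complete_cotorsionE'[OF pairs(1) XO] by blast
    have "tgt b \<in> Trv M" using thickD(1)[OF pairs(7) ab(1)] ab X by (simp add: trivially_cofibrant_iff trivially_fibrant_iff)
    moreover have "tgt a \<in> Cof M" using cotorsion_left_ext[OF pairs(3) ab(1)] ab X by simp
    ultimately show ?thesis using ab by auto
  qed
  then obtain a b where ab: "\<And>X. X \<in> trivially_cofibrant M \<Longrightarrow> A.ses (a X) (b X) \<and> src (a X) = X \<and>
      tgt (a X) \<in> trivially_fibrant M \<and> tgt (b X) \<in> trivially_cofibrant M \<and> tgt (a X) \<in> Cof M" by metis
  \<comment> \<open>The iterated cokernels of D.\<close>
  define S where "S k = ((\<lambda>X. tgt (b X)) ^^ k) D" for k
  have S0: "S 0 = D" and SS: "S (Suc k) = tgt (b (S k))" for k by (simp_all add: S_def)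
  have S: "S k \<in> trivially_cofibrant M" for k
  proof (induction k)
    case (Suc k)
    show ?case unfolding SS using ab[OF Suc] by blast
  qed (use D S0 in simp)
  have DO: "D \<in> Obj K" using cotorsion_Obj(1)[OF pairs(4)] D by blast
  obtain Z where Z: "A.nul (hidn K Z)" using A.ex_zero_object by blast
  have ZO: "Z \<in> Obj K" using A.nul_arr[OF Z] by simp
  obtain o' where o': "A.nul o'" "src o' = Z" "tgt o' = D" using A.ex_nul[of Z D] ZO DO by auto
  \<comment> \<open>The cycles in degree n < 0 are \<open>S (nat (- 1 - n))\<close>, so degree -1
    has D itself as its cycles and \<open>e 0\<close> is the identity of D. All cycles in degrees n
    \<ge> 0 are zero.\<close>
  define z where "z n = (if n > 0 then hidn K Z else if n = 0 then o' else a (S (nat (- 1 - n))))" for n :: int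
  define e where "e n = (if n > 0 then hidn K Z else if n = 0 then hidn K D else b (S (nat (- 1 - n))))" for n :: int
  have o's: "A.ses o' (hidn K D)"
  proof (rule A.sesI)
    have m: "A.mono o'"
      unfolding A.mono_def
    proof (intro conjI allI impI)
      fix u assume "A.nul (o' \<bullet> u)"
      from A.nul_arr[OF this] have "harr K u" "tgt u = Z" using o' by auto
      then show "A.nul u" using A.zero_comp[OF Z] by blast
    qed (rule A.nul_arr[OF o'(1)])
    have oh: "harr K o'" using A.nul_arr[OF o'(1)] .
    show "A.ker o' (hidn K D)"
    proof (rule A.kerI[OF _ m])
      show "A.nul (hidn K D \<bullet> o')" using o' oh by simp
      fix u assume u: "A.nul (hidn K D \<bullet> u)"
      have uh: "harr K u" "tgt u = D" using A.nul_arr[OF u] DO by auto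
      have nu: "A.nul u" using u uh by simp
      obtain v where v: "A.nul v" "src v = src u" "tgt v = Z" using A.ex_nul[of "src u" Z] uh ZO harrD(1) by auto
      have "o' \<bullet> v = u" by (rule A.nul_eq) (use A.nul_compR[OF v(1), of o'] A.nul_arr[OF v(1)] nu uh v o' oh in simp_all)
      then show "\<exists>v. o' \<bullet> v = u" by blast
    qed
    show "A.epi (hidn K D)" using DO by simp
  qed
  have st: "A.ses (z n) (e n) \<and> tgt (e n) = src (z (n - 1))" for n
  proof -
    consider "n > 1" | "n = 1" | "n = 0" | "n < 0" by linarith
    then show ?thesis
    proof cases
      case 4
      have "nat (- 1 - (n - 1)) = Suc (nat (- 1 - n))" using 4 by simp
      then have "z (n - 1) = a (tgt (b (S (nat (- 1 - n)))))" using 4 by (simp add: z_def SS)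
      then show ?thesis using 4 ab[OF S] ab[of "tgt (b (S (nat (- 1 - n))))"] by (simp add: z_def e_def)
    next
      case 3
      then show ?thesis using o's ab[OF D] DO by (simp add: z_def e_def S0)
    qed (use zero_ses[of "hidn K Z"] ZO Z o' in \<open>simp_all add: z_def e_def\<close>)
  qed
  obtain Y where Y: "spliced Y z e" "\<And>n. ob Y n = src (e n)" using spliced_build[of z e] st by blast
  note YD = splicedD[OF Y(1)]
  have YO: "Y \<in> Obj (Ch K)" using Y(1) by (rule splicedD)
  note [simp] = dff_simps[OF YO]
  have zero_Q: "Z \<in> trivially_cofibrant M" using cotorsion_zero(1)[OF pairs(4) Z] .
  have zQ: "src (z n) \<in> trivially_cofibrant M" for n
    using zero_Q o' ZO S ab[OF S] by (auto simp: z_def)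
  have YR: "ob Y n \<in> trivially_fibrant M" "ob Y n \<in> trivially_cofibrant M" if "n < 0" for n
  proof -
    have "ob Y n = tgt (a (S (nat (- 1 - n))))"
      using Y(2)[of n] that A.sesD(3)[OF ab[OF S, THEN conjunct1]] by (simp add: e_def)
    then show "ob Y n \<in> trivially_fibrant M" "ob Y n \<in> trivially_cofibrant M"
      using ab[OF S[of "nat (- 1 - n)"]] by (simp_all add: trivially_cofibrant_iff trivially_fibrant_iff)
  qed
  have Y0: "ob Y 0 = D" using Y(2)[of 0] DO by (simp add: e_def)
  have Yp: "ob Y n = Z" if "n > 0" for n using Y(2)[of n] that ZO by (simp add: e_def)
  have YQ: "ob Y n \<in> trivially_cofibrant M" for n
  proof -
    consider "n > 0" | "n = 0" | "n < 0" by linarith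
    then show ?thesis
    proof cases
      case 1
      show ?thesis unfolding Yp[OF 1] by (rule zero_Q)
    next
      case 2
      show ?thesis unfolding 2 Y0 by (rule D)
    qed (rule YR(2))
  qed
  have YC: "Y \<in> class_C K M"
    unfolding class_C_iff
  proof (intro exI conjI allI)
    show "spliced Y z e" by fact
    show "src (z n) \<in> Cof M" for n using zQ[of n] by (simp only: trivially_cofibrant_iff)
    show "ob Y n \<in> trivially_cofibrant M" for n by (rule YQ)
  qed
  define q where "q = hm (Ch K) Y (to_stalk K Y D (mor (hidn K D))) (stalk K D)"
  have "A.nul (dff K Y 1)" by (rule A.comp_zero[OF Z]) (use Yp[of 1] in simp_all)
  then have "A.nul (hidn K D \<bullet> dff K Y 1)" by (rule A.nul_compR) (use DO Y0 in simp_all)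
  moreover have "src (hidn K D) = ob Y 0" "tgt (hidn K D) = D" using DO Y0 by simp_all
  ultimately have q: "harr (Ch K) q" "src q = Y" "tgt q = stalk K D" "cpt K 0 q = hidn K D"
    unfolding q_def using to_stalk_arr[OF YO DO, of "hidn K D"] by blast+
  note [simp] = q(1-3)
  have qz: "A.nul (hidn K (tgt (cpt K n q)))" if "n \<noteq> 0" for n using stalk_ob(2)[OF DO that] by simp
  have "A.epi (cpt K n q)" for n
    using q(4) zero_epi[OF _ qz[of n]] DO by (cases "n = 0") simp_all
  then have "Ch.A.epi q" using Ch_epiI[OF q(1)] by blast
  then obtain k where k: "Ch.A.ses k q" using Ch.A.ex_epi_ses by blast
  have [simp]: "harr (Ch K) k" "tgt k = Y" using Ch.A.sesD[OF k] by auto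
  have NO: "src k \<in> Obj (Ch K)" by simp
  have kn: "A.ses (cpt K n k) (cpt K n q)" for n using k by (rule Ch_ses_cpt)
  have kk: "A.ker (cpt K n k) (cpt K n q)" for n using kn by (simp add: A.ses_def)
  have zero_k: "A.nul (hidn K (ob (src k) n))" if n: "A.nul (cpt K n k)" for n
  proof -
    have "A.nul (cpt K n k \<bullet> hidn K (ob (src k) n))" using n NO by simp
    then show ?thesis by (rule A.mono_nul[OF A.sesD(5)[OF kn]])
  qed
  have "src k \<in> perp_C"
  proof (rule perp_C_bounded[OF NO])
    show "A.nul (hidn K (ob (src k) n))" if "n > 0" for n
      by (rule zero_k) (use A.zero_comp[OF Z, of "cpt K n k"] Yp[OF that] in simp)
    show "ob (src k) n \<in> trivially_fibrant M" if n: "n \<le> 0" for n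
    proof (cases "n = 0")
      case True
      have "A.nul (cpt K 0 k)" using A.sesD(7)[OF kn[of 0]] q(4) Y0 by simp
      then show ?thesis using cotorsion_zero(2)[OF pairs(3) zero_k] True by blast
    next
      case False
      have "A.ker (hidn K (ob Y n)) (cpt K n q)" using zero_ses[of "cpt K n q"] qz[OF False] by (simp add: A.ses_def)
      then have "src (cpt K n k) \<in> trivially_fibrant M"
        by (rule ker_iso_closed[OF cotorsion_iso_closed(2)[OF pairs(3)] _ kk]) (use YR(1)[of n] n False YO in simp)
      then show ?thesis by simp
    qed
  qed
  then have "cofr (stalk K D) q" unfolding cofr_def using k YC by auto
  then show thesis using that Y(1) zQ YC q(2) by blast
qed

text \<open>In the application \<open>a\<close> is the fibrant replacement of QA and
  \<open>p\<close> the map from QA to A. The two resulting complexes are the middle and the left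
  term of a short exact sequence with quotient Y, so \<open>restriction_cohomology\<close> compares
  them; Y has trivially cofibrant cycles, which are orthogonal to every fibrant B.\<close>

lemma cofr_compare:
  assumes ab: "A.ses a b" "tgt b \<in> trivially_cofibrant M" and ip: "A.ses i p" "src p = src a" "src i \<in> trivially_fibrant M"
  obtains q1 q2 where "cofr (stalk K (tgt a)) q1" "cofr (stalk K (tgt p)) q2"
    "\<And>B n. B \<in> Fib M \<Longrightarrow> Hom_cohomology K (src q1) B n \<cong> Hom_cohomology K (src q2) B n"
proof -
  obtain Y z e y where Y: "spliced Y z e" "\<And>n. src (z n) \<in> trivially_cofibrant M" "Y \<in> class_C K M"
    and y: "cofr (stalk K (tgt b)) y" "src y = Y" using injective_stalk_replacement[OF ab(2)] by metis
  obtain \<nu> where \<nu>: "Ch.A.ses \<nu> y" "src \<nu> \<in> perp_C" "tgt y = stalk K (tgt b)" using y(1) by (auto simp: cofr_def)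
  obtain \<alpha> \<beta> where \<alpha>: "Ch.A.ses \<alpha> \<beta>" "src \<alpha> = stalk K (src a)" "tgt \<alpha> = stalk K (tgt a)" "tgt \<beta> = stalk K (tgt b)"
    by (rule stalk_ses[OF ab(1)])
  obtain \<iota> \<pi> where \<iota>: "Ch.A.ses \<iota> \<pi>" "src \<iota> = stalk K (src i)" "tgt \<iota> = stalk K (tgt i)" "tgt \<pi> = stalk K (tgt p)"
    by (rule stalk_ses[OF ip(1)])
  \<comment> \<open>In the pullback of \<beta> and \<open>y\<close>, the projection \<open>r\<close>
    to the stalk of \<open>tgt a\<close> inherits the kernel of \<open>y\<close>, which lies in
    \<open>perp_C\<close>; the projection \<open>t\<close> to Y inherits the stalk of
    \<open>src a\<close> as kernel.\<close>
  have "tgt \<beta> = tgt y" using \<alpha>(4) \<nu>(3) by simp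
  from this obtain \<alpha>' \<nu>' r t where P: "Ch.A.ses \<nu>' r" "Ch.A.ses \<alpha>' t" "tgt r = src \<beta>" "tgt t = src y"
      "src \<nu>' = src \<nu>" "src \<alpha>' = src \<alpha>" "src r = src t"
    by (rule Ch.A.pullback_square[OF \<alpha>(1) \<nu>(1)])
  have h[simp]: "harr (Ch K) r" "harr (Ch K) t" using Ch.A.sesD(2)[OF P(1)] Ch.A.sesD(2)[OF P(2)] by auto
  obtain c w where w: "Ch.A.ses c w" "src c \<in> perp_C" "tgt c \<in> class_C K M" "tgt w = src r"
    using Ch.complete_cotorsionE[OF Ch_pair(1), of "src r"] by auto
  have wc: "src w = tgt c" "harr (Ch K) w" using Ch.A.sesD(2-4)[OF w(1)] by auto
  have cw: "cofr (src r) w" unfolding cofr_def using w wc by auto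
  have q1: "cofr (tgt r) (r \<star> w)" using cofr_comp[OF cw P(1)] P(5) \<nu>(2) by simp
  have "tgt r = stalk K (tgt a)" using P(3) \<alpha>(3) Ch.A.sesD(3)[OF \<alpha>(1)] by simp
  then have q1': "cofr (stalk K (tgt a)) (r \<star> w)" using q1 by simp
  have s1: "src (r \<star> w) = src w" "src (t \<star> w) = src w" "tgt (t \<star> w) = Y" using wc w(4) P(4,7) y(2) by simp_all
  have "Ch.A.epi (t \<star> w)"
    using Ch.A.epi_comp[of w t] Ch.A.sesD(6)[OF w(1)] Ch.A.sesD(6)[OF P(2)] w(4) P(7) by simp
  then obtain \<kappa> where \<kappa>: "Ch.A.ses \<kappa> (t \<star> w)" using Ch.A.ex_epi_ses by blast
  have kk: "Ch.A.ker \<kappa> (t \<star> w)" using \<kappa> by (simp add: Ch.A.ses_def)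
  have \<kappa>C: "src \<kappa> \<in> class_C K M"
    using class_C_ker[OF \<kappa>] s1 wc w(3) Y(3) by simp
  \<comment> \<open>The kernel of \<open>t \<star> w\<close> maps onto the kernel of
    \<open>t\<close>, the stalk of \<open>src a\<close>, and the kernel of that map is again the
    kernel of \<open>w\<close>. So \<open>b'\<close> is a cofibrant replacement.\<close>
  obtain a' b' where ab': "Ch.A.ses a' b'" "tgt a' = src \<kappa>" "src a' = src c" "tgt b' = src \<alpha>'"
    using Ch.A.ses_comp[OF w(1) P(2) _ kk] w(4) P(7) by auto
  have b's: "src b' = src \<kappa>" "harr (Ch K) b'" using Ch.A.sesD(2-4)[OF ab'(1)] ab'(2) by auto
  have cb: "cofr (stalk K (src a)) b'"
    unfolding cofr_def using ab' b's \<kappa>C w(2) P(6) \<alpha>(2) by auto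
  have p1: "src \<pi> = stalk K (src a)"
    using Ch.A.sesD(3)[OF \<iota>(1)] \<iota>(3) A.sesD(3)[OF ip(1)] ip(2) by simp
  \<comment> \<open>Passing from the stalk of \<open>src p\<close> to that of \<open>tgt p\<close>
    costs only the stalk of a trivially fibrant object, which lies in \<open>perp_C\<close>.\<close>
  have q2: "cofr (stalk K (tgt p)) (\<pi> \<star> b')"
    using cofr_comp[OF cb \<iota>(1) _ p1] stalk_perp_C[OF ip(3)] \<iota>(2,4) by simp
  have "tgt b' = src \<pi>" using ab'(4) P(6) \<alpha>(2) p1 by simp
  then have s2: "src (\<pi> \<star> b') = src \<kappa>" using b's Ch.A.sesD(2)[OF \<iota>(1)] by simp
  have "Hom_cohomology K (src (r \<star> w)) B n \<cong> Hom_cohomology K (src (\<pi> \<star> b')) B n" if B: "B \<in> Fib M" for B n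
  proof -
    have Y': "spliced (tgt (t \<star> w)) z e" using Y(1) s1(3) by simp
    have "Hom_cohomology K (src (t \<star> w)) B n \<cong> Hom_cohomology K (src \<kappa>) B n"
      using restriction_cohomology[OF \<kappa> Y' cotorsion_ext0[OF pairs(4) Y(2) B]] cotorsion_Obj(2)[OF pairs(4)] B by blast
    then show ?thesis using s1 s2 by simp
  qed
  then show thesis using that[OF q1' q2] by blast
qed

end

context abelian_category begin

interpretation Ch: abelian_category "Ch K" by (rule Ch_abelian)

section \<open>Replacing the second argument\<close>

lemma cocycle_comp:
  assumes X: "X \<in> Obj (Ch K)" and u: "harr K u" "src u = B" "tgt u = B'"
  shows "cocycle X B n f \<Longrightarrow> cocycle X B' n (u \<bullet> f)"
    "coboundary X B n f \<Longrightarrow> coboundary X B' n (u \<bullet> f)"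
proof -
  { assume f: "cocycle X B n f"
    note [simp] = cocycleD(1-3)[OF X f] u dff_simps[OF X]
    have "A.nul (u \<bullet> f \<bullet> dff K X (n + 1))" by (rule A.nul_compR[OF cocycleD(4)[OF X f]]) simp_all
    then show "cocycle X B' n (u \<bullet> f)" by (simp add: cocycle_def A.comp_assoc) }
  { assume f: "coboundary X B n f"
    note [simp] = coboundaryD(1-3)[OF X f] u
    obtain g where g: "g \<bullet> dff K X n = f" using coboundaryD(4)[OF X f] by blast
    have "(u \<bullet> g) \<bullet> dff K X n = u \<bullet> f" by (simp only: A.comp_assoc g)
    then show "coboundary X B' n (u \<bullet> f)" unfolding coboundary_def by auto }
qed

lemma acyclic_coboundary:
  assumes s: "spliced X z e" and E: "\<And>n. A.ext0 (src (z n)) B" and f: "cocycle X B n f"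
  shows "coboundary X B n f"
proof -
  note X = splicedD(1)[OF s]
  show ?thesis
    using spliced_factor[OF s E cocycleD(3,4)[OF X f]] cocycleD(1,3)[OF X f] unfolding coboundary_def by blast
qed

end

section \<open>Cochains with values in fibrant and trivially fibrant objects\<close>

context hereditary_model_category begin

interpretation Ch: abelian_category "Ch K" by (rule Ch_abelian)

text \<open>The map \<open>m\<close> extends over an embedding of C into a trivially fibrant object,
  because the cokernel is trivially cofibrant and G is fibrant. Hom(X, -) of a trivially fibrant
  object is acyclic, so the image of \<open>f\<close> there is already a coboundary.\<close>

lemma fibrant_factor_coboundary:
  assumes X: "X \<in> class_C K M" and C: "C \<in> trivially_cofibrant M" and G: "G \<in> Fib M"
    and m: "harr K m" "src m = C" "tgt m = G" and f: "cocycle X C n f"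
  shows "coboundary X G n (m \<bullet> f)"
proof -
  obtain z e where s: "spliced X z e" and z: "\<And>n. src (z n) \<in> Cof M"
    using X class_C_iff by auto
  have XO: "X \<in> Obj (Ch K)" using s by (rule splicedD)
  have CO: "C \<in> Obj K" using cotorsion_Obj(1)[OF pairs(4)] C by blast
  obtain a b where ab: "A.ses a b" "src a = C" "tgt a \<in> trivially_fibrant M" "tgt b \<in> Cof M"
    using complete_cotorsionE'[OF pairs(1) CO] by blast
  have "tgt b \<in> Trv M"
    using thickD(1)[OF pairs(7) ab(1)] ab C by (simp add: trivially_cofibrant_iff trivially_fibrant_iff)
  then have "tgt b \<in> trivially_cofibrant M" using ab(4) by (simp add: trivially_cofibrant_iff)
  from cotorsion_ext0[OF pairs(4) this G]
  obtain l where l: "l \<bullet> a = m" using A.ext0_extend[of "tgt b" G a b m] ab m by auto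
  have ah: "harr K a" using A.sesD(1)[OF ab(1)] .
  have "harr K (l \<bullet> a)" "tgt (l \<bullet> a) = G" unfolding l by fact+
  then have lh: "harr K l" "src l = tgt a" "tgt l = G" by auto
  have "cocycle X (tgt a) n (a \<bullet> f)" using cocycle_comp(1)[OF XO ah ab(2) refl f] .
  then have "coboundary X (tgt a) n (a \<bullet> f)"
    by (rule acyclic_coboundary[OF s cotorsion_ext0[OF pairs(3) z ab(3)]])
  then have "coboundary X G n (l \<bullet> a \<bullet> f)" by (rule cocycle_comp(2)[OF XO lh])
  then show ?thesis by (simp only: l flip: A.comp_assoc)
qed

lemma trivial_kernel_lift:
  assumes X: "X \<in> class_C K M" and s: "A.ses i \<pi>" "src i \<in> trivially_fibrant M"
    and g: "harr K g" "src g = ob X n" "tgt g = tgt \<pi>"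
  obtains g' where "\<pi> \<bullet> g' = g" "harr K g'" "src g' = ob X n" "tgt g' = src \<pi>"
proof -
  have "ob X n \<in> Cof M" using X class_C_iff by auto
  then have "A.ext0 (ob X n) (src i)" using cotorsion_ext0[OF pairs(3) _ s(2)] by blast
  then obtain g' where g': "\<pi> \<bullet> g' = g" using A.ext0_lift[OF _ s(1) refl g] by blast
  have "harr K (\<pi> \<bullet> g')" "src (\<pi> \<bullet> g') = ob X n" unfolding g' by fact+
  then show thesis using that g' by auto
qed

text \<open>Injectivity of \<pi> on cohomology: components of X are orthogonal to the kernel of
  \<pi>, so Hom(X, -) of the sequence is exact in each degree, and its first term is acyclic because
  the cycles are orthogonal as well.\<close>

lemma trivial_kernel_coboundary:
  assumes X: "X \<in> class_C K M" and s: "A.ses i \<pi>" "src i \<in> trivially_fibrant M"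
    and f: "cocycle X (src \<pi>) n f" and c: "coboundary X (tgt \<pi>) n (\<pi> \<bullet> f)"
  shows "coboundary X (src \<pi>) n f"
proof -
  obtain z e where sp: "spliced X z e" and z: "\<And>n. src (z n) \<in> Cof M" using X class_C_iff by auto
  have XO: "X \<in> Obj (Ch K)" using sp by (rule splicedD)
  note [simp] = dff_simps[OF XO] cocycleD(1-3)[OF XO f] A.sesD(1-3)[OF s(1)]
  obtain g where g: "g \<bullet> dff K X n = \<pi> \<bullet> f" "harr K g" "src g = ob X (n - 1)" "tgt g = tgt \<pi>"
    using coboundaryD(4)[OF XO c] by blast
  obtain g' where g': "\<pi> \<bullet> g' = g" "harr K g'" "src g' = ob X (n - 1)" "tgt g' = src \<pi>"
    by (rule trivial_kernel_lift[OF X s g(2-4)])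
  note [simp] = g'(2-4)
  let ?d = "f \<oplus> \<ominus> (g' \<bullet> dff K X n)"
  have "\<pi> \<bullet> g' \<bullet> dff K X n = \<pi> \<bullet> f" by (simp only: g' g flip: A.comp_assoc)
  then have "A.nul (\<pi> \<bullet> ?d)" by (simp add: A.comp_add A.comp_neg)
  then obtain h where h: "i \<bullet> h = ?d" "harr K h" "src h = ob X n" "tgt h = src i"
    using A.ses_lift[OF s(1), of ?d] by auto
  note [simp] = h(2-4)
  have "cocycle X (src \<pi>) n (g' \<bullet> dff K X n)"
  proof (rule coboundary_cocycle[OF XO])
    show "coboundary X (src \<pi>) n (g' \<bullet> dff K X n)" unfolding coboundary_def by auto
  qed
  then have "cocycle X (src \<pi>) n ?d" using cocycle_add[OF XO f] cocycle_add(2)[OF XO] by blast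
  then have "A.nul ((i \<bullet> h) \<bullet> dff K X (n + 1))" unfolding h(1) by (rule cocycleD(4)[OF XO])
  then have "A.nul (i \<bullet> h \<bullet> dff K X (n + 1))" by (simp only: A.comp_assoc)
  then have "A.nul (h \<bullet> dff K X (n + 1))" by (rule A.mono_nul[OF A.sesD(5)[OF s(1)]])
  then have "cocycle X (src i) n h" by (simp add: cocycle_def)
  then have "coboundary X (src i) n h" by (rule acyclic_coboundary[OF sp cotorsion_ext0[OF pairs(3) z s(2)]])
  then obtain l where l: "l \<bullet> dff K X n = h" "harr K l" "src l = ob X (n - 1)" "tgt l = src i"
    using coboundaryD(4)[OF XO] by blast
  note [simp] = l(2-4)
  have "(i \<bullet> l \<oplus> g') \<bullet> dff K X n = ?d \<oplus> g' \<bullet> dff K X n" by (simp only: A.add_comp A.comp_assoc l(1) h(1))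
  also have "\<dots> = f" by (rule A.diff_add) simp_all
  finally show ?thesis unfolding coboundary_def by auto
qed

text \<open>The matching surjectivity, on the level of cocycles: the coboundary of a lift takes
  values in the kernel \<open>src i\<close>, is a coboundary there, and the lift is corrected
  accordingly.\<close>

lemma trivial_kernel_cocycle_lift:
  assumes X: "X \<in> class_C K M" and s: "A.ses i \<pi>" "src i \<in> trivially_fibrant M"
    and f: "cocycle X (tgt \<pi>) n f"
  obtains g where "cocycle X (src \<pi>) n g" "\<pi> \<bullet> g = f"
proof -
  obtain z e where sp: "spliced X z e" and z: "\<And>n. src (z n) \<in> Cof M" using X class_C_iff by auto
  have XO: "X \<in> Obj (Ch K)" using sp by (rule splicedD)
  note [simp] = dff_simps[OF XO] cocycleD(1-3)[OF XO f] A.sesD(1-3)[OF s(1)]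
  obtain g where g: "\<pi> \<bullet> g = f" "harr K g" "src g = ob X n" "tgt g = src \<pi>"
    by (rule trivial_kernel_lift[OF X s cocycleD(1-3)[OF XO f]])
  note [simp] = g(2-4)
  have "\<pi> \<bullet> g \<bullet> dff K X (n + 1) = f \<bullet> dff K X (n + 1)" by (simp only: g(1) flip: A.comp_assoc)
  then have "A.nul (\<pi> \<bullet> g \<bullet> dff K X (n + 1))" using cocycleD(4)[OF XO f] by simp
  then obtain h where h: "i \<bullet> h = g \<bullet> dff K X (n + 1)" "harr K h" "src h = ob X (n + 1)" "tgt h = src i"
    using A.ses_lift[OF s(1), of "g \<bullet> dff K X (n + 1)"] by auto
  note [simp] = h(2-4)
  have "A.nul (g \<bullet> dff K X (n + 1) \<bullet> dff K X (n + 1 + 1))"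
    by (rule A.nul_compR[OF dff_dff'[OF XO]]) (simp_all add: add.commute[of "1::int"])
  then have "A.nul (i \<bullet> h \<bullet> dff K X (n + 1 + 1))" by (simp only: h(1) flip: A.comp_assoc)
  then have "A.nul (h \<bullet> dff K X (n + 1 + 1))" by (rule A.mono_nul[OF A.sesD(5)[OF s(1)]])
  then have "cocycle X (src i) (n + 1) h" by (simp add: cocycle_def)
  then have "coboundary X (src i) (n + 1) h" by (rule acyclic_coboundary[OF sp cotorsion_ext0[OF pairs(3) z s(2)]])
  then obtain l where l: "l \<bullet> dff K X (n + 1) = h" "harr K l" "src l = ob X n" "tgt l = src i"
    using coboundaryD(4)[OF XO, of "src i" "n + 1" h] by auto
  note [simp] = l(2-4)
  let ?g = "g \<oplus> \<ominus> (i \<bullet> l)"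
  have "?g \<bullet> dff K X (n + 1) = g \<bullet> dff K X (n + 1) \<oplus> \<ominus> (g \<bullet> dff K X (n + 1))"
    by (simp only: A.add_comp A.neg_comp A.comp_assoc l(1) h(1))
  then have c: "cocycle X (src \<pi>) n ?g" by (simp add: cocycle_def)
  have "A.nul ((\<pi> \<bullet> i) \<bullet> l)" by (rule A.nul_compL[OF A.sesD(7)[OF s(1)]]) simp_all
  then have "A.nul (\<pi> \<bullet> i \<bullet> l)" by (simp only: A.comp_assoc)
  then have "\<pi> \<bullet> ?g = f" by (simp add: A.comp_add A.comp_neg g(1) A.add_nul)
  then show thesis using that c by blast
qed

text \<open>In the application \<open>j\<close> embeds QB in RQB, \<open>k\<close> embeds B in RB,
  and \<open>q\<close> is QB to B with kernel \<open>f\<close>. The comparison \<open>u\<close>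
  extends \<open>k \<bullet> q\<close>. It factors as \<open>u' \<bullet> \<pi>\<close>, where \<pi>
  divides out the trivially fibrant \<open>src f\<close> and so is an isomorphism on cohomology,
  while \<open>u'\<close> has \<open>v\<close> as an inverse up to maps that factor through
  \<open>tgt c\<close> and \<open>tgt d\<close>. The detour is forced because extension along
  \<open>k\<close> yields a map from RB only into fibrant objects that receive B, and that is
  \<open>tgt \<pi>\<close>.\<close>

lemma fibrant_target_iso:
  assumes X: "X \<in> class_C K M"
    and f: "A.ses f q" "src f \<in> trivially_fibrant M"
    and j: "A.ses j c" "src j = src q" "tgt j \<in> Fib M" "tgt c \<in> trivially_cofibrant M"
    and k: "A.ses k d" "src k = tgt q" "tgt k \<in> Fib M" "tgt d \<in> trivially_cofibrant M"
  shows "Hom_cohomology K X (tgt j) n \<cong> Hom_cohomology K X (tgt k) n"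
proof -
  have XO: "X \<in> Obj (Ch K)" using class_C_Obj[OF X] .
  have h[simp]: "harr K f" "harr K q" "tgt f = src q" "harr K j" "harr K c" "src c = tgt j" "src j = src q"
    "harr K k" "harr K d" "src d = tgt k" "src k = tgt q"
    using A.sesD(1-4)[OF f(1)] A.sesD(1-4)[OF j(1)] A.sesD(1-4)[OF k(1)] j(2) k(2) by blast+
  have RO: "tgt j \<in> Obj K" "tgt k \<in> Obj K" using h harrD(2) by blast+
  have "A.mono (j \<bullet> f)" using A.mono_comp[of j f] A.sesD(5)[OF f(1)] A.sesD(5)[OF j(1)] by simp
  then obtain \<pi> where \<pi>: "A.ses (j \<bullet> f) \<pi>" using A.ex_mono_ses by blast
  have [simp]: "harr K \<pi>" "src \<pi> = tgt j" using A.sesD(2,4)[OF \<pi>] by simp_all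
  have sF: "src (j \<bullet> f) \<in> trivially_fibrant M" using f(2) by simp
  \<comment> \<open>Fibrancy of the quotient is what permits \<beta> to be extended along
    \<open>k\<close>; it needs heredity, as a quotient of fibrant objects.\<close>
  have P: "tgt \<pi> \<in> Fib M"
  proof (rule hereditary_coker[OF pairs(4,6) \<pi>])
    show "src (j \<bullet> f) \<in> Fib M" using sF by (simp only: trivially_fibrant_iff)
    show "tgt (j \<bullet> f) \<in> Fib M" using j(3) by simp
  qed
  have jf: "A.nul (\<pi> \<bullet> j \<bullet> f)" using A.sesD(7)[OF \<pi>] .
  then have "A.nul ((\<pi> \<bullet> j) \<bullet> f)" by (simp only: A.comp_assoc)
  then obtain \<beta> where \<beta>: "\<beta> \<bullet> q = \<pi> \<bullet> j" "harr K \<beta>" "tgt \<beta> = tgt \<pi>" "src \<beta> = tgt q"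
    using A.ses_colift[OF f(1), of "\<pi> \<bullet> j"] by auto
  note [simp] = \<beta>(2-4)
  obtain v where v: "v \<bullet> k = \<beta>"
    using A.ext0_extend[OF cotorsion_ext0[OF pairs(4) k(4) P] k(1) refl, of \<beta>] by auto
  have "harr K (v \<bullet> k)" "tgt (v \<bullet> k) = tgt \<pi>" unfolding v by simp_all
  then have [simp]: "harr K v" "src v = tgt k" "tgt v = tgt \<pi>" by auto
  obtain u where u: "u \<bullet> j = k \<bullet> q"
    using A.ext0_extend[OF cotorsion_ext0[OF pairs(4) j(4) k(3)] j(1) refl, of "k \<bullet> q"] by auto
  have "harr K (u \<bullet> j)" "tgt (u \<bullet> j) = tgt k" unfolding u by simp_all
  then have [simp]: "harr K u" "src u = tgt j" "tgt u = tgt k" by auto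
  have "u \<bullet> j \<bullet> f = k \<bullet> q \<bullet> f" by (simp only: u flip: A.comp_assoc)
  moreover have "A.nul (k \<bullet> q \<bullet> f)" by (rule A.nul_compR[OF A.sesD(7)[OF f(1)]]) simp_all
  ultimately have "A.nul (u \<bullet> j \<bullet> f)" by simp
  then obtain u' where u': "u' \<bullet> \<pi> = u" "harr K u'" "src u' = tgt \<pi>" "tgt u' = tgt k"
    using A.ses_colift[OF \<pi>, of u] by auto
  note [simp] = u'(2-4)
  have "(v \<bullet> u' \<bullet> \<pi>) \<bullet> j = v \<bullet> u \<bullet> j" by (simp only: A.comp_assoc flip: u'(1))
  also have "\<dots> = (v \<bullet> k) \<bullet> q" by (simp only: u A.comp_assoc)
  finally have "(v \<bullet> u' \<bullet> \<pi>) \<bullet> j = \<pi> \<bullet> j" by (simp only: v \<beta>(1))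
  \<comment> \<open>The composite of \<open>v\<close> and \<open>u'\<close> agrees with the identity
    after \<pi> on the image of \<open>j\<close>, so the difference factors through the cokernel
    \<open>c\<close> of \<open>j\<close>, that is, through a trivially cofibrant object.\<close>
  then have "A.nul ((v \<bullet> u' \<bullet> \<pi> \<oplus> \<ominus> \<pi>) \<bullet> j)" unfolding A.add_comp A.neg_comp by simp
  then obtain m where m: "m \<bullet> c = v \<bullet> u' \<bullet> \<pi> \<oplus> \<ominus> \<pi>" "harr K m" "src m = tgt c" "tgt m = tgt \<pi>"
    using A.ses_colift[OF j(1), of "v \<bullet> u' \<bullet> \<pi> \<oplus> \<ominus> \<pi>"] by auto
  have u\<beta>: "u' \<bullet> \<beta> = k"
  proof (rule A.epiD[OF A.sesD(6)[OF f(1)]])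
    have "(u' \<bullet> \<beta>) \<bullet> q = (u' \<bullet> \<pi>) \<bullet> j" by (simp only: A.comp_assoc \<beta>(1))
    then show "(u' \<bullet> \<beta>) \<bullet> q = k \<bullet> q" unfolding u'(1) u .
  qed simp_all
  let ?I = "hidn K (tgt k)"
  have "(u' \<bullet> v) \<bullet> k = k" by (simp only: A.comp_assoc v u\<beta>)
  then have "A.nul ((u' \<bullet> v \<oplus> \<ominus> ?I) \<bullet> k)" unfolding A.add_comp A.neg_comp by simp
  then obtain m' where m': "m' \<bullet> d = u' \<bullet> v \<oplus> \<ominus> ?I" "harr K m'" "src m' = tgt d" "tgt m' = tgt k"
    using A.ses_colift[OF k(1), of "u' \<bullet> v \<oplus> \<ominus> ?I"] RO by auto
  show ?thesis
  proof (rule Hom_cohomology_iso[OF XO XO RO, where T = "\<lambda>x. u \<bullet> x"])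
    show "cocycle X (tgt k) n (u \<bullet> x)" if "cocycle X (tgt j) n x" for x
      by (rule cocycle_comp(1)[OF XO _ _ _ that]) simp_all
    show "u \<bullet> (x \<oplus> y) = u \<bullet> x \<oplus> u \<bullet> y" for x y by (rule A.comp_add)
    fix x assume x: "cocycle X (tgt j) n x"
    note [simp] = cocycleD(1-3)[OF XO x]
    show "coboundary X (tgt k) n (u \<bullet> x) \<longleftrightarrow> coboundary X (tgt j) n x"
    proof
      assume "coboundary X (tgt k) n (u \<bullet> x)"
      then have 1: "coboundary X (tgt \<pi>) n (v \<bullet> u \<bullet> x)" by (rule cocycle_comp(2)[OF XO, rotated -1]) simp_all
      have "cocycle X (tgt c) n (c \<bullet> x)" by (rule cocycle_comp(1)[OF XO _ _ _ x]) simp_all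
      then have "coboundary X (tgt \<pi>) n (m \<bullet> c \<bullet> x)"
        by (rule fibrant_factor_coboundary[OF X j(4) P m(2-4)])
      moreover have "m \<bullet> c \<bullet> x = v \<bullet> u \<bullet> x \<oplus> \<ominus> (\<pi> \<bullet> x)"
      proof -
        have "m \<bullet> c \<bullet> x = (v \<bullet> u' \<bullet> \<pi> \<oplus> \<ominus> \<pi>) \<bullet> x" by (simp only: m(1) flip: A.comp_assoc)
        then show ?thesis by (simp only: A.add_comp A.neg_comp A.comp_assoc flip: u'(1))
      qed
      ultimately have 2: "coboundary X (tgt \<pi>) n (v \<bullet> u \<bullet> x \<oplus> \<ominus> (\<pi> \<bullet> x))" by simp
      have "coboundary X (tgt \<pi>) n (\<ominus> (v \<bullet> u \<bullet> x \<oplus> \<ominus> (\<pi> \<bullet> x)) \<oplus> v \<bullet> u \<bullet> x)"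
        using coboundary_add(1)[OF XO coboundary_add(2)[OF XO 2 2] 1] .
      moreover have "\<ominus> (v \<bullet> u \<bullet> x \<oplus> \<ominus> (\<pi> \<bullet> x)) \<oplus> v \<bullet> u \<bullet> x = \<pi> \<bullet> x"
      proof -
        have "\<ominus> (v \<bullet> u \<bullet> x \<oplus> \<ominus> (\<pi> \<bullet> x)) \<oplus> v \<bullet> u \<bullet> x = (\<pi> \<bullet> x \<oplus> \<ominus> (v \<bullet> u \<bullet> x)) \<oplus> v \<bullet> u \<bullet> x"
          by (simp add: A.neg_add A.add_commute)
        also have "\<dots> = \<pi> \<bullet> x" by (rule A.diff_add) simp_all
        finally show ?thesis .
      qed
      ultimately have "coboundary X (tgt \<pi>) n (\<pi> \<bullet> x)" by simp
      then have "coboundary X (src \<pi>) n x"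
        by (rule trivial_kernel_coboundary[OF X \<pi> sF, rotated]) (use x in simp)
      then show "coboundary X (tgt j) n x" by simp
    next
      assume "coboundary X (tgt j) n x"
      then show "coboundary X (tgt k) n (u \<bullet> x)" by (rule cocycle_comp(2)[OF XO, rotated -1]) simp_all
    qed
  next
    fix y assume y: "cocycle X (tgt k) n y"
    note [simp] = cocycleD(1-3)[OF XO y]
    \<comment> \<open>The preimage of \<open>y\<close> is found by moving to
      \<open>tgt \<pi>\<close> with \<open>v\<close> and lifting the cocycle along \<pi>. Applying
      \<open>u\<close> then returns \<open>u' \<bullet> v \<bullet> y\<close>, which differs from
      \<open>y\<close> by the coboundary \<open>m' \<bullet> d \<bullet> y\<close>.\<close>
    have "cocycle X (tgt \<pi>) n (v \<bullet> y)" by (rule cocycle_comp(1)[OF XO _ _ _ y]) simp_all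
    then obtain g where g: "cocycle X (src \<pi>) n g" "\<pi> \<bullet> g = v \<bullet> y"
      by (rule trivial_kernel_cocycle_lift[OF X \<pi> sF])
    have "cocycle X (tgt d) n (d \<bullet> y)" by (rule cocycle_comp(1)[OF XO _ _ _ y]) simp_all
    then have c: "coboundary X (tgt k) n (m' \<bullet> d \<bullet> y)"
      by (rule fibrant_factor_coboundary[OF X k(4,3) m'(2-4)])
    have ug: "u \<bullet> g = u' \<bullet> v \<bullet> y" by (simp only: A.comp_assoc g(2) flip: u'(1))
    have "m' \<bullet> d \<bullet> y = (u' \<bullet> v \<oplus> \<ominus> ?I) \<bullet> y" by (simp only: m'(1) flip: A.comp_assoc)
    then have e: "m' \<bullet> d \<bullet> y = u \<bullet> g \<oplus> \<ominus> y" unfolding ug by (simp add: A.add_comp A.neg_comp A.comp_assoc)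
    have ugh: "harr K (u \<bullet> g)" "src (u \<bullet> g) = ob X n" "tgt (u \<bullet> g) = tgt k" unfolding ug by simp_all
    have "\<ominus> (m' \<bullet> d \<bullet> y) \<oplus> u \<bullet> g = (y \<oplus> \<ominus> (u \<bullet> g)) \<oplus> u \<bullet> g"
      unfolding e by (simp add: A.neg_add A.add_commute)
    also have "\<dots> = y" by (rule A.diff_add) (simp_all only: ugh cocycleD(1-3)[OF XO y])
    finally have "y = \<ominus> (m' \<bullet> d \<bullet> y) \<oplus> u \<bullet> g" by (rule sym)
    moreover have "cocycle X (tgt j) n g" using g(1) by simp
    ultimately show "\<exists>x c. cocycle X (tgt j) n x \<and> coboundary X (tgt k) n c \<and> y = c \<oplus> u \<bullet> x"
      using coboundary_add(2)[OF XO c c] by blast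
  qed
qed

text \<open>With W fixed the target changes from RQB to RB. Then, with target RB, W is exchanged for
  another replacement of the stalk of RQA, that one for a replacement of the stalk of A, and the
  latter for C. The middle exchange is \<open>cofr_compare\<close>, the outer two are
  \<open>cofr_cohomology\<close>.\<close>

lemma Ext_Ho_iso:
  assumes E: "is_Ext_Ho K M A B n E"
    and C: "cofibrant_replacement (Ch K) (Ch_model K M \<V>) (stalk K A) C q"
    and R: "fibrant_replacement K M B RB l"
  shows "E \<cong> Hom_cohomology K C RB n"
proof -
  obtain QA RQA QB RQB p j r k W \<epsilon> \<eta> where
    QA: "cofibrant_replacement K M A QA p" and RQA: "fibrant_replacement K M QA RQA j" and
    QB: "cofibrant_replacement K M B QB r" and RQB: "fibrant_replacement K M QB RQB k" and
    W: "RQA \<in> Cof M" "model_resolution K M RQA W \<epsilon> \<eta>" "E = Hom_cohomology K W RQB n"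
    using E unfolding is_Ext_Ho_def is_Ext_model_def by blast
  obtain F i where F: "F \<in> trivially_fibrant M" "ses K F QA A i p" using QA unfolding cofibrant_replacement_def by blast
  obtain D b where D: "D \<in> trivially_cofibrant M" "ses K QA RQA D j b" using RQA unfolding fibrant_replacement_def by blast
  obtain F' i' where F': "F' \<in> trivially_fibrant M" "ses K F' QB B i' r" using QB unfolding cofibrant_replacement_def by blast
  obtain D' b' where RQB': "RQB \<in> Fib M" and D': "D' \<in> trivially_cofibrant M" "ses K QB RQB D' k b'"
    using RQB unfolding fibrant_replacement_def by blast
  obtain D2 b2 where RB: "RB \<in> Fib M" and D2: "D2 \<in> trivially_cofibrant M" "ses K B RB D2 l b2"
    using R unfolding fibrant_replacement_def by blast
  obtain a1 c1 where s1: "A.ses a1 c1" "src a1 = F" "src c1 = QA" "tgt c1 = A" using ses_arrowE[OF F(2)] by metis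
  obtain a2 c2 where s2: "A.ses a2 c2" "src a2 = QA" "tgt a2 = RQA" "tgt c2 = D" using ses_arrowE[OF D(2)] by metis
  obtain a3 c3 where s3: "A.ses a3 c3" "src a3 = F'" "src c3 = QB" "tgt c3 = B" using ses_arrowE[OF F'(2)] by metis
  obtain a4 c4 where s4: "A.ses a4 c4" "src a4 = QB" "tgt a4 = RQB" "tgt c4 = D'" using ses_arrowE[OF D'(2)] by metis
  obtain a5 c5 where s5: "A.ses a5 c5" "src a5 = B" "tgt a5 = RB" "tgt c5 = D2" using ses_arrowE[OF D2(2)] by metis
  obtain w where w: "cofr (stalk K RQA) w" "src w = W" by (rule resolution_cofr_self[OF W(2,1)])
  have WC: "W \<in> class_C K M" using w by (auto simp: cofr_def)
  have RBO: "RB \<in> Obj K" using cotorsion_Obj(2)[OF pairs(4)] RB by blast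
  have 1: "Hom_cohomology K W RQB n \<cong> Hom_cohomology K W RB n"
    using fibrant_target_iso[OF WC s3(1) _ s4(1) _ _ _ s5(1), of n] s3 s4 s5 F'(1) RQB' D'(1) RB D2(1) by simp
  obtain q1 q2 where q1: "cofr (stalk K RQA) q1" and q2: "cofr (stalk K A) q2"
    and q12: "Hom_cohomology K (src q1) RB n \<cong> Hom_cohomology K (src q2) RB n"
  proof (rule cofr_compare[OF s2(1) _ s1(1)])
    fix q1 q2 assume "cofr (stalk K (tgt a2)) q1" "cofr (stalk K (tgt c1)) q2"
      "\<And>B n. B \<in> Fib M \<Longrightarrow> Hom_cohomology K (src q1) B n \<cong> Hom_cohomology K (src q2) B n"
    then show thesis using that RB s1 s2 by simp
  qed (use s1 s2 F(1) D(1) in simp_all)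
  have 2: "Hom_cohomology K W RB n \<cong> Hom_cohomology K (src q1) RB n"
    using cofr_cohomology[OF q1 w(1) RBO] w(2) by simp
  have c: "cofr (stalk K A) (hm (Ch K) C q (stalk K A))" using C by (simp only: cofr_iff)
  then obtain i where "Ch.A.ses i (hm (Ch K) C q (stalk K A))" unfolding cofr_def by blast
  then have "harr (Ch K) (hm (Ch K) C q (stalk K A))" by (rule Ch.A.sesD)
  then have "src (hm (Ch K) C q (stalk K A)) = C" by (rule Ch.hm_simps)
  then have 3: "Hom_cohomology K (src q2) RB n \<cong> Hom_cohomology K C RB n"
    using cofr_cohomology[OF c q2 RBO, of n] by simp
  show ?thesis unfolding W(3) using 1 2 q12 3 by (blast intro: iso_trans)
qed

end

text \<open>The second claim is made for every group \<open>E\<close> that some choice of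
  replacements and resolution yields, so for given C and RB all these groups are isomorphic to one
  and the same.\<close>

theorem corollary9p4:
  fixes K :: "('o, 'm) cat" and U :: "'u set" and M :: "'o model" and \<V> :: "('o, 'm) chain set"
  assumes grothendieck: "grothendieck_category K U"
    and model: "abelian_model_structure K M"
    and hereditary: "hereditary_model K M"
    and cof_gen: "cofibrantly_generated U K M"
    and becker: "abelian_model_structure (Ch K) (Ch_model K M \<V>)"
  shows "(\<forall>A\<in>Obj K. \<forall>W f. canonical_resolution K M A W f \<longrightarrow>
            cofibrant_replacement (Ch K) (Ch_model K M \<V>) (stalk K A) W f) \<and>
         (\<forall>A\<in>Obj K. \<forall>B\<in>Obj K. \<forall>n::int. \<forall>E C q RB j.
            is_Ext_Ho K M A B n E \<and>
            cofibrant_replacement (Ch K) (Ch_model K M \<V>) (stalk K A) C q \<and>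
            fibrant_replacement K M B RB j \<longrightarrow>
            E \<cong> Hom_cohomology K C RB n)"
proof -
  have "abelian_category K" using grothendieck by (rule grothendieck_category.axioms)
  then interpret hereditary_model_category K M \<V>
    using model hereditary becker by (simp add: hereditary_model_category_def hereditary_model_category_axioms_def)
  show ?thesis using canonical_resolution_cofibrant Ext_Ho_iso by blast
qed

end
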